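(* Let $G$ be a second countable locally compact Hausdorff groupoid with a Haar system, $H$ a closed wide subgroupoid of $G$ with Haar system $\{\lambda_H^u\}_{u\in G^0}$, $\mu=\{\mu^u\}_{u\in G^0}$ a full equivariant $r_{G^0}$-system on $G/H$, and $(\mathcal H^\sigma,\sigma)$ a continuous unitary representation of $H$. Let $(\bar{\mathcal F}^\sigma_G,\Delta)$ be the continuous Hilbert bundle over $G^0$ with fibres $\mathcal F^u$ associated with the Hilbert $C_0(G^0)$-module $\mathcal F^\sigma(G)$. Then $(\bar{\mathcal F}^\sigma_G,\Delta,L)$ is a continuous unitary representation of $G$, where for $x\in G$ $$L(x):\mathcal F^{d(x)}\to\mathcal F^{r(x)},\qquad (L(x)f)(y)=f(x^{-1}y).$$
   Context: Groupoids. For a groupoid $G$: $r(x)=xx^{-1}$, $d(x)=x^{-1}x$, unit space $G^0$, $G^2=\{(x,y):d(x)=r(y)\}$, $G^u=r^{-1}(u)$. A Haar system on $G$ is a family $\{\lambda^u\}_{u\in G^0}$ of positive Radon measures on $G$ with $\mathrm{supp}\,\lambda^u=G^u$, $u\mapsto\int f\,d\lambda^u$ continuous for $f\in C_c(G)$, and $\int f(xy)\,d\lambda^{d(x)}(y)=\int f(y)\,d\lambda^{r(x)}(y)$. A subgroupoid is wide if its unit space is $G^0$. $G/H$ is the space of cosets $xH=\{xh:h\in H, r(h)=d(x)\}$ with quotient topology (locally compact Hausdorff), quotient map $q_H$, moment map $r_{G^0}(xH)=r(x)$ and left action $g\cdot xH=gxH$. A full equivariant $r_{G^0}$-system on $G/H$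 is a family $\mu=\{\mu^u\}_{u\in G^0}$ of positive Radon measures on $G/H$ with $\mathrm{supp}\,\mu^u=r_{G^0}^{-1}(u)$, $u\mapsto\int f\,d\mu^u$ continuous for $f\in C_c(G/H)$, and $\int f(x\cdot y)\,d\mu^{d(x)}(y)=\int f(y)\,d\mu^{r(x)}(y)$ for $x\in G$. Hilbert bundles and representations. A continuous field of Hilbert spaces (continuous Hilbert bundle) over $G^0$ is a family $\{\mathcal H_u\}_{u\in G^0}$ with a linear subspace $\Gamma\subset\prod_u\mathcal H_u$ such that $\{\xi(u):\xi\in\Gamma\}$ is dense in $\mathcal H_u$, $u\mapsto\|\xi(u)\|$ is continuous for $\xi\in\Gamma$, and $\Gamma$ is closed under locally uniform approximation. The total space $\mathcal H=\bigsqcup_u\mathcal H_u$, with projection $p$, has the topology generated by the sets $\{h:\ p(h)\in V,\ \|h-\xi(p(h))\|<\epsilon\}$ ($V\subset G^0$ open, $\epsilon>0$, $\xi\in\Gamma$); $C_0(G^0,\mathcal H)$ is the space of continuous sections vanishing at infinity, with sup norm. A continuous unitary representation $(\mathcal H^\pi,\pi)$ of $G$ consists of a continuous Hilbert bundle $\mathcal H^\pi$ over $G^0$ and unitaries $\pi(x):\mathcal H^\pi_{d(x)}\to\mathcal H^\pi_{r(x)}$ with $\pi(u)=\mathrm{id}$ for $u\in G^0$, $\pi(x)\pi(y)=\pi(xy)$ on $G^2$, $\pi(x^{-1})=\pi(x)^{-1}$, and $x\mapsto\langle\pi(x)\xi(d(x)),\eta(r(x))\rangle$ continuous for $\xi,\eta\in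 C_0(G^0,\mathcal H^\pi)$. The module and bundle. $C(G,\mathcal H^\sigma)$ is the set of continuous $f:G\to\mathcal H^\sigma$ with $f(x)\in\mathcal H^\sigma_{d(x)}$, and $$\mathcal F_0^\sigma(G)=\{f\in C(G,\mathcal H^\sigma): q_H(\mathrm{supp} f)\text{ compact},\ f(x\xi)=\sigma(\xi^{-1})f(x)\ \text{for } (x,\xi)\in G^2,\ \xi\in H\}.$$ For $f,g\in\mathcal F_0^\sigma(G)$ put $\langle f,g\rangle(u)=\int_{G/H}\langle f(x),g(x)\rangle_{\mathcal H^\sigma_{d(x)}}d\mu^u(xH)$ and $\|f\|=\sup_u\sqrt{\langle f,f\rangle(u)}$; $\mathcal F^\sigma(G)$ is the completion, a Hilbert $C_0(G^0)$-module with $(bf)(x)=b(r(x))f(x)$. Put $\mathcal N^u=\{f\in\mathcal F^\sigma(G):\langle f,f\rangle(u)=0\}$ and $\mathcal F^u=\mathcal F^\sigma(G)/\mathcal N^u$, identified with the completion of $\{f|_{G^u}:f\in\mathcal F_0^\sigma(G)\}$ in the norm $\sqrt{\langle f,f\rangle(u)}$. The fibres $\mathcal F^u$ form a continuous Hilbert bundle $\bar{\mathcal F}^\sigma_G$ whose topology is determined by the space of sections $\Delta=\{t_F: F\in\mathcal F^\sigma(G)\}$, $t_F(u)=F+\mathcal N^u$. The formula for $L(x)$ is given on restrictions to $G^{d(x)}$ of elements of $\mathcal F_0^\sigma(G)$ (with $y\in G^{r(x)}$) and extended by continuity. *)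

theory Defs
  imports "HOL-Analysis.Analysis"
begin

subsection \<open>Complex inner product spaces with explicit carrier\<close>

text \<open>The fibres of a Hilbert bundle vary with the base point, so vector spaces are records with a
  carrier rather than types. Inner products are linear in the first argument.\<close>

record 'v cvec =
  pts :: "'v set"
  vadd :: "'v \<Rightarrow> 'v \<Rightarrow> 'v"
  vzero :: 'v
  vscale :: "complex \<Rightarrow> 'v \<Rightarrow> 'v"

record 'v cinner = "'v cvec" +
  vinner :: "'v \<Rightarrow> 'v \<Rightarrow> complex"

definition vdiff :: "('v, 'm) cvec_scheme \<Rightarrow> 'v \<Rightarrow> 'v \<Rightarrow> 'v" where
  "vdiff V a b = vadd V a (vscale V (- 1) b)"

definition vnorm :: "'v cinner \<Rightarrow> 'v \<Rightarrow> real" where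
  "vnorm V a = sqrt (Re (vinner V a a))"

definition complex_vector_space :: "('v, 'm) cvec_scheme \<Rightarrow> bool" where
  "complex_vector_space V \<longleftrightarrow>
     vzero V \<in> pts V \<and>
     (\<forall>a\<in>pts V. \<forall>b\<in>pts V. vadd V a b \<in> pts V \<and> vadd V a b = vadd V b a) \<and>
     (\<forall>a\<in>pts V. \<forall>b\<in>pts V. \<forall>c\<in>pts V. vadd V (vadd V a b) c = vadd V a (vadd V b c)) \<and>
     (\<forall>a\<in>pts V. vadd V (vzero V) a = a \<and> vadd V a (vscale V (- 1) a) = vzero V) \<and>
     (\<forall>s. \<forall>a\<in>pts V. vscale V s a \<in> pts V) \<and>
     (\<forall>a\<in>pts V. vscale V 1 a = a) \<and>
     (\<forall>s t. \<forall>a\<in>pts V. vscale V (s * t) a = vscale V s (vscale V t a) \<and>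
                       vscale V (s + t) a = vadd V (vscale V s a) (vscale V t a)) \<and>
     (\<forall>s. \<forall>a\<in>pts V. \<forall>b\<in>pts V. vscale V s (vadd V a b) = vadd V (vscale V s a) (vscale V s b))"

definition cauchy_seq :: "('v, 'm) cvec_scheme \<Rightarrow> ('v \<Rightarrow> real) \<Rightarrow> (nat \<Rightarrow> 'v) \<Rightarrow> bool" where
  "cauchy_seq V \<nu> s \<longleftrightarrow>
     (\<forall>n. s n \<in> pts V) \<and> (\<forall>e>0. \<exists>N. \<forall>m\<ge>N. \<forall>n\<ge>N. \<nu> (vdiff V (s m) (s n)) < e)"

definition hilbert_space :: "'v cinner \<Rightarrow> bool" where
  "hilbert_space V \<longleftrightarrow>
     complex_vector_space V \<and>
     (\<forall>a\<in>pts V. \<forall>b\<in>pts V. vinner V b a = cnj (vinner V a b)) \<and>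
     (\<forall>a\<in>pts V. \<forall>b\<in>pts V. \<forall>c\<in>pts V. vinner V (vadd V a b) c = vinner V a c + vinner V b c) \<and>
     (\<forall>s. \<forall>a\<in>pts V. \<forall>b\<in>pts V. vinner V (vscale V s a) b = s * vinner V a b) \<and>
     (\<forall>a\<in>pts V. 0 \<le> Re (vinner V a a) \<and> (vinner V a a = 0 \<longrightarrow> a = vzero V)) \<and>
     (\<forall>s. cauchy_seq V (vnorm V) s \<longrightarrow>
        (\<exists>a\<in>pts V. (\<lambda>n. vnorm V (vdiff V (s n) a)) \<longlonglongrightarrow> 0))"

definition unitary_map :: "'v cinner \<Rightarrow> 'w cinner \<Rightarrow> ('v \<Rightarrow> 'w) \<Rightarrow> bool" where
  "unitary_map V W T \<longleftrightarrow>
     bij_betw T (pts V) (pts W) \<and>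
     (\<forall>a\<in>pts V. \<forall>b\<in>pts V. T (vadd V a b) = vadd W (T a) (T b)) \<and>
     (\<forall>s. \<forall>a\<in>pts V. T (vscale V s a) = vscale W s (T a)) \<and>
     (\<forall>a\<in>pts V. \<forall>b\<in>pts V. vinner W (T a) (T b) = vinner V a b)"

definition norm_continuous :: "'v cinner \<Rightarrow> 'w cinner \<Rightarrow> ('v \<Rightarrow> 'w) \<Rightarrow> bool" where
  "norm_continuous V W T \<longleftrightarrow>
     (\<forall>a\<in>pts V. \<forall>e>0. \<exists>d>0. \<forall>b\<in>pts V.
        vnorm V (vdiff V b a) < d \<longrightarrow> vnorm W (vdiff W (T b) (T a)) < e)"

text \<open>Completion of a seminormed space: Cauchy sequences modulo null sequences.\<close>

definition cauchy_class :: "('v, 'm) cvec_scheme \<Rightarrow> ('v \<Rightarrow> real) \<Rightarrow> (nat \<Rightarrow> 'v) \<Rightarrow> (nat \<Rightarrow> 'v) set" where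
  "cauchy_class V \<nu> s = {t. cauchy_seq V \<nu> t \<and> (\<lambda>n. \<nu> (vdiff V (t n) (s n))) \<longlonglongrightarrow> 0}"

definition completion :: "('v, 'm) cvec_scheme \<Rightarrow> ('v \<Rightarrow> real) \<Rightarrow> (nat \<Rightarrow> 'v) set cvec" where
  "completion V \<nu> =
     \<lparr>pts = cauchy_class V \<nu> ` {s. cauchy_seq V \<nu> s},
      vadd = (\<lambda>A B. cauchy_class V \<nu> (\<lambda>n. vadd V ((SOME s. s \<in> A) n) ((SOME t. t \<in> B) n))),
      vzero = cauchy_class V \<nu> (\<lambda>n. vzero V),
      vscale = (\<lambda>c A. cauchy_class V \<nu> (\<lambda>n. vscale V c ((SOME s. s \<in> A) n)))\<rparr>"

text \<open>Quotient of a semi-inner product space by its null space.\<close>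

definition null_space :: "'v cinner \<Rightarrow> 'v set" where
  "null_space V = {a \<in> pts V. vinner V a a = 0}"

definition null_coset :: "'v cinner \<Rightarrow> 'v \<Rightarrow> 'v set" where
  "null_coset V a = vadd V a ` null_space V"

definition null_quotient :: "'v cinner \<Rightarrow> 'v set cinner" where
  "null_quotient V =
     \<lparr>pts = null_coset V ` pts V,
      vadd = (\<lambda>A B. {vadd V a b | a b. a \<in> A \<and> b \<in> B}),
      vzero = null_space V,
      vscale = (\<lambda>c A. null_coset V (vscale V c (SOME a. a \<in> A))),
      vinner = (\<lambda>A B. vinner V (SOME a. a \<in> A) (SOME b. b \<in> B))\<rparr>"


subsection \<open>Radon measures on abstract topological spaces\<close>

definition Cc :: "'a topology \<Rightarrow> ('a \<Rightarrow> complex) set" where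
  "Cc X = {f. continuous_map X euclidean f \<and> compactin X (X closure_of {x \<in> topspace X. f x \<noteq> 0})}"

definition radon_measure :: "'a topology \<Rightarrow> 'a measure \<Rightarrow> bool" where
  "radon_measure X M \<longleftrightarrow>
     space M = topspace X \<and>
     sets M = sigma_sets (topspace X) {U. openin X U} \<and>
     (\<forall>K. compactin X K \<and> K \<in> sets M \<longrightarrow> emeasure M K < \<infinity>) \<and>
     (\<forall>A\<in>sets M. emeasure M A = (INF U\<in>{U. openin X U \<and> A \<subseteq> U}. emeasure M U)) \<and>
     (\<forall>U. openin X U \<longrightarrow>
        emeasure M U = (SUP K\<in>{K. compactin X K \<and> K \<in> sets M \<and> K \<subseteq> U}. emeasure M K))"

definition msupport :: "'a topology \<Rightarrow> 'a measure \<Rightarrow> 'a set" where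
  "msupport X M = {x \<in> topspace X. \<forall>U. openin X U \<and> x \<in> U \<longrightarrow> emeasure M U > 0}"


subsection \<open>Topological groupoids\<close>

text \<open>The set of arrows is the underlying set of the topology. Products are meaningful only for
  composable pairs; \<open>gmul\<close> is arbitrary elsewhere.\<close>

record 'g groupoid =
  gtop :: "'g topology"
  gmul :: "'g \<Rightarrow> 'g \<Rightarrow> 'g"
  ginv :: "'g \<Rightarrow> 'g"

definition arrows :: "'g groupoid \<Rightarrow> 'g set" where
  "arrows G = topspace (gtop G)"

definition rng :: "'g groupoid \<Rightarrow> 'g \<Rightarrow> 'g" where
  "rng G x = gmul G x (ginv G x)"

definition src :: "'g groupoid \<Rightarrow> 'g \<Rightarrow> 'g" where
  "src G x = gmul G (ginv G x) x"

definition units :: "'g groupoid \<Rightarrow> 'g set" where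
  "units G = rng G ` arrows G"

definition unit_top :: "'g groupoid \<Rightarrow> 'g topology" where
  "unit_top G = subtopology (gtop G) (units G)"

definition composable :: "'g groupoid \<Rightarrow> ('g \<times> 'g) set" where
  "composable G = {(x, y). x \<in> arrows G \<and> y \<in> arrows G \<and> src G x = rng G y}"

definition rfibre :: "'g groupoid \<Rightarrow> 'g \<Rightarrow> 'g set" where
  "rfibre G u = {x \<in> arrows G. rng G x = u}"

definition topological_groupoid :: "'g groupoid \<Rightarrow> bool" where
  "topological_groupoid G \<longleftrightarrow>
     (\<forall>x\<in>arrows G. ginv G x \<in> arrows G \<and> ginv G (ginv G x) = x) \<and>
     (\<forall>(x, y)\<in>composable G. gmul G x y \<in> arrows G) \<and>
     (\<forall>x y z. (x, y) \<in> composable G \<and> (y, z) \<in> composable G \<longrightarrow>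
        (gmul G x y, z) \<in> composable G \<and> (x, gmul G y z) \<in> composable G \<and>
        gmul G (gmul G x y) z = gmul G x (gmul G y z)) \<and>
     (\<forall>(x, y)\<in>composable G. gmul G (ginv G x) (gmul G x y) = y \<and>
                            gmul G (gmul G x y) (ginv G y) = x) \<and>
     continuous_map (gtop G) (gtop G) (ginv G) \<and>
     continuous_map (subtopology (prod_topology (gtop G) (gtop G)) (composable G)) (gtop G)
       (\<lambda>(x, y). gmul G x y)"

text \<open>The set integral below ignores the values of \<open>gmul\<close> on non-composable pairs;
  the complement of \<open>rfibre G (src G x)\<close> is a null set by the support condition.\<close>

definition haar_system :: "'g groupoid \<Rightarrow> ('g \<Rightarrow> 'g measure) \<Rightarrow> bool" where
  "haar_system G lam \<longleftrightarrow>
     (\<forall>u\<in>units G. radon_measure (gtop G) (lam u) \<and> msupport (gtop G) (lam u) = rfibre G u) \<and>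
     (\<forall>f\<in>Cc (gtop G). continuous_map (unit_top G) euclidean (\<lambda>u. LINT x|lam u. f x)) \<and>
     (\<forall>f\<in>Cc (gtop G). \<forall>x\<in>arrows G.
        (LINT y:rfibre G (src G x)|lam (src G x). f (gmul G x y)) = (LINT y|lam (rng G x). f y))"

definition restrict_groupoid :: "'g groupoid \<Rightarrow> 'g set \<Rightarrow> 'g groupoid" where
  "restrict_groupoid G H = G\<lparr>gtop := subtopology (gtop G) H\<rparr>"

definition wide_subgroupoid :: "'g groupoid \<Rightarrow> 'g set \<Rightarrow> bool" where
  "wide_subgroupoid G H \<longleftrightarrow>
     H \<subseteq> arrows G \<and>
     (\<forall>x\<in>H. ginv G x \<in> H) \<and>
     (\<forall>x\<in>H. \<forall>y\<in>H. (x, y) \<in> composable G \<longrightarrow> gmul G x y \<in> H) \<and>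
     units (restrict_groupoid G H) = units G"


subsection \<open>The coset space\<close>

definition coset :: "'g groupoid \<Rightarrow> 'g set \<Rightarrow> 'g \<Rightarrow> 'g set" where
  "coset G H x = {gmul G x h | h. h \<in> H \<and> rng G h = src G x}"

definition coset_top :: "'g groupoid \<Rightarrow> 'g set \<Rightarrow> 'g set topology" where
  "coset_top G H =
     topology (\<lambda>U. U \<subseteq> coset G H ` arrows G \<and> openin (gtop G) {x \<in> arrows G. coset G H x \<in> U})"

lemma openin_coset_top:
  "openin (coset_top G H) U \<longleftrightarrow>
     U \<subseteq> coset G H ` arrows G \<and> openin (gtop G) {x \<in> arrows G. coset G H x \<in> U}"
proof -
  have "istopology (\<lambda>U. U \<subseteq> coset G H ` arrows G \<and>
          openin (gtop G) {x \<in> arrows G. coset G H x \<in> U})" (is "istopology ?P")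
    unfolding istopology_def
  proof (intro conjI allI impI)
    fix S T assume "?P S" "?P T"
    then show "S \<inter> T \<subseteq> coset G H ` arrows G" by blast
    have "{x \<in> arrows G. coset G H x \<in> S \<inter> T} =
        {x \<in> arrows G. coset G H x \<in> S} \<inter> {x \<in> arrows G. coset G H x \<in> T}" by blast
    then show "openin (gtop G) {x \<in> arrows G. coset G H x \<in> S \<inter> T}"
      using \<open>?P S\<close> \<open>?P T\<close> by auto
  next
    fix \<K> assume K: "\<forall>K\<in>\<K>. ?P K"
    then show "\<Union>\<K> \<subseteq> coset G H ` arrows G" by blast
    have "{x \<in> arrows G. coset G H x \<in> \<Union>\<K>} = (\<Union>K\<in>\<K>. {x \<in> arrows G. coset G H x \<in> K})"
      by blast
    then show "openin (gtop G) {x \<in> arrows G. coset G H x \<in> \<Union>\<K>}"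
      using K by auto
  qed
  then show ?thesis
    by (simp add: coset_top_def topology_inverse')
qed

lemma topspace_coset_top: "topspace (coset_top G H) = coset G H ` arrows G"
proof -
  have "{x \<in> arrows G. coset G H x \<in> coset G H ` arrows G} = topspace (gtop G)"
    by (auto simp: arrows_def)
  then have "openin (coset_top G H) (coset G H ` arrows G)"
    by (simp add: openin_coset_top)
  then show ?thesis
    by (metis openin_coset_top openin_subset openin_topspace subset_antisym)
qed

lemma quotient_map_coset: "quotient_map (gtop G) (coset_top G H) (coset G H)"
  by (auto simp: quotient_map_def topspace_coset_top openin_coset_top arrows_def)

definition coset_rep :: "'g groupoid \<Rightarrow> 'g set \<Rightarrow> 'g set \<Rightarrow> 'g" where
  "coset_rep G H = inv_into (arrows G) (coset G H)"

definition moment :: "'g groupoid \<Rightarrow> 'g set \<Rightarrow> 'g set \<Rightarrow> 'g" where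
  "moment G H c = rng G (coset_rep G H c)"

definition moment_fibre :: "'g groupoid \<Rightarrow> 'g set \<Rightarrow> 'g \<Rightarrow> 'g set set" where
  "moment_fibre G H u = {c \<in> topspace (coset_top G H). moment G H c = u}"

text \<open>The action on cosets is \<open>g \<cdot> xH = gxH\<close>, i.e. the image of the coset under left
  multiplication by \<open>g\<close>.\<close>

definition equivariant_system ::
    "'g groupoid \<Rightarrow> 'g set \<Rightarrow> ('g \<Rightarrow> 'g set measure) \<Rightarrow> bool" where
  "equivariant_system G H mu \<longleftrightarrow>
     (\<forall>u\<in>units G. radon_measure (coset_top G H) (mu u) \<and>
        msupport (coset_top G H) (mu u) = moment_fibre G H u) \<and>
     (\<forall>f\<in>Cc (coset_top G H). continuous_map (unit_top G) euclidean (\<lambda>u. LINT c|mu u. f c)) \<and>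
     (\<forall>f\<in>Cc (coset_top G H). \<forall>x\<in>arrows G.
        (LINT c:moment_fibre G H (src G x)|mu (src G x). f (gmul G x ` c)) =
        (LINT c|mu (rng G x). f c))"


subsection \<open>Continuous Hilbert bundles\<close>

text \<open>Sections are functions on the base space, extended by \<open>undefined\<close> outside it.\<close>

record ('b, 'h) hbundle =
  fib :: "'b \<Rightarrow> 'h cinner"
  sects :: "('b \<Rightarrow> 'h) set"

definition all_sections :: "'b topology \<Rightarrow> ('b \<Rightarrow> 'h cinner) \<Rightarrow> ('b \<Rightarrow> 'h) set" where
  "all_sections X E = (\<Pi>\<^sub>E u\<in>topspace X. pts (E u))"

definition local_uniform_closure ::
    "'b topology \<Rightarrow> ('b \<Rightarrow> 'h cinner) \<Rightarrow> ('b \<Rightarrow> 'h) set \<Rightarrow> ('b \<Rightarrow> 'h) set" where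
  "local_uniform_closure X E D =
     {xi \<in> all_sections X E.
        \<forall>u\<in>topspace X. \<forall>e>0. \<exists>eta\<in>D. \<exists>V. openin X V \<and> u \<in> V \<and>
          (\<forall>v\<in>V. vnorm (E v) (vdiff (E v) (xi v) (eta v)) < e)}"

definition hilbert_bundle :: "'b topology \<Rightarrow> ('b, 'h) hbundle \<Rightarrow> bool" where
  "hilbert_bundle X B \<longleftrightarrow>
     (\<forall>u\<in>topspace X. hilbert_space (fib B u)) \<and>
     sects B \<subseteq> all_sections X (fib B) \<and>
     (\<lambda>u\<in>topspace X. vzero (fib B u)) \<in> sects B \<and>
     (\<forall>xi\<in>sects B. \<forall>eta\<in>sects B.
        (\<lambda>u\<in>topspace X. vadd (fib B u) (xi u) (eta u)) \<in> sects B) \<and>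
     (\<forall>c. \<forall>xi\<in>sects B. (\<lambda>u\<in>topspace X. vscale (fib B u) c (xi u)) \<in> sects B) \<and>
     (\<forall>u\<in>topspace X. \<forall>h\<in>pts (fib B u). \<forall>e>0. \<exists>xi\<in>sects B.
        vnorm (fib B u) (vdiff (fib B u) (xi u) h) < e) \<and>
     (\<forall>xi\<in>sects B. continuous_map X euclideanreal (\<lambda>u. vnorm (fib B u) (xi u))) \<and>
     local_uniform_closure X (fib B) (sects B) \<subseteq> sects B"

text \<open>The total space is the disjoint union of the fibres, as a set of pairs.\<close>

definition total_top :: "'b topology \<Rightarrow> ('b, 'h) hbundle \<Rightarrow> ('b \<times> 'h) topology" where
  "total_top X B = topology_generated_by
     {{(u, h). u \<in> V \<and> h \<in> pts (fib B u) \<and> vnorm (fib B u) (vdiff (fib B u) h (xi u)) < e} |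
        V e xi. openin X V \<and> 0 < e \<and> xi \<in> sects B}"

definition C0_sections :: "'b topology \<Rightarrow> ('b, 'h) hbundle \<Rightarrow> ('b \<Rightarrow> 'h) set" where
  "C0_sections X B =
     {xi \<in> all_sections X (fib B).
        continuous_map X (total_top X B) (\<lambda>u. (u, xi u)) \<and>
        (\<forall>e>0. \<exists>K. compactin X K \<and> (\<forall>u\<in>topspace X - K. vnorm (fib B u) (xi u) < e))}"


subsection \<open>Continuous unitary representations\<close>

definition unitary_representation ::
    "'g groupoid \<Rightarrow> ('g, 'h) hbundle \<Rightarrow> ('g \<Rightarrow> 'h \<Rightarrow> 'h) \<Rightarrow> bool" where
  "unitary_representation G B \<pi> \<longleftrightarrow>
     hilbert_bundle (unit_top G) B \<and>
     (\<forall>x\<in>arrows G. unitary_map (fib B (src G x)) (fib B (rng G x)) (\<pi> x)) \<and>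
     (\<forall>u\<in>units G. \<forall>h\<in>pts (fib B u). \<pi> u h = h) \<and>
     (\<forall>(x, y)\<in>composable G. \<forall>h\<in>pts (fib B (src G y)). \<pi> x (\<pi> y h) = \<pi> (gmul G x y) h) \<and>
     (\<forall>x\<in>arrows G. \<forall>h\<in>pts (fib B (rng G x)).
        \<pi> (ginv G x) h = inv_into (pts (fib B (src G x))) (\<pi> x) h) \<and>
     (\<forall>xi\<in>C0_sections (unit_top G) B. \<forall>eta\<in>C0_sections (unit_top G) B.
        continuous_map (gtop G) euclidean
          (\<lambda>x. vinner (fib B (rng G x)) (\<pi> x (xi (src G x))) (eta (rng G x))))"


subsection \<open>The induced module and bundle\<close>

text \<open>Here \<open>\<H>\<close> is the bundle of a representation \<open>\<sigma>\<close> of the subgroupoid \<open>H\<close>;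
  its base is the unit space of \<open>G\<close>, since \<open>H\<close> is wide.\<close>

definition fun_support :: "'g groupoid \<Rightarrow> ('g, 'h) hbundle \<Rightarrow> ('g \<Rightarrow> 'h) \<Rightarrow> 'g set" where
  "fun_support G \<H> f = gtop G closure_of {x \<in> arrows G. f x \<noteq> vzero (fib \<H> (src G x))}"

definition C_bundle :: "'g groupoid \<Rightarrow> ('g, 'h) hbundle \<Rightarrow> ('g \<Rightarrow> 'h) set" where
  "C_bundle G \<H> =
     {f \<in> (\<Pi>\<^sub>E x\<in>arrows G. pts (fib \<H> (src G x))).
        continuous_map (gtop G) (total_top (unit_top G) \<H>) (\<lambda>x. (src G x, f x))}"

definition F0 :: "'g groupoid \<Rightarrow> 'g set \<Rightarrow> ('g, 'h) hbundle \<Rightarrow> ('g \<Rightarrow> 'h \<Rightarrow> 'h) \<Rightarrow> ('g \<Rightarrow> 'h) cvec" where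
  "F0 G H \<H> \<sigma> =
     \<lparr>pts = {f \<in> C_bundle G \<H>.
              compactin (coset_top G H) (coset G H ` fun_support G \<H> f) \<and>
              (\<forall>x h. (x, h) \<in> composable G \<and> h \<in> H \<longrightarrow> f (gmul G x h) = \<sigma> (ginv G h) (f x))},
      vadd = (\<lambda>f g. \<lambda>x\<in>arrows G. vadd (fib \<H> (src G x)) (f x) (g x)),
      vzero = (\<lambda>x\<in>arrows G. vzero (fib \<H> (src G x))),
      vscale = (\<lambda>c f. \<lambda>x\<in>arrows G. vscale (fib \<H> (src G x)) c (f x))\<rparr>"

text \<open>For \<open>f\<close> and \<open>g\<close> in \<open>F0\<close> the integrand depends only on the coset \<open>xH\<close>, not on the
  representative \<open>x\<close>, because \<open>\<sigma>\<close> is unitary.\<close>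

definition F0_inner ::
    "'g groupoid \<Rightarrow> 'g set \<Rightarrow> ('g, 'h) hbundle \<Rightarrow> ('g \<Rightarrow> 'g set measure) \<Rightarrow>
     'g \<Rightarrow> ('g \<Rightarrow> 'h) \<Rightarrow> ('g \<Rightarrow> 'h) \<Rightarrow> complex" where
  "F0_inner G H \<H> mu u f g =
     (LINT c|mu u. (let x = coset_rep G H c in vinner (fib \<H> (src G x)) (f x) (g x)))"

definition F0_norm ::
    "'g groupoid \<Rightarrow> 'g set \<Rightarrow> ('g, 'h) hbundle \<Rightarrow> ('g \<Rightarrow> 'g set measure) \<Rightarrow> ('g \<Rightarrow> 'h) \<Rightarrow> real" where
  "F0_norm G H \<H> mu f = (SUP u\<in>units G. sqrt (Re (F0_inner G H \<H> mu u f f)))"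

type_synonym ('g, 'h) compl = "(nat \<Rightarrow> 'g \<Rightarrow> 'h) set"

definition F_module ::
    "'g groupoid \<Rightarrow> 'g set \<Rightarrow> ('g, 'h) hbundle \<Rightarrow> ('g \<Rightarrow> 'h \<Rightarrow> 'h) \<Rightarrow> ('g \<Rightarrow> 'g set measure) \<Rightarrow>
     ('g, 'h) compl cvec" where
  "F_module G H \<H> \<sigma> mu = completion (F0 G H \<H> \<sigma>) (F0_norm G H \<H> mu)"

definition F_embed ::
    "'g groupoid \<Rightarrow> 'g set \<Rightarrow> ('g, 'h) hbundle \<Rightarrow> ('g \<Rightarrow> 'h \<Rightarrow> 'h) \<Rightarrow> ('g \<Rightarrow> 'g set measure) \<Rightarrow>
     ('g \<Rightarrow> 'h) \<Rightarrow> ('g, 'h) compl" where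
  "F_embed G H \<H> \<sigma> mu f = cauchy_class (F0 G H \<H> \<sigma>) (F0_norm G H \<H> mu) (\<lambda>n. f)"

definition F_inner ::
    "'g groupoid \<Rightarrow> 'g set \<Rightarrow> ('g, 'h) hbundle \<Rightarrow> ('g \<Rightarrow> 'g set measure) \<Rightarrow>
     'g \<Rightarrow> ('g, 'h) compl \<Rightarrow> ('g, 'h) compl \<Rightarrow> complex" where
  "F_inner G H \<H> mu u S T =
     lim (\<lambda>n. F0_inner G H \<H> mu u ((SOME s. s \<in> S) n) ((SOME t. t \<in> T) n))"

text \<open>The module with its semi-inner product at the unit \<open>u\<close>. Its null space is \<open>\<N>\<^sup>u\<close> and its
  quotient by it is the fibre \<open>\<F>\<^sup>u\<close>.\<close>

definition F_at ::
    "'g groupoid \<Rightarrow> 'g set \<Rightarrow> ('g, 'h) hbundle \<Rightarrow> ('g \<Rightarrow> 'h \<Rightarrow> 'h) \<Rightarrow> ('g \<Rightarrow> 'g set measure) \<Rightarrow>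
     'g \<Rightarrow> ('g, 'h) compl cinner" where
  "F_at G H \<H> \<sigma> mu u =
     (let F = F_module G H \<H> \<sigma> mu in
      \<lparr>pts = pts F, vadd = vadd F, vzero = vzero F, vscale = vscale F,
       vinner = F_inner G H \<H> mu u\<rparr>)"

definition F_fibre ::
    "'g groupoid \<Rightarrow> 'g set \<Rightarrow> ('g, 'h) hbundle \<Rightarrow> ('g \<Rightarrow> 'h \<Rightarrow> 'h) \<Rightarrow> ('g \<Rightarrow> 'g set measure) \<Rightarrow>
     'g \<Rightarrow> ('g, 'h) compl set cinner" where
  "F_fibre G H \<H> \<sigma> mu u = null_quotient (F_at G H \<H> \<sigma> mu u)"

definition F_section ::
    "'g groupoid \<Rightarrow> 'g set \<Rightarrow> ('g, 'h) hbundle \<Rightarrow> ('g \<Rightarrow> 'h \<Rightarrow> 'h) \<Rightarrow> ('g \<Rightarrow> 'g set measure) \<Rightarrow>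
     ('g, 'h) compl \<Rightarrow> 'g \<Rightarrow> ('g, 'h) compl set" where
  "F_section G H \<H> \<sigma> mu S = (\<lambda>u\<in>units G. null_coset (F_at G H \<H> \<sigma> mu u) S)"

definition Delta ::
    "'g groupoid \<Rightarrow> 'g set \<Rightarrow> ('g, 'h) hbundle \<Rightarrow> ('g \<Rightarrow> 'h \<Rightarrow> 'h) \<Rightarrow> ('g \<Rightarrow> 'g set measure) \<Rightarrow>
     ('g \<Rightarrow> ('g, 'h) compl set) set" where
  "Delta G H \<H> \<sigma> mu = F_section G H \<H> \<sigma> mu ` pts (F_module G H \<H> \<sigma> mu)"

text \<open>All sections in \<open>Delta\<close> vanish at infinity, so if the unit space is not compact then \<open>Delta\<close>
  is in general not closed under locally uniform approximation. It determines the bundle whose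
  distinguished sections are its closure under locally uniform approximation; passing to the
  closure does not change the topology of the total space.\<close>

definition F_bundle ::
    "'g groupoid \<Rightarrow> 'g set \<Rightarrow> ('g, 'h) hbundle \<Rightarrow> ('g \<Rightarrow> 'h \<Rightarrow> 'h) \<Rightarrow> ('g \<Rightarrow> 'g set measure) \<Rightarrow>
     ('g, ('g, 'h) compl set) hbundle" where
  "F_bundle G H \<H> \<sigma> mu =
     \<lparr>fib = F_fibre G H \<H> \<sigma> mu,
      sects = local_uniform_closure (unit_top G) (F_fibre G H \<H> \<sigma> mu) (Delta G H \<H> \<sigma> mu)\<rparr>"

text \<open>\<open>L x\<close> is the continuous extension of \<open>f \<mapsto> f (x\<^sup>-\<^sup>1 \<cdot>)\<close> on restrictions. The restriction of
  \<open>f\<close> to \<open>rfibre G u\<close>, viewed in \<open>\<F>\<^sup>u\<close>, is the value at \<open>u\<close> of the section of \<open>f\<close>; so the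
  translate of the restriction of \<open>f\<close> is given through some \<open>g\<close> in \<open>F0\<close> that restricts to it.\<close>

definition left_translation ::
    "'g groupoid \<Rightarrow> 'g set \<Rightarrow> ('g, 'h) hbundle \<Rightarrow> ('g \<Rightarrow> 'h \<Rightarrow> 'h) \<Rightarrow> ('g \<Rightarrow> 'g set measure) \<Rightarrow>
     ('g \<Rightarrow> ('g, 'h) compl set \<Rightarrow> ('g, 'h) compl set) \<Rightarrow> bool" where
  "left_translation G H \<H> \<sigma> mu L \<longleftrightarrow>
     L \<in> extensional (arrows G) \<and>
     (\<forall>x\<in>arrows G.
        L x \<in> pts (F_fibre G H \<H> \<sigma> mu (src G x)) \<rightarrow>\<^sub>E pts (F_fibre G H \<H> \<sigma> mu (rng G x)) \<and>
        norm_continuous (F_fibre G H \<H> \<sigma> mu (src G x)) (F_fibre G H \<H> \<sigma> mu (rng G x)) (L x) \<and>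
        (\<forall>f\<in>pts (F0 G H \<H> \<sigma>). \<exists>g\<in>pts (F0 G H \<H> \<sigma>).
           (\<forall>y\<in>rfibre G (rng G x). g y = f (gmul G (ginv G x) y)) \<and>
           L x (F_section G H \<H> \<sigma> mu (F_embed G H \<H> \<sigma> mu f) (src G x)) =
             F_section G H \<H> \<sigma> mu (F_embed G H \<H> \<sigma> mu g) (rng G x)))"

end

theory Submission
  imports Defs
begin

text \<open>
  For \<open>x \<in> G\<close> and \<open>f \<in> F0\<close> the translate \<open>y \<mapsto> f (x\<^sup>-\<^sup>1 y)\<close> is defined on the single range fibre
  \<open>G\<^sup>u\<close>, \<open>u = r x\<close>, whereas vectors of the bundle come from functions on all of \<open>G\<close>. The heart of
  the matter is therefore an extension problem: to find \<open>g \<in> F0\<close> with \<open>g y = f (x\<^sup>-\<^sup>1 y)\<close> for all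
  \<open>y \<in> G\<^sup>u\<close>. Once such extensions exist, invariance of \<open>\<mu>\<close> gives
  \<open>\<langle>g, g'\<rangle>(r x) = \<langle>f, f'\<rangle>(d x)\<close> for translates of \<open>f, f'\<close>, and a relation between dense subsets of two
  Hilbert spaces that preserves inner products is the graph of a restriction of exactly one unitary
  operator (\<open>unitary_extension\<close>). This gives \<open>L x\<close>; the algebraic identities hold on the
  dense set of restrictions, hence everywhere.

  Extensions are found in two steps. Convolving \<open>f\<close> with a kernel \<open>k \<in> C\<^sub>c(G)\<close> of mass one with
  respect to \<open>\<lambda>\<^sup>u\<close>, concentrated near \<open>x\<close>, gives an element
  \<open>y \<mapsto> \<integral> k(z) f (z\<^sup>-\<^sup>1 y) d\<lambda>(z)\<close> of \<open>F0\<close> that is uniformly close to the translate on \<open>G\<^sup>u\<close>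
  (\<open>translate_approx\<close>). The integral is taken weakly in each fibre of \<open>\<H>\<close>. That a vector with the
  prescribed inner products exists, and that it depends continuously on \<open>y\<close>, both follow from one
  estimate, \<open>weak_conv_approx\<close>: a partition of unity on the support of \<open>k\<close> approximates the integrand by
  finite sums of scalar functions times sections. Closeness is uniform since \<open>f\<close> is
  supported in a compact set of cosets and norms do not depend on the representative of a coset
  (\<open>tube\<close>). Secondly, differences of successive approximations are truncated, which leaves them
  unchanged on \<open>G\<^sup>u\<close> and makes the telescoping series converge uniformly on \<open>G\<close>; its sum is an exact
  extension (\<open>F0_extend_translate\<close>).

  The same truncation, applied to the continuous function \<open>v \<mapsto> \<parallel>f\<parallel>\<^sub>v\<close> on the unit space, shows that the
  quotient of the completed module by the null space at \<open>u\<close> is already complete (\<open>at_complete\<close>), so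
  the fibres are Hilbert spaces. Strong continuity (\<open>translation_continuous\<close>) compares, for
  \<open>x\<close> near \<open>x\<^sub>0\<close>, the translate of \<open>f\<close> by \<open>x\<close> with a fixed extension of the translate by \<open>x\<^sub>0\<close>:
  they are uniformly close on \<open>G\<^bsup>r x\<^esup>\<close>, and their \<open>L\<^sup>2\<close> distance is controlled by the uniform distance
  together with the \<open>L\<^sup>1\<close> norms, which are locally bounded.

  Topologically, the Haar system of \<open>H\<close> enters only through openness of its range map, which makes the
  quotient map to the coset space open; closedness of \<open>H\<close> then makes the coset space Hausdorff.
\<close>

section \<open>Vector spaces and inner products on carriers\<close>

locale cvs =
  fixes V :: "('v, 'm) cvec_scheme"
  assumes complex_vector_space: "complex_vector_space V"
begin

lemma zero_closed [simp, intro]: "vzero V \<in> pts V"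
  using complex_vector_space by (simp add: complex_vector_space_def)

lemma add_closed [simp, intro]: "a \<in> pts V \<Longrightarrow> b \<in> pts V \<Longrightarrow> vadd V a b \<in> pts V"
  using complex_vector_space by (simp add: complex_vector_space_def)

lemma scale_closed [simp, intro]: "a \<in> pts V \<Longrightarrow> vscale V c a \<in> pts V"
  using complex_vector_space by (simp add: complex_vector_space_def)

lemma diff_closed [simp, intro]: "a \<in> pts V \<Longrightarrow> b \<in> pts V \<Longrightarrow> vdiff V a b \<in> pts V"
  by (simp add: vdiff_def)

lemma add_commute: "a \<in> pts V \<Longrightarrow> b \<in> pts V \<Longrightarrow> vadd V a b = vadd V b a"
  using complex_vector_space by (simp add: complex_vector_space_def)

lemma add_assoc: "a \<in> pts V \<Longrightarrow> b \<in> pts V \<Longrightarrow> c \<in> pts V \<Longrightarrow>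
    vadd V (vadd V a b) c = vadd V a (vadd V b c)"
  using complex_vector_space unfolding complex_vector_space_def by blast

lemma add_left_commute: "a \<in> pts V \<Longrightarrow> b \<in> pts V \<Longrightarrow> c \<in> pts V \<Longrightarrow>
    vadd V a (vadd V b c) = vadd V b (vadd V a c)"
  by (metis add_assoc add_commute)

lemma zero_add [simp]: "a \<in> pts V \<Longrightarrow> vadd V (vzero V) a = a"
  using complex_vector_space unfolding complex_vector_space_def by blast

lemma add_zero [simp]: "a \<in> pts V \<Longrightarrow> vadd V a (vzero V) = a"
  by (metis add_commute zero_add zero_closed)

lemma add_neg [simp]: "a \<in> pts V \<Longrightarrow> vadd V a (vscale V (- 1) a) = vzero V"
  using complex_vector_space by (simp add: complex_vector_space_def)

lemma scale_one [simp]: "a \<in> pts V \<Longrightarrow> vscale V 1 a = a"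
  using complex_vector_space by (simp add: complex_vector_space_def)

lemma scale_scale: "a \<in> pts V \<Longrightarrow> vscale V s (vscale V t a) = vscale V (s * t) a"
  using complex_vector_space by (simp add: complex_vector_space_def)

lemma scale_add_left: "a \<in> pts V \<Longrightarrow> vscale V (s + t) a = vadd V (vscale V s a) (vscale V t a)"
  using complex_vector_space by (simp add: complex_vector_space_def)

lemma scale_add_right: "a \<in> pts V \<Longrightarrow> b \<in> pts V \<Longrightarrow>
    vscale V s (vadd V a b) = vadd V (vscale V s a) (vscale V s b)"
  using complex_vector_space by (simp add: complex_vector_space_def)

lemma add_neg_cancel [simp]:
  assumes "a \<in> pts V" "b \<in> pts V"
  shows "vadd V a (vadd V (vscale V (- 1) a) b) = b"
  using assms by (simp add: add_assoc [symmetric])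

lemma neg_add_cancel [simp]:
  assumes "a \<in> pts V" "b \<in> pts V"
  shows "vadd V (vscale V (- 1) a) (vadd V a b) = b"
  using assms by (metis add_left_commute add_neg_cancel scale_closed)

lemma scale_zero_left [simp]:
  assumes "a \<in> pts V"
  shows "vscale V 0 a = vzero V"
  using scale_add_left [OF assms, of 1 "- 1"] assms by simp

lemma scale_zero_right [simp]: "vscale V c (vzero V) = vzero V"
  by (metis mult_zero_right scale_scale scale_zero_left zero_closed)

lemma diff_self [simp]: "a \<in> pts V \<Longrightarrow> vdiff V a a = vzero V"
  by (simp add: vdiff_def)

lemma diff_zero [simp]: "a \<in> pts V \<Longrightarrow> vdiff V a (vzero V) = a"
  by (simp add: vdiff_def)

lemma add_diff_cancel [simp]: "a \<in> pts V \<Longrightarrow> b \<in> pts V \<Longrightarrow> vadd V b (vdiff V a b) = a"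
  by (simp add: vdiff_def add_left_commute [of b a])

lemma diff_eq_zero_iff: "a \<in> pts V \<Longrightarrow> b \<in> pts V \<Longrightarrow> vdiff V a b = vzero V \<longleftrightarrow> a = b"
  by (metis add_diff_cancel add_zero diff_self)

lemma diff_split: "a \<in> pts V \<Longrightarrow> b \<in> pts V \<Longrightarrow> c \<in> pts V \<Longrightarrow>
    vdiff V a c = vadd V (vdiff V a b) (vdiff V b c)"
  by (simp add: vdiff_def add_assoc)

lemma diff_swap: "a \<in> pts V \<Longrightarrow> b \<in> pts V \<Longrightarrow> vdiff V b a = vscale V (- 1) (vdiff V a b)"
  by (simp add: vdiff_def scale_add_right scale_scale add_commute)

lemma diff_add: "a \<in> pts V \<Longrightarrow> b \<in> pts V \<Longrightarrow> c \<in> pts V \<Longrightarrow> d \<in> pts V \<Longrightarrow>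
    vdiff V (vadd V a b) (vadd V c d) = vadd V (vdiff V a c) (vdiff V b d)"
  by (simp add: vdiff_def scale_add_right add_assoc add_left_commute [of b])

lemma diff_scale: "a \<in> pts V \<Longrightarrow> b \<in> pts V \<Longrightarrow>
    vdiff V (vscale V c a) (vscale V c b) = vscale V c (vdiff V a b)"
  by (simp add: vdiff_def scale_add_right scale_scale)

lemma diff_scale_left: "a \<in> pts V \<Longrightarrow>
    vdiff V (vscale V c a) (vscale V d a) = vscale V (c - d) a"
  by (simp add: vdiff_def scale_scale scale_add_left [symmetric])

lemma add_left_diff_cancel: "a \<in> pts V \<Longrightarrow> b \<in> pts V \<Longrightarrow> vdiff V (vadd V a b) a = b"
  by (metis add_closed add_commute add_neg_cancel add_assoc scale_closed vdiff_def)

end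

locale seminormed = cvs V for V :: "('v, 'm) cvec_scheme" +
  fixes \<nu> :: "'v \<Rightarrow> real"
  assumes norm_add: "a \<in> pts V \<Longrightarrow> b \<in> pts V \<Longrightarrow> \<nu> (vadd V a b) \<le> \<nu> a + \<nu> b"
    and norm_scale: "a \<in> pts V \<Longrightarrow> \<nu> (vscale V c a) = cmod c * \<nu> a"
begin

lemma norm_zero [simp]: "\<nu> (vzero V) = 0"
  using norm_scale [OF zero_closed, of 0] by simp

lemma norm_diff_commute: "a \<in> pts V \<Longrightarrow> b \<in> pts V \<Longrightarrow> \<nu> (vdiff V a b) = \<nu> (vdiff V b a)"
  by (simp add: diff_swap [of a b] norm_scale)

lemma norm_nonneg: assumes "a \<in> pts V" shows "0 \<le> \<nu> a"
  using norm_add [OF assms scale_closed [OF assms], of "- 1"] assms by (simp add: norm_scale)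

lemma norm_diff_triangle: "a \<in> pts V \<Longrightarrow> b \<in> pts V \<Longrightarrow> c \<in> pts V \<Longrightarrow>
    \<nu> (vdiff V a c) \<le> \<nu> (vdiff V a b) + \<nu> (vdiff V b c)"
  by (simp add: diff_split [of a b c] norm_add)

lemma norm_le_diff: "a \<in> pts V \<Longrightarrow> b \<in> pts V \<Longrightarrow> \<nu> a \<le> \<nu> b + \<nu> (vdiff V a b)"
  by (metis add_diff_cancel diff_closed norm_add)

lemma norm_diff_abs: "a \<in> pts V \<Longrightarrow> b \<in> pts V \<Longrightarrow> \<bar>\<nu> a - \<nu> b\<bar> \<le> \<nu> (vdiff V a b)"
  using norm_le_diff [of a b] norm_le_diff [of b a] norm_diff_commute [of a b] by (simp add: abs_le_iff)

lemma norm_diff_le: "a \<in> pts V \<Longrightarrow> b \<in> pts V \<Longrightarrow> \<nu> (vdiff V a b) \<le> \<nu> a + \<nu> b"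
  unfolding vdiff_def using norm_add [of a "vscale V (- 1) b"] by (simp add: norm_scale)

lemma norm_diff_add: "a \<in> pts V \<Longrightarrow> b \<in> pts V \<Longrightarrow> c \<in> pts V \<Longrightarrow> d \<in> pts V \<Longrightarrow>
    \<nu> (vdiff V (vadd V a b) (vadd V c d)) \<le> \<nu> (vdiff V a c) + \<nu> (vdiff V b d)"
  by (simp add: diff_add norm_add)

lemma cauchy_seqD: "cauchy_seq V \<nu> s \<Longrightarrow> s n \<in> pts V"
  by (simp add: cauchy_seq_def)

lemma cauchy_seq_const [simp]: "a \<in> pts V \<Longrightarrow> cauchy_seq V \<nu> (\<lambda>n. a)"
  by (simp add: cauchy_seq_def)

lemma cauchy_seq_add:
  assumes s: "cauchy_seq V \<nu> s" and t: "cauchy_seq V \<nu> t"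
  shows "cauchy_seq V \<nu> (\<lambda>n. vadd V (s n) (t n))"
  unfolding cauchy_seq_def
proof (intro conjI allI impI)
  fix n show "vadd V (s n) (t n) \<in> pts V" using s t by (simp add: cauchy_seq_def)
next
  fix e :: real assume "0 < e"
  then obtain M N where M: "\<forall>m\<ge>M. \<forall>n\<ge>M. \<nu> (vdiff V (s m) (s n)) < e/2"
    and N: "\<forall>m\<ge>N. \<forall>n\<ge>N. \<nu> (vdiff V (t m) (t n)) < e/2"
    using s t by (meson cauchy_seq_def half_gt_zero)
  show "\<exists>N. \<forall>m\<ge>N. \<forall>n\<ge>N. \<nu> (vdiff V (vadd V (s m) (t m)) (vadd V (s n) (t n))) < e"
  proof (intro exI allI impI)
    fix m n assume "max M N \<le> m" "max M N \<le> n"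
    then show "\<nu> (vdiff V (vadd V (s m) (t m)) (vadd V (s n) (t n))) < e"
      using M N norm_diff_add [of "s m" "t m" "s n" "t n"] s t
      by (smt (verit) cauchy_seqD field_sum_of_halves max.bounded_iff)
  qed
qed

lemma cauchy_seq_scale:
  assumes s: "cauchy_seq V \<nu> s"
  shows "cauchy_seq V \<nu> (\<lambda>n. vscale V c (s n))"
  unfolding cauchy_seq_def
proof (intro conjI allI impI)
  fix n show "vscale V c (s n) \<in> pts V" using s by (simp add: cauchy_seq_def)
next
  fix e :: real assume "0 < e"
  then have "0 < e / (cmod c + 1)" by (simp add: add_nonneg_pos)
  then obtain M where M: "\<forall>m\<ge>M. \<forall>n\<ge>M. \<nu> (vdiff V (s m) (s n)) < e/(cmod c + 1)"
    using s by (meson cauchy_seq_def)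
  show "\<exists>N. \<forall>m\<ge>N. \<forall>n\<ge>N. \<nu> (vdiff V (vscale V c (s m)) (vscale V c (s n))) < e"
  proof (intro exI allI impI)
    fix m n assume "M \<le> m" "M \<le> n"
    then have "\<nu> (vdiff V (s m) (s n)) * (cmod c + 1) < e" 
      using M by (simp add: pos_less_divide_eq add_nonneg_pos)
    moreover have "0 \<le> \<nu> (vdiff V (s m) (s n))"
      using s by (intro norm_nonneg) (auto simp: cauchy_seq_def)
    ultimately show "\<nu> (vdiff V (vscale V c (s m)) (vscale V c (s n))) < e"
      using s by (simp add: diff_scale cauchy_seqD norm_scale algebra_simps)
  qed
qed

lemma cauchy_class_self: "cauchy_seq V \<nu> s \<Longrightarrow> s \<in> cauchy_class V \<nu> s"
  by (simp add: cauchy_class_def cauchy_seqD)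

lemma null_seq_trans:
  assumes "\<And>n. a n \<in> pts V" "\<And>n. b n \<in> pts V" "\<And>n. c n \<in> pts V"
    and "(\<lambda>n. \<nu> (vdiff V (a n) (b n))) \<longlonglongrightarrow> 0" "(\<lambda>n. \<nu> (vdiff V (b n) (c n))) \<longlonglongrightarrow> 0"
  shows "(\<lambda>n. \<nu> (vdiff V (a n) (c n))) \<longlonglongrightarrow> 0"
proof (rule tendsto_sandwich [OF _ _ tendsto_const])
  show "(\<lambda>n. \<nu> (vdiff V (a n) (b n)) + \<nu> (vdiff V (b n) (c n))) \<longlonglongrightarrow> 0"
    using tendsto_add [OF assms(4,5)] by simp
qed (use assms norm_nonneg norm_diff_triangle in auto)

text \<open>Passing to a class forgets exactly null sequences; all later computations with classes rest on this.\<close>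

lemma cauchy_class_eq_iff:
  assumes s: "cauchy_seq V \<nu> s" and t: "cauchy_seq V \<nu> t"
  shows "cauchy_class V \<nu> s = cauchy_class V \<nu> t \<longleftrightarrow> (\<lambda>n. \<nu> (vdiff V (s n) (t n))) \<longlonglongrightarrow> 0"
proof
  assume "cauchy_class V \<nu> s = cauchy_class V \<nu> t"
  then show "(\<lambda>n. \<nu> (vdiff V (s n) (t n))) \<longlonglongrightarrow> 0"
    using cauchy_class_self [OF s] by (simp add: cauchy_class_def)
next
  assume L: "(\<lambda>n. \<nu> (vdiff V (s n) (t n))) \<longlonglongrightarrow> 0"
  then have R: "(\<lambda>n. \<nu> (vdiff V (t n) (s n))) \<longlonglongrightarrow> 0"
    using s t by (simp add: norm_diff_commute cauchy_seqD)
  show "cauchy_class V \<nu> s = cauchy_class V \<nu> t"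
    unfolding cauchy_class_def
    using null_seq_trans [OF _ _ _ _ L] null_seq_trans [OF _ _ _ _ R] s t
    by (auto simp: cauchy_seqD)
qed

lemma cauchy_class_rep:
  assumes s: "cauchy_seq V \<nu> s"
  defines "s' \<equiv> SOME t. t \<in> cauchy_class V \<nu> s"
  shows "cauchy_seq V \<nu> s'" "(\<lambda>n. \<nu> (vdiff V (s' n) (s n))) \<longlonglongrightarrow> 0"
proof -
  have "s' \<in> cauchy_class V \<nu> s"
    unfolding s'_def by (rule someI [of "\<lambda>t. t \<in> cauchy_class V \<nu> s"]) (rule cauchy_class_self [OF s])
  then show "cauchy_seq V \<nu> s'" "(\<lambda>n. \<nu> (vdiff V (s' n) (s n))) \<longlonglongrightarrow> 0"
    by (auto simp: cauchy_class_def)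
qed

abbreviation "cls \<equiv> cauchy_class V \<nu>"
abbreviation "cpl \<equiv> completion V \<nu>"

lemma completion_cases:
  assumes "A \<in> pts cpl"
  obtains s where "cauchy_seq V \<nu> s" "A = cls s"
  using assms by (auto simp: completion_def)

lemma completion_closed [simp]: "cauchy_seq V \<nu> s \<Longrightarrow> cls s \<in> pts cpl"
  by (auto simp: completion_def)

lemma completion_zero: "vzero cpl = cls (\<lambda>n. vzero V)"
  by (simp add: completion_def)

text \<open>The operations on classes go through arbitrarily chosen representatives. Any representatives may be
  used instead, because the chosen ones differ from them by null sequences.\<close>

lemma completion_add:
  assumes s: "cauchy_seq V \<nu> s" and t: "cauchy_seq V \<nu> t"
  shows "vadd cpl (cls s) (cls t) = cls (\<lambda>n. vadd V (s n) (t n))"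
proof -
  note s' = cauchy_class_rep [OF s] and t' = cauchy_class_rep [OF t]
  have "vadd cpl (cls s) (cls t) =
      cls (\<lambda>n. vadd V ((SOME x. x \<in> cls s) n) ((SOME x. x \<in> cls t) n))"
    by (simp add: completion_def)
  also have "\<dots> = cls (\<lambda>n. vadd V (s n) (t n))"
  proof (subst cauchy_class_eq_iff)
    show "(\<lambda>n. \<nu> (vdiff V (vadd V ((SOME x. x \<in> cls s) n) ((SOME x. x \<in> cls t) n)) (vadd V (s n) (t n)))) \<longlonglongrightarrow> 0"
      by (rule tendsto_sandwich [OF _ _ tendsto_const tendsto_add_zero [OF s'(2) t'(2)]])
        (use s t s' t' in \<open>auto intro!: always_eventually norm_nonneg norm_diff_add simp: cauchy_seqD\<close>)
  qed (use s t s' t' in \<open>auto intro!: cauchy_seq_add\<close>)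
  finally show ?thesis .
qed

lemma completion_scale:
  assumes s: "cauchy_seq V \<nu> s"
  shows "vscale cpl c (cls s) = cls (\<lambda>n. vscale V c (s n))"
proof -
  note s' = cauchy_class_rep [OF s]
  have "vscale cpl c (cls s) = cls (\<lambda>n. vscale V c ((SOME x. x \<in> cls s) n))"
    by (simp add: completion_def)
  also have "\<dots> = cls (\<lambda>n. vscale V c (s n))"
  proof (subst cauchy_class_eq_iff)
    show "(\<lambda>n. \<nu> (vdiff V (vscale V c ((SOME x. x \<in> cls s) n)) (vscale V c (s n)))) \<longlonglongrightarrow> 0"
      using tendsto_mult_right_zero [OF s'(2), of "cmod c"] s s'(1)
      by (simp add: diff_scale cauchy_seqD norm_scale)
  qed (use s s' in \<open>auto intro!: cauchy_seq_scale\<close>)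
  finally show ?thesis .
qed

lemma completion_diff:
  assumes s: "cauchy_seq V \<nu> s" and t: "cauchy_seq V \<nu> t"
  shows "vdiff cpl (cls s) (cls t) = cls (\<lambda>n. vdiff V (s n) (t n))"
  unfolding vdiff_def using assms by (simp add: completion_scale completion_add cauchy_seq_scale)

lemma cauchy_seq_diff:
  "cauchy_seq V \<nu> s \<Longrightarrow> cauchy_seq V \<nu> t \<Longrightarrow> cauchy_seq V \<nu> (\<lambda>n. vdiff V (s n) (t n))"
  unfolding vdiff_def by (intro cauchy_seq_add cauchy_seq_scale)

lemma cvs_completion: "cvs cpl"
proof
  note ops = completion_zero completion_add completion_scale cauchy_seq_add cauchy_seq_scale cauchy_seqD
  show "complex_vector_space cpl"
    unfolding complex_vector_space_def
  proof (intro conjI allI ballI)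
    fix A B assume "A \<in> pts cpl" "B \<in> pts cpl"
    then obtain s t where st: "cauchy_seq V \<nu> s" "cauchy_seq V \<nu> t" and AB: "A = cls s" "B = cls t"
      by (metis completion_cases)
    show "vadd cpl A B \<in> pts cpl" using st by (simp add: AB ops)
    have "vadd V (s n) (t n) = vadd V (t n) (s n)" for n
      using st by (intro add_commute) (auto simp: cauchy_seqD)
    then show "vadd cpl A B = vadd cpl B A" using st by (simp add: AB ops)
    show "vscale cpl c (vadd cpl A B) = vadd cpl (vscale cpl c A) (vscale cpl c B)" for c
      using st by (simp add: AB ops scale_add_right)
    fix C assume "C \<in> pts cpl"
    then obtain r where "cauchy_seq V \<nu> r" "C = cls r" by (metis completion_cases)
    then show "vadd cpl (vadd cpl A B) C = vadd cpl A (vadd cpl B C)"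
      using st by (simp add: AB ops add_assoc)
  next
    fix A assume "A \<in> pts cpl"
    then obtain s where s: "cauchy_seq V \<nu> s" and A: "A = cls s" by (metis completion_cases)
    show "vadd cpl (vzero cpl) A = A" "vadd cpl A (vscale cpl (- 1) A) = vzero cpl"
      "vscale cpl 1 A = A" using s by (simp_all add: A ops)
    fix c d
    show "vscale cpl c A \<in> pts cpl" "vscale cpl (c * d) A = vscale cpl c (vscale cpl d A)"
      "vscale cpl (c + d) A = vadd cpl (vscale cpl c A) (vscale cpl d A)"
      using s by (simp_all add: A ops scale_scale scale_add_left)
  qed (simp add: ops)
qed

end

text \<open>The form varies with the unit while the vector space of functions stays the same.\<close>

definition with_inner :: "('v, 'm) cvec_scheme \<Rightarrow> ('v \<Rightarrow> 'v \<Rightarrow> complex) \<Rightarrow> 'v cinner" where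
  "with_inner V ip = \<lparr>pts = pts V, vadd = vadd V, vzero = vzero V, vscale = vscale V, vinner = ip\<rparr>"

lemma with_inner_simps [simp]:
  "pts (with_inner V ip) = pts V" "vadd (with_inner V ip) = vadd V"
  "vzero (with_inner V ip) = vzero V" "vscale (with_inner V ip) = vscale V"
  "vinner (with_inner V ip) = ip" "vdiff (with_inner V ip) = vdiff V"
  by (auto simp: with_inner_def vdiff_def fun_eq_iff)

lemma cvs_with_inner: "cvs V \<Longrightarrow> cvs (with_inner V ip)"
  unfolding cvs_def complex_vector_space_def with_inner_simps .

locale semi_inner = cvs V for V :: "'v cinner" +
  assumes inner_commute: "a \<in> pts V \<Longrightarrow> b \<in> pts V \<Longrightarrow> vinner V b a = cnj (vinner V a b)"
    and inner_add: "a \<in> pts V \<Longrightarrow> b \<in> pts V \<Longrightarrow> c \<in> pts V \<Longrightarrow>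
        vinner V (vadd V a b) c = vinner V a c + vinner V b c"
    and inner_scale: "a \<in> pts V \<Longrightarrow> b \<in> pts V \<Longrightarrow> vinner V (vscale V s a) b = s * vinner V a b"
    and inner_nonneg: "a \<in> pts V \<Longrightarrow> 0 \<le> Re (vinner V a a)"
begin

lemma inner_add_right: "a \<in> pts V \<Longrightarrow> b \<in> pts V \<Longrightarrow> c \<in> pts V \<Longrightarrow>
    vinner V a (vadd V b c) = vinner V a b + vinner V a c"
  by (metis add_closed complex_cnj_add inner_add inner_commute)

lemma inner_scale_right: "a \<in> pts V \<Longrightarrow> b \<in> pts V \<Longrightarrow> vinner V a (vscale V s b) = cnj s * vinner V a b"
  by (metis complex_cnj_mult inner_commute inner_scale scale_closed)

lemma inner_diff: "a \<in> pts V \<Longrightarrow> b \<in> pts V \<Longrightarrow> c \<in> pts V \<Longrightarrow>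
    vinner V (vdiff V a b) c = vinner V a c - vinner V b c"
  by (simp add: vdiff_def inner_add inner_scale)

lemma inner_diff_right: "a \<in> pts V \<Longrightarrow> b \<in> pts V \<Longrightarrow> c \<in> pts V \<Longrightarrow>
    vinner V a (vdiff V b c) = vinner V a b - vinner V a c"
  by (simp add: vdiff_def inner_add_right inner_scale_right)

lemmas inner_linear = inner_add inner_add_right inner_scale inner_scale_right inner_diff inner_diff_right

lemma inner_zero [simp]: "a \<in> pts V \<Longrightarrow> vinner V (vzero V) a = 0"
  by (metis inner_scale mult_zero_left scale_zero_left zero_closed)

lemma inner_zero_right [simp]: "a \<in> pts V \<Longrightarrow> vinner V a (vzero V) = 0"
  by (metis complex_cnj_zero inner_commute inner_zero zero_closed)

lemma inner_self: "a \<in> pts V \<Longrightarrow> vinner V a a = of_real ((vnorm V a)\<^sup>2)"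
  using inner_commute [of a a] inner_nonneg [of a] by (auto simp: vnorm_def complex_eq_iff)

lemma norm_sq: "a \<in> pts V \<Longrightarrow> (vnorm V a)\<^sup>2 = Re (vinner V a a)"
  by (simp add: inner_self)

lemma inner_self_zero_iff: "a \<in> pts V \<Longrightarrow> vinner V a a = 0 \<longleftrightarrow> vnorm V a = 0"
  by (simp add: inner_self)

lemma vnorm_nonneg: "a \<in> pts V \<Longrightarrow> 0 \<le> vnorm V a"
  by (simp add: vnorm_def inner_nonneg)

lemma norm_scale_sq: "a \<in> pts V \<Longrightarrow> vnorm V (vscale V c a) = cmod c * vnorm V a"
proof -
  assume a: "a \<in> pts V"
  have "vinner V (vscale V c a) (vscale V c a) = (c * cnj c) * vinner V a a"
    using a by (simp add: inner_linear mult.assoc mult.left_commute)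
  also have "\<dots> = of_real ((cmod c * vnorm V a)\<^sup>2)"
    using a by (simp add: inner_self complex_norm_square [symmetric] power_mult_distrib)
  finally show ?thesis
    using a vnorm_nonneg by (simp add: vnorm_def [of V "vscale V c a"])
qed

lemma norm_add_sq: "a \<in> pts V \<Longrightarrow> b \<in> pts V \<Longrightarrow>
    (vnorm V (vadd V a b))\<^sup>2 = (vnorm V a)\<^sup>2 + 2 * Re (vinner V a b) + (vnorm V b)\<^sup>2"
  by (simp add: norm_sq inner_linear inner_commute [of a b])

text \<open>The seminorm may vanish on nonzero vectors, so the usual division by a norm is not available. Instead
  \<open>\<parallel>s a + t b\<parallel>\<^sup>2 \<ge> 0\<close> is used with coefficients slightly larger than the norms.\<close>

lemma Re_inner_le:
  assumes "a \<in> pts V" "b \<in> pts V"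
  shows "Re (vinner V a b) \<le> vnorm V a * vnorm V b"
proof -
  define p q where "p = vnorm V a" and "q = vnorm V b"
  have *: "0 \<le> s\<^sup>2 * p\<^sup>2 + 2 * (s * t) * Re (vinner V a b) + t\<^sup>2 * q\<^sup>2" for s t :: real
  proof -
    have "0 \<le> (vnorm V (vadd V (vscale V (of_real s) a) (vscale V (of_real t) b)))\<^sup>2" by simp
    then show ?thesis using assms
      by (simp add: norm_add_sq norm_scale_sq inner_linear p_def q_def power_mult_distrib mult_ac)
  qed
  have pq: "0 \<le> p" "0 \<le> q" using assms vnorm_nonneg by (auto simp: p_def q_def)
  have le: "Re (vinner V a b) \<le> (q + e) * (p + e)" if e: "0 < e" for e
  proof -
    have "0 < (q + e) * (p + e)" using e pq by (simp add: add_nonneg_pos)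
    moreover have "0 \<le> (q + e)\<^sup>2 * p\<^sup>2 + (p + e)\<^sup>2 * q\<^sup>2 - 2 * ((q + e) * (p + e)) * Re (vinner V a b)"
      using *[of "q + e" "- (p + e)"] unfolding power2_minus by (simp add: algebra_simps)
    moreover have "(q + e)\<^sup>2 * p\<^sup>2 \<le> (q + e)\<^sup>2 * (p + e)\<^sup>2" "(p + e)\<^sup>2 * q\<^sup>2 \<le> (p + e)\<^sup>2 * (q + e)\<^sup>2"
      using e pq by (auto intro!: mult_left_mono power_mono)
    ultimately have "0 \<le> 2 * ((q + e) * (p + e)) * ((q + e) * (p + e) - Re (vinner V a b))"
      by (simp add: power2_eq_square algebra_simps)
    moreover have "2 * ((q + e) * (p + e)) * ((q + e) * (p + e) - Re (vinner V a b)) < 0"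
      if "(q + e) * (p + e) < Re (vinner V a b)"
      using that \<open>0 < (q + e) * (p + e)\<close> by (intro mult_pos_neg) auto
    ultimately show ?thesis by (meson not_le)
  qed
  have "((\<lambda>e. (q + e) * (p + e)) \<longlongrightarrow> (q + 0) * (p + 0)) (at_right 0)"
    by (intro tendsto_intros)
  then have "Re (vinner V a b) \<le> (q + 0) * (p + 0)"
    by (rule tendsto_lowerbound) (use le in \<open>auto intro: eventually_mono [OF eventually_at_right_less]\<close>)
  then show ?thesis by (simp add: p_def q_def mult.commute)
qed

lemma Cauchy_Schwarz:
  assumes "a \<in> pts V" "b \<in> pts V"
  shows "cmod (vinner V a b) \<le> vnorm V a * vnorm V b"
proof (cases "vinner V a b = 0")
  case True
  then show ?thesis using assms by (simp add: vnorm_nonneg)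
next
  case False
  \<comment> \<open>rotate \<open>a\<close> so that the inner product becomes its modulus\<close>
  define c where "c = cnj (vinner V a b) / of_real (cmod (vinner V a b))"
  have "cmod c = 1" using False by (simp add: c_def norm_divide)
  have "c * vinner V a b = of_real (cmod (vinner V a b))"
    using False by (simp add: c_def complex_norm_square [symmetric] mult.commute power2_eq_square)
  then have "Re (vinner V (vscale V c a) b) = cmod (vinner V a b)"
    using assms by (simp add: inner_scale)
  then show ?thesis
    using Re_inner_le [of "vscale V c a" b] assms \<open>cmod c = 1\<close> by (simp add: norm_scale_sq)
qed

lemma vnorm_add: 
  assumes "a \<in> pts V" "b \<in> pts V" shows "vnorm V (vadd V a b) \<le> vnorm V a + vnorm V b"
proof (rule power2_le_imp_le)
  show "(vnorm V (vadd V a b))\<^sup>2 \<le> (vnorm V a + vnorm V b)\<^sup>2"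
    using Re_inner_le [OF assms] assms by (simp add: norm_add_sq power2_sum)
qed (use assms vnorm_nonneg in auto)

sublocale seminormed V "vnorm V"
  by unfold_locales (auto simp: vnorm_add norm_scale_sq)

lemma inner_tendsto:
  assumes a: "\<And>n. a n \<in> pts V" "a' \<in> pts V" "(\<lambda>n. vnorm V (vdiff V (a n) a')) \<longlonglongrightarrow> 0"
    and b: "b \<in> pts V"
  shows "(\<lambda>n. vinner V (a n) b) \<longlonglongrightarrow> vinner V a' b"
proof (rule LIM_zero_cancel, rule Lim_null_comparison)
  show "\<forall>\<^sub>F n in sequentially. norm (vinner V (a n) b - vinner V a' b) \<le> vnorm V (vdiff V (a n) a') * vnorm V b"
    using Cauchy_Schwarz [OF diff_closed [OF a(1) a(2)] b] a b by (auto simp: inner_diff)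
  show "(\<lambda>n. vnorm V (vdiff V (a n) a') * vnorm V b) \<longlonglongrightarrow> 0"
    using tendsto_mult_right [OF a(3), of "vnorm V b"] by (simp add: mult.commute)
qed

text \<open>Testing against the vector itself turns a weak estimate into a norm estimate. Vectors defined by
  integrals are known only through their inner products, so this is how they are compared.\<close>

lemma norm_le_if_weak:
  assumes a: "a \<in> pts V" and le: "\<And>b. b \<in> pts V \<Longrightarrow> cmod (vinner V b a) \<le> e * vnorm V b"
    and e: "0 \<le> e"
  shows "vnorm V a \<le> e"
proof -
  have "(vnorm V a)\<^sup>2 \<le> e * vnorm V a"
    using le [OF a] by (simp add: inner_self [OF a] norm_power)
  then show ?thesis using e vnorm_nonneg [OF a]
    by (cases "vnorm V a = 0") (auto simp: power2_eq_square)
qed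

text \<open>Reduces continuity of inner products to continuity of norms.\<close>

lemma polarization:
  assumes "a \<in> pts V" "b \<in> pts V"
  shows "vinner V a b = (of_real ((vnorm V (vadd V a b))\<^sup>2) - of_real ((vnorm V (vadd V a (vscale V (-1) b)))\<^sup>2)
     + \<i> * of_real ((vnorm V (vadd V a (vscale V \<i> b)))\<^sup>2) - \<i> * of_real ((vnorm V (vadd V a (vscale V (- \<i>) b)))\<^sup>2)) / 4"
  using assms by (simp only: inner_self [symmetric] add_closed scale_closed) (simp add: inner_linear algebra_simps)

end

locale hilbert = semi_inner V for V :: "'v cinner" +
  assumes norm_zeroD: "a \<in> pts V \<Longrightarrow> vnorm V a = 0 \<Longrightarrow> a = vzero V"
    and complete: "cauchy_seq V (vnorm V) s \<Longrightarrow> \<exists>a\<in>pts V. (\<lambda>n. vnorm V (vdiff V (s n) a)) \<longlonglongrightarrow> 0"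

lemma hilbert_iff: "hilbert_space V \<longleftrightarrow> hilbert V"
proof
  assume V: "hilbert_space V"
  interpret cvs V
    using V unfolding hilbert_space_def by unfold_locales blast
  interpret semi_inner V
    using V unfolding hilbert_space_def by unfold_locales blast+
  show "hilbert V"
  proof
    show "a = vzero V" if "a \<in> pts V" "vnorm V a = 0" for a
      using V that inner_self_zero_iff [of a] unfolding hilbert_space_def by blast
    show "\<exists>a\<in>pts V. (\<lambda>n. vnorm V (vdiff V (s n) a)) \<longlonglongrightarrow> 0"
      if "cauchy_seq V (vnorm V) s" for s
      using V that unfolding hilbert_space_def by blast
  qed
next
  assume "hilbert V"
  then interpret hilbert V .
  show "hilbert_space V"
    unfolding hilbert_space_def
  proof (intro conjI ballI allI impI)
    fix a b assume *: "a \<in> pts V" "b \<in> pts V"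
    show "vinner V b a = cnj (vinner V a b)" using * by (rule inner_commute)
    show "vinner V (vadd V a b) c = vinner V a c + vinner V b c" if "c \<in> pts V" for c
      using * that by (rule inner_add)
    show "vinner V (vscale V s a) b = s * vinner V a b" for s using * by (rule inner_scale)
  qed (use complex_vector_space inner_nonneg complete norm_zeroD inner_self_zero_iff in auto)
qed

context hilbert
begin

lemma norm_zero_iff: "a \<in> pts V \<Longrightarrow> vnorm V a = 0 \<longleftrightarrow> a = vzero V"
  using norm_zeroD by auto

lemma eq_if_norm_diff_zero: "a \<in> pts V \<Longrightarrow> b \<in> pts V \<Longrightarrow> vnorm V (vdiff V a b) = 0 \<Longrightarrow> a = b"
  using norm_zeroD diff_eq_zero_iff by auto

lemma eq_if_inner_eq:
  assumes "a \<in> pts V" "b \<in> pts V" and "\<And>c. c \<in> pts V \<Longrightarrow> vinner V a c = vinner V b c"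
  shows "a = b"
proof (rule eq_if_norm_diff_zero)
  have "vinner V (vdiff V a b) (vdiff V a b) = 0"
    using assms by (simp add: inner_diff)
  then show "vnorm V (vdiff V a b) = 0" using assms by (simp add: vnorm_def)
qed (use assms in auto)

end

section \<open>Completions, null quotients and unitary operators\<close>

text \<open>The expression defining \<open>F_inner\<close>, for an arbitrary form \<open>ip\<close> in place of the integral at a unit.\<close>

definition completion_inner :: "('v \<Rightarrow> 'v \<Rightarrow> complex) \<Rightarrow> (nat \<Rightarrow> 'v) set \<Rightarrow> (nat \<Rightarrow> 'v) set \<Rightarrow> complex" where
  "completion_inner ip S T = lim (\<lambda>n. ip ((SOME s. s \<in> S) n) ((SOME t. t \<in> T) n))"

text \<open>In the application \<open>\<nu>\<close> is the supremum over all units and \<open>ip\<close> the form at one of them. The bound makes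
  \<open>ip\<close> converge along sequences that are Cauchy for \<open>\<nu>\<close>.\<close>

locale seminormed_inner = seminormed V \<nu> for V :: "('v, 'm) cvec_scheme" and \<nu> :: "'v \<Rightarrow> real" +
  fixes ip :: "'v \<Rightarrow> 'v \<Rightarrow> complex"
  assumes semi_inner: "semi_inner (with_inner V ip)"
    and norm_le: "a \<in> pts V \<Longrightarrow> vnorm (with_inner V ip) a \<le> \<nu> a"
begin

interpretation W: semi_inner "with_inner V ip" by (rule semi_inner)

abbreviation "CI \<equiv> with_inner cpl (completion_inner ip)"

lemma inner_le: "a \<in> pts V \<Longrightarrow> b \<in> pts V \<Longrightarrow> cmod (ip a b) \<le> \<nu> a * \<nu> b"
  using W.Cauchy_Schwarz [of a b] mult_mono [OF norm_le [of a] norm_le [of b]] norm_nonneg [of a]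
    W.vnorm_nonneg [of b] by simp

lemma inner_diff_le:
  assumes "a \<in> pts V" "b \<in> pts V" "c \<in> pts V" "d \<in> pts V"
  shows "cmod (ip a b - ip c d) \<le> \<nu> (vdiff V a c) * \<nu> b + \<nu> c * \<nu> (vdiff V b d)"
proof -
  have "ip a b - ip c d = ip (vdiff V a c) b + ip c (vdiff V b d)"
    using assms W.inner_diff [of a c b] W.inner_diff_right [of c b d] by simp
  then show ?thesis
    using inner_le [of "vdiff V a c" b] inner_le [of c "vdiff V b d"] assms
    by (simp add: norm_triangle_le)
qed

lemma cauchy_seq_norm_Cauchy:
  assumes "cauchy_seq V \<nu> s"
  shows "convergent (\<lambda>n. \<nu> (s n))"
proof (rule Cauchy_convergent, rule metric_CauchyI)
  fix e :: real assume "0 < e"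
  then obtain N where "\<forall>m\<ge>N. \<forall>n\<ge>N. \<nu> (vdiff V (s m) (s n)) < e"
    using assms by (auto simp: cauchy_seq_def)
  then have "dist (\<nu> (s m)) (\<nu> (s n)) < e" if "N \<le> m" "N \<le> n" for m n
    using that norm_diff_abs [of "s m" "s n"] assms
    by (auto simp: dist_real_def cauchy_seqD intro: le_less_trans)
  then show "\<exists>M. \<forall>m\<ge>M. \<forall>n\<ge>M. dist (\<nu> (s m)) (\<nu> (s n)) < e" by blast
qed

lemma cauchy_seq_bounded:
  assumes "cauchy_seq V \<nu> s"
  obtains B where "\<And>n. \<nu> (s n) \<le> B" "0 < B"
proof -
  from cauchy_seq_norm_Cauchy [OF assms] have "Bseq (\<lambda>n. \<nu> (s n))"
    by (rule convergent_imp_Bseq)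
  then obtain B where "0 < B" "\<forall>n. norm (\<nu> (s n)) \<le> B" unfolding Bseq_def by blast
  then have "\<nu> (s n) \<le> B" for n by (metis abs_le_D1 real_norm_def)
  then show ?thesis using \<open>0 < B\<close> by (rule that)
qed

lemma inner_null_diff:
  assumes s: "cauchy_seq V \<nu> s" "cauchy_seq V \<nu> s'" and t: "cauchy_seq V \<nu> t" "cauchy_seq V \<nu> t'"
    and d: "(\<lambda>n. \<nu> (vdiff V (s n) (s' n))) \<longlonglongrightarrow> 0" "(\<lambda>n. \<nu> (vdiff V (t n) (t' n))) \<longlonglongrightarrow> 0"
  shows "(\<lambda>n. ip (s n) (t n) - ip (s' n) (t' n)) \<longlonglongrightarrow> 0"
proof (rule Lim_null_comparison)
  show "\<forall>\<^sub>F n in sequentially. norm (ip (s n) (t n) - ip (s' n) (t' n)) \<le>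
      \<nu> (vdiff V (s n) (s' n)) * \<nu> (t n) + \<nu> (s' n) * \<nu> (vdiff V (t n) (t' n))"
    using inner_diff_le s t by (auto simp: cauchy_seqD)
  have "(\<lambda>n. \<nu> (vdiff V (s n) (s' n)) * \<nu> (t n) + \<nu> (s' n) * \<nu> (vdiff V (t n) (t' n))) \<longlonglongrightarrow>
     0 * lim (\<lambda>n. \<nu> (t n)) + lim (\<lambda>n. \<nu> (s' n)) * 0"
    by (intro tendsto_intros d) (use s t cauchy_seq_norm_Cauchy convergent_LIMSEQ_iff in auto)
  then show "(\<lambda>n. \<nu> (vdiff V (s n) (s' n)) * \<nu> (t n) + \<nu> (s' n) * \<nu> (vdiff V (t n) (t' n))) \<longlonglongrightarrow> 0"
    by simp
qed

lemma inner_convergent: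
  assumes s: "cauchy_seq V \<nu> s" and t: "cauchy_seq V \<nu> t"
  shows "convergent (\<lambda>n. ip (s n) (t n))"
proof (rule Cauchy_convergent, rule metric_CauchyI)
  fix e :: real assume "0 < e"
  obtain B where B: "\<And>n. \<nu> (s n) \<le> B" "0 < B" using cauchy_seq_bounded [OF s] by blast
  obtain C where C: "\<And>n. \<nu> (t n) \<le> C" "0 < C" using cauchy_seq_bounded [OF t] by blast
  have "0 < e / (2 * C)" "0 < e / (2 * B)" using \<open>0 < e\<close> B C by auto
  then obtain M N where M: "\<forall>m\<ge>M. \<forall>n\<ge>M. \<nu> (vdiff V (s m) (s n)) < e / (2 * C)"
    and N: "\<forall>m\<ge>N. \<forall>n\<ge>N. \<nu> (vdiff V (t m) (t n)) < e / (2 * B)"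
    using s t unfolding cauchy_seq_def by meson
  have "dist (ip (s m) (t m)) (ip (s n) (t n)) < e" if "max M N \<le> m" "max M N \<le> n" for m n
  proof -
    have pt: "s k \<in> pts V" "t k \<in> pts V" for k using s t by (auto simp: cauchy_seqD)
    have "\<nu> (vdiff V (s m) (s n)) * \<nu> (t m) \<le> \<nu> (vdiff V (s m) (s n)) * C"
      using C pt norm_nonneg by (intro mult_left_mono) auto
    also have "\<dots> < e / (2 * C) * C" using M that C by (intro mult_strict_right_mono) auto
    also have "\<dots> = e / 2" using C by simp
    finally have 1: "\<nu> (vdiff V (s m) (s n)) * \<nu> (t m) < e / 2" .
    have "\<nu> (s n) * \<nu> (vdiff V (t m) (t n)) \<le> B * \<nu> (vdiff V (t m) (t n))"
      using B pt norm_nonneg by (intro mult_right_mono) auto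
    also have "\<dots> < B * (e / (2 * B))" using N that B by (intro mult_strict_left_mono) auto
    also have "\<dots> = e / 2" using B by simp
    finally show ?thesis
      using 1 inner_diff_le [OF pt(1,2) pt(1,2), of m m n n] by (simp add: dist_norm)
  qed
  then show "\<exists>M. \<forall>m\<ge>M. \<forall>n\<ge>M. dist (ip (s m) (t m)) (ip (s n) (t n)) < e" by blast
qed

lemma completion_inner_tendsto:
  assumes s: "cauchy_seq V \<nu> s" and t: "cauchy_seq V \<nu> t"
  shows "(\<lambda>n. ip (s n) (t n)) \<longlonglongrightarrow> completion_inner ip (cls s) (cls t)"
proof -
  let ?s = "SOME x. x \<in> cls s" and ?t = "SOME x. x \<in> cls t"
  have *: "(\<lambda>n. ip (?s n) (?t n)) \<longlonglongrightarrow> completion_inner ip (cls s) (cls t)"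
    using inner_convergent [OF cauchy_class_rep(1) [OF s] cauchy_class_rep(1) [OF t]]
    by (simp add: completion_inner_def convergent_LIMSEQ_iff)
  have "(\<lambda>n. ip (?s n) (?t n) - ip (s n) (t n)) \<longlonglongrightarrow> 0"
    using cauchy_class_rep [OF s] cauchy_class_rep [OF t] s t by (intro inner_null_diff) auto
  from tendsto_diff [OF * this] show ?thesis by simp
qed

lemma semi_inner_completion: "semi_inner CI"
proof -
  interpret C: cvs CI by (rule cvs_with_inner [OF cvs_completion])
  note ops = completion_add completion_scale cauchy_seq_add cauchy_seq_scale cauchy_seqD
  note lim = completion_inner_tendsto and uniq = LIMSEQ_unique
  show ?thesis
  proof
    fix A B assume "A \<in> pts CI" "B \<in> pts CI"
    then obtain s t where s: "cauchy_seq V \<nu> s" "A = cls s" and t: "cauchy_seq V \<nu> t" "B = cls t"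
      by (metis completion_cases with_inner_simps(1))
    have "ip (t n) (s n) = cnj (ip (s n) (t n))" for n
      using W.inner_commute [of "s n" "t n"] s t by (simp add: ops)
    then show "vinner CI B A = cnj (vinner CI A B)"
      using uniq [OF lim [OF t(1) s(1)]] tendsto_cnj [OF lim [OF s(1) t(1)]] s t by simp
    have "ip (vscale V c (s n)) (t n) = c * ip (s n) (t n)" for n c
      using W.inner_scale [of "s n" "t n" c] s t by (simp add: ops)
    then show "vinner CI (vscale CI c A) B = c * vinner CI A B" for c
      using uniq [OF lim [OF cauchy_seq_scale [OF s(1), of c] t(1)]] tendsto_mult_left [OF lim [OF s(1) t(1)], of c] s t
      by (simp add: ops)
    fix C assume "C \<in> pts CI"
    then obtain r where r: "cauchy_seq V \<nu> r" "C = cls r"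
      by (metis completion_cases with_inner_simps(1))
    have "ip (vadd V (s n) (t n)) (r n) = ip (s n) (r n) + ip (t n) (r n)" for n
      using W.inner_add [of "s n" "t n" "r n"] s t r by (simp add: ops)
    then show "vinner CI (vadd CI A B) C = vinner CI A C + vinner CI B C"
      using uniq [OF lim [OF cauchy_seq_add [OF s(1) t(1)] r(1)]]
        tendsto_add [OF lim [OF s(1) r(1)] lim [OF t(1) r(1)]] s t r
      by (simp add: ops)
  next
    fix A assume "A \<in> pts CI"
    then obtain s where s: "cauchy_seq V \<nu> s" "A = cls s"
      by (metis completion_cases with_inner_simps(1))
    have "(\<lambda>n. Re (ip (s n) (s n))) \<longlonglongrightarrow> Re (vinner CI A A)"
      using tendsto_Re [OF lim [OF s(1) s(1)]] s by simp
    then show "0 \<le> Re (vinner CI A A)"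
      by (rule LIMSEQ_le_const) (use W.inner_nonneg s in \<open>auto simp: ops\<close>)
  qed
qed

lemma completion_norm_tendsto:
  assumes s: "cauchy_seq V \<nu> s"
  shows "(\<lambda>n. vnorm (with_inner V ip) (s n)) \<longlonglongrightarrow> vnorm CI (cls s)"
  unfolding vnorm_def with_inner_simps
  by (intro tendsto_intros completion_inner_tendsto s)

lemma completion_norm_const:
  assumes "a \<in> pts V"
  shows "vnorm CI (cls (\<lambda>n. a)) = vnorm (with_inner V ip) a"
  by (rule LIMSEQ_unique [OF completion_norm_tendsto]) (use assms in auto)

lemma completion_inner_const:
  assumes "a \<in> pts V" "b \<in> pts V"
  shows "completion_inner ip (cls (\<lambda>n. a)) (cls (\<lambda>n. b)) = ip a b"
  by (rule LIMSEQ_unique [OF completion_inner_tendsto]) (use assms in auto)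

lemma completion_norm_le:
  assumes s: "cauchy_seq V \<nu> s" and le: "\<And>n. N \<le> n \<Longrightarrow> \<nu> (s n) \<le> e"
  shows "vnorm CI (cls s) \<le> e"
proof (rule LIMSEQ_le_const2 [OF completion_norm_tendsto [OF s]])
  have "vnorm (with_inner V ip) (s n) \<le> e" if "N \<le> n" for n
    using norm_le [OF cauchy_seqD [OF s]] le [OF that] by (rule order_trans)
  then show "\<exists>N. \<forall>n\<ge>N. vnorm (with_inner V ip) (s n) \<le> e" by blast
qed

text \<open>A late enough member of a Cauchy sequence, taken as a constant sequence, is close to the class.\<close>

lemma completion_approx:
  assumes s: "cauchy_seq V \<nu> s" and e: "0 < e"
  obtains a where "a \<in> pts V" "vnorm CI (vdiff cpl (cls (\<lambda>n. a)) (cls s)) < e"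
proof -
  obtain N where N: "\<forall>m\<ge>N. \<forall>n\<ge>N. \<nu> (vdiff V (s m) (s n)) < e / 2"
    using s e by (meson cauchy_seq_def half_gt_zero)
  have sN: "s N \<in> pts V" using s by (rule cauchy_seqD)
  have "vnorm CI (cls (\<lambda>n. vdiff V (s N) (s n))) \<le> e / 2"
    using s N sN by (intro completion_norm_le [where N = N] cauchy_seq_diff cauchy_seq_const) (auto intro: less_imp_le)
  then have "vnorm CI (vdiff cpl (cls (\<lambda>n. s N)) (cls s)) < e"
    using s sN e by (simp add: completion_diff)
  then show ?thesis using that sN by blast
qed

end

context semi_inner
begin

lemma null_space_eq: "null_space V = {a \<in> pts V. vnorm V a = 0}"
  by (auto simp: null_space_def inner_self_zero_iff)

lemma null_coset_eq: "a \<in> pts V \<Longrightarrow> null_coset V a = {b \<in> pts V. vnorm V (vdiff V b a) = 0}"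
proof (intro equalityI subsetI)
  fix b assume a: "a \<in> pts V" and "b \<in> {b \<in> pts V. vnorm V (vdiff V b a) = 0}"
  then show "b \<in> null_coset V a"
    unfolding null_coset_def null_space_eq
    by (intro image_eqI [of _ _ "vdiff V b a"]) auto
qed (auto simp: null_coset_def null_space_eq add_left_diff_cancel)

lemma null_coset_self: "a \<in> pts V \<Longrightarrow> a \<in> null_coset V a"
  by (simp add: null_coset_eq)

lemma null_coset_eq_iff:
  assumes a: "a \<in> pts V" and b: "b \<in> pts V"
  shows "null_coset V a = null_coset V b \<longleftrightarrow> vnorm V (vdiff V a b) = 0"
proof
  assume "null_coset V a = null_coset V b"
  then show "vnorm V (vdiff V a b) = 0" using null_coset_self [OF a] b by (simp add: null_coset_eq)
next
  assume *: "vnorm V (vdiff V a b) = 0"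
  then have **: "vnorm V (vdiff V b a) = 0" using a b norm_diff_commute by simp
  have "vnorm V (vdiff V c a) = 0 \<longleftrightarrow> vnorm V (vdiff V c b) = 0" if "c \<in> pts V" for c
    using norm_diff_triangle [of c a b] norm_diff_triangle [of c b a] norm_nonneg [of "vdiff V c a"]
      norm_nonneg [of "vdiff V c b"] a b that * ** by auto
  then show "null_coset V a = null_coset V b" using a b by (auto simp: null_coset_eq)
qed

abbreviation "nq \<equiv> null_quotient V"

lemma null_quotient_cases:
  assumes "A \<in> pts nq" obtains a where "a \<in> pts V" "A = null_coset V a"
  using assms by (auto simp: null_quotient_def)

lemma null_quotient_closed [simp]: "a \<in> pts V \<Longrightarrow> null_coset V a \<in> pts nq"
  by (auto simp: null_quotient_def)

lemma some_null_coset: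
  assumes "a \<in> pts V"
  shows "(SOME x. x \<in> null_coset V a) \<in> pts V" "vnorm V (vdiff V (SOME x. x \<in> null_coset V a) a) = 0"
  using someI [of "\<lambda>x. x \<in> null_coset V a", OF null_coset_self [OF assms]] assms
  by (simp_all add: null_coset_eq)

lemma null_quotient_zero: "vzero nq = null_coset V (vzero V)"
  by (auto simp: null_quotient_def null_coset_eq null_space_eq)

lemma null_quotient_add:
  assumes a: "a \<in> pts V" and b: "b \<in> pts V"
  shows "vadd nq (null_coset V a) (null_coset V b) = null_coset V (vadd V a b)"
proof (intro equalityI subsetI)
  fix c assume "c \<in> vadd nq (null_coset V a) (null_coset V b)"
  then obtain x y where xy: "c = vadd V x y" "x \<in> pts V" "vnorm V (vdiff V x a) = 0"
    "y \<in> pts V" "vnorm V (vdiff V y b) = 0"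
    using a b by (auto simp: null_quotient_def null_coset_eq)
  then have "vnorm V (vdiff V c (vadd V a b)) \<le> 0"
    using norm_diff_add [of x y a b] a b by simp
  then show "c \<in> null_coset V (vadd V a b)"
    using xy a b vnorm_nonneg [of "vdiff V c (vadd V a b)"] by (simp add: null_coset_eq)
next
  fix c assume "c \<in> null_coset V (vadd V a b)"
  then obtain n where n: "n \<in> null_space V" "c = vadd V (vadd V a b) n"
    by (auto simp: null_coset_def)
  then have "c = vadd V a (vadd V b n)" using a b by (simp add: add_assoc null_space_eq)
  moreover have "vadd V b n \<in> null_coset V b" using n by (auto simp: null_coset_def)
  ultimately show "c \<in> vadd nq (null_coset V a) (null_coset V b)"
    using null_coset_self [OF a] by (auto simp: null_quotient_def)
qed

lemma null_quotient_scale: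
  assumes a: "a \<in> pts V"
  shows "vscale nq c (null_coset V a) = null_coset V (vscale V c a)"
  using some_null_coset [OF a] a
  by (simp add: null_quotient_def null_coset_eq_iff diff_scale norm_scale)

text \<open>By the Cauchy--Schwarz inequality null vectors are orthogonal to everything, so representatives do
  not matter.\<close>

lemma null_quotient_inner:
  assumes a: "a \<in> pts V" and b: "b \<in> pts V"
  shows "vinner nq (null_coset V a) (null_coset V b) = vinner V a b"
proof -
  note a' = some_null_coset [OF a] and b' = some_null_coset [OF b]
  let ?a = "SOME x. x \<in> null_coset V a" and ?b = "SOME x. x \<in> null_coset V b"
  have 1: "vinner V ?a ?b = vinner V a ?b"
    using Cauchy_Schwarz [of "vdiff V ?a a" ?b] a' b' a by (simp add: inner_diff)
  have 2: "vinner V a ?b = vinner V a b"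
    using Cauchy_Schwarz [of a "vdiff V ?b b"] a b b' by (simp add: inner_diff_right)
  show ?thesis using 1 2 by (simp add: null_quotient_def)
qed

lemma null_quotient_diff:
  assumes a: "a \<in> pts V" and b: "b \<in> pts V"
  shows "vdiff nq (null_coset V a) (null_coset V b) = null_coset V (vdiff V a b)"
  unfolding vdiff_def using assms by (simp add: null_quotient_add null_quotient_scale)

lemma null_quotient_norm: "a \<in> pts V \<Longrightarrow> vnorm nq (null_coset V a) = vnorm V a"
  by (simp add: vnorm_def null_quotient_inner)

lemmas null_quotient_simps = null_quotient_zero null_quotient_add null_quotient_scale
  null_quotient_inner null_quotient_diff null_quotient_norm

lemma cvs_null_quotient: "cvs nq"
proof
  show "complex_vector_space nq"
    unfolding complex_vector_space_def
  proof (intro conjI allI ballI)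
    fix A B assume "A \<in> pts nq" "B \<in> pts nq"
    then obtain a b where ab: "a \<in> pts V" "b \<in> pts V" and AB: "A = null_coset V a" "B = null_coset V b"
      by (metis null_quotient_cases)
    show "vadd nq A B \<in> pts nq" using ab by (simp add: AB null_quotient_simps)
    show "vadd nq A B = vadd nq B A"
      using ab by (simp add: AB null_quotient_simps add_commute [of a b])
    show "vscale nq c (vadd nq A B) = vadd nq (vscale nq c A) (vscale nq c B)" for c
      using ab by (simp add: AB null_quotient_simps scale_add_right)
    fix C assume "C \<in> pts nq"
    then obtain c where "c \<in> pts V" "C = null_coset V c" by (metis null_quotient_cases)
    then show "vadd nq (vadd nq A B) C = vadd nq A (vadd nq B C)"
      using ab by (simp add: AB null_quotient_simps add_assoc)
  next
    fix A assume "A \<in> pts nq"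
    then obtain a where a: "a \<in> pts V" "A = null_coset V a" by (metis null_quotient_cases)
    show "vadd nq (vzero nq) A = A" "vadd nq A (vscale nq (- 1) A) = vzero nq" "vscale nq 1 A = A"
      using a by (simp_all add: null_quotient_simps)
    fix c d
    show "vscale nq c A \<in> pts nq" "vscale nq (c * d) A = vscale nq c (vscale nq d A)"
      "vscale nq (c + d) A = vadd nq (vscale nq c A) (vscale nq d A)"
      using a by (simp_all add: null_quotient_simps scale_scale scale_add_left)
  qed (simp add: null_quotient_simps)
qed

text \<open>Dividing by the null space makes the form definite, so completeness is the only thing to supply.\<close>

lemma hilbert_null_quotient:
  assumes complete: "\<And>s. cauchy_seq V (vnorm V) s \<Longrightarrow>
      \<exists>a\<in>pts V. (\<lambda>n. vnorm V (vdiff V (s n) a)) \<longlonglongrightarrow> 0"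
  shows "hilbert nq"
proof -
  interpret Q: cvs nq by (rule cvs_null_quotient)
  show ?thesis
  proof
    fix A B assume "A \<in> pts nq" "B \<in> pts nq"
    then obtain a b where ab: "a \<in> pts V" "b \<in> pts V" and AB: "A = null_coset V a" "B = null_coset V b"
      by (metis null_quotient_cases)
    show "vinner nq B A = cnj (vinner nq A B)" 
      using ab inner_commute [of a b] by (simp add: AB null_quotient_simps)
    show "vinner nq (vscale nq c A) B = c * vinner nq A B" for c
      using ab by (simp add: AB null_quotient_simps inner_scale)
    fix C assume "C \<in> pts nq"
    then obtain c where "c \<in> pts V" "C = null_coset V c" by (metis null_quotient_cases)
    then show "vinner nq (vadd nq A B) C = vinner nq A C + vinner nq B C"
      using ab by (simp add: AB null_quotient_simps inner_add)
  next
    fix A assume "A \<in> pts nq"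
    then obtain a where a: "a \<in> pts V" "A = null_coset V a" by (metis null_quotient_cases)
    show "0 \<le> Re (vinner nq A A)" using a by (simp add: null_quotient_simps inner_nonneg)
    show "A = vzero nq" if "vnorm nq A = 0"
      using that a by (simp add: null_quotient_simps null_coset_eq_iff)
  next
    fix S assume S: "cauchy_seq nq (vnorm nq) S"
    then have "\<exists>a. a \<in> pts V \<and> S n = null_coset V a" for n
      by (metis cauchy_seq_def null_quotient_cases)
    then obtain s where s: "\<And>n. s n \<in> pts V" "\<And>n. S n = null_coset V (s n)" by metis
    have "cauchy_seq V (vnorm V) s"
      using S s by (simp add: cauchy_seq_def null_quotient_simps)
    then obtain a where "a \<in> pts V" "(\<lambda>n. vnorm V (vdiff V (s n) a)) \<longlonglongrightarrow> 0"
      using complete by blast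
    then show "\<exists>A\<in>pts nq. (\<lambda>n. vnorm nq (vdiff nq (S n) A)) \<longlonglongrightarrow> 0"
      using s by (intro bexI [of _ "null_coset V a"]) (simp_all add: null_quotient_simps)
  qed
qed

end

text \<open>If \<open>(c\<^sub>n, d\<^sub>n) \<in> D\<close> and \<open>c\<^sub>n \<rightarrow> a\<close>, then \<open>d\<^sub>n\<close> is Cauchy because \<open>D\<close> preserves inner products, and its
  limit is the vector sought. Applied to \<open>D\<close> this constructs an operator, applied to the converse
  of \<open>D\<close> it shows surjectivity.\<close>

lemma weak_transport:
  assumes V: "hilbert V" and W: "hilbert W"
    and D: "D \<subseteq> pts V \<times> pts W"
    and dense: "\<And>a e. a \<in> pts V \<Longrightarrow> 0 < e \<Longrightarrow> \<exists>(c, d)\<in>D. vnorm V (vdiff V c a) < e"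
    and iso: "\<And>a b c d. (a, b) \<in> D \<Longrightarrow> (c, d) \<in> D \<Longrightarrow> vinner W b d = vinner V a c"
    and a: "a \<in> pts V"
  shows "\<exists>w\<in>pts W. (\<forall>(c, d)\<in>D. vinner W w d = vinner V a c) \<and>
    (\<forall>e>0. \<exists>(c, d)\<in>D. vnorm V (vdiff V c a) < e \<and> vnorm W (vdiff W d w) < e)"
proof -
  interpret V: hilbert V by fact
  interpret W: hilbert W by fact
  have "\<exists>p. p \<in> D \<and> vnorm V (vdiff V (fst p) a) < inverse (real (Suc n))" for n
    using dense [OF a, of "inverse (real (Suc n))"] by auto
  then obtain p where p: "\<And>n. p n \<in> D" "\<And>n. vnorm V (vdiff V (fst (p n)) a) < inverse (real (Suc n))"
    by metis
  define c d where "c = (\<lambda>n. fst (p n))" and "d = (\<lambda>n. snd (p n))"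
  have cd: "(c n, d n) \<in> D" for n using p by (simp add: c_def d_def)
  have pt: "c n \<in> pts V" "d n \<in> pts W" for n using cd D by auto
  have ca: "(\<lambda>n. vnorm V (vdiff V (c n) a)) \<longlonglongrightarrow> 0"
  proof (rule tendsto_sandwich [OF _ _ tendsto_const LIMSEQ_inverse_real_of_nat])
    show "\<forall>\<^sub>F n in sequentially. 0 \<le> vnorm V (vdiff V (c n) a)" using pt a by (intro always_eventually allI V.vnorm_nonneg V.diff_closed)
    show "\<forall>\<^sub>F n in sequentially. vnorm V (vdiff V (c n) a) \<le> inverse (real (Suc n))"
      using p by (auto simp: c_def less_imp_le)
  qed
  have dist: "vnorm W (vdiff W (d m) (d n)) = vnorm V (vdiff V (c m) (c n))" for m n
    using pt by (simp add: vnorm_def W.inner_linear V.inner_linear iso [OF cd cd])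
  have "cauchy_seq W (vnorm W) d"
    unfolding cauchy_seq_def
  proof (intro conjI allI impI)
    fix e :: real assume "0 < e"
    then obtain N where N: "\<forall>n\<ge>N. norm (vnorm V (vdiff V (c n) a) - 0) < e / 2"
      using LIMSEQ_D [OF ca, of "e/2"] by auto
    show "\<exists>N. \<forall>m\<ge>N. \<forall>n\<ge>N. vnorm W (vdiff W (d m) (d n)) < e"
    proof (intro exI allI impI)
      fix m n assume "N \<le> m" "N \<le> n"
      then have "vnorm V (vdiff V (c m) a) < e / 2" "vnorm V (vdiff V (c n) a) < e / 2"
        using N by auto
      then show "vnorm W (vdiff W (d m) (d n)) < e"
        using V.norm_diff_triangle [OF pt(1) a pt(1), of m n] V.norm_diff_commute [OF a pt(1), of n]
        by (simp add: dist)
    qed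
  qed (rule pt)
  then obtain w where w: "w \<in> pts W" "(\<lambda>n. vnorm W (vdiff W (d n) w)) \<longlonglongrightarrow> 0"
    using W.complete by blast
  have "vinner W w y = vinner V a x" if "(x, y) \<in> D" for x y
  proof (rule LIMSEQ_unique)
    have xy: "x \<in> pts V" "y \<in> pts W" using that D by auto
    show "(\<lambda>n. vinner W (d n) y) \<longlonglongrightarrow> vinner W w y"
      by (rule W.inner_tendsto) (use pt w xy in auto)
    have "(\<lambda>n. vinner V (c n) x) \<longlonglongrightarrow> vinner V a x"
      by (rule V.inner_tendsto) (use pt a ca xy in auto)
    then show "(\<lambda>n. vinner W (d n) y) \<longlonglongrightarrow> vinner V a x"
      by (simp add: iso [OF cd that])
  qed
  moreover have "\<exists>(c, d)\<in>D. vnorm V (vdiff V c a) < e \<and> vnorm W (vdiff W d w) < e" if "0 < e" for e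
  proof -
    have "\<forall>\<^sub>F n in sequentially. vnorm V (vdiff V (c n) a) < e \<and> vnorm W (vdiff W (d n) w) < e"
      using order_tendstoD(2) [OF ca that] order_tendstoD(2) [OF w(2) that] by eventually_elim auto
    then obtain n where "vnorm V (vdiff V (c n) a) < e \<and> vnorm W (vdiff W (d n) w) < e"
      unfolding eventually_sequentially by blast
    then show ?thesis using cd by blast
  qed
  ultimately show ?thesis using w(1) by blast
qed

lemma (in hilbert) eq_if_inner_eq_dense:
  assumes "a \<in> pts V" "b \<in> pts V" "S \<subseteq> pts V"
    and dense: "\<And>c e. c \<in> pts V \<Longrightarrow> 0 < e \<Longrightarrow> \<exists>x\<in>S. vnorm V (vdiff V x c) < e"
    and eq: "\<And>c. c \<in> S \<Longrightarrow> vinner V a c = vinner V b c"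
  shows "a = b"
proof -
  let ?d = "vdiff V a b"
  have d: "?d \<in> pts V" using assms by auto
  have *: "(vnorm V ?d)\<^sup>2 \<le> e * vnorm V ?d" if e: "0 < e" for e
  proof -
    obtain x where x: "x \<in> S" "vnorm V (vdiff V x ?d) < e" using dense [OF d e] by auto
    then have xp: "x \<in> pts V" using assms by auto
    have "vinner V ?d x = 0" using x xp assms by (simp add: inner_diff)
    then have "vinner V ?d ?d = - vinner V ?d (vdiff V x ?d)" using d xp by (simp add: inner_diff_right)
    then have "cmod (vinner V ?d ?d) \<le> vnorm V ?d * vnorm V (vdiff V x ?d)"
      using Cauchy_Schwarz [OF d diff_closed [OF xp d]] by simp
    also have "\<dots> \<le> vnorm V ?d * e" by (rule mult_left_mono) (use x(2) vnorm_nonneg [OF d] in linarith)+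
    finally show ?thesis using d by (simp add: inner_self norm_power mult.commute)
  qed
  have "vnorm V ?d \<le> 0"
  proof (rule ccontr)
    assume "\<not> vnorm V ?d \<le> 0"
    then show False using *[of "vnorm V ?d / 2"] by (simp add: power2_eq_square)
  qed
  then show ?thesis using vnorm_nonneg [OF d] eq_if_norm_diff_zero assms by auto
qed

text \<open>The value \<open>T a\<close> is determined by its inner products with the dense range of \<open>D\<close>. Linearity of \<open>T\<close> is
  therefore immediate, and limits are needed only to see that \<open>T\<close> is isometric.\<close>

lemma unitary_extension:
  assumes V: "hilbert V" and W: "hilbert W"
    and D: "D \<subseteq> pts V \<times> pts W"
    and denseV: "\<And>a e. a \<in> pts V \<Longrightarrow> 0 < e \<Longrightarrow> \<exists>(c, d)\<in>D. vnorm V (vdiff V c a) < e"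
    and denseW: "\<And>b e. b \<in> pts W \<Longrightarrow> 0 < e \<Longrightarrow> \<exists>(c, d)\<in>D. vnorm W (vdiff W d b) < e"
    and iso: "\<And>a b c d. (a, b) \<in> D \<Longrightarrow> (c, d) \<in> D \<Longrightarrow> vinner W b d = vinner V a c"
  obtains T where "T \<in> pts V \<rightarrow>\<^sub>E pts W" "unitary_map V W T" "\<And>a b. (a, b) \<in> D \<Longrightarrow> T a = b"
proof -
  interpret V: hilbert V by fact
  interpret W: hilbert W by fact
  have "\<forall>a. \<exists>w. a \<in> pts V \<longrightarrow> w \<in> pts W \<and> (\<forall>(c, d)\<in>D. vinner W w d = vinner V a c) \<and>
    (\<forall>e>0. \<exists>(c, d)\<in>D. vnorm V (vdiff V c a) < e \<and> vnorm W (vdiff W d w) < e)"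
    using weak_transport [OF V W D denseV iso] by blast
  then obtain T0 where T0: "\<And>a. a \<in> pts V \<Longrightarrow> T0 a \<in> pts W \<and> (\<forall>(c, d)\<in>D. vinner W (T0 a) d = vinner V a c) \<and>
    (\<forall>e>0. \<exists>(c, d)\<in>D. vnorm V (vdiff V c a) < e \<and> vnorm W (vdiff W d (T0 a)) < e)"
    by (metis (no_types))
  define T where "T = restrict T0 (pts V)"
  have T: "T \<in> pts V \<rightarrow>\<^sub>E pts W" using T0 by (auto simp: T_def)
  have Tc: "T a \<in> pts W" if "a \<in> pts V" for a using T0 that by (simp add: T_def)
  have Ti: "vinner W (T a) d = vinner V a c" if "a \<in> pts V" "(c, d) \<in> D" for a c d
    using T0 [OF that(1)] that by (auto simp: T_def)
  have uW: "w = T a" if "w \<in> pts W" "a \<in> pts V" "\<And>c d. (c, d) \<in> D \<Longrightarrow> vinner W w d = vinner V a c" for w a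
  proof (rule W.eq_if_inner_eq_dense [of w "T a" "snd ` D"])
    show "\<exists>x\<in>snd ` D. vnorm W (vdiff W x c) < e" if "c \<in> pts W" "0 < e" for c e
      using denseW [OF that] by force
  qed (use that Tc Ti D in auto)
  have uV: "a = b" if "a \<in> pts V" "b \<in> pts V" "\<And>c d. (c, d) \<in> D \<Longrightarrow> vinner V a c = vinner V b c" for a b
  proof (rule V.eq_if_inner_eq_dense [of a b "fst ` D"])
    show "\<exists>x\<in>fst ` D. vnorm V (vdiff V x c) < e" if "c \<in> pts V" "0 < e" for c e
      using denseV [OF that] by force
  qed (use that D in auto)
  have TD: "T a = b" if "(a, b) \<in> D" for a b
    using that D iso by (intro uW [symmetric]) auto
  have conv: "D\<inverse> \<subseteq> pts W \<times> pts V" using D by auto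
  have surj: "\<exists>a\<in>pts V. T a = w" if w: "w \<in> pts W" for w
  proof -
    have "\<exists>a\<in>pts V. (\<forall>(d, c)\<in>D\<inverse>. vinner V a c = vinner W w d) \<and>
      (\<forall>e>0. \<exists>(d, c)\<in>D\<inverse>. vnorm W (vdiff W d w) < e \<and> vnorm V (vdiff V c a) < e)"
    proof (rule weak_transport [OF W V conv _ _ w])
      show "\<exists>(c, d)\<in>D\<inverse>. vnorm W (vdiff W c a) < e" if "a \<in> pts W" "0 < e" for a e
        using denseW [OF that] by auto
    qed (use iso in auto)
    then obtain a where a: "a \<in> pts V" "\<forall>(d, c)\<in>D\<inverse>. vinner V a c = vinner W w d" by blast
    have "vinner W w d = vinner V a c" if "(c, d) \<in> D" for c d
      using bspec [OF a(2), of "(d, c)"] that by simp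
    then have "w = T a" using w a by (intro uW) auto
    then show ?thesis using a by blast
  qed
  have inner: "vinner W (T a) (T b) = vinner V a b" if a: "a \<in> pts V" and b: "b \<in> pts V" for a b
  proof -
    have "cmod (vinner W (T a) (T b) - vinner V a b) \<le> 0 + e" if e: "0 < e" for e
    proof -
      define M where "M = vnorm W (T a) + vnorm V a + 1"
      have M: "0 < M" "0 \<le> vnorm W (T a)" "0 \<le> vnorm V a"
        using W.vnorm_nonneg [OF Tc [OF a]] V.vnorm_nonneg [OF a] by (auto simp: M_def)
      have "T b = T0 b" using b by (simp add: T_def)
      then obtain c d where cd: "(c, d) \<in> D" "vnorm V (vdiff V c b) < e / M" "vnorm W (vdiff W d (T b)) < e / M"
        using T0 [OF b] e M by (auto dest: spec [of _ "e / M"])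
      have pt: "c \<in> pts V" "d \<in> pts W" "T a \<in> pts W" "T b \<in> pts W" using cd D Tc a b by auto
      have "vinner W (T a) (T b) - vinner V a b = vinner V a (vdiff V c b) - vinner W (T a) (vdiff W d (T b))"
        using Ti [OF a cd(1)] pt a b by (simp add: V.inner_diff_right W.inner_diff_right)
      then have "cmod (vinner W (T a) (T b) - vinner V a b) \<le>
          cmod (vinner V a (vdiff V c b)) + cmod (vinner W (T a) (vdiff W d (T b)))"
        by (simp add: norm_triangle_ineq4)
      also have "\<dots> \<le> vnorm V a * (e / M) + vnorm W (T a) * (e / M)"
        using V.Cauchy_Schwarz [of a "vdiff V c b"] W.Cauchy_Schwarz [of "T a" "vdiff W d (T b)"] pt a b cd M
        by (intro add_mono order_trans [OF V.Cauchy_Schwarz] order_trans [OF W.Cauchy_Schwarz] mult_left_mono) auto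
      also have "\<dots> \<le> M * (e / M)"
        using e M by (simp only: distrib_right [symmetric]) (intro mult_right_mono, auto simp: M_def)
      finally show ?thesis using M by simp
    qed
    then show ?thesis using field_le_epsilon [of "cmod (vinner W (T a) (T b) - vinner V a b)" 0] by simp
  qed
  have add: "T (vadd V a b) = vadd W (T a) (T b)" if "a \<in> pts V" "b \<in> pts V" for a b
  proof (rule uW [symmetric])
    fix c d assume cd: "(c, d) \<in> D"
    then have "c \<in> pts V" "d \<in> pts W" using D by auto
    then show "vinner W (vadd W (T a) (T b)) d = vinner V (vadd V a b) c"
      using that Ti [OF _ cd] Tc by (simp add: W.inner_add V.inner_add)
  qed (use that Tc in auto)
  have scale: "T (vscale V s a) = vscale W s (T a)" if "a \<in> pts V" for a s
  proof (rule uW [symmetric])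
    fix c d assume cd: "(c, d) \<in> D"
    then have "c \<in> pts V" "d \<in> pts W" using D by auto
    then show "vinner W (vscale W s (T a)) d = vinner V (vscale V s a) c"
      using that Ti [OF _ cd] Tc by (simp add: W.inner_scale V.inner_scale)
  qed (use that Tc in auto)
  have "inj_on T (pts V)"
    using uV Ti by (intro inj_onI) (metis (no_types, lifting))
  then have "unitary_map V W T"
    unfolding unitary_map_def bij_betw_def using surj Tc inner add scale by auto
  then show ?thesis using that T TD by blast
qed

lemma unitary_map_norm:
  assumes "unitary_map V W T" "a \<in> pts V"
  shows "vnorm W (T a) = vnorm V a"
  using assms by (simp add: unitary_map_def vnorm_def)

lemma unitary_map_closed: "unitary_map V W T \<Longrightarrow> a \<in> pts V \<Longrightarrow> T a \<in> pts W"
  by (auto simp: unitary_map_def bij_betw_def)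

lemma unitary_map_diff:
  assumes "unitary_map V W T" "hilbert V" "a \<in> pts V" "b \<in> pts V"
  shows "T (vdiff V a b) = vdiff W (T a) (T b)"
proof -
  interpret V: hilbert V by fact
  show ?thesis using assms by (simp add: unitary_map_def vdiff_def)
qed

lemma unitary_map_norm_diff:
  assumes "unitary_map V W T" "hilbert V" "a \<in> pts V" "b \<in> pts V"
  shows "vnorm W (vdiff W (T a) (T b)) = vnorm V (vdiff V a b)"
proof -
  interpret V: hilbert V by fact
  show ?thesis using assms unitary_map_norm [OF assms(1), of "vdiff V a b"]
    by (simp add: unitary_map_diff)
qed

lemma norm_continuous_unitary:
  assumes "unitary_map V W T" "hilbert V"
  shows "norm_continuous V W T"
  unfolding norm_continuous_def using unitary_map_norm_diff [OF assms] by auto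

lemma norm_continuous_unique:
  assumes V: "hilbert V" and W: "hilbert W"
    and S: "norm_continuous V W S" "\<And>a. a \<in> pts V \<Longrightarrow> S a \<in> pts W"
    and T: "norm_continuous V W T" "\<And>a. a \<in> pts V \<Longrightarrow> T a \<in> pts W"
    and dense: "\<And>a e. a \<in> pts V \<Longrightarrow> 0 < e \<Longrightarrow> \<exists>c\<in>D. c \<in> pts V \<and> vnorm V (vdiff V c a) < e"
    and eq: "\<And>c. c \<in> D \<Longrightarrow> c \<in> pts V \<Longrightarrow> S c = T c"
    and a: "a \<in> pts V"
  shows "S a = T a"
proof -
  interpret V: hilbert V by fact
  interpret W: hilbert W by fact
  have "vnorm W (vdiff W (S a) (T a)) \<le> 0 + e" if e: "0 < e" for e
  proof -
    obtain d1 where d1: "0 < d1" "\<And>b. b \<in> pts V \<Longrightarrow> vnorm V (vdiff V b a) < d1 \<Longrightarrow> vnorm W (vdiff W (S b) (S a)) < e/2"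
      using S(1) a e unfolding norm_continuous_def by (meson half_gt_zero)
    obtain d2 where d2: "0 < d2" "\<And>b. b \<in> pts V \<Longrightarrow> vnorm V (vdiff V b a) < d2 \<Longrightarrow> vnorm W (vdiff W (T b) (T a)) < e/2"
      using T(1) a e unfolding norm_continuous_def by (meson half_gt_zero)
    obtain c where c: "c \<in> D" "c \<in> pts V" "vnorm V (vdiff V c a) < min d1 d2"
      using dense [OF a, of "min d1 d2"] d1 d2 by auto
    have "vnorm W (vdiff W (S a) (T a)) \<le> vnorm W (vdiff W (S a) (S c)) + vnorm W (vdiff W (S c) (T a))"
      using S T a c by (intro W.norm_diff_triangle) auto
    moreover have "vnorm W (vdiff W (S a) (S c)) < e/2"
      using d1 c S a W.norm_diff_commute [of "S a" "S c"] by auto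
    moreover have "vnorm W (vdiff W (S c) (T a)) < e/2"
      using d2 c eq by auto
    ultimately show ?thesis by simp
  qed
  then have "vnorm W (vdiff W (S a) (T a)) \<le> 0" by (rule field_le_epsilon)
  then show ?thesis
    using S T a W.vnorm_nonneg [of "vdiff W (S a) (T a)"] by (intro W.eq_if_norm_diff_zero) auto
qed

section \<open>Continuous sections of Hilbert bundles\<close>

lemma continuous_map_euclidean_iff:
  fixes h :: "'y \<Rightarrow> 'm :: metric_space"
  shows "continuous_map Y euclidean h \<longleftrightarrow>
    (\<forall>y\<in>topspace Y. \<forall>e>0. \<exists>W. openin Y W \<and> y \<in> W \<and> (\<forall>z\<in>W. dist (h z) (h y) < e))"
proof (intro iffI ballI allI impI)
  fix y and e :: real assume h: "continuous_map Y euclidean h" and y: "y \<in> topspace Y" "0 < e"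
  then have "openin Y {z \<in> topspace Y. h z \<in> ball (h y) e}"
    by (intro openin_continuous_map_preimage [OF h]) (simp add: open_ball)
  then show "\<exists>W. openin Y W \<and> y \<in> W \<and> (\<forall>z\<in>W. dist (h z) (h y) < e)"
    using y by (intro exI [of _ "{z \<in> topspace Y. h z \<in> ball (h y) e}"]) (auto simp: dist_commute)
next
  assume *: "\<forall>y\<in>topspace Y. \<forall>e>0. \<exists>W. openin Y W \<and> y \<in> W \<and> (\<forall>z\<in>W. dist (h z) (h y) < e)"
  show "continuous_map Y euclidean h"
    unfolding continuous_map
  proof (intro conjI allI impI)
    fix U :: "'m set" assume "openin euclidean U"
    then have U: "open U" by simp
    show "openin Y {x \<in> topspace Y. h x \<in> U}"
    proof (subst openin_subopen, intro ballI)
      fix y assume y: "y \<in> {x \<in> topspace Y. h x \<in> U}"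
      then have "h y \<in> U" "y \<in> topspace Y" by auto
      then obtain e where e: "0 < e" "\<forall>w. dist w (h y) < e \<longrightarrow> w \<in> U" using U unfolding open_dist by meson
      obtain W where W: "openin Y W" "y \<in> W" "\<forall>z\<in>W. dist (h z) (h y) < e" using *[rule_format, OF \<open>y \<in> topspace Y\<close> \<open>0 < e\<close>] by blast
      then have "W \<subseteq> {x \<in> topspace Y. h x \<in> U}" using e openin_subset [OF W(1)] by blast
      then show "\<exists>T. openin Y T \<and> y \<in> T \<and> T \<subseteq> {x \<in> topspace Y. h x \<in> U}" using W by blast
    qed
  qed auto
qed

lemma continuous_map_euclideanD:
  fixes h :: "'y \<Rightarrow> 'm :: metric_space"
  assumes "continuous_map Y euclidean h" "y \<in> topspace Y" "0 < e"
  obtains W where "openin Y W" "y \<in> W" "\<forall>z\<in>W. dist (h z) (h y) < e"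
  using assms(1)[unfolded continuous_map_euclidean_iff, rule_format, OF assms(2,3)] by blast

lemma continuous_map_realD:
  fixes h :: "'y \<Rightarrow> real"
  assumes "continuous_map Y euclideanreal h" "y \<in> topspace Y" "h y < c"
  obtains W where "openin Y W" "y \<in> W" "\<And>z. z \<in> W \<Longrightarrow> h z < c"
proof -
  have "openin Y {z \<in> topspace Y. h z \<in> {..<c}}"
    by (rule openin_continuous_map_preimage [OF assms(1)]) simp
  moreover have "y \<in> {z \<in> topspace Y. h z \<in> {..<c}}" using assms by simp
  ultimately show ?thesis by (rule that) simp
qed

text \<open>Every axiom of a Hilbert bundle survives locally uniform approximation, by the usual estimates with
  fractions of \<open>e\<close>. With \<open>D = Delta\<close> this makes \<open>F_bundle\<close> a bundle.\<close>

lemma hilbert_bundle_closure: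
  assumes hilb: "\<And>u. u \<in> topspace X \<Longrightarrow> hilbert (E u)"
    and D: "D \<subseteq> all_sections X E"
    and zero: "(\<lambda>u\<in>topspace X. vzero (E u)) \<in> D"
    and add: "\<And>f g. f \<in> D \<Longrightarrow> g \<in> D \<Longrightarrow> (\<lambda>u\<in>topspace X. vadd (E u) (f u) (g u)) \<in> D"
    and scale: "\<And>c f. f \<in> D \<Longrightarrow> (\<lambda>u\<in>topspace X. vscale (E u) c (f u)) \<in> D"
    and dense: "\<And>u h e. u \<in> topspace X \<Longrightarrow> h \<in> pts (E u) \<Longrightarrow> 0 < e \<Longrightarrow>
        \<exists>f\<in>D. vnorm (E u) (vdiff (E u) (f u) h) < e"
    and norm: "\<And>f. f \<in> D \<Longrightarrow> continuous_map X euclideanreal (\<lambda>u. vnorm (E u) (f u))"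
  shows "hilbert_bundle X \<lparr>fib = E, sects = local_uniform_closure X E D\<rparr>"
    and "D \<subseteq> local_uniform_closure X E D"
proof -
  let ?L = "local_uniform_closure X E D"
  have pt: "f u \<in> pts (E u)" if "f \<in> all_sections X E" "u \<in> topspace X" for f u
    using that by (auto simp: all_sections_def)
  have L_all: "?L \<subseteq> all_sections X E" by (auto simp: local_uniform_closure_def)
  show DL: "D \<subseteq> ?L"
  proof
    fix f assume f: "f \<in> D"
    have "vnorm (E v) (vdiff (E v) (f v) (f v)) < e" if "v \<in> topspace X" "0 < e" for v and e :: real
    proof -
      interpret hilbert "E v" using hilb that by simp
      show ?thesis using pt f D that by (auto simp: in_mono)
    qed
    then show "f \<in> ?L" using f D
      by (auto simp: local_uniform_closure_def intro!: bexI [of _ f] exI [of _ "topspace X"])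
  qed
  have approx: "\<exists>eta\<in>D. \<exists>V. openin X V \<and> u \<in> V \<and> (\<forall>v\<in>V. v \<in> topspace X \<and> eta v \<in> pts (E v) \<and> xi v \<in> pts (E v) \<and>
      vnorm (E v) (vdiff (E v) (xi v) (eta v)) < e)"
    if xi: "xi \<in> ?L" "u \<in> topspace X" "0 < e" for xi u e
  proof -
    obtain eta V where *: "eta \<in> D" "openin X V" "u \<in> V" "\<forall>v\<in>V. vnorm (E v) (vdiff (E v) (xi v) (eta v)) < e"
      using xi unfolding local_uniform_closure_def by blast
    then have "v \<in> topspace X" if "v \<in> V" for v using openin_subset that by blast
    then show ?thesis using * xi L_all D pt by (intro bexI [of _ eta] exI [of _ V]) (auto 0 3)
  qed
  have L_add: "(\<lambda>u\<in>topspace X. vadd (E u) (f u) (g u)) \<in> ?L" (is "?s \<in> _") if f: "f \<in> ?L" and g: "g \<in> ?L" for f g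
    unfolding local_uniform_closure_def
  proof (intro CollectI conjI ballI allI impI)
    have "vadd (E u) (f u) (g u) \<in> pts (E u)" if u: "u \<in> topspace X" for u
    proof -
      interpret hilbert "E u" using hilb u .
      show ?thesis using f g u L_all pt by blast
    qed
    then show "?s \<in> all_sections X E" by (auto simp: all_sections_def)
    fix u and e :: real assume u: "u \<in> topspace X" and e: "0 < e"
    obtain f' V where f': "f' \<in> D" "openin X V" "u \<in> V" "\<And>v. v\<in>V \<Longrightarrow> v \<in> topspace X \<and> f' v \<in> pts (E v) \<and> f v \<in> pts (E v) \<and>
      vnorm (E v) (vdiff (E v) (f v) (f' v)) < e/2" using approx [OF f u, of "e/2"] e by fastforce
    obtain g' W where g': "g' \<in> D" "openin X W" "u \<in> W" "\<And>v. v\<in>W \<Longrightarrow> v \<in> topspace X \<and> g' v \<in> pts (E v) \<and> g v \<in> pts (E v) \<and>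
      vnorm (E v) (vdiff (E v) (g v) (g' v)) < e/2" using approx [OF g u, of "e/2"] e by fastforce
    let ?s' = "\<lambda>u\<in>topspace X. vadd (E u) (f' u) (g' u)"
    have "vnorm (E v) (vdiff (E v) (?s v) (?s' v)) < e" if v: "v \<in> V \<inter> W" for v
    proof -
      interpret hilbert "E v" using hilb f' v by blast
      show ?thesis using f'(4) [of v] g'(4) [of v] v norm_diff_add [of "f v" "g v" "f' v" "g' v"] by auto
    qed
    then show "\<exists>eta\<in>D. \<exists>V. openin X V \<and> u \<in> V \<and> (\<forall>v\<in>V. vnorm (E v) (vdiff (E v) (?s v) (eta v)) < e)"
      using add [OF f'(1) g'(1)] f' g' by (intro bexI [of _ ?s'] exI [of _ "V \<inter> W"]) auto
  qed
  have L_scale: "(\<lambda>u\<in>topspace X. vscale (E u) c (f u)) \<in> ?L" (is "?s \<in> _") if f: "f \<in> ?L" for f c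
    unfolding local_uniform_closure_def
  proof (intro CollectI conjI ballI allI impI)
    have "vscale (E u) c (f u) \<in> pts (E u)" if u: "u \<in> topspace X" for u
    proof -
      interpret hilbert "E u" using hilb u .
      show ?thesis using f u L_all pt by blast
    qed
    then show "?s \<in> all_sections X E" by (auto simp: all_sections_def)
    fix u and e :: real assume u: "u \<in> topspace X" and e: "0 < e"
    have c: "0 < cmod c + 1" by (simp add: add_nonneg_pos)
    obtain f' V where f': "f' \<in> D" "openin X V" "u \<in> V" "\<And>v. v\<in>V \<Longrightarrow> v \<in> topspace X \<and> f' v \<in> pts (E v) \<and> f v \<in> pts (E v) \<and>
      vnorm (E v) (vdiff (E v) (f v) (f' v)) < e / (cmod c + 1)" using approx [OF f u, of "e/(cmod c+1)"] e c by fastforce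
    let ?s' = "\<lambda>u\<in>topspace X. vscale (E u) c (f' u)"
    have "vnorm (E v) (vdiff (E v) (?s v) (?s' v)) < e" if v: "v \<in> V" for v
    proof -
      interpret hilbert "E v" using hilb f' v by blast
      have n: "0 \<le> vnorm (E v) (vdiff (E v) (f v) (f' v))" using f'(4) v by (intro vnorm_nonneg) auto
      have "vnorm (E v) (vdiff (E v) (f v) (f' v)) * (cmod c + 1) < e"
        using f'(4) [OF v] c by (simp add: pos_less_divide_eq)
      then show ?thesis using f'(4) [of v] v n by (auto simp: diff_scale norm_scale algebra_simps)
    qed
    then show "\<exists>eta\<in>D. \<exists>V. openin X V \<and> u \<in> V \<and> (\<forall>v\<in>V. vnorm (E v) (vdiff (E v) (?s v) (eta v)) < e)"
      using scale [OF f'(1)] f' by (intro bexI [of _ ?s'] exI [of _ V]) auto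
  qed
  have L_norm: "continuous_map X euclideanreal (\<lambda>u. vnorm (E u) (f u))" if f: "f \<in> ?L" for f
    unfolding continuous_map_euclidean_iff
  proof (intro ballI allI impI)
    fix u and e :: real assume u: "u \<in> topspace X" and e: "0 < e"
    obtain f' V where f': "f' \<in> D" "openin X V" "u \<in> V" "\<And>v. v\<in>V \<Longrightarrow> v \<in> topspace X \<and> f' v \<in> pts (E v) \<and> f v \<in> pts (E v) \<and>
      vnorm (E v) (vdiff (E v) (f v) (f' v)) < e / 3" using approx [OF f u, of "e/3"] e by fastforce
    obtain W where W: "openin X W" "u \<in> W" "\<forall>v\<in>W. dist (vnorm (E v) (f' v)) (vnorm (E u) (f' u)) < e/3"
      using norm [OF f'(1)] u e by (elim continuous_map_euclideanD [of _ _ u "e/3"]) auto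
    have *: "\<bar>vnorm (E v) (f v) - vnorm (E v) (f' v)\<bar> < e/3" if v: "v \<in> V" for v
    proof -
      interpret hilbert "E v" using hilb f' v by blast
      show ?thesis using f'(4) [OF v] norm_diff_abs [of "f v" "f' v"] by auto
    qed
    have "dist (vnorm (E v) (f v)) (vnorm (E u) (f u)) < e" if "v \<in> V \<inter> W" for v
      using *[OF IntD1 [OF that]] *[OF f'(3)] bspec [OF W(3) IntD2 [OF that]]
      unfolding dist_real_def by linarith
    then show "\<exists>W. openin X W \<and> u \<in> W \<and> (\<forall>v\<in>W. dist (vnorm (E v) (f v)) (vnorm (E u) (f u)) < e)"
      using f' W by (intro exI [of _ "V \<inter> W"]) auto
  qed
  have L_closed: "local_uniform_closure X E ?L \<subseteq> ?L"
  proof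
    fix f assume f: "f \<in> local_uniform_closure X E ?L"
    show "f \<in> ?L"
      unfolding local_uniform_closure_def
    proof (intro CollectI conjI ballI allI impI)
      show f_all: "f \<in> all_sections X E" using f by (simp add: local_uniform_closure_def)
      fix u and e :: real assume u: "u \<in> topspace X" and e: "0 < e"
      obtain g V where g: "g \<in> ?L" "openin X V" "u \<in> V" "\<forall>v\<in>V. vnorm (E v) (vdiff (E v) (f v) (g v)) < e/2"
      proof -
        have "\<forall>u\<in>topspace X. \<forall>e>0. \<exists>g\<in>?L. \<exists>V. openin X V \<and> u \<in> V \<and>
            (\<forall>v\<in>V. vnorm (E v) (vdiff (E v) (f v) (g v)) < e)"
          using f unfolding local_uniform_closure_def [of X E ?L] by (elim CollectE conjE)
        from bspec [OF this u, THEN spec, of "e/2"] show ?thesis using e that by auto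
      qed
      obtain f' W where f': "f' \<in> D" "openin X W" "u \<in> W" "\<And>v. v\<in>W \<Longrightarrow> v \<in> topspace X \<and> f' v \<in> pts (E v) \<and> g v \<in> pts (E v) \<and>
        vnorm (E v) (vdiff (E v) (g v) (f' v)) < e/2" using approx [OF g(1) u, of "e/2"] e by fastforce
      have "vnorm (E v) (vdiff (E v) (f v) (f' v)) < e" if v: "v \<in> V \<inter> W" for v
      proof -
        have "v \<in> topspace X" using f' v by blast
        interpret hilbert "E v" using hilb f' v by blast
        show ?thesis using f'(4) [of v] bspec [OF g(4), of v] v norm_diff_triangle [of "f v" "g v" "f' v"] pt [OF f_all \<open>v \<in> topspace X\<close>] by simp
      qed
      then show "\<exists>eta\<in>D. \<exists>V. openin X V \<and> u \<in> V \<and> (\<forall>v\<in>V. vnorm (E v) (vdiff (E v) (f v) (eta v)) < e)"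
        using f' g by (intro bexI [of _ f'] exI [of _ "V \<inter> W"]) auto
    qed
  qed
  show "hilbert_bundle X \<lparr>fib = E, sects = ?L\<rparr>"
    unfolding hilbert_bundle_def
    using hilb L_all DL zero L_add L_scale dense L_norm L_closed
    by (simp add: hilbert_iff) (meson in_mono)
qed

text \<open>Continuity of a section along a map \<open>p\<close> to the base, expressed by local approximation with distinguished
  sections; this form is stable under sums, scalar functions and uniform limits by direct estimates, and
  \<open>cts_iff_total_top\<close> identifies it with continuity into the total space. The map \<open>p\<close> is the source
  map for functions on \<open>G\<close>, the range map for orbits of a representation, and a projection composed with the
  source map for functions of two arrows.\<close>

definition cts_section ::
  "'y topology \<Rightarrow> 'b topology \<Rightarrow> ('b, 'h) hbundle \<Rightarrow> ('y \<Rightarrow> 'b) \<Rightarrow> ('y \<Rightarrow> 'h) \<Rightarrow> bool" where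
  "cts_section Y X B p f \<longleftrightarrow> continuous_map Y X p \<and> (\<forall>y\<in>topspace Y. f y \<in> pts (fib B (p y))) \<and>
     (\<forall>y\<in>topspace Y. \<forall>e>0. \<exists>xi\<in>sects B. \<exists>W. openin Y W \<and> y \<in> W \<and>
        (\<forall>z\<in>W. vnorm (fib B (p z)) (vdiff (fib B (p z)) (f z) (xi (p z))) < e))"

locale hilb_bundle =
  fixes X :: "'b topology" and B :: "('b, 'h) hbundle"
  assumes hilbert_bundle: "hilbert_bundle X B"
begin

lemma fib_hilbert: "u \<in> topspace X \<Longrightarrow> hilbert (fib B u)"
  using hilbert_bundle by (simp add: hilbert_bundle_def hilbert_iff)

lemma sect_closed: "xi \<in> sects B \<Longrightarrow> u \<in> topspace X \<Longrightarrow> xi u \<in> pts (fib B u)"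
  using hilbert_bundle by (auto simp: hilbert_bundle_def all_sections_def)

lemma sect_add: "xi \<in> sects B \<Longrightarrow> eta \<in> sects B \<Longrightarrow> (\<lambda>u\<in>topspace X. vadd (fib B u) (xi u) (eta u)) \<in> sects B"
  using hilbert_bundle by (simp add: hilbert_bundle_def)

lemma sect_scale: "xi \<in> sects B \<Longrightarrow> (\<lambda>u\<in>topspace X. vscale (fib B u) c (xi u)) \<in> sects B"
  using hilbert_bundle by (simp add: hilbert_bundle_def)

lemma sect_dense: "u \<in> topspace X \<Longrightarrow> h \<in> pts (fib B u) \<Longrightarrow> 0 < e \<Longrightarrow>
    \<exists>xi\<in>sects B. vnorm (fib B u) (vdiff (fib B u) (xi u) h) < e"
  using hilbert_bundle by (simp add: hilbert_bundle_def)

lemma sect_norm: "xi \<in> sects B \<Longrightarrow> continuous_map X euclideanreal (\<lambda>u. vnorm (fib B u) (xi u))"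
  using hilbert_bundle by (simp add: hilbert_bundle_def)

abbreviation cts :: "'y topology \<Rightarrow> ('y \<Rightarrow> 'b) \<Rightarrow> ('y \<Rightarrow> 'h) \<Rightarrow> bool" where
  "cts Y p f \<equiv> cts_section Y X B p f"

abbreviation dst :: "'b \<Rightarrow> 'h \<Rightarrow> 'h \<Rightarrow> real" where
  "dst u a b \<equiv> vnorm (fib B u) (vdiff (fib B u) a b)"

lemma ctsD:
  assumes "cts Y p f"
  shows "continuous_map Y X p" "y \<in> topspace Y \<Longrightarrow> f y \<in> pts (fib B (p y))" "y \<in> topspace Y \<Longrightarrow> p y \<in> topspace X"
  using assms by (auto simp: cts_section_def continuous_map_def)

lemma cts_approx:
  assumes "cts Y p f" "y \<in> topspace Y" "0 < e"
  obtains xi W where "xi \<in> sects B" "openin Y W" "y \<in> W" "W \<subseteq> topspace Y"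
    "\<And>z. z \<in> W \<Longrightarrow> dst (p z) (f z) (xi (p z)) < e"
proof -
  obtain xi W where "xi \<in> sects B" "openin Y W" "y \<in> W" "\<forall>z\<in>W. dst (p z) (f z) (xi (p z)) < e"
    using assms unfolding cts_section_def by blast
  then show ?thesis by (intro that [of xi W]) (auto dest: openin_subset)
qed

lemma cts_sect:
  assumes xi: "xi \<in> sects B" and p: "continuous_map Y X p"
  shows "cts Y p (\<lambda>y. xi (p y))"
proof -
  have "p y \<in> topspace X" if "y \<in> topspace Y" for y
    using p that continuous_map_image_subset_topspace by fastforce
  moreover have "dst u (xi u) (xi u) < e" if "u \<in> topspace X" "0 < e" for u and e :: real
  proof -
    interpret hilbert "fib B u" using fib_hilbert that by simp
    show ?thesis using sect_closed [OF xi] that by simp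
  qed
  ultimately show ?thesis
    unfolding cts_section_def using p xi sect_closed
    by (auto intro!: bexI [of _ xi] exI [of _ "topspace Y"])
qed

lemma cts_compose:
  assumes f: "cts Y p f" and q: "continuous_map Z Y q"
  shows "cts Z (\<lambda>z. p (q z)) (\<lambda>z. f (q z))"
  unfolding cts_section_def
proof (intro conjI ballI allI impI)
  show "continuous_map Z X (\<lambda>z. p (q z))"
    using continuous_map_compose [OF q ctsD(1) [OF f]] by (simp add: o_def)
  fix z assume z: "z \<in> topspace Z"
  then have qz: "q z \<in> topspace Y" using q continuous_map_image_subset_topspace by fastforce
  then show "f (q z) \<in> pts (fib B (p (q z)))" by (rule ctsD [OF f])
  fix e :: real assume e: "0 < e"
  obtain xi W where W: "xi \<in> sects B" "openin Y W" "q z \<in> W" "\<And>y. y \<in> W \<Longrightarrow> dst (p y) (f y) (xi (p y)) < e"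
    using cts_approx [OF f qz e] by metis
  show "\<exists>xi\<in>sects B. \<exists>W. openin Z W \<and> z \<in> W \<and> (\<forall>z\<in>W. dst (p (q z)) (f (q z)) (xi (p (q z))) < e)"
    using W z openin_continuous_map_preimage [OF q W(2)]
    by (intro bexI [of _ xi] exI [of _ "{z \<in> topspace Z. q z \<in> W}"]) auto
qed

lemma cts_subtopology: "cts Y p f \<Longrightarrow> cts (subtopology Y S) p f"
  using cts_compose [of Y p f "subtopology Y S" "\<lambda>x. x"] by (simp add: continuous_map_from_subtopology)

lemma cts_eq:
  assumes "cts Y p f" "\<And>y. y \<in> topspace Y \<Longrightarrow> p y = q y" "\<And>y. y \<in> topspace Y \<Longrightarrow> f y = g y"
  shows "cts Y q g"
proof -
  have "continuous_map Y X q" using continuous_map_eq assms ctsD(1) by metis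
  then show ?thesis
    using assms(1) openin_subset [of Y] unfolding cts_section_def
    by (smt (verit) assms(2,3) subset_iff)
qed

text \<open>Approximation by arbitrary continuous sections, not only by distinguished ones, suffices.\<close>

lemma cts_limit:
  assumes p: "continuous_map Y X p" and cl: "\<And>y. y \<in> topspace Y \<Longrightarrow> f y \<in> pts (fib B (p y))"
    and lim: "\<And>y e. y \<in> topspace Y \<Longrightarrow> 0 < e \<Longrightarrow>
      \<exists>g W. cts Y p g \<and> openin Y W \<and> y \<in> W \<and> (\<forall>z\<in>W. dst (p z) (f z) (g z) < e)"
  shows "cts Y p f"
  unfolding cts_section_def
proof (intro conjI ballI allI impI p cl)
  fix y and e :: real assume y: "y \<in> topspace Y" and e: "0 < e"
  obtain g W where g: "cts Y p g" "openin Y W" "y \<in> W" "\<forall>z\<in>W. dst (p z) (f z) (g z) < e/2"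
    using lim [OF y, of "e/2"] e by auto
  obtain xi W' where xi: "xi \<in> sects B" "openin Y W'" "y \<in> W'" "W' \<subseteq> topspace Y"
    "\<And>z. z \<in> W' \<Longrightarrow> dst (p z) (g z) (xi (p z)) < e/2"
    using cts_approx [OF g(1) y, of "e/2"] e by (metis half_gt_zero)
  have "dst (p z) (f z) (xi (p z)) < e" if z: "z \<in> W \<inter> W'" for z
  proof -
    have zY: "z \<in> topspace Y" using xi z by blast
    interpret hilbert "fib B (p z)" using fib_hilbert ctsD(3) [OF g(1) zY] by simp
    show ?thesis
      using norm_diff_triangle [of "f z" "g z" "xi (p z)"] cl [OF zY] ctsD(2,3) [OF g(1) zY]
        sect_closed [OF xi(1) ctsD(3) [OF g(1) zY]] bspec [OF g(4), of z] xi(5) [of z] z by simp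
  qed
  then show "\<exists>xi\<in>sects B. \<exists>W. openin Y W \<and> y \<in> W \<and> (\<forall>z\<in>W. dst (p z) (f z) (xi (p z)) < e)"
    using g xi by (intro bexI [of _ xi] exI [of _ "W \<inter> W'"]) auto
qed

lemma cts_norm:
  assumes f: "cts Y p f"
  shows "continuous_map Y euclideanreal (\<lambda>y. vnorm (fib B (p y)) (f y))"
  unfolding continuous_map_euclidean_iff
proof (intro ballI allI impI)
  fix y and e :: real assume y: "y \<in> topspace Y" and e: "0 < e"
  obtain xi W where W: "xi \<in> sects B" "openin Y W" "y \<in> W" "W \<subseteq> topspace Y"
    "\<And>z. z \<in> W \<Longrightarrow> dst (p z) (f z) (xi (p z)) < e/3"
    using cts_approx [OF f y, of "e/3"] e by (metis divide_pos_pos zero_less_numeral)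
  have "continuous_map Y euclideanreal (\<lambda>y. vnorm (fib B (p y)) (xi (p y)))"
    using continuous_map_compose [OF ctsD(1) [OF f] sect_norm [OF W(1)]] by (simp add: o_def)
  then obtain W' where W': "openin Y W'" "y \<in> W'"
    "\<forall>z\<in>W'. dist (vnorm (fib B (p z)) (xi (p z))) (vnorm (fib B (p y)) (xi (p y))) < e/3"
    using y e by (elim continuous_map_euclideanD [of _ _ y "e/3"]) auto
  have *: "\<bar>vnorm (fib B (p z)) (f z) - vnorm (fib B (p z)) (xi (p z))\<bar> < e/3" if z: "z \<in> W" for z
  proof -
    have zY: "z \<in> topspace Y" using W z by blast
    interpret hilbert "fib B (p z)" using fib_hilbert ctsD(3) [OF f zY] by simp
    show ?thesis using norm_diff_abs [of "f z" "xi (p z)"] W(5) [OF z] ctsD(2) [OF f zY]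
      sect_closed [OF W(1) ctsD(3) [OF f zY]] by simp
  qed
  have "dist (vnorm (fib B (p z)) (f z)) (vnorm (fib B (p y)) (f y)) < e" if "z \<in> W \<inter> W'" for z
    using *[OF IntD1 [OF that]] *[OF W(3)] bspec [OF W'(3) IntD2 [OF that]]
    unfolding dist_real_def by linarith
  then show "\<exists>W. openin Y W \<and> y \<in> W \<and> (\<forall>z\<in>W. dist (vnorm (fib B (p z)) (f z)) (vnorm (fib B (p y)) (f y)) < e)"
    using W W' by (intro exI [of _ "W \<inter> W'"]) auto
qed

lemma cts_add:
  assumes f: "cts Y p f" and g: "cts Y p g"
  shows "cts Y p (\<lambda>y. vadd (fib B (p y)) (f y) (g y))"
  unfolding cts_section_def
proof (intro conjI ballI allI impI)
  show "continuous_map Y X p" by (rule ctsD [OF f])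
  fix y assume y: "y \<in> topspace Y"
  interpret hilbert "fib B (p y)" using fib_hilbert ctsD(3) [OF f y] by simp
  show "vadd (fib B (p y)) (f y) (g y) \<in> pts (fib B (p y))" using ctsD(2) [OF f y] ctsD(2) [OF g y] by simp
next
  fix y and e :: real assume y: "y \<in> topspace Y" and e: "0 < e"
  obtain xi W where W: "xi \<in> sects B" "openin Y W" "y \<in> W" "W \<subseteq> topspace Y"
    "\<And>z. z \<in> W \<Longrightarrow> dst (p z) (f z) (xi (p z)) < e/2"
    using cts_approx [OF f y, of "e/2"] e by (metis half_gt_zero)
  obtain eta W' where W': "eta \<in> sects B" "openin Y W'" "y \<in> W'" "W' \<subseteq> topspace Y"
    "\<And>z. z \<in> W' \<Longrightarrow> dst (p z) (g z) (eta (p z)) < e/2"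
    using cts_approx [OF g y, of "e/2"] e by (metis half_gt_zero)
  let ?s = "\<lambda>u\<in>topspace X. vadd (fib B u) (xi u) (eta u)"
  have "dst (p z) (vadd (fib B (p z)) (f z) (g z)) (?s (p z)) < e" if z: "z \<in> W \<inter> W'" for z
  proof -
    have zY: "z \<in> topspace Y" "p z \<in> topspace X" using W z ctsD(3) [OF f] by auto
    interpret hilbert "fib B (p z)" using fib_hilbert zY by simp
    show ?thesis
      using norm_diff_add [of "f z" "g z" "xi (p z)" "eta (p z)"] ctsD(2) [OF f zY(1)] ctsD(2) [OF g zY(1)] zY
        sect_closed [OF W(1) zY(2)] sect_closed [OF W'(1) zY(2)] W(5) [of z] W'(5) [of z] z by simp
  qed
  then show "\<exists>xi\<in>sects B. \<exists>V. openin Y V \<and> y \<in> V \<and> (\<forall>z\<in>V. dst (p z) (vadd (fib B (p z)) (f z) (g z)) (xi (p z)) < e)"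
    using sect_add [OF W(1) W'(1)] W W' by (intro bexI [of _ ?s] exI [of _ "W \<inter> W'"]) auto
qed

lemma cts_scale:
  assumes f: "cts Y p f" and c: "continuous_map Y euclidean c"
  shows "cts Y p (\<lambda>y. vscale (fib B (p y)) (c y) (f y))"
  unfolding cts_section_def
proof (intro conjI ballI allI impI)
  show "continuous_map Y X p" by (rule ctsD [OF f])
  fix y assume y: "y \<in> topspace Y"
  interpret hilbert "fib B (p y)" using fib_hilbert ctsD(3) [OF f y] by simp
  show "vscale (fib B (p y)) (c y) (f y) \<in> pts (fib B (p y))" using ctsD(2) [OF f y] by simp
next
  fix y and e :: real assume y: "y \<in> topspace Y" and e: "0 < e"
  interpret Y: hilbert "fib B (p y)" using fib_hilbert ctsD(3) [OF f y] by simp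
  define M where "M = vnorm (fib B (p y)) (f y) + 1"
  have M: "0 < M" using Y.vnorm_nonneg [OF ctsD(2) [OF f y]] by (simp add: M_def)
  define C where "C = cmod (c y) + 1"
  have C: "0 < C" by (simp add: C_def add_nonneg_pos)
  obtain xi W where W: "xi \<in> sects B" "openin Y W" "y \<in> W" "W \<subseteq> topspace Y"
    "\<And>z. z \<in> W \<Longrightarrow> dst (p z) (f z) (xi (p z)) < e / (2 * C)"
    using cts_approx [OF f y, of "e / (2 * C)"] e C by (metis divide_pos_pos mult_pos_pos zero_less_numeral)
  obtain W1 where W1: "openin Y W1" "y \<in> W1" "\<And>z. z \<in> W1 \<Longrightarrow> vnorm (fib B (p z)) (f z) < M"
    using continuous_map_realD [OF cts_norm [OF f] y, of M] by (auto simp: M_def)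
  obtain W2 where W2: "openin Y W2" "y \<in> W2" "\<forall>z\<in>W2. dist (c z) (c y) < e / (2 * M)"
    using c y e M by (elim continuous_map_euclideanD [of _ _ y "e / (2 * M)"]) auto
  let ?s = "\<lambda>u\<in>topspace X. vscale (fib B u) (c y) (xi u)"
  have "dst (p z) (vscale (fib B (p z)) (c z) (f z)) (?s (p z)) < e" if z: "z \<in> W \<inter> (W1 \<inter> W2)" for z
  proof -
    have zY: "z \<in> topspace Y" "p z \<in> topspace X" using W z ctsD(3) [OF f] by auto
    interpret hilbert "fib B (p z)" using fib_hilbert zY by simp
    note pt = ctsD(2) [OF f zY(1)] sect_closed [OF W(1) zY(2)]
    have "dst (p z) (vscale (fib B (p z)) (c z) (f z)) (?s (p z)) \<le>
        cmod (c z - c y) * vnorm (fib B (p z)) (f z) + cmod (c y) * dst (p z) (f z) (xi (p z))"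
      using norm_diff_triangle [of "vscale (fib B (p z)) (c z) (f z)" "vscale (fib B (p z)) (c y) (f z)" "?s (p z)"] pt zY
      by (simp add: diff_scale diff_scale_left norm_scale)
    also have "\<dots> < e / (2 * M) * M + C * (e / (2 * C))"
    proof (rule add_le_less_mono)
      show "cmod (c z - c y) * vnorm (fib B (p z)) (f z) \<le> e / (2 * M) * M"
        using bspec [OF W2(3), of z] W1(3) [of z] z e M vnorm_nonneg [OF pt(1)]
        by (intro mult_mono) (auto intro: less_imp_le simp: dist_norm)
      show "cmod (c y) * dst (p z) (f z) (xi (p z)) < C * (e / (2 * C))"
      proof (rule le_less_trans)
        show "cmod (c y) * dst (p z) (f z) (xi (p z)) \<le> C * dst (p z) (f z) (xi (p z))"
          using vnorm_nonneg pt by (intro mult_right_mono) (auto simp: C_def)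
        show "C * dst (p z) (f z) (xi (p z)) < C * (e / (2 * C))"
          using W(5) [of z] z C by (intro mult_strict_left_mono) auto
      qed
    qed
    also have "\<dots> = e" using M C by simp
    finally show ?thesis .
  qed
  then show "\<exists>xi\<in>sects B. \<exists>V. openin Y V \<and> y \<in> V \<and> (\<forall>z\<in>V. dst (p z) (vscale (fib B (p z)) (c z) (f z)) (xi (p z)) < e)"
    using sect_scale [OF W(1)] W W1 W2 by (intro bexI [of _ ?s] exI [of _ "W \<inter> (W1 \<inter> W2)"]) auto
qed

lemma cts_diff:
  assumes "cts Y p f" "cts Y p g"
  shows "cts Y p (\<lambda>y. vdiff (fib B (p y)) (f y) (g y))"
  unfolding vdiff_def by (intro cts_add cts_scale assms) simp

lemma cts_zero:
  assumes p: "continuous_map Y X p"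
  shows "cts Y p (\<lambda>y. vzero (fib B (p y)))"
proof (rule cts_eq)
  have "(\<lambda>u\<in>topspace X. vzero (fib B u)) \<in> sects B" using hilbert_bundle by (simp add: hilbert_bundle_def)
  from cts_sect [OF this p] show "cts Y p (\<lambda>y. (\<lambda>u\<in>topspace X. vzero (fib B u)) (p y))" .
qed (use p continuous_map_image_subset_topspace in fastforce)+

lemma cts_inner:
  assumes f: "cts Y p f" and g: "cts Y p g"
  shows "continuous_map Y euclidean (\<lambda>y. vinner (fib B (p y)) (f y) (g y))"
proof -
  define N where "N c y = vnorm (fib B (p y)) (vadd (fib B (p y)) (f y) (vscale (fib B (p y)) c (g y)))" for c y
  have N: "continuous_map Y euclidean (\<lambda>y. s * complex_of_real ((N c y)\<^sup>2))" for c s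
  proof -
    have "continuous_map Y euclideanreal (N c)"
      unfolding N_def by (intro cts_norm cts_add cts_scale f g) simp
    moreover have "continuous_map euclideanreal euclidean (\<lambda>t. s * complex_of_real (t\<^sup>2))"
      by (simp add: continuous_intros)
    ultimately have "continuous_map Y euclidean ((\<lambda>t. s * complex_of_real (t\<^sup>2)) \<circ> N c)"
      by (rule continuous_map_compose)
    then show ?thesis by (simp add: o_def)
  qed
  have "continuous_map Y euclidean (\<lambda>y. (1/4) * complex_of_real ((N 1 y)\<^sup>2) + (-1/4) * complex_of_real ((N (-1) y)\<^sup>2)
      + (\<i>/4) * complex_of_real ((N \<i> y)\<^sup>2) + (-\<i>/4) * complex_of_real ((N (- \<i>) y)\<^sup>2))"
    by (intro continuous_map_add N)
  then show ?thesis
  proof (rule continuous_map_eq)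
    fix y assume y: "y \<in> topspace Y"
    interpret hilbert "fib B (p y)" using fib_hilbert ctsD(3) [OF f y] by simp
    show "(1/4) * complex_of_real ((N 1 y)\<^sup>2) + (-1/4) * complex_of_real ((N (-1) y)\<^sup>2)
      + (\<i>/4) * complex_of_real ((N \<i> y)\<^sup>2) + (-\<i>/4) * complex_of_real ((N (- \<i>) y)\<^sup>2)
      = vinner (fib B (p y)) (f y) (g y)"
    proof -
      have *: "vinner (fib B (p y)) (f y) (g y) = (of_real ((N 1 y)\<^sup>2) - of_real ((N (-1) y)\<^sup>2)
          + \<i> * of_real ((N \<i> y)\<^sup>2) - \<i> * of_real ((N (- \<i>) y)\<^sup>2)) / 4"
        using polarization [of "f y" "g y"] ctsD(2) [OF f y] ctsD(2) [OF g y] by (simp add: N_def)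
      show ?thesis unfolding * by (simp add: algebra_simps add_divide_distrib diff_divide_distrib)
    qed
  qed
qed

text \<open>Left to right, the tube of radius \<open>e\<close> around a section through a nearby vector is open. Right to left,
  the preimage of a basic open set is cut out by the continuous function measuring the distance to a
  section.\<close>

lemma cts_iff_total_top:
  assumes p: "continuous_map Y X p" and cl: "\<And>y. y \<in> topspace Y \<Longrightarrow> f y \<in> pts (fib B (p y))"
  shows "continuous_map Y (total_top X B) (\<lambda>y. (p y, f y)) \<longleftrightarrow> cts Y p f"
proof
  have pX: "p y \<in> topspace X" if "y \<in> topspace Y" for y
    using p that continuous_map_image_subset_topspace by fastforce
  {
    assume c: "continuous_map Y (total_top X B) (\<lambda>y. (p y, f y))"
    show "cts Y p f"
      unfolding cts_section_def
    proof (intro conjI ballI allI impI p cl)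
      fix y and e :: real assume y: "y \<in> topspace Y" and e: "0 < e"
      interpret hilbert "fib B (p y)" using fib_hilbert pX [OF y] by simp
      obtain xi where xi: "xi \<in> sects B" "dst (p y) (xi (p y)) (f y) < e"
        using sect_dense [OF pX [OF y] cl [OF y] e] by blast
      let ?U = "{(u, h). u \<in> topspace X \<and> h \<in> pts (fib B u) \<and> dst u h (xi u) < e}"
      have "openin (total_top X B) ?U"
        unfolding total_top_def using xi e by (intro topology_generated_by_Basis) blast
      from openin_continuous_map_preimage [OF c this]
      have "openin Y {z \<in> topspace Y. (p z, f z) \<in> ?U}" .
      moreover have "y \<in> {z \<in> topspace Y. (p z, f z) \<in> ?U}"
        using y pX cl xi norm_diff_commute [of "xi (p y)" "f y"] sect_closed by auto
      ultimately show "\<exists>xi\<in>sects B. \<exists>W. openin Y W \<and> y \<in> W \<and> (\<forall>z\<in>W. dst (p z) (f z) (xi (p z)) < e)"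
        using xi by (intro bexI [of _ xi] exI [of _ "{z \<in> topspace Y. (p z, f z) \<in> ?U}"]) auto
    qed
  }
  {
    assume f: "cts Y p f"
    show "continuous_map Y (total_top X B) (\<lambda>y. (p y, f y))"
      unfolding total_top_def
    proof (rule continuous_on_generated_topo)
      fix U assume "U \<in> {{(u, h). u \<in> V \<and> h \<in> pts (fib B u) \<and> dst u h (xi u) < e} |V e xi. openin X V \<and> 0 < e \<and> xi \<in> sects B}"
      then obtain V e xi where U: "U = {(u, h). u \<in> V \<and> h \<in> pts (fib B u) \<and> dst u h (xi u) < e}"
        and V: "openin X V" "0 < e" "xi \<in> sects B" by blast
      have "openin Y ({y \<in> topspace Y. p y \<in> V} \<inter> {y \<in> topspace Y. dst (p y) (f y) (xi (p y)) \<in> {..<e}})"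
        by (intro openin_Int openin_continuous_map_preimage [OF p V(1)]
            openin_continuous_map_preimage [OF cts_norm [OF cts_diff [OF f cts_sect [OF V(3) p]]]]) simp
      also have "\<dots> = (\<lambda>y. (p y, f y)) -` U \<inter> topspace Y" using cl by (auto simp: U)
      finally show "openin Y ((\<lambda>y. (p y, f y)) -` U \<inter> topspace Y)" .
    next
      show "(\<lambda>y. (p y, f y)) ` topspace Y
        \<subseteq> \<Union> {{(u, h). u \<in> V \<and> h \<in> pts (fib B u) \<and> dst u h (xi u) < e} |V e xi. openin X V \<and> 0 < e \<and> xi \<in> sects B}"
      proof (clarify)
        fix y assume y: "y \<in> topspace Y"
        interpret hilbert "fib B (p y)" using fib_hilbert pX [OF y] by simp
        obtain xi where xi: "xi \<in> sects B" "dst (p y) (xi (p y)) (f y) < 1"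
          using sect_dense [OF pX [OF y] cl [OF y], of 1] by auto
        then have "dst (p y) (f y) (xi (p y)) < 1"
          using norm_diff_commute [of "xi (p y)" "f y"] sect_closed pX cl y by auto
        then show "(p y, f y) \<in> \<Union> {{(u, h). u \<in> V \<and> h \<in> pts (fib B u) \<and> dst u h (xi u) < e} |V e xi. openin X V \<and> 0 < e \<and> xi \<in> sects B}"
          using xi y pX cl
          by (intro UnionI [of "{(u, h). u \<in> topspace X \<and> h \<in> pts (fib B u) \<and> dst u h (xi u) < 1}"] CollectI
              exI [of _ "topspace X"] exI [of _ "1::real"] exI [of _ xi]) auto
      qed
    qed
  }
qed

end

section \<open>Radon measures and bump functions\<close>

lemma radon_space: "radon_measure X M \<Longrightarrow> space M = topspace X"
  by (simp add: radon_measure_def)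

lemma radon_openin_sets: "radon_measure X M \<Longrightarrow> openin X U \<Longrightarrow> U \<in> sets M"
  by (simp add: radon_measure_def sigma_sets.Basic)

lemma radon_closedin_sets:
  assumes "radon_measure X M" "closedin X C" shows "C \<in> sets M"
proof -
  have "C = space M - (topspace X - C)"
    using closedin_subset [OF assms(2)] radon_space [OF assms(1)] by auto
  moreover have "topspace X - C \<in> sets M"
    using assms by (intro radon_openin_sets) auto
  ultimately show ?thesis using sets.compl_sets [of "topspace X - C" M] by simp
qed

lemma radon_compact_finite: "radon_measure X M \<Longrightarrow> compactin X K \<Longrightarrow> closedin X K \<Longrightarrow> emeasure M K < \<infinity>"
  using radon_closedin_sets [of X M K] unfolding radon_measure_def by blast

text \<open>Integrands over a range fibre are defined only there; they are extended by zero.\<close>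

lemma radon_measurable_closed:
  fixes f :: "'a \<Rightarrow> 'b :: {topological_space, zero}"
  assumes M: "radon_measure X M" and C: "closedin X C"
    and f: "continuous_map (subtopology X C) euclidean f"
  shows "(\<lambda>x. if x \<in> C then f x else 0) \<in> borel_measurable M"
proof (rule borel_measurableI)
  fix S :: "'b set" assume S: "open S"
  have C': "C \<subseteq> topspace X" using C by (rule closedin_subset)
  have "openin (subtopology X C) {x \<in> topspace (subtopology X C). f x \<in> S}"
    by (rule openin_continuous_map_preimage [OF f]) (use S in simp)
  then obtain T where T: "openin X T" "{x \<in> C. f x \<in> S} = T \<inter> C"
    using C' by (auto simp: openin_subtopology Int_absorb2 topspace_subtopology)
  have "(\<lambda>x. if x \<in> C then f x else 0) -` S \<inter> space M =
      (T \<inter> C) \<union> (if 0 \<in> S then space M - C else {})"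
    using T(2) C' radon_space [OF M] by (auto split: if_splits)
  also have "\<dots> \<in> sets M"
    using radon_openin_sets [OF M T(1)] radon_closedin_sets [OF M C] by auto
  finally show "(\<lambda>x. if x \<in> C then f x else 0) -` S \<inter> space M \<in> sets M" .
qed

lemma radon_measurable:
  fixes f :: "'a \<Rightarrow> 'b :: topological_space"
  assumes M: "radon_measure X M" and f: "continuous_map X euclidean f"
  shows "f \<in> borel_measurable M"
proof (rule borel_measurableI)
  fix S :: "'b set" assume S: "open S"
  have "openin X {x \<in> topspace X. f x \<in> S}"
    by (rule openin_continuous_map_preimage [OF f]) (use S in simp)
  moreover have "f -` S \<inter> space M = {x \<in> topspace X. f x \<in> S}" using radon_space [OF M] by auto
  ultimately show "f -` S \<inter> space M \<in> sets M" using radon_openin_sets [OF M] by simp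
qed

lemma continuous_map_bounded_on_compactin:
  fixes f :: "'a \<Rightarrow> 'b :: real_normed_vector"
  assumes f: "continuous_map X euclidean f" and K: "compactin X K"
  obtains b where "0 < b" "\<And>x. x \<in> K \<Longrightarrow> norm (f x) \<le> b"
proof -
  have "compact (f ` K)" using image_compactin [OF K f] by simp
  then obtain b where "0 < b" "\<forall>y\<in>f ` K. norm y \<le> b" using compact_imp_bounded bounded_pos by blast
  then show ?thesis using that by blast
qed

lemma radon_integrable:
  fixes f :: "'a \<Rightarrow> complex"
  assumes M: "radon_measure X M" and meas: "f \<in> borel_measurable M"
    and K: "compactin X K" "closedin X K" and bound: "\<And>x. x \<in> K \<Longrightarrow> norm (f x) \<le> b"
    and zero: "\<And>x. x \<in> topspace X \<Longrightarrow> x \<notin> K \<Longrightarrow> f x = 0"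
  shows "integrable M f"
  by (rule integrableI_bounded_set [where A = K and B = b])
    (use radon_closedin_sets [OF M K(2)] radon_compact_finite [OF M K] meas bound zero radon_space [OF M] in auto)

lemma CcD:
  assumes "f \<in> Cc X"
  shows "continuous_map X euclidean f" "compactin X (X closure_of {x \<in> topspace X. f x \<noteq> 0})"
  using assms by (auto simp: Cc_def)

lemma CcI:
  assumes "continuous_map X euclidean f" "compactin X K" "closedin X K" "\<And>x. x \<in> topspace X \<Longrightarrow> x \<notin> K \<Longrightarrow> f x = 0"
  shows "f \<in> Cc X"
proof -
  have "X closure_of {x \<in> topspace X. f x \<noteq> 0} \<subseteq> K"
    using assms by (intro closure_of_minimal) auto
  then show ?thesis using assms closed_compactin [OF assms(2)] by (simp add: Cc_def)
qed

lemma Cc_integrable: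
  assumes "radon_measure X M" "f \<in> Cc X"
  shows "integrable M f"
proof -
  obtain b where "\<And>x. x \<in> X closure_of {x \<in> topspace X. f x \<noteq> 0} \<Longrightarrow> norm (f x) \<le> b"
    using continuous_map_bounded_on_compactin CcD [OF assms(2)] by metis
  then show ?thesis
    using closure_of_subset [of "{x \<in> topspace X. f x \<noteq> 0}" X] CcD [OF assms(2)]
    by (intro radon_integrable [OF assms(1) radon_measurable [OF assms(1)], of _ "X closure_of {x \<in> topspace X. f x \<noteq> 0}"]) auto
qed

text \<open>The complement of the support is a union of open null sets. This union may be uncountable, but each compact
  subset is covered by finitely many of them, and inner regularity on open sets does the rest.\<close>

lemma radon_AE_msupport:
  assumes M: "radon_measure X M"
  shows "AE x in M. x \<in> msupport X M"
proof -
  define N where "N = \<Union>{U. openin X U \<and> emeasure M U = 0}"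
  have N: "openin X N" unfolding N_def by (intro openin_Union) auto
  have "emeasure M K = 0" if K: "compactin X K" "K \<in> sets M" "K \<subseteq> N" for K
  proof -
    have "\<exists>\<F>. finite \<F> \<and> \<F> \<subseteq> {U. openin X U \<and> emeasure M U = 0} \<and> K \<subseteq> \<Union>\<F>"
    proof -
      have "\<forall>\<U>. (\<forall>U\<in>\<U>. openin X U) \<and> K \<subseteq> \<Union>\<U> \<longrightarrow> (\<exists>\<F>. finite \<F> \<and> \<F> \<subseteq> \<U> \<and> K \<subseteq> \<Union>\<F>)"
        using K(1) unfolding compactin_def by (rule conjunct2)
      from spec [OF this, of "{U. openin X U \<and> emeasure M U = 0}"] show ?thesis
        using K(3) by (simp add: N_def)
    qed
    then obtain \<F> where F: "finite \<F>" "\<F> \<subseteq> {U. openin X U \<and> emeasure M U = 0}" "K \<subseteq> \<Union>\<F>" by blast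
    then have "\<And>U. U \<in> \<F> \<Longrightarrow> U \<in> null_sets M" using radon_openin_sets [OF M] by (auto intro!: null_setsI)
    then have "(\<Union>U\<in>\<F>. U) \<in> null_sets M" using F(1) by (intro null_sets_UN') (auto simp: countable_finite)
    then have "K \<in> null_sets M" using F(3) K(2) by (intro null_sets_subset [of _ M K]) auto
    then show ?thesis by auto
  qed
  moreover have "emeasure M N = (SUP K\<in>{K. compactin X K \<and> K \<in> sets M \<and> K \<subseteq> N}. emeasure M K)"
    using M N unfolding radon_measure_def by blast
  ultimately have "emeasure M N = 0" by (auto simp: SUP_eq_const intro!: antisym SUP_least)
  then have "N \<in> null_sets M" using radon_openin_sets [OF M N] by auto
  moreover have "{x \<in> space M. x \<notin> msupport X M} \<subseteq> N"
    by (auto simp: msupport_def N_def radon_space [OF M] not_gr_zero)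
  ultimately show ?thesis by (rule AE_I')
qed

lemma radon_integral_pos:
  fixes f :: "'a \<Rightarrow> real"
  assumes M: "radon_measure X M" and f: "continuous_map X euclideanreal f" "integrable M f"
    and nonneg: "\<And>x. x \<in> topspace X \<Longrightarrow> 0 \<le> f x" and x: "x \<in> msupport X M" "0 < f x"
  shows "0 < (LINT x|M. f x)"
proof -
  have ae: "AE x in M. 0 \<le> f x" using nonneg radon_space [OF M] by auto
  then have "0 \<le> (LINT x|M. f x)" by (rule integral_nonneg_AE)
  moreover have False if "(LINT x|M. f x) = 0"
  proof -
    have "AE x in M. f x = 0" using integral_nonneg_eq_0_iff_AE [OF f(2) ae] that by simp
    then have "emeasure M {x \<in> space M. f x \<in> {0<..}} = 0"
      by (intro emeasure_eq_0_AE) (auto elim: eventually_mono)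
    then have "emeasure M {x \<in> topspace X. f x \<in> {0<..}} = 0" by (simp add: radon_space [OF M])
    moreover have U: "openin X {x \<in> topspace X. f x \<in> {0<..}}"
      by (rule openin_continuous_map_preimage [OF f(1)]) simp
    moreover have "x \<in> {x \<in> topspace X. f x \<in> {0<..}}" using x by (auto simp: msupport_def)
    ultimately show False using x(1) unfolding msupport_def by (metis (no_types, lifting) less_irrefl mem_Collect_eq)
  qed
  ultimately show ?thesis by fastforce
qed

text \<open>A locally compact Hausdorff space is completely regular; intersecting with a relatively compact
  neighbourhood makes the support compact.\<close>

lemma bump_function:
  assumes X: "locally_compact_space X" "Hausdorff_space X" and U: "openin X U" "x \<in> U"
  obtains b :: "'a \<Rightarrow> real" where "continuous_map X euclideanreal b" "\<And>y. y \<in> topspace X \<Longrightarrow> 0 \<le> b y"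
    "\<And>y. y \<in> topspace X \<Longrightarrow> b y \<le> 1" "b x = 1"
    "\<And>y. y \<in> topspace X \<Longrightarrow> y \<notin> U \<Longrightarrow> b y = 0" "(\<lambda>y. complex_of_real (b y)) \<in> Cc X"
proof -
  have xX: "x \<in> topspace X" using U openin_subset by blast
  obtain V K where VK: "openin X V" "compactin X K" "x \<in> V" "V \<subseteq> K"
    using X(1) xX unfolding locally_compact_space_def by blast
  have "completely_regular_space X"
    using X locally_compact_Hausdorff_imp_regular_space locally_compact_regular_imp_completely_regular_space by blast
  moreover have "closedin X (topspace X - U \<inter> V)" using U VK by auto
  ultimately obtain f where f: "continuous_map X (top_of_set {0..1::real}) f" "f x = 0" "f ` (topspace X - U \<inter> V) \<subseteq> {1}"
  proof -
    assume *: "completely_regular_space X" and **: "closedin X (topspace X - U \<inter> V)"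
    have "x \<in> topspace X - (topspace X - U \<inter> V)" using xX U VK by blast
    then have "\<exists>f. continuous_map X (top_of_set {0..1::real}) f \<and> f x = 0 \<and> f ` (topspace X - U \<inter> V) \<subseteq> {1}"
      using * ** unfolding completely_regular_space_def by meson
    then show ?thesis using that by blast
  qed
  have f01: "f y \<in> {0..1}" if "y \<in> topspace X" for y
    using f(1) that by (auto simp: continuous_map_def)
  have fc: "continuous_map X euclideanreal f" using f(1) continuous_map_into_fulltopology by blast
  have bc: "continuous_map X euclideanreal (\<lambda>y. 1 - f y)" by (intro continuous_map_diff fc) simp
  have "continuous_map X euclidean (complex_of_real \<circ> (\<lambda>y. 1 - f y))"
    by (rule continuous_map_compose [OF bc]) (simp add: continuous_intros)
  then have "(\<lambda>y. complex_of_real (1 - f y)) \<in> Cc X"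
    using f(3) VK compactin_imp_closedin [OF X(2) VK(2)]
    by (intro CcI [of _ _ K]) (auto simp: o_def)
  then show ?thesis
    using f f01 bc by (intro that [of "\<lambda>y. 1 - f y"]) auto
qed

section \<open>Topological groupoids and Haar systems\<close>

locale tgroupoid =
  fixes G :: "'g groupoid"
  assumes topological_groupoid: "topological_groupoid G"
begin

abbreviation r where "r \<equiv> rng G"
abbreviation d where "d \<equiv> src G"
abbreviation mul (infixl "\<cdot>" 70) where "x \<cdot> y \<equiv> gmul G x y"
abbreviation iv where "iv \<equiv> ginv G"
abbreviation arr where "arr \<equiv> arrows G"

lemma inv_arr [simp, intro]: "x \<in> arr \<Longrightarrow> iv x \<in> arr"
  and inv_inv [simp]: "x \<in> arr \<Longrightarrow> iv (iv x) = x"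
  using topological_groupoid by (auto simp: topological_groupoid_def)

lemma d_inv [simp]: "x \<in> arr \<Longrightarrow> d (iv x) = r x"
  and r_inv [simp]: "x \<in> arr \<Longrightarrow> r (iv x) = d x"
  by (simp_all add: src_def rng_def)

lemma composable_iff: "(x, y) \<in> composable G \<longleftrightarrow> x \<in> arr \<and> y \<in> arr \<and> d x = r y"
  by (auto simp: composable_def)

lemma mul_arr [simp, intro]: "x \<in> arr \<Longrightarrow> y \<in> arr \<Longrightarrow> d x = r y \<Longrightarrow> x \<cdot> y \<in> arr"
  using topological_groupoid by (fastforce simp: topological_groupoid_def composable_iff)

lemma assoc_all:
  assumes "x \<in> arr" "y \<in> arr" "z \<in> arr" "d x = r y" "d y = r z"
  shows "(x \<cdot> y, z) \<in> composable G" "(x, y \<cdot> z) \<in> composable G" "x \<cdot> y \<cdot> z = x \<cdot> (y \<cdot> z)"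
proof -
  have "\<forall>x y z. (x, y) \<in> composable G \<and> (y, z) \<in> composable G \<longrightarrow>
        (x \<cdot> y, z) \<in> composable G \<and> (x, y \<cdot> z) \<in> composable G \<and> x \<cdot> y \<cdot> z = x \<cdot> (y \<cdot> z)"
    using topological_groupoid unfolding topological_groupoid_def by blast
  then show "(x \<cdot> y, z) \<in> composable G" "(x, y \<cdot> z) \<in> composable G" "x \<cdot> y \<cdot> z = x \<cdot> (y \<cdot> z)"
    using assms by (auto simp: composable_iff)
qed

lemma d_mul [simp]: "x \<in> arr \<Longrightarrow> y \<in> arr \<Longrightarrow> d x = r y \<Longrightarrow> d (x \<cdot> y) = d y"
  using assoc_all(1) [of x y "iv y"] by (simp add: composable_iff)

lemma r_mul [simp]: "x \<in> arr \<Longrightarrow> y \<in> arr \<Longrightarrow> d x = r y \<Longrightarrow> r (x \<cdot> y) = r x"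
  using assoc_all(2) [of "iv x" x y] by (simp add: composable_iff)

lemma assoc: "x \<in> arr \<Longrightarrow> y \<in> arr \<Longrightarrow> z \<in> arr \<Longrightarrow> d x = r y \<Longrightarrow> d y = r z \<Longrightarrow> x \<cdot> y \<cdot> z = x \<cdot> (y \<cdot> z)"
  by (rule assoc_all)

lemma cancel:
  assumes "x \<in> arr" "y \<in> arr" "d x = r y"
  shows inv_mul_cancel [simp]: "iv x \<cdot> (x \<cdot> y) = y" and mul_inv_cancel_right [simp]: "x \<cdot> y \<cdot> iv y = x"
proof -
  have "\<forall>(x, y)\<in>composable G. iv x \<cdot> (x \<cdot> y) = y \<and> x \<cdot> y \<cdot> iv y = x"
    using topological_groupoid unfolding topological_groupoid_def by blast
  then show "iv x \<cdot> (x \<cdot> y) = y" "x \<cdot> y \<cdot> iv y = x"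
    using assms by (auto simp: composable_iff)
qed

lemma mul_inv_cancel [simp]: "x \<in> arr \<Longrightarrow> y \<in> arr \<Longrightarrow> r x = r y \<Longrightarrow> x \<cdot> (iv x \<cdot> y) = y"
  using inv_mul_cancel [of "iv x" y] by simp

lemma r_arr [simp, intro]: "x \<in> arr \<Longrightarrow> r x \<in> arr" and d_arr [simp, intro]: "x \<in> arr \<Longrightarrow> d x \<in> arr"
  by (simp_all add: rng_def src_def mul_arr)

lemma r_units [simp, intro]: "x \<in> arr \<Longrightarrow> r x \<in> units G" and d_units [simp, intro]: "x \<in> arr \<Longrightarrow> d x \<in> units G"
  by (auto simp: units_def) (metis imageI inv_arr r_inv)

lemma units_arr: "u \<in> units G \<Longrightarrow> u \<in> arr"
  by (auto simp: units_def)

lemma r_mul_self [simp]: "x \<in> arr \<Longrightarrow> r x \<cdot> x = x"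
proof -
  assume x: "x \<in> arr"
  then have "x \<cdot> iv x \<cdot> iv (iv x) = x" by (intro mul_inv_cancel_right) auto
  with x show ?thesis by (simp add: rng_def)
qed

lemma mul_d_self [simp]: "x \<in> arr \<Longrightarrow> x \<cdot> d x = x"
  using mul_inv_cancel [of x x] by (simp add: src_def)

lemma r_unit [simp]: "u \<in> units G \<Longrightarrow> r u = u" and d_unit [simp]: "u \<in> units G \<Longrightarrow> d u = u"
proof -
  have "r (r x) = r x" "d (r x) = r x" if "x \<in> arr" for x
    using r_mul [of x "iv x"] d_mul [of x "iv x"] that by (simp_all add: rng_def [of G x])
  then show "u \<in> units G \<Longrightarrow> r u = u" "u \<in> units G \<Longrightarrow> d u = u" by (auto simp: units_def)
qed

lemma inv_unit [simp]: "u \<in> units G \<Longrightarrow> iv u = u"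
  using mul_d_self [of "iv u"] units_arr [of u] by (metis d_inv d_unit inv_arr r_unit src_def)

lemma units_subset: "units G \<subseteq> topspace (gtop G)"
  using units_arr by (auto simp: arrows_def)

lemma topspace_unit_top [simp]: "topspace (unit_top G) = units G"
  using units_subset by (auto simp: unit_top_def)

lemma inv_mul:
  assumes "x \<in> arr" "y \<in> arr" "d x = r y"
  shows "iv (x \<cdot> y) = iv y \<cdot> iv x"
proof -
  have "x \<cdot> y \<cdot> (iv y \<cdot> iv x) = x \<cdot> iv x"
    using assms by (simp add: assoc)
  then have "x \<cdot> y \<cdot> (iv y \<cdot> iv x) = r x" by (simp add: rng_def [of G x])
  then have "iv (x \<cdot> y) \<cdot> (x \<cdot> y \<cdot> (iv y \<cdot> iv x)) = iv (x \<cdot> y)"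
    using assms mul_d_self [of "iv (x \<cdot> y)"] by simp
  then show ?thesis using assms by (subst (asm) inv_mul_cancel) auto
qed

abbreviation "PG \<equiv> prod_topology (gtop G) (gtop G)"

lemma continuous_inv: "continuous_map (gtop G) (gtop G) iv"
  using topological_groupoid by (simp add: topological_groupoid_def)

lemma continuous_mul: "continuous_map (subtopology PG (composable G)) (gtop G) (\<lambda>(x, y). x \<cdot> y)"
  using topological_groupoid by (simp add: topological_groupoid_def)

lemma continuous_mul':
  assumes f: "continuous_map Y (gtop G) f" and g: "continuous_map Y (gtop G) g"
    and fg: "\<And>y. y \<in> topspace Y \<Longrightarrow> d (f y) = r (g y)"
  shows "continuous_map Y (gtop G) (\<lambda>y. f y \<cdot> g y)"
proof -
  have "continuous_map Y (subtopology PG (composable G)) (\<lambda>y. (f y, g y))"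
    unfolding continuous_map_in_subtopology
  proof
    show "continuous_map Y PG (\<lambda>y. (f y, g y))" using f g by (rule continuous_map_pairedI)
    show "(\<lambda>y. (f y, g y)) \<in> topspace Y \<rightarrow> composable G"
      using f g fg by (auto simp: composable_iff arrows_def continuous_map_def)
  qed
  from continuous_map_compose [OF this continuous_mul] show ?thesis by (simp add: o_def)
qed

lemma continuous_r: "continuous_map (gtop G) (unit_top G) r"
  and continuous_d: "continuous_map (gtop G) (unit_top G) d"
proof -
  have id: "continuous_map (gtop G) (gtop G) (\<lambda>x. x)" by simp
  have "continuous_map (gtop G) (gtop G) (\<lambda>x. x \<cdot> iv x)" "continuous_map (gtop G) (gtop G) (\<lambda>x. iv x \<cdot> x)"
    by (auto intro!: continuous_mul' continuous_inv simp: arrows_def [symmetric])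
  then show "continuous_map (gtop G) (unit_top G) r" "continuous_map (gtop G) (unit_top G) d"
    unfolding unit_top_def rng_def src_def
    by (auto simp: continuous_map_in_subtopology rng_def [symmetric] src_def [symmetric] arrows_def [symmetric])
qed

lemma continuous_r': "continuous_map Y (gtop G) f \<Longrightarrow> continuous_map Y (unit_top G) (\<lambda>y. r (f y))"
  and continuous_d': "continuous_map Y (gtop G) f \<Longrightarrow> continuous_map Y (unit_top G) (\<lambda>y. d (f y))"
  using continuous_map_compose [OF _ continuous_r] continuous_map_compose [OF _ continuous_d] by (auto simp: o_def)

lemma continuous_inv': "continuous_map Y (gtop G) f \<Longrightarrow> continuous_map Y (gtop G) (\<lambda>y. iv (f y))"
  using continuous_map_compose [OF _ continuous_inv] by (auto simp: o_def)

lemma openin_unit_top_preimage: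
  assumes "openin (unit_top G) V"
  shows "openin (gtop G) {x \<in> arr. r x \<in> V}" "openin (gtop G) {x \<in> arr. d x \<in> V}"
  using openin_continuous_map_preimage [OF continuous_r assms]
    openin_continuous_map_preimage [OF continuous_d assms] by (simp_all add: arrows_def)

end

locale hausdorff_groupoid = tgroupoid +
  assumes Hausdorff: "Hausdorff_space (gtop G)"
begin

lemma closedin_agree:
  assumes "continuous_map Y (unit_top G) f" "continuous_map Y (unit_top G) g"
  shows "closedin Y {y \<in> topspace Y. f y = g y}"
proof -
  have 1: "continuous_map Y (gtop G) f" "continuous_map Y (gtop G) g"
    using assms unfolding unit_top_def by (auto simp: continuous_map_in_subtopology)
  show ?thesis using Hausdorff 1
    by (rule closedin_continuous_maps_eq)
qed

lemma closedin_composable: "closedin PG (composable G)"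
proof -
  have "closedin PG {p \<in> topspace PG. d (fst p) = r (snd p)}"
    by (intro closedin_agree continuous_d' continuous_r' continuous_map_fst continuous_map_snd)
  also have "{p \<in> topspace PG. d (fst p) = r (snd p)} = composable G"
    by (auto simp: composable_iff arrows_def)
  finally show ?thesis .
qed

lemma closedin_rfibre: "u \<in> units G \<Longrightarrow> closedin (gtop G) (rfibre G u)"
proof -
  assume "u \<in> units G"
  then have "closedin (gtop G) {x \<in> topspace (gtop G). r x = u}"
    by (intro closedin_agree continuous_r) auto
  then show ?thesis by (simp add: rfibre_def arrows_def)
qed

end

text \<open>The Haar system is used in two ways: its existence makes the range map open, and its integrals provide
  convolutions.\<close>

locale haar_groupoid = hausdorff_groupoid +
  fixes lam :: "'a \<Rightarrow> 'a measure"
  assumes locally_compact: "locally_compact_space (gtop G)"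
    and haar: "haar_system G lam"
begin

lemma haar_radon: "u \<in> units G \<Longrightarrow> radon_measure (gtop G) (lam u)"
  and haar_support: "u \<in> units G \<Longrightarrow> msupport (gtop G) (lam u) = rfibre G u"
  and haar_continuous: "f \<in> Cc (gtop G) \<Longrightarrow> continuous_map (unit_top G) euclidean (\<lambda>u. LINT x|lam u. f x)"
  using haar by (auto simp: haar_system_def)

lemma haar_AE: "u \<in> units G \<Longrightarrow> AE x in lam u. x \<in> rfibre G u"
  using radon_AE_msupport [OF haar_radon] haar_support by auto

lemma haar_bump_pos:
  assumes b: "(\<lambda>y. complex_of_real (b y)) \<in> Cc (gtop G)" "\<And>y. y \<in> arr \<Longrightarrow> 0 \<le> b y"
    and x: "x \<in> arr" "0 < b x"
  shows "0 < (LINT y|lam (r x). b y)"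
proof (rule radon_integral_pos [OF haar_radon])
  have "continuous_map (gtop G) euclideanreal (Re \<circ> (\<lambda>y. complex_of_real (b y)))"
    by (rule continuous_map_compose [OF CcD(1) [OF b(1)]]) (simp add: continuous_intros)
  then show "continuous_map (gtop G) euclideanreal b" by (simp add: o_def)
  show "integrable (lam (r x)) b"
    using integrable_Re [OF Cc_integrable [OF haar_radon [OF r_units [OF x(1)]] b(1)]] by simp
  show "x \<in> msupport (gtop G) (lam (r x))" using x by (simp add: haar_support rfibre_def)
qed (use assms in \<open>auto simp: arrows_def\<close>)

text \<open>The range map of a groupoid with a Haar system is open: if \<open>b\<close> is a bump function at \<open>x\<close>, then
  \<open>u \<mapsto> \<integral> b d\<lambda>\<^sup>u\<close> is continuous and positive at \<open>r x\<close>, and where it does not vanish the fibre contains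
  a point with \<open>b \<noteq> 0\<close>.\<close>

lemma open_r:
  assumes U: "openin (gtop G) U"
  shows "openin (unit_top G) (r ` U)"
proof (subst openin_subopen, intro ballI)
  fix u assume "u \<in> r ` U"
  then obtain x where x: "x \<in> U" "u = r x" by blast
  then have xa: "x \<in> arr" using openin_subset [OF U] by (auto simp: arrows_def)
  obtain b :: "'a \<Rightarrow> real" where b: "continuous_map (gtop G) euclideanreal b" "\<And>y. y \<in> topspace (gtop G) \<Longrightarrow> 0 \<le> b y"
    "b x = 1" "\<And>y. y \<in> topspace (gtop G) \<Longrightarrow> y \<notin> U \<Longrightarrow> b y = 0" "(\<lambda>y. complex_of_real (b y)) \<in> Cc (gtop G)"
    using bump_function [OF locally_compact Hausdorff U x(1)] by metis
  define F where "F u = (LINT y|lam u. complex_of_real (b y))" for u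
  have "continuous_map (unit_top G) euclidean F" unfolding F_def using haar_continuous b(5) by blast
  then have "openin (unit_top G) {u \<in> topspace (unit_top G). F u \<in> - {0}}"
    by (rule openin_continuous_map_preimage) (simp add: open_Compl)
  moreover have "F u \<noteq> 0"
    using haar_bump_pos [OF b(5) _ xa] b x by (simp add: F_def arrows_def)
  moreover have "u' \<in> r ` U" if u': "u' \<in> units G" "F u' \<noteq> 0" for u'
  proof (rule ccontr)
    assume "u' \<notin> r ` U"
    then have "AE y in lam u'. complex_of_real (b y) = 0"
      by (intro eventually_mono [OF haar_AE [OF u'(1)]]) (use b(4) in \<open>auto simp: rfibre_def arrows_def\<close>)
    then have "F u' = 0" unfolding F_def by (rule integral_eq_zero_AE)
    then show False using u' by simp
  qed
  ultimately show "\<exists>T. openin (unit_top G) T \<and> u \<in> T \<and> T \<subseteq> r ` U"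
    using x xa by (intro exI [of _ "{u \<in> topspace (unit_top G). F u \<in> - {0}}"]) auto
qed

end

section \<open>The coset space\<close>

lemma openin_prod_topologyE:
  assumes "openin (prod_topology X Y) S" "(x, y) \<in> S"
  obtains U V where "openin X U" "openin Y V" "x \<in> U" "y \<in> V" "U \<times> V \<subseteq> S"
  using assms unfolding openin_prod_topology_alt by meson

locale coset_setting = haar_groupoid G lam for G :: "'g groupoid" and lam +
  fixes H :: "'g set" and lamH :: "'g \<Rightarrow> 'g measure"
  assumes wide: "wide_subgroupoid G H"
    and closed_H: "closedin (gtop G) H"
    and haarH: "haar_system (restrict_groupoid G H) lamH"
begin

lemma H_arr: "h \<in> H \<Longrightarrow> h \<in> arr"
  and H_inv [simp, intro]: "h \<in> H \<Longrightarrow> iv h \<in> H"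
  and H_mul [simp, intro]: "h \<in> H \<Longrightarrow> k \<in> H \<Longrightarrow> d h = r k \<Longrightarrow> h \<cdot> k \<in> H"
  using wide by (auto simp: wide_subgroupoid_def composable_iff subset_iff)

abbreviation "GH \<equiv> restrict_groupoid G H"

lemma restrict_simps [simp]:
  "gtop GH = subtopology (gtop G) H" "gmul GH = gmul G" "ginv GH = ginv G"
  "rng GH = rng G" "src GH = src G"
  by (auto simp: restrict_groupoid_def rng_def src_def fun_eq_iff)

lemma arrows_restrict [simp]: "arrows GH = H"
  using H_arr by (auto simp: arrows_def)

lemma units_restrict [simp]: "units GH = units G"
  using wide by (simp add: wide_subgroupoid_def)

lemma units_H: "u \<in> units G \<Longrightarrow> u \<in> H"
proof -
  assume "u \<in> units G"
  then have "u \<in> r ` H" by (metis arrows_restrict restrict_simps(4) units_def units_restrict)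
  then obtain h where "h \<in> H" "u = r h" by blast
  then show ?thesis using H_mul [of h "iv h"] H_arr [of h] by (simp add: rng_def [of G h])
qed

lemma unit_top_restrict: "unit_top GH = unit_top G"
  unfolding unit_top_def using units_H
  by (auto simp: subtopology_subtopology intro!: arg_cong [where f = "subtopology (gtop G)"])

text \<open>The range map of \<open>H\<close> becomes open through this instance.\<close>

lemma haar_groupoid_restrict: "haar_groupoid GH lamH"
proof
  have comp: "composable GH = composable G \<inter> H \<times> H"
    using H_arr by (auto simp: composable_def)
  show "topological_groupoid GH"
    unfolding topological_groupoid_def
  proof (intro conjI ballI allI impI; (clarsimp simp: comp composable_iff)?)
    show "continuous_map (subtopology (gtop G) H) (subtopology (gtop G) H) iv"
      using continuous_inv by (auto simp: continuous_map_in_subtopology continuous_map_from_subtopology)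
    have "continuous_map (subtopology PG (composable G \<inter> H \<times> H)) (gtop G) (\<lambda>(x, y). x \<cdot> y)"
      using continuous_mul by (rule continuous_map_from_subtopology_mono) auto
    then have "continuous_map (subtopology PG (composable G \<inter> H \<times> H)) (subtopology (gtop G) H) (\<lambda>(x, y). x \<cdot> y)"
      unfolding continuous_map_in_subtopology by (auto simp: composable_iff)
    moreover have "H \<times> H \<inter> (composable G \<inter> H \<times> H) = composable G \<inter> H \<times> H" by blast
    ultimately show "continuous_map (subtopology (prod_topology (subtopology (gtop G) H) (subtopology (gtop G) H))
        (composable G \<inter> H \<times> H)) (subtopology (gtop G) H) (\<lambda>(x, y). x \<cdot> y)"
      by (simp only: subtopology_Times [symmetric] subtopology_subtopology)
  qed (auto simp: H_arr assoc)
  show "Hausdorff_space (gtop GH)" using Hausdorff by (simp add: Hausdorff_space_subtopology)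
  show "locally_compact_space (gtop GH)"
    using locally_compact closed_H by (simp add: locally_compact_space_closed_subset)
  show "haar_system GH lamH" by (rule haarH)
qed

abbreviation "q \<equiv> coset G H"
abbreviation "CT \<equiv> coset_top G H"
abbreviation "rep \<equiv> coset_rep G H"

lemma coset_self: "x \<in> arr \<Longrightarrow> x \<in> q x"
  using units_H [of "d x"] by (auto simp: coset_def intro!: exI [of _ "d x"])

lemma mem_cosetD:
  assumes "x \<in> arr" "y \<in> q x" shows "y \<in> arr" "r y = r x" "iv x \<cdot> y \<in> H"
  using assms by (auto simp: coset_def H_arr)

lemma coset_mul_H [simp]:
  assumes "x \<in> arr" "h \<in> H" "d x = r h" shows "q (x \<cdot> h) = q x"
proof
  show "q (x \<cdot> h) \<subseteq> q x"
    using assms by (force simp: coset_def assoc H_arr)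
  show "q x \<subseteq> q (x \<cdot> h)"
  proof
    fix y assume "y \<in> q x"
    then obtain k where k: "k \<in> H" "r k = d x" "y = x \<cdot> k" by (auto simp: coset_def)
    then have "y = x \<cdot> h \<cdot> (iv h \<cdot> k)" using assms by (simp add: assoc H_arr)
    moreover have "iv h \<cdot> k \<in> H" "r (iv h \<cdot> k) = d (x \<cdot> h)" using assms k by (auto simp: H_arr)
    ultimately show "y \<in> q (x \<cdot> h)" by (auto simp: coset_def)
  qed
qed

lemma coset_eq_iff:
  assumes "x \<in> arr" "y \<in> arr"
  shows "q x = q y \<longleftrightarrow> r x = r y \<and> iv x \<cdot> y \<in> H"
proof
  assume "q x = q y"
  then show "r x = r y \<and> iv x \<cdot> y \<in> H" using coset_self [OF assms(2)] mem_cosetD [OF assms(1), of y] by auto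
next
  assume *: "r x = r y \<and> iv x \<cdot> y \<in> H"
  then have "q (x \<cdot> (iv x \<cdot> y)) = q x" using assms by (intro coset_mul_H) auto
  then show "q x = q y" using * assms by simp
qed

lemma coset_eqE:
  assumes "x \<in> arr" "y \<in> arr" "q x = q y"
  obtains h where "h \<in> H" "d x = r h" "y = x \<cdot> h"
  using assms that [of "iv x \<cdot> y"] by (simp add: coset_eq_iff)

lemma rep_coset: "x \<in> arr \<Longrightarrow> rep (q x) \<in> arr" "x \<in> arr \<Longrightarrow> q (rep (q x)) = q x"
  by (simp_all add: coset_rep_def inv_into_into f_inv_into_f)

lemma rep_cases:
  assumes "x \<in> arr"
  obtains h where "h \<in> H" "d x = r h" "rep (q x) = x \<cdot> h"
  using coset_eqE [OF assms rep_coset(1) [OF assms]] rep_coset(2) [OF assms] by metis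

lemma moment_coset [simp]: "x \<in> arr \<Longrightarrow> moment G H (q x) = r x"
  using rep_coset [of x] coset_eq_iff [of x "rep (q x)"] by (simp add: moment_def)

lemma topspace_CT: "topspace CT = q ` arr"
  by (rule topspace_coset_top)

lemma mem_moment_fibre: "c \<in> moment_fibre G H u \<longleftrightarrow> (\<exists>x\<in>arr. c = q x \<and> r x = u)"
  by (auto simp: moment_fibre_def topspace_CT)

lemma translate_coset:
  assumes "x \<in> arr" "y \<in> arr" "d x = r y" shows "gmul G x ` q y = q (x \<cdot> y)"
  using assms by (force simp: coset_def assoc H_arr image_iff)

lemma continuous_q: "continuous_map (gtop G) CT q"
  by (rule quotient_imp_continuous_map [OF quotient_map_coset])

text \<open>The value at a coset is read off at a chosen representative; invariance makes the choice irrelevant, and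
  continuity descends along the quotient map.\<close>

lemma continuous_map_CT:
  assumes f: "continuous_map (gtop G) Y f" and inv: "\<And>x h. x \<in> arr \<Longrightarrow> h \<in> H \<Longrightarrow> d x = r h \<Longrightarrow> f (x \<cdot> h) = f x"
  shows "continuous_map CT Y (\<lambda>c. f (rep c))"
proof (rule continuous_compose_quotient_map [OF quotient_map_coset])
  show "continuous_map (gtop G) Y ((\<lambda>c. f (rep c)) \<circ> q)"
  proof (rule continuous_map_eq [OF f])
    fix x assume "x \<in> topspace (gtop G)"
    then have x: "x \<in> arr" by (simp add: arrows_def)
    obtain h where "h \<in> H" "d x = r h" "rep (q x) = x \<cdot> h" by (rule rep_cases [OF x])
    then show "f x = ((\<lambda>c. f (rep c)) \<circ> q) x" using inv x by simp
  qed
qed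

lemma continuous_moment: "continuous_map CT (unit_top G) (moment G H)"
  unfolding moment_def by (intro continuous_map_CT continuous_r) (auto simp: H_arr)

lemma closedin_moment_fibre: "u \<in> units G \<Longrightarrow> closedin CT (moment_fibre G H u)"
proof -
  assume u: "u \<in> units G"
  have "closedin CT {c \<in> topspace CT. moment G H c = u}"
    by (intro closedin_agree continuous_moment) (use u in simp)
  then show ?thesis by (simp add: moment_fibre_def)
qed

text \<open>The quotient map is open, because the range map of \<open>H\<close> is.\<close>

lemma open_q:
  assumes U: "openin (gtop G) U"
  shows "openin CT (q ` U)"
proof -
  interpret K: haar_groupoid GH lamH by (rule haar_groupoid_restrict)
  have Ua: "U \<subseteq> arr" using openin_subset [OF U] by (simp add: arrows_def)
  have "openin (gtop G) {y \<in> arr. q y \<in> q ` U}"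
  proof (subst openin_subopen, intro ballI)
    fix y assume "y \<in> {y \<in> arr. q y \<in> q ` U}"
    then obtain x where y: "y \<in> arr" and x: "x \<in> U" "q y = q x" by auto
    then have xa: "x \<in> arr" using Ua by auto
    obtain k where k: "k \<in> H" "d y = r k" "x = y \<cdot> k" using coset_eqE [OF y xa x(2)] .
    have "openin (subtopology PG (composable G)) {p \<in> topspace (subtopology PG (composable G)). (\<lambda>(x, y). x \<cdot> y) p \<in> U}"
      by (rule openin_continuous_map_preimage [OF continuous_mul U])
    then obtain T where T: "openin PG T" "{p \<in> topspace (subtopology PG (composable G)). (\<lambda>(x, y). x \<cdot> y) p \<in> U} = T \<inter> composable G"
      by (auto simp: openin_subtopology)
    have "(y, k) \<in> {p \<in> topspace (subtopology PG (composable G)). (\<lambda>(x, y). x \<cdot> y) p \<in> U}"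
      using y k x H_arr by (auto simp: composable_iff arrows_def)
    then have "(y, k) \<in> T" unfolding T(2) by (rule IntD1)
    then obtain A B where AB: "openin (gtop G) A" "openin (gtop G) B" "y \<in> A" "k \<in> B" "A \<times> B \<subseteq> T"
      using openin_prod_topologyE [OF T(1)] by metis
    have "openin (unit_top GH) (rng GH ` (B \<inter> H))"
      using AB(2) by (intro K.open_r) (auto simp: openin_subtopology)
    then have "openin (unit_top G) (r ` (B \<inter> H))" by (simp add: unit_top_restrict)
    then have "openin (gtop G) (A \<inter> {z \<in> arr. d z \<in> r ` (B \<inter> H)})"
      using AB(1) openin_unit_top_preimage by auto
    moreover have "y \<in> A \<inter> {z \<in> arr. d z \<in> r ` (B \<inter> H)}" using AB y k by auto
    moreover have "A \<inter> {z \<in> arr. d z \<in> r ` (B \<inter> H)} \<subseteq> {y \<in> arr. q y \<in> q ` U}"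
    proof
      fix z assume "z \<in> A \<inter> {z \<in> arr. d z \<in> r ` (B \<inter> H)}"
      then obtain h where z: "z \<in> A" "z \<in> arr" "d z = r h" "h \<in> B" "h \<in> H" by auto
      then have "(z, h) \<in> T \<inter> composable G" using AB H_arr by (auto simp: composable_iff)
      then have "z \<cdot> h \<in> U" unfolding T(2) [symmetric] by simp
      moreover have "q z = q (z \<cdot> h)" using z by simp
      ultimately show "z \<in> {y \<in> arr. q y \<in> q ` U}" using z by blast
    qed
    ultimately show "\<exists>T. openin (gtop G) T \<and> y \<in> T \<and> T \<subseteq> {y \<in> arr. q y \<in> q ` U}" by blast
  qed
  then show ?thesis using Ua by (auto simp: openin_coset_top)
qed

text \<open>An open quotient by a closed equivalence relation is Hausdorff. The relation is closed since it consists
  of the pairs with equal range and \<open>x\<^sup>-\<^sup>1 y\<close> in the closed set \<open>H\<close>.\<close>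

lemma Hausdorff_CT: "Hausdorff_space CT"
  unfolding Hausdorff_space_def
proof (intro allI impI)
  fix c e assume ce: "c \<in> topspace CT \<and> e \<in> topspace CT \<and> c \<noteq> e"
  then obtain x y where xy: "x \<in> arr" "y \<in> arr" "c = q x" "e = q y" by (auto simp: topspace_CT)
  let ?D = "{p \<in> topspace PG. r (fst p) = r (snd p)}"
  have D: "closedin PG ?D"
    by (intro closedin_agree continuous_r' continuous_map_fst continuous_map_snd)
  have cont: "continuous_map (subtopology PG ?D) (gtop G) (\<lambda>p. iv (fst p) \<cdot> snd p)"
    by (intro continuous_mul' continuous_inv' continuous_map_from_subtopology continuous_map_fst continuous_map_snd)
      (auto simp: arrows_def [symmetric])
  have "closedin (subtopology PG ?D) {p \<in> topspace (subtopology PG ?D). iv (fst p) \<cdot> snd p \<in> H}"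
    by (rule closedin_continuous_map_preimage [OF cont closed_H])
  then have R: "closedin PG {p \<in> topspace (subtopology PG ?D). iv (fst p) \<cdot> snd p \<in> H}" (is "closedin PG ?R")
    using D closedin_closed_subtopology by blast
  have 1: "(x, y) \<in> topspace PG - ?R" using ce xy coset_eq_iff [of x y] by (auto simp: arrows_def)
  have 2: "openin PG (topspace PG - ?R)" using R by (rule openin_diff [OF openin_topspace])
  obtain A B where AB: "openin (gtop G) A" "openin (gtop G) B" "x \<in> A" "y \<in> B" "A \<times> B \<subseteq> topspace PG - ?R"
    by (rule openin_prod_topologyE [OF 2 1])
  have "q a \<noteq> q b" if "a \<in> A" "b \<in> B" for a b
  proof -
    have ab: "a \<in> arr" "b \<in> arr" using that AB openin_subset by (auto simp: arrows_def)
    have "(a, b) \<notin> ?R" using AB that by auto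
    then show ?thesis using ab coset_eq_iff [OF ab] by (auto simp: arrows_def)
  qed
  then have "disjnt (q ` A) (q ` B)" by (auto simp: disjnt_def)
  then show "\<exists>U V. openin CT U \<and> openin CT V \<and> c \<in> U \<and> e \<in> V \<and> disjnt U V"
    using open_q AB xy by blast
qed

lemma compact_CT_closed: "compactin CT K \<Longrightarrow> closedin CT K"
  by (rule compactin_imp_closedin [OF Hausdorff_CT])

text \<open>The images of relatively compact open sets are open and cover.\<close>

lemma compact_lift:
  assumes K: "compactin CT K"
  obtains C where "compactin (gtop G) C" "K \<subseteq> q ` C"
proof -
  have "\<exists>V C. openin (gtop G) V \<and> compactin (gtop G) C \<and> x \<in> V \<and> V \<subseteq> C" if "x \<in> arr" for x
    using locally_compact that unfolding locally_compact_space_def arrows_def by blast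
  then obtain V C where VC: "\<And>x. x \<in> arr \<Longrightarrow> openin (gtop G) (V x) \<and> compactin (gtop G) (C x) \<and> x \<in> V x \<and> V x \<subseteq> C x"
    by metis
  have sub: "K \<subseteq> \<Union>((\<lambda>x. q ` V x) ` arr)"
  proof
    fix c assume "c \<in> K"
    then obtain x where "x \<in> arr" "c = q x" using compactin_subset_topspace [OF K] by (auto simp: topspace_CT)
    then show "c \<in> \<Union>((\<lambda>x. q ` V x) ` arr)" using VC by blast
  qed
  have op: "openin CT W" if "W \<in> (\<lambda>x. q ` V x) ` arr" for W using that VC open_q by auto
  obtain F where F: "finite F" "F \<subseteq> (\<lambda>x. q ` V x) ` arr" "K \<subseteq> \<Union>F"
    using compactinD [OF K, of "(\<lambda>x. q ` V x) ` arr"] sub op by auto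
  then obtain X where X: "X \<subseteq> arr" "finite X" "F = (\<lambda>x. q ` V x) ` X" by (metis finite_subset_image)
  have "compactin (gtop G) (\<Union>(C ` X))"
    using X VC by (intro compactin_Union) auto
  moreover have "K \<subseteq> q ` \<Union>(C ` X)" 
  proof
    fix c assume "c \<in> K"
    then obtain x where "x \<in> X" "c \<in> q ` V x" using F(3) X(3) by auto
    moreover have "V x \<subseteq> C x" using VC X(1) \<open>x \<in> X\<close> by auto
    ultimately show "c \<in> q ` \<Union>(C ` X)" by auto
  qed
  ultimately show ?thesis by (rule that)
qed

end

locale equivariant_setting = coset_setting G lam H lamH for G :: "'g groupoid" and lam H lamH +
  fixes mu :: "'g \<Rightarrow> 'g set measure"
  assumes equivariant: "equivariant_system G H mu"
begin

lemma mu_radon: "u \<in> units G \<Longrightarrow> radon_measure CT (mu u)"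
  and mu_continuous: "f \<in> Cc CT \<Longrightarrow> continuous_map (unit_top G) euclidean (\<lambda>u. LINT c|mu u. f c)"
  using equivariant by (auto simp: equivariant_system_def)

lemma mu_AE: "u \<in> units G \<Longrightarrow> AE c in mu u. c \<in> moment_fibre G H u"
  using radon_AE_msupport [OF mu_radon, of u] equivariant by (auto simp: equivariant_system_def)

lemma mu_integrable: "u \<in> units G \<Longrightarrow> f \<in> Cc CT \<Longrightarrow> integrable (mu u) f"
  using Cc_integrable mu_radon by blast

lemma mu_cong:
  assumes u: "u \<in> units G" and f: "f \<in> Cc CT" and g: "g \<in> Cc CT"
    and eq: "\<And>x. x \<in> arr \<Longrightarrow> r x = u \<Longrightarrow> f (q x) = g (q x)"
  shows "(LINT c|mu u. f c) = (LINT c|mu u. g c)"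
proof (rule integral_cong_AE)
  show "AE c in mu u. f c = g c"
    using mu_AE [OF u] by (rule eventually_mono) (auto simp: mem_moment_fibre eq)
qed (use mu_integrable [OF u] f g in auto)

text \<open>Equivariance of \<open>\<mu>\<close>, in a form that mentions representatives of cosets only.\<close>

lemma mu_translate:
  assumes x: "x \<in> arr" and f: "f \<in> Cc CT" and g: "g \<in> Cc CT"
    and eq: "\<And>y. y \<in> arr \<Longrightarrow> r y = d x \<Longrightarrow> f (q (x \<cdot> y)) = g (q y)"
  shows "(LINT c|mu (r x). f c) = (LINT c|mu (d x). g c)"
proof -
  let ?F = "moment_fibre G H (d x)"
  have "(LINT c|mu (r x). f c) = (LINT c:?F|mu (d x). f (gmul G x ` c))"
    using equivariant f x by (auto simp: equivariant_system_def)
  also have "\<dots> = (LINT c:?F|mu (d x). g c)"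
    unfolding set_lebesgue_integral_def
  proof (rule Bochner_Integration.integral_cong [OF refl])
    fix c show "indicat_real ?F c *\<^sub>R f (gmul G x ` c) = indicat_real ?F c *\<^sub>R g c"
      using eq x translate_coset by (auto simp: indicator_def mem_moment_fibre)
  qed
  also have "\<dots> = (LINT c|mu (d x). g c)"
    unfolding set_lebesgue_integral_def
  proof (rule integral_cong_AE)
    have gm: "g \<in> borel_measurable (mu (d x))" using mu_integrable [of "d x" g] x g by auto
    then show "g \<in> borel_measurable (mu (d x))" .
    have "?F \<in> sets (mu (d x))" using radon_closedin_sets [OF mu_radon closedin_moment_fibre] x by simp
    then show "(\<lambda>c. indicat_real ?F c *\<^sub>R g c) \<in> borel_measurable (mu (d x))" using gm by auto
    show "AE c in mu (d x). indicat_real ?F c *\<^sub>R g c = g c"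
      using mu_AE [of "d x"] x by (auto elim: eventually_mono)
  qed
  finally show ?thesis .
qed

end

section \<open>Equivariant functions and their inner products\<close>

lemma continuous_map_of_real:
  assumes "continuous_map X euclideanreal f"
  shows "continuous_map X euclidean (\<lambda>x. complex_of_real (f x))"
proof -
  have "continuous_map X euclidean (complex_of_real \<circ> f)"
    by (rule continuous_map_compose [OF assms]) (simp add: continuous_intros)
  then show ?thesis by (simp add: o_def)
qed

lemma continuous_map_Re:
  assumes "continuous_map X euclidean f"
  shows "continuous_map X euclideanreal (\<lambda>x. Re (f x))"
proof -
  have "continuous_map X euclidean (Re \<circ> f)"
    by (rule continuous_map_compose [OF assms]) (simp add: continuous_intros)
  then show ?thesis by (simp add: o_def)
qed

locale induced_setting = equivariant_setting G lam H lamH mu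
  for G :: "'g groupoid" and lam H lamH mu +
  fixes \<H> :: "('g, 'h) hbundle" and \<sigma> :: "'g \<Rightarrow> 'h \<Rightarrow> 'h"
  assumes rep_H: "unitary_representation (restrict_groupoid G H) \<H> \<sigma>"
begin

sublocale hilb_bundle "unit_top G" \<H>
  using rep_H by unfold_locales (simp add: unitary_representation_def unit_top_restrict)

abbreviation "E x \<equiv> fib \<H> (d x)"

lemma hilbert_E: "x \<in> arr \<Longrightarrow> hilbert (E x)"
  by (rule fib_hilbert) simp

lemma unitary_sigma: "h \<in> H \<Longrightarrow> unitary_map (fib \<H> (d h)) (fib \<H> (r h)) (\<sigma> h)"
  using rep_H by (simp add: unitary_representation_def)

lemma unitary_sigma_inv: "h \<in> H \<Longrightarrow> unitary_map (fib \<H> (r h)) (fib \<H> (d h)) (\<sigma> (iv h))"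
  using unitary_sigma [of "iv h"] H_arr [of h] by simp

definition equivariant_fun :: "('g \<Rightarrow> 'h) \<Rightarrow> bool" where
  "equivariant_fun f \<longleftrightarrow> (\<forall>x\<in>arr. \<forall>h\<in>H. d x = r h \<longrightarrow> f (x \<cdot> h) = \<sigma> (iv h) (f x))"

definition supported :: "'g set set \<Rightarrow> ('g \<Rightarrow> 'h) \<Rightarrow> bool" where
  "supported K f \<longleftrightarrow> (\<forall>x\<in>arr. q x \<notin> K \<longrightarrow> f x = vzero (E x))"

abbreviation "V \<equiv> F0 G H \<H> \<sigma>"

lemma unitary_map_zero_iff:
  assumes T: "unitary_map W W' T" and "hilbert W" "hilbert W'" "a \<in> pts W"
  shows "T a = vzero W' \<longleftrightarrow> a = vzero W"
proof -
  interpret W: hilbert W by fact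
  interpret W': hilbert W' by fact
  show ?thesis
    using unitary_map_norm [OF T assms(4)] unitary_map_closed [OF T assms(4)] assms(4)
    by (metis W'.norm_zero_iff W.norm_zero_iff)
qed

lemma equivariant_zero_iff:
  assumes f: "equivariant_fun f" "f x \<in> pts (E x)" and x: "x \<in> arr" and h: "h \<in> H" "d x = r h"
  shows "f (x \<cdot> h) = vzero (E (x \<cdot> h)) \<longleftrightarrow> f x = vzero (E x)"
proof -
  have "f (x \<cdot> h) = \<sigma> (iv h) (f x)" using f x h by (simp add: equivariant_fun_def)
  then show ?thesis
    using unitary_map_zero_iff [OF unitary_sigma_inv [OF h(1)]] h x f(2) H_arr [OF h(1)]
    by (simp add: fib_hilbert)
qed

text \<open>The set where \<open>f\<close> does not vanish is a union of cosets. As the quotient map is open, so is its closure.\<close>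

lemma closed_coset_support:
  assumes f: "equivariant_fun f" "\<And>x. x \<in> arr \<Longrightarrow> f x \<in> pts (E x)"
  shows "closedin CT (q ` fun_support G \<H> f)"
proof -
  let ?S = "{x \<in> arr. f x \<noteq> vzero (E x)}" and ?O = "arr - fun_support G \<H> f"
  have O: "openin (gtop G) ?O"
    unfolding fun_support_def arrows_def by (intro openin_diff openin_topspace closedin_closure_of)
  let ?W = "{z \<in> topspace (gtop G). q z \<in> q ` ?O}"
  have W: "openin (gtop G) ?W"
    by (rule openin_continuous_map_preimage [OF continuous_q open_q [OF O]])
  have "?W \<inter> ?S = {}"
  proof (rule ccontr)
    assume "?W \<inter> ?S \<noteq> {}"
    then obtain z y where z: "z \<in> arr" "f z \<noteq> vzero (E z)" and y: "y \<in> ?O" "q z = q y" by auto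
    have "y \<in> arr" "q z = q y" using y by auto
    then obtain h where h: "h \<in> H" "d z = r h" "y = z \<cdot> h" using coset_eqE [OF z(1)] by metis
    have "f y \<noteq> vzero (E y)" using equivariant_zero_iff [OF f(1) f(2) z(1) h(1,2)] z h by simp
    then have "y \<in> ?S" using y by auto
    also have "?S \<subseteq> fun_support G \<H> f"
      unfolding fun_support_def by (rule closure_of_subset) (auto simp: arrows_def)
    finally show False using y by auto
  qed
  then have "?W \<inter> (gtop G closure_of ?S) = {}"
    by (rule iffD2 [OF openin_Int_closure_of_eq_empty [OF W]])
  moreover have "gtop G closure_of ?S = fun_support G \<H> f" by (simp add: fun_support_def)
  ultimately have disj: "x \<notin> fun_support G \<H> f" if "x \<in> arr" "q x \<in> q ` ?O" for x
    using that by (auto simp: arrows_def)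
  have sub: "fun_support G \<H> f \<subseteq> arr"
    unfolding fun_support_def arrows_def by (rule closure_of_subset_topspace)
  have "q ` fun_support G \<H> f = topspace CT - q ` ?O"
    unfolding topspace_CT
  proof (intro equalityI subsetI)
    fix c assume "c \<in> q ` fun_support G \<H> f"
    then obtain x where "x \<in> fun_support G \<H> f" "c = q x" by blast
    then show "c \<in> q ` arr - q ` ?O" using disj [of x] sub by blast
  qed blast
  then show ?thesis using open_q [OF O] by (simp add: closedin_diff)
qed

text \<open>Compactness of the image of the support may be replaced by vanishing outside some compact set of cosets,
  a condition that passes directly to sums, multiples and limits.\<close>

lemma F0_iff:
  "f \<in> pts V \<longleftrightarrow> f \<in> extensional arr \<and> cts (gtop G) d f \<and> equivariant_fun f \<and>
     (\<exists>K. compactin CT K \<and> supported K f)" (is "_ \<longleftrightarrow> ?R")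
proof -
  have eq: "f \<in> pts V \<longleftrightarrow> f \<in> extensional arr \<and> cts (gtop G) d f \<and> equivariant_fun f \<and>
     compactin CT (q ` fun_support G \<H> f)"
  proof -
    have "f \<in> C_bundle G \<H> \<longleftrightarrow> f \<in> extensional arr \<and> cts (gtop G) d f"
    proof -
      have "f \<in> C_bundle G \<H> \<longleftrightarrow> f \<in> extensional arr \<and> (\<forall>x\<in>arr. f x \<in> pts (E x)) \<and>
          continuous_map (gtop G) (total_top (unit_top G) \<H>) (\<lambda>x. (d x, f x))"
        by (auto simp: C_bundle_def PiE_def)
      also have "\<dots> \<longleftrightarrow> f \<in> extensional arr \<and> cts (gtop G) d f"
        using cts_iff_total_top [OF continuous_d, of f] ctsD(2) [of "gtop G" d f]
        by (auto simp: arrows_def)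
      finally show ?thesis .
    qed
    then show ?thesis
      by (auto simp: F0_def equivariant_fun_def composable_iff H_arr)
  qed
  show ?thesis
  proof
    assume f: "f \<in> pts V"
    have "{x \<in> arr. f x \<noteq> vzero (E x)} \<subseteq> fun_support G \<H> f"
      unfolding fun_support_def by (rule closure_of_subset) (auto simp: arrows_def)
    then have "supported (q ` fun_support G \<H> f) f" by (auto simp: supported_def)
    then show ?R using f eq by blast
  next
    assume R: ?R
    then obtain K where K: "compactin CT K" "supported K f" by blast
    have "closedin (gtop G) {x \<in> topspace (gtop G). q x \<in> K}"
      by (rule closedin_continuous_map_preimage [OF continuous_q compact_CT_closed [OF K(1)]])
    then have "fun_support G \<H> f \<subseteq> {x \<in> topspace (gtop G). q x \<in> K}"
      unfolding fun_support_def using K(2) by (intro closure_of_minimal) (auto simp: supported_def arrows_def)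
    then have "q ` fun_support G \<H> f \<subseteq> K" by auto
    moreover have "closedin CT (q ` fun_support G \<H> f)"
      using R ctsD(2) by (intro closed_coset_support) (auto simp: arrows_def)
    ultimately have "compactin CT (q ` fun_support G \<H> f)"
      using closed_compactin K(1) by blast
    then show "f \<in> pts V" using eq R by blast
  qed
qed

lemma F0D:
  assumes "f \<in> pts V"
  shows "f \<in> extensional arr" "cts (gtop G) d f" "equivariant_fun f" "x \<in> arr \<Longrightarrow> f x \<in> pts (E x)"
  using assms ctsD(2) [of "gtop G" d f] by (auto simp: F0_iff arrows_def)

lemma F0E:
  assumes "f \<in> pts V" obtains K where "compactin CT K" "supported K f"
  using assms by (auto simp: F0_iff)

lemma F0I:
  assumes f: "cts (gtop G) d f" "equivariant_fun f" and K: "compactin CT K" "supported K f"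
  shows "restrict f arr \<in> pts V"
proof -
  have "cts (gtop G) d (restrict f arr)" by (rule cts_eq [OF f(1)]) (auto simp: arrows_def)
  moreover have "equivariant_fun (restrict f arr)" using f(2) H_arr by (auto simp: equivariant_fun_def)
  moreover have "supported K (restrict f arr)" using K(2) by (auto simp: supported_def)
  ultimately show ?thesis using K(1) by (auto simp: F0_iff)
qed

lemma equivariant_apply: "f \<in> pts V \<Longrightarrow> x \<in> arr \<Longrightarrow> h \<in> H \<Longrightarrow> d x = r h \<Longrightarrow> f (x \<cdot> h) = \<sigma> (iv h) (f x)"
  using F0D(3) by (auto simp: equivariant_fun_def)

lemma F0_ops [simp]:
  "vadd V f g = (\<lambda>x\<in>arr. vadd (E x) (f x) (g x))"
  "vzero V = (\<lambda>x\<in>arr. vzero (E x))"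
  "vscale V c f = (\<lambda>x\<in>arr. vscale (E x) c (f x))"
  by (simp_all add: F0_def)

lemma F0_diff: "x \<in> arr \<Longrightarrow> vdiff V f g x = vdiff (E x) (f x) (g x)"
  by (simp add: vdiff_def)

lemma zero_in_F0: "vzero V \<in> pts V"
proof -
  have "restrict (\<lambda>x. vzero (E x)) arr \<in> pts V"
  proof (rule F0I [of _ "{}"])
    show "cts (gtop G) d (\<lambda>x. vzero (E x))" by (intro cts_zero continuous_d)
    show "equivariant_fun (\<lambda>x. vzero (E x))"
      unfolding equivariant_fun_def
    proof (intro ballI impI)
      fix x h assume x: "x \<in> arr" "h \<in> H" "d x = r h"
      interpret W: hilbert "E x" by (rule hilbert_E) (use x in simp)
      show "vzero (E (x \<cdot> h)) = \<sigma> (iv h) (vzero (E x))"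
        using unitary_map_zero_iff [OF unitary_sigma_inv [OF x(2)], of "vzero (E x)"] x H_arr W.zero_closed
        by (simp add: fib_hilbert)
    qed
  qed (auto simp: supported_def)
  then show ?thesis by simp
qed

lemma F0_add:
  assumes f: "f \<in> pts V" and g: "g \<in> pts V" shows "vadd V f g \<in> pts V"
proof -
  obtain K L where KL: "compactin CT K" "supported K f" "compactin CT L" "supported L g"
    using f g by (meson F0E)
  have "restrict (\<lambda>x. vadd (E x) (f x) (g x)) arr \<in> pts V"
  proof (rule F0I [of _ "K \<union> L"])
    show "cts (gtop G) d (\<lambda>x. vadd (E x) (f x) (g x))" by (intro cts_add F0D f g)
    show "equivariant_fun (\<lambda>x. vadd (E x) (f x) (g x))"
      unfolding equivariant_fun_def
    proof (intro ballI impI)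
      fix x h assume x: "x \<in> arr" "h \<in> H" "d x = r h"
      show "vadd (E (x \<cdot> h)) (f (x \<cdot> h)) (g (x \<cdot> h)) = \<sigma> (iv h) (vadd (E x) (f x) (g x))"
        using unitary_sigma_inv [OF x(2)] x F0D(4) [OF f x(1)] F0D(4) [OF g x(1)] H_arr [OF x(2)]
        by (simp add: equivariant_apply f g unitary_map_def)
    qed
    show "supported (K \<union> L) (\<lambda>x. vadd (E x) (f x) (g x))"
      unfolding supported_def
    proof (intro ballI impI)
      fix x assume x: "x \<in> arr" "q x \<notin> K \<union> L"
      interpret hilbert "E x" by (rule hilbert_E) (use x in simp)
      show "vadd (E x) (f x) (g x) = vzero (E x)" using x KL by (simp add: supported_def)
    qed
  qed (use KL in \<open>auto intro: compactin_Un\<close>)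
  then show ?thesis by simp
qed

text \<open>Scalars that are constant on cosets are compatible with the equivariance condition. Functions of the
  range are of this kind, and so are functions of the norm of an element of \<open>F0\<close>.\<close>

lemma F0_multiply:
  assumes f: "f \<in> pts V" and t: "continuous_map (gtop G) euclidean t"
    and inv: "\<And>x h. x \<in> arr \<Longrightarrow> h \<in> H \<Longrightarrow> d x = r h \<Longrightarrow> t (x \<cdot> h) = t x"
  shows "(\<lambda>x\<in>arr. vscale (E x) (t x) (f x)) \<in> pts V"
proof -
  obtain K where K: "compactin CT K" "supported K f" using f by (rule F0E)
  show ?thesis
  proof (rule F0I [of _ K])
    show "cts (gtop G) d (\<lambda>x. vscale (E x) (t x) (f x))" by (intro cts_scale F0D f t)
    show "equivariant_fun (\<lambda>x. vscale (E x) (t x) (f x))"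
      unfolding equivariant_fun_def
    proof (intro ballI impI)
      fix x h assume x: "x \<in> arr" "h \<in> H" "d x = r h"
      show "vscale (E (x \<cdot> h)) (t (x \<cdot> h)) (f (x \<cdot> h)) = \<sigma> (iv h) (vscale (E x) (t x) (f x))"
        using unitary_sigma_inv [OF x(2)] x F0D(4) [OF f x(1)] H_arr [OF x(2)]
        by (simp add: equivariant_apply f unitary_map_def inv)
    qed
    show "supported K (\<lambda>x. vscale (E x) (t x) (f x))"
      unfolding supported_def
    proof (intro ballI impI)
      fix x assume x: "x \<in> arr" "q x \<notin> K"
      interpret hilbert "E x" by (rule hilbert_E) (use x in simp)
      show "vscale (E x) (t x) (f x) = vzero (E x)" using x K by (simp add: supported_def)
    qed
  qed (rule K)
qed

lemma F0_scale: "f \<in> pts V \<Longrightarrow> vscale V c f \<in> pts V"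
  using F0_multiply [of f "\<lambda>_. c"] by simp

sublocale F0: cvs V
proof
  show "complex_vector_space V"
    unfolding complex_vector_space_def
  proof (intro conjI allI ballI)
    show "vzero V \<in> pts V" by (rule zero_in_F0)
    fix f g assume f: "f \<in> pts V" and g: "g \<in> pts V"
    show "vadd V f g \<in> pts V" using f g by (rule F0_add)
    show "vadd V f g = vadd V g f"
      using F0D(4) [OF f] F0D(4) [OF g] hilbert_E
      by (auto intro!: restrict_ext cvs.add_commute simp: hilbert_def semi_inner_def)
    show "vscale V c (vadd V f g) = vadd V (vscale V c f) (vscale V c g)" for c
      using F0D(4) [OF f] F0D(4) [OF g] hilbert_E
      by (auto intro!: restrict_ext cvs.scale_add_right simp: hilbert_def semi_inner_def)
    fix k assume k: "k \<in> pts V"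
    show "vadd V (vadd V f g) k = vadd V f (vadd V g k)"
      using F0D(4) [OF f] F0D(4) [OF g] F0D(4) [OF k] hilbert_E
      by (auto intro!: restrict_ext cvs.add_assoc simp: hilbert_def semi_inner_def)
  next
    fix f assume f: "f \<in> pts V"
    have E: "cvs (E x)" if "x \<in> arr" for x using hilbert_E [OF that] by (simp add: hilbert_def semi_inner_def)
    show "vadd V (vzero V) f = f" "vscale V 1 f = f"
      using f F0D(4) [OF f] F0D(1) [OF f] cvs.zero_add [OF E] cvs.scale_one [OF E]
      by (auto intro!: extensionalityI [of _ arr])
    show "vadd V f (vscale V (- 1) f) = vzero V"
      using F0D(4) [OF f] cvs.add_neg [OF E] by (auto intro!: restrict_ext)
    fix s t
    show "vscale V s f \<in> pts V" using f by (rule F0_scale)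
    show "vscale V (s * t) f = vscale V s (vscale V t f)"
      "vscale V (s + t) f = vadd V (vscale V s f) (vscale V t f)"
      using F0D(4) [OF f] cvs.scale_scale [OF E] cvs.scale_add_left [OF E] by (auto intro!: restrict_ext)
  qed
qed

text \<open>The integrands for \<open>\<mu>\<close>, inner products and norms alike, all arise from invariant functions on \<open>G\<close> in
  this way.\<close>

lemma invariant_Cc:
  assumes c: "continuous_map (gtop G) euclidean t"
    and inv: "\<And>x h. x \<in> arr \<Longrightarrow> h \<in> H \<Longrightarrow> d x = r h \<Longrightarrow> t (x \<cdot> h) = t x"
    and K: "compactin CT K" "\<And>x. x \<in> arr \<Longrightarrow> q x \<notin> K \<Longrightarrow> t x = 0"
  shows "(\<lambda>c. t (rep c)) \<in> Cc CT" "x \<in> arr \<Longrightarrow> t (rep (q x)) = t x"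
proof -
  have t: "t (rep (q x)) = t x" if "x \<in> arr" for x
    using rep_cases [OF that] inv [OF that] by metis
  then show "x \<in> arr \<Longrightarrow> t (rep (q x)) = t x" .
  show "(\<lambda>c. t (rep c)) \<in> Cc CT"
  proof (rule CcI [OF _ K(1) compact_CT_closed [OF K(1)]])
    show "continuous_map CT euclidean (\<lambda>c. t (rep c))" by (rule continuous_map_CT [OF c inv])
    show "t (rep x) = 0" if "x \<in> topspace CT" "x \<notin> K" for x
      using that t K(2) by (auto simp: topspace_CT)
  qed
qed

definition integrand :: "('g \<Rightarrow> 'h) \<Rightarrow> ('g \<Rightarrow> 'h) \<Rightarrow> 'g set \<Rightarrow> complex" where
  "integrand f g c = vinner (E (rep c)) (f (rep c)) (g (rep c))"

definition pnorm :: "('g \<Rightarrow> 'h) \<Rightarrow> 'g set \<Rightarrow> complex" where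
  "pnorm f c = complex_of_real (vnorm (E (rep c)) (f (rep c)))"

abbreviation "inn \<equiv> F0_inner G H \<H> mu"

lemma inner_eq: "inn u f g = (LINT c|mu u. integrand f g c)"
  by (simp add: F0_inner_def integrand_def Let_def)

lemma norm_invariant:
  assumes "f \<in> pts V" "x \<in> arr" "h \<in> H" "d x = r h"
  shows "vnorm (E (x \<cdot> h)) (f (x \<cdot> h)) = vnorm (E x) (f x)"
  using assms unitary_map_norm [OF unitary_sigma_inv [OF assms(3)], of "f x"] F0D(4) [OF assms(1,2)]
  by (simp add: equivariant_apply H_arr)

lemma integrand_Cc:
  assumes f: "f \<in> pts V" and g: "g \<in> pts V"
  shows "integrand f g \<in> Cc CT" "x \<in> arr \<Longrightarrow> integrand f g (q x) = vinner (E x) (f x) (g x)"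
proof -
  obtain K where K: "compactin CT K" "supported K f" using f by (rule F0E)
  let ?t = "\<lambda>x. vinner (E x) (f x) (g x)"
  have c: "continuous_map (gtop G) euclidean ?t" by (intro cts_inner F0D f g)
  have inv: "?t (x \<cdot> h) = ?t x" if "x \<in> arr" "h \<in> H" "d x = r h" for x h
    using that unitary_sigma_inv [OF that(2)] F0D(4) [OF f that(1)] F0D(4) [OF g that(1)]
    by (simp add: equivariant_apply f g H_arr unitary_map_def)
  have z: "?t x = 0" if "x \<in> arr" "q x \<notin> K" for x
  proof -
    interpret hilbert "E x" by (rule hilbert_E) (use that in simp)
    show ?thesis using that K(2) F0D(4) [OF g that(1)] by (simp add: supported_def)
  qed
  show "integrand f g \<in> Cc CT" "x \<in> arr \<Longrightarrow> integrand f g (q x) = vinner (E x) (f x) (g x)"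
    using invariant_Cc [OF c inv K(1) z] unfolding integrand_def by blast+
qed

lemma pnorm_Cc:
  assumes f: "f \<in> pts V"
  shows "pnorm f \<in> Cc CT" "x \<in> arr \<Longrightarrow> pnorm f (q x) = complex_of_real (vnorm (E x) (f x))"
proof -
  obtain K where K: "compactin CT K" "supported K f" using f by (rule F0E)
  let ?t = "\<lambda>x. complex_of_real (vnorm (E x) (f x))"
  have c: "continuous_map (gtop G) euclidean ?t" by (intro continuous_map_of_real cts_norm F0D f)
  have inv: "?t (x \<cdot> h) = ?t x" if "x \<in> arr" "h \<in> H" "d x = r h" for x h
    using norm_invariant [OF f that] by simp
  have z: "?t x = 0" if "x \<in> arr" "q x \<notin> K" for x
  proof -
    interpret hilbert "E x" by (rule hilbert_E) (use that in simp)
    show ?thesis using that K(2) by (simp add: supported_def)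
  qed
  show "pnorm f \<in> Cc CT" "x \<in> arr \<Longrightarrow> pnorm f (q x) = complex_of_real (vnorm (E x) (f x))"
    using invariant_Cc [OF c inv K(1) z] unfolding pnorm_def by blast+
qed

lemma inner_continuous:
  "f \<in> pts V \<Longrightarrow> g \<in> pts V \<Longrightarrow> continuous_map (unit_top G) euclidean (\<lambda>u. inn u f g)"
  unfolding inner_eq using mu_continuous integrand_Cc by blast

lemma zero_Cc: "(\<lambda>_. 0) \<in> Cc X"
  by (rule CcI [of _ _ "{}"]) auto

lemma inner_cong:
  assumes "u \<in> units G" "f \<in> pts V" "g \<in> pts V" "f' \<in> pts V" "g' \<in> pts V"
    and "\<And>x. x \<in> arr \<Longrightarrow> r x = u \<Longrightarrow> vinner (E x) (f x) (g x) = vinner (E x) (f' x) (g' x)"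
  shows "inn u f g = inn u f' g'"
  unfolding inner_eq by (rule mu_cong) (use assms integrand_Cc in auto)

lemma semi_inner_F0:
  assumes u: "u \<in> units G"
  shows "semi_inner (with_inner V (inn u))"
proof -
  have int: "integrable (mu u) (integrand f g)" if "f \<in> pts V" "g \<in> pts V" for f g
    using mu_integrable [OF u] integrand_Cc that by blast
  have ae: "AE c in mu u. \<exists>x\<in>arr. c = q x"
    using mu_AE [OF u] by (rule eventually_mono) (auto simp: mem_moment_fibre)
  interpret W: cvs "with_inner V (inn u)" by (intro cvs_with_inner F0.cvs_axioms)
  show ?thesis
  proof
    fix f g assume "f \<in> pts (with_inner V (inn u))" "g \<in> pts (with_inner V (inn u))"
    then have f: "f \<in> pts V" and g: "g \<in> pts V" by auto
    have H: "hilbert (E x)" "f x \<in> pts (E x)" "g x \<in> pts (E x)" if "x \<in> arr" for x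
      using F0D(4) f g hilbert_E that by auto
    have comm: "vinner (E x) (g x) (f x) = cnj (vinner (E x) (f x) (g x))" if "x \<in> arr" for x
    proof -
      interpret hilbert "E x" by (rule H) (rule that)
      show ?thesis using H that by (intro inner_commute) auto
    qed
    have "inn u g f = (LINT c|mu u. cnj (integrand f g c))"
      unfolding inner_eq
    proof (rule integral_cong_AE)
      show "AE c in mu u. integrand g f c = cnj (integrand f g c)"
        using ae by (rule eventually_mono)
          (auto simp: integrand_Cc f g comm)
      have "integrable (mu u) (\<lambda>c. cnj (integrand f g c))" using int f g by simp
      then show "(\<lambda>c. cnj (integrand f g c)) \<in> borel_measurable (mu u)" by (rule borel_measurable_integrable)
    qed (use int f g in auto)
    then show "vinner (with_inner V (inn u)) g f = cnj (vinner (with_inner V (inn u)) f g)"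
      by (simp add: inner_eq)
    have scal: "vinner (E x) (vscale (E x) c (f x)) (g x) = c * vinner (E x) (f x) (g x)" if "x \<in> arr" for x c
    proof -
      interpret hilbert "E x" by (rule H) (rule that)
      show ?thesis using H that by (intro inner_scale) auto
    qed
    have "inn u (vscale V c f) g = (LINT c'|mu u. c * (integrand f g c'))" for c
      unfolding inner_eq
    proof (rule integral_cong_AE)
      show "AE c' in mu u. integrand (vscale V c f) g c' = c * integrand f g c'"
        using ae by (rule eventually_mono)
          (auto simp: integrand_Cc f g F0_scale [unfolded F0_ops] scal)
    qed (use int f g F0.scale_closed in auto)
    then show "vinner (with_inner V (inn u)) (vscale (with_inner V (inn u)) c f) g = c * vinner (with_inner V (inn u)) f g" for c
      by (simp add: inner_eq del: F0_ops)
    fix k assume "k \<in> pts (with_inner V (inn u))"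
    then have k: "k \<in> pts V" by simp
    have kE: "k x \<in> pts (E x)" if "x \<in> arr" for x using F0D(4) k that by auto
    have addi: "vinner (E x) (vadd (E x) (f x) (g x)) (k x) = vinner (E x) (f x) (k x) + vinner (E x) (g x) (k x)"
      if "x \<in> arr" for x
    proof -
      interpret hilbert "E x" by (rule H) (rule that)
      show ?thesis using H kE that by (intro inner_add) auto
    qed
    have "inn u (vadd V f g) k = (LINT c|mu u. integrand f k c + integrand g k c)"
      unfolding inner_eq
    proof (rule integral_cong_AE)
      show "AE c in mu u. integrand (vadd V f g) k c = integrand f k c + integrand g k c"
        using ae by (rule eventually_mono)
          (auto simp: integrand_Cc f g k F0_add [unfolded F0_ops] addi)
    qed (use int f g k F0.add_closed in auto)
    then show "vinner (with_inner V (inn u)) (vadd (with_inner V (inn u)) f g) k =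
        vinner (with_inner V (inn u)) f k + vinner (with_inner V (inn u)) g k"
      using int f g k by (simp add: inner_eq del: F0_ops)
  next
    fix f assume "f \<in> pts (with_inner V (inn u))"
    then have f: "f \<in> pts V" by simp
    have pos: "0 \<le> Re (vinner (E x) (f x) (f x))" if "x \<in> arr" for x
    proof -
      interpret hilbert "E x" by (rule hilbert_E) (rule that)
      show ?thesis using F0D(4) [OF f that] by (rule inner_nonneg)
    qed
    have "AE c in mu u. 0 \<le> Re (integrand f f c)"
      using ae by (rule eventually_mono)
        (auto simp: integrand_Cc f pos)
    then have "0 \<le> (LINT c|mu u. Re (integrand f f c))" by (rule integral_nonneg_AE)
    then show "0 \<le> Re (vinner (with_inner V (inn u)) f f)"
      using int f by (simp add: inner_eq)
  qed
qed

abbreviation "space_at u \<equiv> with_inner V (inn u)"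
abbreviation "unorm u \<equiv> vnorm (space_at u)"

lemma unorm_continuous: "f \<in> pts V \<Longrightarrow> continuous_map (unit_top G) euclideanreal (\<lambda>u. unorm u f)"
proof -
  assume f: "f \<in> pts V"
  have "continuous_map (unit_top G) euclideanreal (sqrt \<circ> (\<lambda>u. Re (inn u f f)))"
    by (intro continuous_map_compose [OF continuous_map_Re [OF inner_continuous [OF f f]]])
      (simp add: continuous_intros)
  then show ?thesis by (simp add: vnorm_def o_def)
qed

text \<open>At units outside the compact moment image of the support the integrand vanishes almost everywhere;
  on that image the norm is a continuous function.\<close>

lemma unorm_bounded:
  assumes f: "f \<in> pts V"
  obtains b where "\<And>u. u \<in> units G \<Longrightarrow> unorm u f \<le> b"
proof -
  obtain K where K: "compactin CT K" "supported K f" using f by (rule F0E)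
  have mK: "compactin (unit_top G) (moment G H ` K)" by (rule image_compactin [OF K(1) continuous_moment])
  obtain b where b: "0 < b" "\<And>u. u \<in> moment G H ` K \<Longrightarrow> norm (unorm u f) \<le> b"
    using continuous_map_bounded_on_compactin [OF unorm_continuous [OF f] mK] by blast
  have "unorm u f \<le> b" if u: "u \<in> units G" for u
  proof (cases "u \<in> moment G H ` K")
    case False
    have "inn u f f = (LINT c|mu u. 0)"
      unfolding inner_eq
    proof (rule mu_cong [OF u integrand_Cc(1) [OF f f] zero_Cc])
      fix x assume x: "x \<in> arr" "r x = u"
      interpret hilbert "E x" by (rule hilbert_E) (use x in simp)
      have "q x \<notin> K"
      proof
        assume "q x \<in> K"
        then have "moment G H (q x) \<in> moment G H ` K" by (rule imageI)
        then show False using False x by simp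
      qed
      then show "integrand f f (q x) = 0" using K x by (simp add: integrand_Cc f supported_def)
    qed
    then show ?thesis using b by (simp add: vnorm_def)
  next
    case True
    then show ?thesis using b(2) [OF True] by simp
  qed
  then show ?thesis by (rule that)
qed

abbreviation "nu \<equiv> F0_norm G H \<H> mu"

lemma nu_eq: "nu f = (SUP u\<in>units G. unorm u f)"
  by (simp add: F0_norm_def vnorm_def)

lemma unorm_le_nu: "u \<in> units G \<Longrightarrow> f \<in> pts V \<Longrightarrow> unorm u f \<le> nu f"
proof -
  assume u: "u \<in> units G" and f: "f \<in> pts V"
  obtain b where "\<And>u. u \<in> units G \<Longrightarrow> unorm u f \<le> b" using unorm_bounded [OF f] by blast
  then have "bdd_above ((\<lambda>u. unorm u f) ` units G)" by (rule bdd_aboveI2)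
  then show ?thesis unfolding nu_eq by (rule cSUP_upper [OF u])
qed

lemma nu_le: "units G \<noteq> {} \<Longrightarrow> (\<And>u. u \<in> units G \<Longrightarrow> unorm u f \<le> b) \<Longrightarrow> nu f \<le> b"
  unfolding nu_eq by (rule cSUP_least)

text \<open>Over an empty unit space the supremum defining \<open>F0_norm\<close> has an unspecified value, hence the hypothesis.\<close>

lemma seminormed_F0:
  assumes ne: "units G \<noteq> {}"
  shows "seminormed V nu"
proof
  fix f g assume f: "f \<in> pts V" and g: "g \<in> pts V"
  show "nu (vadd V f g) \<le> nu f + nu g"
  proof (rule nu_le [OF ne])
    fix u assume u: "u \<in> units G"
    interpret semi_inner "space_at u" by (rule semi_inner_F0 [OF u])
    show "unorm u (vadd V f g) \<le> nu f + nu g"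
      using vnorm_add [of f g] f g unorm_le_nu [OF u f] unorm_le_nu [OF u g] by (simp del: F0_ops)
  qed
next
  fix f c assume f: "f \<in> pts V"
  have le: "nu (vscale V c f) \<le> cmod c * nu f" if f: "f \<in> pts V" for c f
  proof (rule nu_le [OF ne])
    fix u assume u: "u \<in> units G"
    interpret semi_inner "space_at u" by (rule semi_inner_F0 [OF u])
    show "unorm u (vscale V c f) \<le> cmod c * nu f"
      using norm_scale [of f c] f unorm_le_nu [OF u f] by (simp del: F0_ops add: mult_left_mono)
  qed
  show "nu (vscale V c f) = cmod c * nu f"
  proof (cases "c = 0")
    case True
    obtain u where u: "u \<in> units G" using ne by blast
    interpret semi_inner "space_at u" by (rule semi_inner_F0 [OF u])
    have "0 \<le> nu (vscale V c f)"
      using vnorm_nonneg [of "vscale V c f"] unorm_le_nu [OF u, of "vscale V c f"] F0.scale_closed [OF f, of c]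
      by (simp del: F0_ops)
    then show ?thesis using le [OF f, of c] True by simp
  next
    case False
    have "f = vscale V (1 / c) (vscale V c f)" using False f by (simp add: F0.scale_scale del: F0_ops)
    then have "nu f \<le> cmod (1 / c) * nu (vscale V c f)"
      using le [of "vscale V c f" "1 / c"] F0.scale_closed [OF f] by metis
    then have "cmod c * nu f \<le> nu (vscale V c f)"
      using False by (simp add: norm_divide field_simps)
    then show ?thesis using le [OF f, of c] by simp
  qed
qed

lemma seminormed_inner_F0: "u \<in> units G \<Longrightarrow> seminormed_inner V nu (inn u)"
  using seminormed_F0 semi_inner_F0 unorm_le_nu
  by (intro seminormed_inner.intro seminormed_inner_axioms.intro) auto

end

section \<open>Translates\<close>

text \<open>A functional that is approximated in norm by functionals \<open>a \<mapsto> \<langle>a, s\<rangle>\<close> is itself of this form: the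
  approximating vectors form a Cauchy sequence. This yields vector-valued integrals without integrating vectors.\<close>

lemma (in hilbert) approx_representable:
  assumes approx: "\<And>e. 0 < e \<Longrightarrow> \<exists>s\<in>pts V. \<forall>a\<in>pts V. cmod (\<Phi> a - vinner V a s) \<le> e * vnorm V a"
  obtains g where "g \<in> pts V" "\<And>a. a \<in> pts V \<Longrightarrow> vinner V a g = \<Phi> a"
proof -
  have "\<exists>s. s \<in> pts V \<and> (\<forall>a\<in>pts V. cmod (\<Phi> a - vinner V a s) \<le> inverse (real (Suc n)) * vnorm V a)" for n
    using approx [of "inverse (real (Suc n))"] by auto
  then obtain s where s: "\<And>n. s n \<in> pts V"
    and le: "\<And>n a. a \<in> pts V \<Longrightarrow> cmod (\<Phi> a - vinner V a (s n)) \<le> inverse (real (Suc n)) * vnorm V a"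
    by metis
  have dist: "vnorm V (vdiff V (s m) (s n)) \<le> inverse (real (Suc m)) + inverse (real (Suc n))" for m n
  proof (rule norm_le_if_weak)
    fix a assume a: "a \<in> pts V"
    have "vinner V a (vdiff V (s m) (s n)) = (\<Phi> a - vinner V a (s n)) - (\<Phi> a - vinner V a (s m))"
      using s a by (simp add: inner_diff_right)
    also have "cmod \<dots> \<le> cmod (\<Phi> a - vinner V a (s n)) + cmod (\<Phi> a - vinner V a (s m))"
      by (rule norm_triangle_ineq4)
    finally show "cmod (vinner V a (vdiff V (s m) (s n))) \<le> (inverse (real (Suc m)) + inverse (real (Suc n))) * vnorm V a"
      using le [OF a, of m] le [OF a, of n] by (simp add: distrib_right)
  qed (use s in auto)
  have "cauchy_seq V (vnorm V) s"
    unfolding cauchy_seq_def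
  proof (intro conjI allI impI s)
    fix e :: real assume "0 < e"
    then obtain N where N: "inverse (real (Suc N)) < e / 2" using reals_Archimedean [of "e/2"] by auto
    show "\<exists>N. \<forall>m\<ge>N. \<forall>n\<ge>N. vnorm V (vdiff V (s m) (s n)) < e"
    proof (intro exI allI impI)
      fix m n assume "N \<le> m" "N \<le> n"
      then have "inverse (real (Suc m)) \<le> inverse (real (Suc N))" "inverse (real (Suc n)) \<le> inverse (real (Suc N))"
        by (auto intro!: le_imp_inverse_le)
      then show "vnorm V (vdiff V (s m) (s n)) < e" using dist [of m n] N by linarith
    qed
  qed
  then obtain g where g: "g \<in> pts V" "(\<lambda>n. vnorm V (vdiff V (s n) g)) \<longlonglongrightarrow> 0" using complete by blast
  have "vinner V a g = \<Phi> a" if a: "a \<in> pts V" for a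
  proof (rule LIMSEQ_unique)
    have "(\<lambda>n. cnj (vinner V (s n) a)) \<longlonglongrightarrow> cnj (vinner V g a)"
      by (intro tendsto_cnj inner_tendsto s g a)
    then show "(\<lambda>n. vinner V a (s n)) \<longlonglongrightarrow> vinner V a g"
      using inner_commute [OF s a] inner_commute [OF g(1) a] by simp
    have "(\<lambda>n. \<Phi> a - vinner V a (s n)) \<longlonglongrightarrow> 0"
    proof (rule Lim_null_comparison)
      show "\<forall>\<^sub>F n in sequentially. norm (\<Phi> a - vinner V a (s n)) \<le> inverse (real (Suc n)) * vnorm V a"
        using le [OF a] by simp
      show "(\<lambda>n. inverse (real (Suc n)) * vnorm V a) \<longlonglongrightarrow> 0"
        using tendsto_mult_left_zero [OF LIMSEQ_inverse_real_of_nat] .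
    qed
    from tendsto_diff [OF tendsto_const [of "\<Phi> a"] this] show "(\<lambda>n. vinner V a (s n)) \<longlonglongrightarrow> \<Phi> a" by simp
  qed
  then show ?thesis using that g by blast
qed

definition vsum :: "('v, 'm) cvec_scheme \<Rightarrow> ('i \<Rightarrow> 'v) \<Rightarrow> 'i list \<Rightarrow> 'v" where
  "vsum V f xs = foldr (\<lambda>i v. vadd V (f i) v) xs (vzero V)"

lemma (in cvs) vsum_closed: "(\<And>i. i \<in> set xs \<Longrightarrow> f i \<in> pts V) \<Longrightarrow> vsum V f xs \<in> pts V"
  by (induction xs) (auto simp: vsum_def)

lemma (in semi_inner) inner_vsum:
  "a \<in> pts V \<Longrightarrow> (\<And>i. i \<in> set xs \<Longrightarrow> f i \<in> pts V) \<Longrightarrow> vinner V a (vsum V f xs) = (\<Sum>i\<leftarrow>xs. vinner V a (f i))"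
proof (induction xs)
  case (Cons i xs)
  then show ?case using vsum_closed [of xs f] by (simp add: vsum_def inner_add_right)
qed (simp add: vsum_def)

lemma (in hilb_bundle) cts_vsum:
  assumes p: "continuous_map Y (X) p" and f: "\<And>i. i \<in> set xs \<Longrightarrow> cts Y p (f i)"
  shows "cts Y p (\<lambda>y. vsum (fib B (p y)) (\<lambda>i. f i y) xs)"
  using f
proof (induction xs)
  case Nil
  then show ?case using cts_zero [OF p] by (simp add: vsum_def)
next
  case (Cons i xs)
  then show ?case using cts_add [of Y p "f i"] by (simp add: vsum_def)
qed

lemma (in hilb_bundle) cts_const:
  assumes u: "u \<in> topspace X" and a: "a \<in> pts (fib B u)"
  shows "cts Y (\<lambda>_. u) (\<lambda>_. a)"
  unfolding cts_section_def
proof (intro conjI ballI allI impI)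
  show "continuous_map Y X (\<lambda>_. u)" using u by simp
  fix e :: real assume e: "0 < e"
  interpret hilbert "fib B u" using fib_hilbert u by simp
  obtain xi where xi: "xi \<in> sects B" "dst u (xi u) a < e" using sect_dense [OF u a e] by blast
  have "dst u a (xi u) < e" using xi norm_diff_commute [OF a sect_closed [OF xi(1) u]] by simp
  then show "\<exists>xi\<in>sects B. \<exists>W. openin Y W \<and> y \<in> W \<and> (\<forall>z\<in>W. dst u a (xi u) < e)" if "y \<in> topspace Y" for y
    using xi that by blast
qed (rule a)

context induced_setting
begin

abbreviation "same_range \<equiv> {p \<in> topspace PG. r (fst p) = r (snd p)}"

lemma closedin_same_range: "closedin PG same_range"
  by (intro closedin_agree continuous_r' continuous_map_fst continuous_map_snd)

lemma cts_translate:
  assumes f: "f \<in> pts V"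
  shows "cts (subtopology PG same_range) (\<lambda>p. d (snd p)) (\<lambda>p. f (iv (fst p) \<cdot> snd p))"
proof -
  have "continuous_map (subtopology PG same_range) (gtop G) (\<lambda>p. iv (fst p) \<cdot> snd p)"
    by (intro continuous_mul' continuous_inv' continuous_map_from_subtopology continuous_map_fst continuous_map_snd)
      (auto simp: arrows_def [symmetric])
  from cts_compose [OF F0D(2) [OF f] this] show ?thesis
    by (rule cts_eq) (auto simp: arrows_def [symmetric])
qed

lemma translate_closed: "f \<in> pts V \<Longrightarrow> z \<in> arr \<Longrightarrow> y \<in> arr \<Longrightarrow> r z = r y \<Longrightarrow> f (iv z \<cdot> y) \<in> pts (E y)"
  using F0D(4) [of f "iv z \<cdot> y"] by simp

lemma translate_equivariant:
  assumes "f \<in> pts V" "z \<in> arr" "y \<in> arr" "r z = r y" "h \<in> H" "d y = r h"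
  shows "f (iv z \<cdot> (y \<cdot> h)) = \<sigma> (iv h) (f (iv z \<cdot> y))"
  using assms equivariant_apply [OF assms(1), of "iv z \<cdot> y" h] by (simp add: assoc H_arr)

text \<open>If \<open>C\<close> is a compact set of arrows covering the support of \<open>f\<close> modulo \<open>H\<close>, then all translates by
  arrows in \<open>Z\<close> are supported in the cosets of the compact set \<open>Z C\<close>.\<close>

lemma translate_support:
  assumes f: "f \<in> pts V" and Z: "compactin (gtop G) Z"
  obtains L where "compactin CT L"
    "\<And>z y. z \<in> Z \<Longrightarrow> y \<in> arr \<Longrightarrow> r z = r y \<Longrightarrow> q y \<notin> L \<Longrightarrow> f (iv z \<cdot> y) = vzero (E y)"
proof -
  obtain K where K: "compactin CT K" "supported K f" using f by (rule F0E)
  obtain C where C: "compactin (gtop G) C" "K \<subseteq> q ` C" using compact_lift [OF K(1)] by blast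
  let ?P = "composable G \<inter> Z \<times> C"
  have "compactin PG (Z \<times> C)" using Z C by (simp add: compactin_Times)
  then have "compactin PG ?P" by (intro closed_Int_compactin closedin_composable)
  then have "compactin (subtopology PG (composable G)) ?P" by (simp add: compactin_subtopology)
  then have "compactin (gtop G) ((\<lambda>(x, y). x \<cdot> y) ` ?P)" by (rule image_compactin [OF _ continuous_mul])
  then have L: "compactin CT (q ` (\<lambda>(x, y). x \<cdot> y) ` ?P)" by (rule image_compactin [OF _ continuous_q])
  have Za: "Z \<subseteq> arr" and Ca: "C \<subseteq> arr"
    using compactin_subset_topspace [OF Z] compactin_subset_topspace [OF C(1)] by (auto simp: arrows_def)
  have "f (iv z \<cdot> y) = vzero (E y)"
    if *: "z \<in> Z" "y \<in> arr" "r z = r y" "q y \<notin> q ` (\<lambda>(x, y). x \<cdot> y) ` ?P" for z y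
  proof -
    have z: "z \<in> arr" using Za * by auto
    have "q (iv z \<cdot> y) \<notin> K"
    proof
      assume "q (iv z \<cdot> y) \<in> K"
      then obtain c where c: "c \<in> C" "q (iv z \<cdot> y) = q c" using C by auto
      then have ca: "c \<in> arr" using Ca by auto
      have rc: "r c = d z" using c(2) coset_eq_iff [of "iv z \<cdot> y" c] z ca * by simp
      have "q (z \<cdot> c) = gmul G z ` q c" using translate_coset z ca rc by simp
      also have "\<dots> = gmul G z ` q (iv z \<cdot> y)" using c by simp
      also have "\<dots> = q y" using translate_coset [of z "iv z \<cdot> y"] z * by simp
      finally have "q y = q (z \<cdot> c)" by simp
      moreover have "(z, c) \<in> ?P" using * c z ca rc by (simp add: composable_iff)
      ultimately show False using *(4) by force
    qed
    then show ?thesis using K(2) z * by (simp add: supported_def)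
  qed
  with L show ?thesis by (rule that)
qed

text \<open>A tube lemma: because of the invariance in the second variable and the compact support modulo
  \<open>H\<close>, smallness along \<open>{x\<^sub>0} \<times> G\<close> persists uniformly near \<open>x\<^sub>0\<close>.\<close>

lemma tube:
  assumes D: "closedin PG D" and N: "continuous_map (subtopology PG D) euclideanreal N"
    and x0: "x0 \<in> Z" "openin (gtop G) Z" and small: "\<And>y. (x0, y) \<in> D \<Longrightarrow> N (x0, y) < e"
    and L: "compactin CT L" and out: "\<And>z y. z \<in> Z \<Longrightarrow> (z, y) \<in> D \<Longrightarrow> q y \<notin> L \<Longrightarrow> N (z, y) < e"
    and inv: "\<And>z y c. (z, y) \<in> D \<Longrightarrow> c \<in> arr \<Longrightarrow> q y = q c \<Longrightarrow> (z, c) \<in> D \<and> N (z, c) = N (z, y)"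
  shows "\<exists>W. openin (gtop G) W \<and> x0 \<in> W \<and> W \<subseteq> Z \<and> (\<forall>z\<in>W. \<forall>y. (z, y) \<in> D \<longrightarrow> N (z, y) < e)"
proof -
  obtain C where C: "compactin (gtop G) C" "L \<subseteq> q ` C" using compact_lift [OF L] by blast
  have Dt: "D \<subseteq> topspace PG" by (rule closedin_subset [OF D])
  have "openin (subtopology PG D) {p \<in> topspace (subtopology PG D). N p \<in> {..<e}}"
    by (rule openin_continuous_map_preimage [OF N]) simp
  then obtain T where T: "openin PG T" "{p \<in> D. N p < e} = T \<inter> D"
    using Dt by (auto simp: openin_subtopology Int_absorb1 inf.absorb2)
  \<comment> \<open>points outside the closed set \<open>D\<close> impose no condition\<close>
  define O' where "O' = T \<union> (topspace PG - D)"
  have O': "openin PG O'" unfolding O'_def by (intro openin_Un openin_diff openin_topspace T(1) D)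
  have x0a: "x0 \<in> topspace (gtop G)" using x0 openin_subset by blast
  have "\<exists>A B. openin (gtop G) A \<and> openin (gtop G) B \<and> x0 \<in> A \<and> c \<in> B \<and> A \<times> B \<subseteq> O'" if "c \<in> topspace (gtop G)" for c
  proof -
    have "(x0, c) \<in> O'"
    proof (cases "(x0, c) \<in> D")
      case True
      then have "(x0, c) \<in> T \<inter> D" unfolding T(2) [symmetric] using small by simp
      then show ?thesis by (simp add: O'_def)
    qed (use x0a that in \<open>auto simp: O'_def\<close>)
    then show ?thesis using openin_prod_topologyE [OF O'] by metis
  qed
  then obtain A B where AB: "\<And>c. c \<in> topspace (gtop G) \<Longrightarrow> openin (gtop G) (A c) \<and> openin (gtop G) (B c) \<and>
      x0 \<in> A c \<and> c \<in> B c \<and> A c \<times> B c \<subseteq> O'"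
    by metis
  have Cs: "C \<subseteq> topspace (gtop G)" by (rule compactin_subset_topspace [OF C(1)])
  have cover: "C \<subseteq> \<Union>(B ` C)" using AB Cs by blast
  have op: "openin (gtop G) U" if "U \<in> B ` C" for U using that AB Cs by auto
  obtain F where F: "finite F" "F \<subseteq> B ` C" "C \<subseteq> \<Union>F" using compactinD [OF C(1) op cover] by blast
  then obtain I where I: "I \<subseteq> C" "finite I" "F = B ` I" by (metis finite_subset_image)
  define W where "W = Z \<inter> (\<Inter>c\<in>I. topspace (gtop G) \<inter> A c)"
  show ?thesis
  proof (intro exI [of _ W] conjI ballI allI impI)
    have "W = (\<Inter>U\<in>insert Z ((\<lambda>c. topspace (gtop G) \<inter> A c) ` I). U)" by (auto simp: W_def)
    also have "openin (gtop G) \<dots>"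
      using I(2) x0(2) AB Cs I(1) by (intro openin_INT2) auto
    finally show "openin (gtop G) W" .
    show "x0 \<in> W" using x0 x0a AB I Cs by (auto simp: W_def)
    show "W \<subseteq> Z" by (auto simp: W_def)
    fix z y assume z: "z \<in> W" and zy: "(z, y) \<in> D"
    show "N (z, y) < e"
    proof (cases "q y \<in> L")
      case True
      then obtain c where c: "c \<in> C" "q y = q c" using C(2) by auto
      then have zc: "(z, c) \<in> D" "N (z, c) = N (z, y)" using inv [OF zy, of c] Cs by (auto simp: arrows_def)
      obtain i where i: "i \<in> I" "c \<in> B i" using F(3) I(3) c(1) by auto
      then have "z \<in> A i" using z unfolding W_def by blast
      then have "(z, c) \<in> O'" using AB [of i] i I Cs by blast
      then have "(z, c) \<in> T \<inter> D" using zc by (auto simp: O'_def)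
      then have "N (z, c) < e" unfolding T(2) [symmetric] by simp
      then show ?thesis using zc by simp
    next
      case False
      then show ?thesis using out z zy by (auto simp: W_def)
    qed
  qed
qed

end

section \<open>Weak convolution integrals\<close>

lemma continuous_map_complex_mult:
  fixes f g :: "'a \<Rightarrow> complex"
  assumes f: "continuous_map X euclidean f" and g: "continuous_map X euclidean g"
  shows "continuous_map X euclidean (\<lambda>x. f x * g x)"
proof -
  have "continuous_map X (prod_topology euclidean euclidean) (\<lambda>x. (f x, g x))"
    using f g by (rule continuous_map_pairedI)
  then have "continuous_map X euclidean ((\<lambda>p. fst p * snd p) \<circ> (\<lambda>x. (f x, g x)))"
    by (rule continuous_map_compose) (simp add: euclidean_product_topology [symmetric] continuous_intros)
  then show ?thesis by (simp add: o_def)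
qed

context induced_setting
begin

text \<open>The inner product of \<open>a\<close> with the convolution \<open>\<integral> k(z) f (z\<^sup>-\<^sup>1 y) d\<lambda>(z)\<close>. The integrand is cut off
  outside the range fibre, where the product \<open>z\<^sup>-\<^sup>1 y\<close> has no meaning.\<close>

definition weak_conv :: "('g \<Rightarrow> real) \<Rightarrow> ('g \<Rightarrow> 'h) \<Rightarrow> 'g \<Rightarrow> 'h \<Rightarrow> complex" where
  "weak_conv k f y a = (LINT z|lam (r y).
     (if z \<in> rfibre G (r y) then complex_of_real (k z) * vinner (E y) a (f (iv z \<cdot> y)) else 0))"

definition conv_kernel :: "('g \<Rightarrow> real) \<Rightarrow> bool" where
  "conv_kernel k \<longleftrightarrow> (\<lambda>z. complex_of_real (k z)) \<in> Cc (gtop G) \<and> (\<forall>z\<in>arr. 0 \<le> k z)"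

abbreviation "ksupp k \<equiv> gtop G closure_of {z \<in> topspace (gtop G). complex_of_real (k z) \<noteq> 0}"

lemma conv_kernelD:
  assumes "conv_kernel k"
  shows "(\<lambda>z. complex_of_real (k z)) \<in> Cc (gtop G)" "z \<in> arr \<Longrightarrow> 0 \<le> k z"
    "compactin (gtop G) (ksupp k)" "closedin (gtop G) (ksupp k)" "z \<in> arr \<Longrightarrow> z \<notin> ksupp k \<Longrightarrow> k z = 0"
    "continuous_map (gtop G) euclideanreal k"
proof -
  show k: "(\<lambda>z. complex_of_real (k z)) \<in> Cc (gtop G)" and "z \<in> arr \<Longrightarrow> 0 \<le> k z"
    using assms by (auto simp: conv_kernel_def)
  show "compactin (gtop G) (ksupp k)" "closedin (gtop G) (ksupp k)"
    using CcD(2) [OF k] by auto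
  show "continuous_map (gtop G) euclideanreal k" using continuous_map_Re [OF CcD(1) [OF k]] by simp
  have "{z \<in> topspace (gtop G). complex_of_real (k z) \<noteq> 0} \<subseteq> ksupp k"
    by (rule closure_of_subset) auto
  then show "z \<in> arr \<Longrightarrow> z \<notin> ksupp k \<Longrightarrow> k z = 0" by (auto simp: arrows_def)
qed

lemma rfibre_lam: "y \<in> arr \<Longrightarrow> AE z in lam (r y). z \<in> arr \<and> r z = r y"
  using haar_AE [of "r y"] by (auto simp: rfibre_def)

lemma weak_conv_integrable:
  assumes k: "conv_kernel k" and f: "f \<in> pts V" and y: "y \<in> arr" and a: "a \<in> pts (E y)"
  shows "integrable (lam (r y))
    (\<lambda>z. if z \<in> rfibre G (r y) then complex_of_real (k z) * vinner (E y) a (f (iv z \<cdot> y)) else 0)"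
proof -
  let ?C = "rfibre G (r y)" and ?F = "\<lambda>z. complex_of_real (k z) * vinner (E y) a (f (iv z \<cdot> y))"
  have M: "radon_measure (gtop G) (lam (r y))" using haar_radon y by simp
  have C: "closedin (gtop G) ?C" using closedin_rfibre y by simp
  have Ct: "topspace (subtopology (gtop G) ?C) = ?C" by (auto simp: rfibre_def arrows_def)
  have "continuous_map (subtopology (gtop G) ?C) (subtopology PG same_range) (\<lambda>z. (z, y))"
    unfolding continuous_map_in_subtopology
  proof
    show "continuous_map (subtopology (gtop G) ?C) PG (\<lambda>z. (z, y))"
      using y by (intro continuous_map_pairedI continuous_map_from_subtopology) (auto simp: arrows_def)
    show "(\<lambda>z. (z, y)) \<in> topspace (subtopology (gtop G) ?C) \<rightarrow> same_range"
      using y by (auto simp: Ct rfibre_def arrows_def)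
  qed
  from cts_compose [OF cts_translate [OF f] this]
  have "cts (subtopology (gtop G) ?C) (\<lambda>_. d y) (\<lambda>z. f (iv z \<cdot> y))" by simp
  then have "continuous_map (subtopology (gtop G) ?C) euclidean (\<lambda>z. vinner (E y) a (f (iv z \<cdot> y)))"
    using y a by (intro cts_inner cts_const) auto
  moreover have "continuous_map (subtopology (gtop G) ?C) euclidean (\<lambda>z. complex_of_real (k z))"
    using CcD(1) [OF conv_kernelD(1) [OF k]] by (rule continuous_map_from_subtopology)
  ultimately have c: "continuous_map (subtopology (gtop G) ?C) euclidean ?F"
    by (intro continuous_map_complex_mult)
  have K: "compactin (gtop G) (?C \<inter> ksupp k)" "closedin (gtop G) (?C \<inter> ksupp k)"
    using C conv_kernelD(3,4) [OF k] by (auto intro: closed_Int_compactin)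
  then have "compactin (subtopology (gtop G) ?C) (?C \<inter> ksupp k)" by (simp add: compactin_subtopology)
  then obtain b where b: "\<And>z. z \<in> ?C \<inter> ksupp k \<Longrightarrow> norm (?F z) \<le> b"
    using continuous_map_bounded_on_compactin [OF c] by metis
  show ?thesis
  proof (rule radon_integrable [OF M radon_measurable_closed [OF M C c] K])
    show "norm (if x \<in> ?C then ?F x else 0) \<le> b" if "x \<in> ?C \<inter> ksupp k" for x
      using b [OF that] that by simp
    show "(if x \<in> ?C then ?F x else 0) = 0" if "x \<in> topspace (gtop G)" "x \<notin> ?C \<inter> ksupp k" for x
      using that conv_kernelD(5) [OF k, of x] by (auto simp: arrows_def)
  qed
qed

lemma kernel_integrable:
  assumes k: "conv_kernel k" and u: "u \<in> units G"
  shows "integrable (lam u) k"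
  using integrable_Re [OF Cc_integrable [OF haar_radon [OF u] conv_kernelD(1) [OF k]]] by simp

text \<open>The measure lives on the range fibre, so it suffices to compare the integrands there.\<close>

lemma weak_conv_estimate:
  assumes k: "conv_kernel k" and f: "f \<in> pts V" and y: "y \<in> arr" and a: "a \<in> pts (E y)"
    and F: "integrable (lam (r y)) F"
    and le: "\<And>z. z \<in> arr \<Longrightarrow> r z = r y \<Longrightarrow>
      cmod (complex_of_real (k z) * vinner (E y) a (f (iv z \<cdot> y)) - F z) \<le> e * k z"
  shows "cmod (weak_conv k f y a - (LINT z|lam (r y). F z)) \<le> e * (LINT z|lam (r y). k z)"
proof -
  let ?I = "\<lambda>z. if z \<in> rfibre G (r y) then complex_of_real (k z) * vinner (E y) a (f (iv z \<cdot> y)) else 0"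
  have I: "integrable (lam (r y)) ?I" by (rule weak_conv_integrable [OF k f y a])
  have "weak_conv k f y a - (LINT z|lam (r y). F z) = (LINT z|lam (r y). ?I z - F z)"
    unfolding weak_conv_def using I F by simp
  also have "cmod \<dots> \<le> (LINT z|lam (r y). cmod (?I z - F z))"
    by (rule integral_norm_bound)
  also have "\<dots> \<le> (LINT z|lam (r y). e * k z)"
  proof (rule integral_mono_AE)
    show "integrable (lam (r y)) (\<lambda>z. cmod (?I z - F z))" using I F by simp
    show "integrable (lam (r y)) (\<lambda>z. e * k z)" using kernel_integrable [OF k] y by simp
    show "AE z in lam (r y). cmod (?I z - F z) \<le> e * k z"
      using rfibre_lam [OF y] by (rule eventually_mono) (use le in \<open>auto simp: rfibre_def\<close>)
  qed
  finally show ?thesis by simp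
qed

text \<open>Bump functions for a finite subcover are normalised by the maximum of \<open>1/2\<close> and their sum. On the support of
  \<open>k\<close> the sum exceeds \<open>1/2\<close>, so there the normalised functions add up to one, while the quotient
  stays continuous everywhere.\<close>

lemma kernel_partition:
  assumes k: "conv_kernel k" and cover: "\<And>z. z \<in> ksupp k \<Longrightarrow> openin (gtop G) (A z) \<and> z \<in> A z"
  obtains zs \<rho> where "set zs \<subseteq> ksupp k" "distinct zs"
    "\<forall>i\<in>set zs. continuous_map (gtop G) euclideanreal (\<rho> i)"
    "\<forall>i\<in>set zs. \<forall>z\<in>arr. 0 \<le> \<rho> i z \<and> (z \<notin> A i \<longrightarrow> \<rho> i z = 0)"
    "\<forall>z\<in>ksupp k. (\<Sum>i\<in>set zs. \<rho> i z) = (1::real)"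
proof -
  have Kt: "ksupp k \<subseteq> topspace (gtop G)" by (rule closure_of_subset_topspace)
  have "\<exists>b::'g \<Rightarrow> real. continuous_map (gtop G) euclideanreal b \<and> (\<forall>y\<in>topspace (gtop G). 0 \<le> b y) \<and>
      b z = 1 \<and> (\<forall>y\<in>topspace (gtop G). y \<notin> A z \<longrightarrow> b y = 0)" if "z \<in> ksupp k" for z
  proof -
    have "openin (gtop G) (A z)" "z \<in> A z" using cover [OF that] by auto
    then obtain b :: "'g \<Rightarrow> real" where "continuous_map (gtop G) euclideanreal b"
      "\<And>y. y \<in> topspace (gtop G) \<Longrightarrow> 0 \<le> b y" "b z = 1" "\<And>y. y \<in> topspace (gtop G) \<Longrightarrow> y \<notin> A z \<Longrightarrow> b y = 0"
      using bump_function [OF locally_compact Hausdorff] by metis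
    then show ?thesis by blast
  qed
  then have "\<forall>z\<in>ksupp k. \<exists>b::'g \<Rightarrow> real. continuous_map (gtop G) euclideanreal b \<and> (\<forall>y\<in>topspace (gtop G). 0 \<le> b y) \<and>
      b z = 1 \<and> (\<forall>y\<in>topspace (gtop G). y \<notin> A z \<longrightarrow> b y = 0)" by (rule ballI)
  from bchoice [OF this] obtain b :: "'g \<Rightarrow> 'g \<Rightarrow> real" where "\<forall>z\<in>ksupp k. continuous_map (gtop G) euclideanreal (b z) \<and>
      (\<forall>y\<in>topspace (gtop G). 0 \<le> b z y) \<and> b z z = 1 \<and> (\<forall>y\<in>topspace (gtop G). y \<notin> A z \<longrightarrow> b z y = 0)" ..
  then have b: "\<And>z. z \<in> ksupp k \<Longrightarrow> continuous_map (gtop G) euclideanreal (b z) \<and>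
      (\<forall>y\<in>topspace (gtop G). 0 \<le> b z y) \<and> b z z = 1 \<and> (\<forall>y\<in>topspace (gtop G). y \<notin> A z \<longrightarrow> b z y = 0)"
    by (rule bspec)
  define U where "U z = {y \<in> topspace (gtop G). b z y \<in> {1/2<..}}" for z
  have U: "openin (gtop G) (U z)" "z \<in> U z" if "z \<in> ksupp k" for z
  proof -
    have "continuous_map (gtop G) euclideanreal (b z)" using b [OF that] by blast
    then show "openin (gtop G) (U z)" unfolding U_def by (rule openin_continuous_map_preimage) simp
    show "z \<in> U z" using b [OF that] subsetD [OF Kt that] by (simp add: U_def)
  qed
  have sub: "ksupp k \<subseteq> \<Union>(U ` ksupp k)"
  proof
    fix z assume "z \<in> ksupp k"
    then show "z \<in> \<Union>(U ` ksupp k)" using U(2) by (intro UnionI [of "U z"] imageI)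
  qed
  have op: "openin (gtop G) W" if "W \<in> U ` ksupp k" for W
    using that by (elim imageE) (simp only: U(1))
  obtain \<F> where \<F>: "finite \<F>" "\<F> \<subseteq> U ` ksupp k" "ksupp k \<subseteq> \<Union>\<F>"
  proof -
    have "\<exists>\<F>. finite \<F> \<and> \<F> \<subseteq> U ` ksupp k \<and> ksupp k \<subseteq> \<Union>\<F>"
      by (rule compactinD [OF conv_kernelD(3) [OF k] _ sub]) (rule op)
    then show ?thesis using that by (elim exE conjE)
  qed
  obtain I where I: "I \<subseteq> ksupp k" "finite I" "\<F> = U ` I"
    using finite_subset_image [OF \<F>(1,2)] by (elim exE conjE) (rule that)
  obtain zs where zs: "set zs = I" "distinct zs" using finite_distinct_list [OF I(2)] by blast
  define S where "S y = max (1/2) (\<Sum>i\<in>I. b i y)" for y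
  have S: "continuous_map (gtop G) euclideanreal S" "0 < S y" for y
  proof -
    have "continuous_map (gtop G) euclideanreal (\<lambda>y. \<Sum>i\<in>I. b i y)"
      using I b by (intro continuous_map_sum) auto
    then show "continuous_map (gtop G) euclideanreal S"
      unfolding S_def by (intro continuous_map_real_max) auto
    show "0 < S y" unfolding S_def by linarith
  qed
  show ?thesis
  proof (rule that [of zs "\<lambda>i y. b i y / S y"])
    show "set zs \<subseteq> ksupp k" "distinct zs" using zs I by auto
    show "\<forall>i\<in>set zs. \<forall>z\<in>arr. 0 \<le> b i z / S z \<and> (z \<notin> A i \<longrightarrow> b i z / S z = 0)"
    proof (intro ballI)
      fix i z assume "i \<in> set zs" "z \<in> arr"
      then show "0 \<le> b i z / S z \<and> (z \<notin> A i \<longrightarrow> b i z / S z = 0)"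
        using zs I b [of i] S(2) [of z] by (auto simp: arrows_def less_imp_le)
    qed
    show "\<forall>i\<in>set zs. continuous_map (gtop G) euclideanreal (\<lambda>y. b i y / S y)"
    proof
      fix i assume "i \<in> set zs"
      then show "continuous_map (gtop G) euclideanreal (\<lambda>y. b i y / S y)"
        using zs I b [of i] S by (intro continuous_map_real_divide) (auto simp: less_imp_neq [symmetric])
    qed
    show "\<forall>z\<in>ksupp k. (\<Sum>i\<in>set zs. b i z / S z) = 1"
    proof
      fix z assume z: "z \<in> ksupp k"
      obtain i where i: "i \<in> I" "z \<in> U i" using z \<F>(3) I(3) by auto
      have zt: "z \<in> topspace (gtop G)" using z Kt by (rule rev_subsetD)
      have "0 \<le> b j z" if "j \<in> I" for j using b [OF subsetD [OF I(1) that]] zt by blast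
      then have "b i z \<le> (\<Sum>i\<in>I. b i z)"
        using i I(2) by (intro member_le_sum) auto
      then have "S z = (\<Sum>i\<in>I. b i z)" using i by (simp add: S_def U_def)
      then show "(\<Sum>i\<in>set zs. b i z / S z) = 1" using S(2) [of z] by (simp add: zs sum_divide_distrib [symmetric])
    qed
  qed
qed

text \<open>Locally, convolutions are uniformly approximated by continuous sections: the function
  \<open>(z, y) \<mapsto> f (z\<^sup>-\<^sup>1 y)\<close> is approximated by finite sums of products of functions of \<open>z\<close> and sections of
  \<open>\<H>\<close>, using a partition of unity on the support of \<open>k\<close>.\<close>

lemma weak_conv_approx:
  assumes k: "conv_kernel k" and f: "f \<in> pts V" and y0: "y0 \<in> arr" and e: "0 < e"
  obtains s W where "cts (gtop G) d s" "openin (gtop G) W" "y0 \<in> W"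
    "\<And>y a. y \<in> W \<Longrightarrow> a \<in> pts (E y) \<Longrightarrow> cmod (weak_conv k f y a - vinner (E y) a (s y)) \<le> e * vnorm (E y) a"
proof -
  \<comment> \<open>the mass of the kernel is locally bounded by \<open>M\<close>, so accuracy \<open>e / M\<close> of the integrand suffices\<close>
  define Q where "Q u = (LINT z|lam u. k z)" for u
  have Qc: "continuous_map (unit_top G) euclideanreal Q"
  proof -
    have "continuous_map (unit_top G) euclideanreal (\<lambda>u. Re (LINT z|lam u. complex_of_real (k z)))"
      by (intro continuous_map_Re haar_continuous conv_kernelD(1) [OF k])
    then show ?thesis by (simp add: Q_def [abs_def])
  qed
  have Q0: "0 \<le> Q u" if "u \<in> units G" for u
    unfolding Q_def
  proof (rule integral_nonneg_AE)
    show "AE z in lam u. 0 \<le> k z"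
      using haar_AE [OF that] by (rule eventually_mono) (use conv_kernelD(2) [OF k] in \<open>auto simp: rfibre_def\<close>)
  qed
  define M where "M = Q (r y0) + 1"
  have M: "0 < M" using Q0 [of "r y0"] y0 by (simp add: M_def)
  obtain W0 where W0: "openin (unit_top G) W0" "r y0 \<in> W0" "\<And>u. u \<in> W0 \<Longrightarrow> Q u < M"
    using continuous_map_realD [OF Qc, of "r y0" M] y0 by (auto simp: M_def)
  define \<delta> where "\<delta> = e / M"
  have \<delta>: "0 < \<delta>" using e M by (simp add: \<delta>_def)
  have Kt: "ksupp k \<subseteq> arr" unfolding arrows_def by (rule closure_of_subset_topspace)
  define Q' where "Q' z0 xi A B \<longleftrightarrow> xi \<in> sects \<H> \<and> openin (gtop G) A \<and> openin (gtop G) B \<and> z0 \<in> A \<and> y0 \<in> B \<and>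
      (\<forall>z\<in>A. \<forall>y\<in>B. r z = r y \<longrightarrow> dst (d y) (f (iv z \<cdot> y)) (xi (d y)) < \<delta>)" for z0 xi A B
  have "\<exists>xi A B. Q' z0 xi A B" if z0: "z0 \<in> arr" for z0
  proof (cases "r z0 = r y0")
    case True
    then have "(z0, y0) \<in> topspace (subtopology PG same_range)" using z0 y0 by (auto simp: arrows_def)
    then have "\<exists>xi\<in>sects \<H>. \<exists>W. openin (subtopology PG same_range) W \<and> (z0, y0) \<in> W \<and>
      (\<forall>p\<in>W. dst (d (snd p)) (f (iv (fst p) \<cdot> snd p)) (xi (d (snd p))) < \<delta>)"
      using cts_translate [OF f] \<delta> unfolding cts_section_def by simp
    then obtain xi W where xi: "xi \<in> sects \<H>" and W: "openin (subtopology PG same_range) W" "(z0, y0) \<in> W"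
      "\<forall>p\<in>W. dst (d (snd p)) (f (iv (fst p) \<cdot> snd p)) (xi (d (snd p))) < \<delta>" by blast
    then obtain T where T: "openin PG T" "W = T \<inter> same_range" by (auto simp: openin_subtopology)
    obtain A B where AB: "openin (gtop G) A" "openin (gtop G) B" "z0 \<in> A" "y0 \<in> B" "A \<times> B \<subseteq> T"
      using openin_prod_topologyE [OF T(1), of z0 y0] W(2) T(2) by blast
    have "dst (d y) (f (iv z \<cdot> y)) (xi (d y)) < \<delta>" if "z \<in> A" "y \<in> B" "r z = r y" for z y
    proof -
      have "(z, y) \<in> W" using that AB T(2) openin_subset [OF AB(1)] openin_subset [OF AB(2)] by auto
      from bspec [OF W(3) this] show ?thesis by simp
    qed
    then show ?thesis using xi AB by (intro exI [of _ xi] exI [of _ A] exI [of _ B]) (auto simp: Q'_def)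
  next
    case False
    have O: "openin PG (topspace PG - same_range)" by (intro openin_diff openin_topspace closedin_same_range)
    have zy: "(z0, y0) \<in> topspace PG - same_range" using False z0 y0 by (auto simp: arrows_def)
    obtain A B where AB: "openin (gtop G) A" "openin (gtop G) B" "z0 \<in> A" "y0 \<in> B" "A \<times> B \<subseteq> topspace PG - same_range"
      by (rule openin_prod_topologyE [OF O zy])
    have "r z \<noteq> r y" if "z \<in> A" "y \<in> B" for z y
      using that AB(5) openin_subset [OF AB(1)] openin_subset [OF AB(2)] by auto
    moreover have "(\<lambda>u\<in>topspace (unit_top G). vzero (fib \<H> u)) \<in> sects \<H>"
      using hilbert_bundle by (simp add: hilbert_bundle_def)
    ultimately show ?thesis using AB
      by (intro exI [of _ "\<lambda>u\<in>topspace (unit_top G). vzero (fib \<H> u)"] exI [of _ A] exI [of _ B]) (auto simp: Q'_def)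
  qed
  then have ex: "\<forall>z0\<in>arr. \<exists>xi A B. Q' z0 xi A B" by (rule ballI)
  obtain xi where "\<forall>z0\<in>arr. \<exists>A B. Q' z0 (xi z0) A B" using bchoice [OF ex] ..
  from bchoice [OF this] obtain A where "\<forall>z0\<in>arr. \<exists>B. Q' z0 (xi z0) (A z0) B" ..
  from bchoice [OF this] obtain B where "\<forall>z0\<in>arr. Q' z0 (xi z0) (A z0) (B z0)" ..
  then have xAB: "\<And>z0. z0 \<in> arr \<Longrightarrow> xi z0 \<in> sects \<H> \<and> openin (gtop G) (A z0) \<and> openin (gtop G) (B z0) \<and>
      z0 \<in> A z0 \<and> y0 \<in> B z0 \<and> (\<forall>z\<in>A z0. \<forall>y\<in>B z0. r z = r y \<longrightarrow> dst (d y) (f (iv z \<cdot> y)) (xi z0 (d y)) < \<delta>)"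
    unfolding Q'_def by (rule bspec)
  have cov: "openin (gtop G) (A z) \<and> z \<in> A z" if "z \<in> ksupp k" for z using xAB [of z] Kt that by auto
  obtain zs \<rho> where zs: "set zs \<subseteq> ksupp k" "distinct zs"
    and rho: "\<forall>i\<in>set zs. continuous_map (gtop G) euclideanreal (\<rho> i)"
      "\<forall>i\<in>set zs. \<forall>z\<in>arr. 0 \<le> \<rho> i z \<and> (z \<notin> A i \<longrightarrow> \<rho> i z = 0)"
      "\<forall>z\<in>ksupp k. (\<Sum>i\<in>set zs. \<rho> i z) = (1::real)"
    by (rule kernel_partition [OF k cov])
  have \<rho>: "\<And>i z. i \<in> set zs \<Longrightarrow> z \<in> arr \<Longrightarrow> 0 \<le> \<rho> i z" "\<And>i. i \<in> set zs \<Longrightarrow> continuous_map (gtop G) euclideanreal (\<rho> i)"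
      "\<And>i z. i \<in> set zs \<Longrightarrow> z \<in> arr \<Longrightarrow> z \<notin> A i \<Longrightarrow> \<rho> i z = 0"
      "\<And>z. z \<in> ksupp k \<Longrightarrow> (\<Sum>i\<in>set zs. \<rho> i z) = (1::real)"
    using rho by simp_all
  have zsa: "i \<in> arr" if "i \<in> set zs" for i using zs Kt that by blast
  define c where "c i u = (LINT z|lam u. complex_of_real (k z * \<rho> i z))" for i u
  have kr: "(\<lambda>z. complex_of_real (k z * \<rho> i z)) \<in> Cc (gtop G)" if "i \<in> set zs" for i
  proof (rule CcI [OF _ conv_kernelD(3,4) [OF k]])
    show "continuous_map (gtop G) euclidean (\<lambda>z. complex_of_real (k z * \<rho> i z))"
      by (intro continuous_map_of_real continuous_map_real_mult conv_kernelD(6) [OF k] \<rho> that)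
    show "complex_of_real (k x * \<rho> i x) = 0" if "x \<in> topspace (gtop G)" "x \<notin> ksupp k" for x
      using that conv_kernelD(5) [OF k, of x] by (simp add: arrows_def)
  qed
  define s where "s y = vsum (E y) (\<lambda>i. vscale (E y) (c i (r y)) (xi i (d y))) zs" for y
  have s: "cts (gtop G) d s"
    unfolding s_def
  proof (rule cts_vsum [OF continuous_d])
    fix i assume i: "i \<in> set zs"
    have "continuous_map (gtop G) euclidean (\<lambda>y. c i (r y))"
      using continuous_map_compose [OF continuous_r haar_continuous [OF kr [OF i]]] by (simp add: o_def c_def)
    then show "cts (gtop G) d (\<lambda>y. vscale (E y) (c i (r y)) (xi i (d y)))"
      using xAB [OF zsa [OF i]] by (intro cts_scale cts_sect continuous_d) auto
  qed
  define W where "W = {y \<in> arr. r y \<in> W0} \<inter> (\<Inter>i\<in>set zs. arr \<inter> B i)"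
  have "openin (gtop G) W"
  proof -
    have "W = (\<Inter>U\<in>insert {y \<in> arr. r y \<in> W0} ((\<lambda>i. arr \<inter> B i) ` set zs). U)" by (auto simp: W_def)
    also have "openin (gtop G) \<dots>"
      using openin_unit_top_preimage(1) [OF W0(1)] xAB zsa by (intro openin_INT2) (auto simp: arrows_def)
    finally show ?thesis .
  qed
  moreover have "y0 \<in> W" using y0 W0 xAB zsa by (auto simp: W_def)
  moreover have "cmod (weak_conv k f y a - vinner (E y) a (s y)) \<le> e * vnorm (E y) a"
    if yW: "y \<in> W" and a: "a \<in> pts (E y)" for y a
  proof -
    have y: "y \<in> arr" "r y \<in> W0" using yW by (auto simp: W_def)
    interpret Y: hilbert "E y" by (rule hilbert_E) (use y in simp)
    have xic: "xi i (d y) \<in> pts (E y)" if "i \<in> set zs" for i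
      using xAB [OF zsa [OF that]] sect_closed y by simp
    define F where "F z = (\<Sum>i\<in>set zs. complex_of_real (k z * \<rho> i z) * vinner (E y) a (xi i (d y)))" for z
    have Fi: "integrable (lam (r y)) (\<lambda>z. complex_of_real (k z * \<rho> i z) * vinner (E y) a (xi i (d y)))"
      if "i \<in> set zs" for i
      using Cc_integrable [OF haar_radon kr [OF that]] y by (intro integrable_mult_left) auto
    have F: "integrable (lam (r y)) F"
      unfolding F_def using Fi by (intro Bochner_Integration.integrable_sum) auto
    have "vinner (E y) a (s y) = (\<Sum>i\<leftarrow>zs. vinner (E y) a (vscale (E y) (c i (r y)) (xi i (d y))))"
      unfolding s_def using a xic by (intro Y.inner_vsum) auto
    also have "\<dots> = (\<Sum>i\<in>set zs. c i (r y) * vinner (E y) a (xi i (d y)))"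
    proof -
      have "cnj (c i u) = c i u" for i u by (simp add: c_def del: of_real_mult)
      then show ?thesis
        using zs(2) a xic by (subst sum_list_distinct_conv_sum_set) (auto intro!: sum.cong simp: Y.inner_scale_right)
    qed
    also have "\<dots> = (LINT z|lam (r y). F z)"
      unfolding F_def c_def using Fi by (subst Bochner_Integration.integral_sum) auto
    finally have sF: "vinner (E y) a (s y) = (LINT z|lam (r y). F z)" .
    have "cmod (weak_conv k f y a - (LINT z|lam (r y). F z)) \<le> (vnorm (E y) a * \<delta>) * (LINT z|lam (r y). k z)"
    proof (rule weak_conv_estimate [OF k f y(1) a F])
      fix z assume z: "z \<in> arr" "r z = r y"
      show "cmod (complex_of_real (k z) * vinner (E y) a (f (iv z \<cdot> y)) - F z) \<le> vnorm (E y) a * \<delta> * k z"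
      proof (cases "z \<in> ksupp k")
        case False
        then show ?thesis using conv_kernelD(5) [OF k z(1)] by (simp add: F_def)
      next
        case True
        have fz: "f (iv z \<cdot> y) \<in> pts (E y)" using translate_closed [OF f z(1) y(1) z(2)] .
        have "complex_of_real (k z) * vinner (E y) a (f (iv z \<cdot> y)) =
            (\<Sum>i\<in>set zs. complex_of_real (k z * \<rho> i z) * vinner (E y) a (f (iv z \<cdot> y)))"
        proof -
          have "complex_of_real (\<Sum>i\<in>set zs. \<rho> i z) = 1" using \<rho>(4) [OF True] by simp
          then have "(\<Sum>i\<in>set zs. complex_of_real (\<rho> i z)) = 1" by simp
          moreover have "(\<Sum>i\<in>set zs. complex_of_real (k z * \<rho> i z) * vinner (E y) a (f (iv z \<cdot> y))) =
              complex_of_real (k z) * vinner (E y) a (f (iv z \<cdot> y)) * (\<Sum>i\<in>set zs. complex_of_real (\<rho> i z))"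
            by (simp add: sum_distrib_left sum_distrib_right mult_ac)
          ultimately show ?thesis by simp
        qed
        then have "complex_of_real (k z) * vinner (E y) a (f (iv z \<cdot> y)) - F z =
            (\<Sum>i\<in>set zs. complex_of_real (k z * \<rho> i z) * vinner (E y) a (vdiff (E y) (f (iv z \<cdot> y)) (xi i (d y))))"
          unfolding F_def using a fz xic by (simp add: Y.inner_diff_right sum_subtractf [symmetric] right_diff_distrib)
        also have "cmod \<dots> \<le> (\<Sum>i\<in>set zs. k z * \<rho> i z * (vnorm (E y) a * \<delta>))"
        proof (rule sum_norm_le)
          fix i assume i: "i \<in> set zs"
          have nn: "0 \<le> k z" "0 \<le> \<rho> i z" using conv_kernelD(2) [OF k z(1)] \<rho>(1) [OF i z(1)] by auto
          show "cmod (complex_of_real (k z * \<rho> i z) * vinner (E y) a (vdiff (E y) (f (iv z \<cdot> y)) (xi i (d y)))) \<le>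
              k z * \<rho> i z * (vnorm (E y) a * \<delta>)"
          proof (cases "z \<in> A i")
            case False
            then show ?thesis using \<rho>(3) [OF i z(1)] by simp
          next
            case True
            have "y \<in> B i" using yW i unfolding W_def by blast
            then have "dst (d y) (f (iv z \<cdot> y)) (xi i (d y)) \<le> \<delta>"
              using xAB [OF zsa [OF i]] True z by (simp add: less_imp_le)
            then have "cmod (vinner (E y) a (vdiff (E y) (f (iv z \<cdot> y)) (xi i (d y)))) \<le> vnorm (E y) a * \<delta>"
              using Y.Cauchy_Schwarz [OF a Y.diff_closed [OF fz xic [OF i]]] Y.vnorm_nonneg [OF a]
              by (meson mult_left_mono order_trans)
            then show ?thesis using nn by (simp add: norm_mult abs_mult mult_left_mono)
          qed
        qed
        also have "\<dots> = vnorm (E y) a * \<delta> * k z * (\<Sum>i\<in>set zs. \<rho> i z)"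
          by (simp add: sum_distrib_left mult_ac)
        finally show ?thesis using \<rho>(4) [OF True] by simp
      qed
    qed
    also have "\<dots> \<le> (vnorm (E y) a * \<delta>) * M"
      using W0(3) [OF y(2)] Y.vnorm_nonneg [OF a] \<delta> by (intro mult_left_mono) (auto simp: Q_def)
    also have "\<dots> = e * vnorm (E y) a" using M by (simp add: \<delta>_def)
    finally show ?thesis using sF by simp
  qed
  ultimately show ?thesis using s by (intro that) auto
qed

end

section \<open>Approximation of translates by convolutions\<close>

context induced_setting
begin

lemma weak_conv_representable:
  assumes k: "conv_kernel k" and f: "f \<in> pts V" and y: "y \<in> arr"
  obtains g where "g \<in> pts (E y)" "\<forall>a\<in>pts (E y). vinner (E y) a g = weak_conv k f y a"
proof -
  interpret hilbert "E y" by (rule hilbert_E [OF y])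
  have ex: "\<exists>s\<in>pts (E y). \<forall>a\<in>pts (E y). cmod (weak_conv k f y a - vinner (E y) a s) \<le> e * vnorm (E y) a" if e: "0 < e" for e
  proof (rule weak_conv_approx [OF k f y e])
    fix s W assume s: "cts (gtop G) d s" "openin (gtop G) W" "y \<in> W"
      "\<And>y a. y \<in> W \<Longrightarrow> a \<in> pts (E y) \<Longrightarrow> cmod (weak_conv k f y a - vinner (E y) a (s y)) \<le> e * vnorm (E y) a"
    have "s y \<in> pts (E y)" using ctsD(2) [OF s(1)] y by (simp add: arrows_def)
    then show ?thesis using s(4) [OF s(3)] by blast
  qed
  show ?thesis
    by (rule approx_representable [OF ex]) (assumption, rule that, assumption, rule ballI)
qed

definition conv :: "('g \<Rightarrow> real) \<Rightarrow> ('g \<Rightarrow> 'h) \<Rightarrow> 'g \<Rightarrow> 'h" where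
  "conv k f y = (SOME g. g \<in> pts (E y) \<and> (\<forall>a\<in>pts (E y). vinner (E y) a g = weak_conv k f y a))"

lemma conv:
  assumes "conv_kernel k" "f \<in> pts V" "y \<in> arr"
  shows "conv k f y \<in> pts (E y)" "a \<in> pts (E y) \<Longrightarrow> vinner (E y) a (conv k f y) = weak_conv k f y a"
proof -
  have "\<exists>g. g \<in> pts (E y) \<and> (\<forall>a\<in>pts (E y). vinner (E y) a g = weak_conv k f y a)"
    by (rule weak_conv_representable [OF assms]) blast
  from someI_ex [OF this] show "conv k f y \<in> pts (E y)"
    "a \<in> pts (E y) \<Longrightarrow> vinner (E y) a (conv k f y) = weak_conv k f y a"
    by (auto simp: conv_def)
qed

lemma conv_unique:
  assumes "conv_kernel k" "f \<in> pts V" "y \<in> arr" "g \<in> pts (E y)"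
    and "\<And>a. a \<in> pts (E y) \<Longrightarrow> vinner (E y) a g = weak_conv k f y a"
  shows "conv k f y = g"
proof -
  interpret hilbert "E y" by (rule hilbert_E [OF assms(3)])
  note c = conv [OF assms(1-3)]
  show ?thesis
  proof (rule eq_if_inner_eq)
    fix a assume a: "a \<in> pts (E y)"
    show "vinner (E y) (conv k f y) a = vinner (E y) g a"
      using inner_commute [OF a c(1)] inner_commute [OF a assms(4)] c(2) [OF a] assms(5) [OF a] by simp
  qed (use c assms in auto)
qed

lemma conv_le:
  assumes k: "conv_kernel k" and f: "f \<in> pts V" and y: "y \<in> arr" and b: "b \<in> pts (E y)" and e: "0 \<le> e"
    and le: "\<And>a. a \<in> pts (E y) \<Longrightarrow> cmod (weak_conv k f y a - vinner (E y) a b) \<le> e * vnorm (E y) a"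
  shows "dst (d y) (conv k f y) b \<le> e"
proof -
  interpret hilbert "E y" by (rule hilbert_E [OF y])
  show ?thesis
    by (rule norm_le_if_weak) (use conv [OF k f y] b e le in \<open>auto simp: inner_diff_right\<close>)
qed

lemma cts_conv:
  assumes k: "conv_kernel k" and f: "f \<in> pts V"
  shows "cts (gtop G) d (conv k f)"
proof (rule cts_limit [OF continuous_d])
  show "conv k f y \<in> pts (E y)" if "y \<in> topspace (gtop G)" for y
    using conv(1) [OF k f, of y] that by (simp add: arrows_def)
  fix y and e :: real assume y: "y \<in> topspace (gtop G)" and e: "0 < e"
  show "\<exists>g W. cts (gtop G) d g \<and> openin (gtop G) W \<and> y \<in> W \<and> (\<forall>z\<in>W. dst (d z) (conv k f z) (g z) < e)"
  proof (rule weak_conv_approx [OF k f, of y "e/2"])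
    show "y \<in> arr" "0 < e/2" using y e by (auto simp: arrows_def)
    fix s W assume s: "cts (gtop G) d s" "openin (gtop G) W" "y \<in> W"
      "\<And>y a. y \<in> W \<Longrightarrow> a \<in> pts (E y) \<Longrightarrow> cmod (weak_conv k f y a - vinner (E y) a (s y)) \<le> e/2 * vnorm (E y) a"
    have "dst (d z) (conv k f z) (s z) < e" if z: "z \<in> W" for z
    proof -
      have zt: "z \<in> topspace (gtop G)" using z openin_subset [OF s(2)] by blast
      have "dst (d z) (conv k f z) (s z) \<le> e/2"
        using zt ctsD(2) [OF s(1) zt] e s(4) [OF z] by (intro conv_le k f) (auto simp: arrows_def)
      then show ?thesis using e by simp
    qed
    then show ?thesis using s by blast
  qed
qed

text \<open>Right translation by \<open>h\<close> multiplies the integrand by the unitary operator of \<open>h\<^sup>-\<^sup>1\<close>, which can be taken out of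
  the weak integral by transposing it to the test vector.\<close>

lemma conv_equivariant:
  assumes k: "conv_kernel k" and f: "f \<in> pts V"
  shows "equivariant_fun (conv k f)"
  unfolding equivariant_fun_def
proof (intro ballI impI)
  fix y h assume y: "y \<in> arr" and h: "h \<in> H" "d y = r h"
  note ha = H_arr [OF h(1)]
  note U = unitary_sigma_inv [OF h(1)]
  show "conv k f (y \<cdot> h) = \<sigma> (iv h) (conv k f y)"
  proof (rule conv_unique [OF k f])
    show yh: "y \<cdot> h \<in> arr" using y h ha by simp
    have c: "conv k f y \<in> pts (fib \<H> (r h))" using conv(1) [OF k f y] h by simp
    show "\<sigma> (iv h) (conv k f y) \<in> pts (E (y \<cdot> h))"
      using unitary_map_closed [OF U c] y h ha by simp
    fix a assume a: "a \<in> pts (E (y \<cdot> h))"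
    then have "a \<in> \<sigma> (iv h) ` pts (fib \<H> (r h))"
      using U y h ha by (simp add: unitary_map_def bij_betw_def)
    then obtain b where b: "b \<in> pts (fib \<H> (r h))" "a = \<sigma> (iv h) b" by blast
    have inner: "vinner (fib \<H> (d h)) (\<sigma> (iv h) b) (\<sigma> (iv h) b') = vinner (fib \<H> (r h)) b b'"
      if "b' \<in> pts (fib \<H> (r h))" for b'
      using U b that by (simp add: unitary_map_def)
    have "weak_conv k f (y \<cdot> h) a = weak_conv k f y b"
      unfolding weak_conv_def
    proof (rule Bochner_Integration.integral_cong)
      fix z
      show "(if z \<in> rfibre G (r (y \<cdot> h)) then complex_of_real (k z) * vinner (E (y \<cdot> h)) a (f (iv z \<cdot> (y \<cdot> h))) else 0) =
        (if z \<in> rfibre G (r y) then complex_of_real (k z) * vinner (E y) b (f (iv z \<cdot> y)) else 0)"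
      proof (cases "z \<in> rfibre G (r y)")
        case True
        then have z: "z \<in> arr" "r z = r y" by (auto simp: rfibre_def)
        have "f (iv z \<cdot> y) \<in> pts (fib \<H> (r h))" using translate_closed [OF f z(1) y z(2)] h by simp
        then show ?thesis
          using True y h ha b translate_equivariant [OF f z(1) y z(2) h] inner by simp
      next
        case False
        then show ?thesis using y h ha by simp
      qed
    qed (use y h ha in simp)
    also have "\<dots> = vinner (E y) b (conv k f y)" using conv(2) [OF k f y] b h by simp
    finally show "vinner (E (y \<cdot> h)) a (\<sigma> (iv h) (conv k f y)) = weak_conv k f (y \<cdot> h) a"
      using inner [OF c] b y h ha by simp
  qed
qed

lemma conv_supported:
  assumes k: "conv_kernel k" and f: "f \<in> pts V" and Z: "\<And>z. z \<in> arr \<Longrightarrow> k z \<noteq> 0 \<Longrightarrow> z \<in> Z"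
    and L: "\<And>z y. z \<in> Z \<Longrightarrow> y \<in> arr \<Longrightarrow> r z = r y \<Longrightarrow> q y \<notin> L \<Longrightarrow> f (iv z \<cdot> y) = vzero (E y)"
  shows "supported L (conv k f)"
  unfolding supported_def
proof (intro ballI impI)
  fix y assume y: "y \<in> arr" "q y \<notin> L"
  interpret hilbert "E y" by (rule hilbert_E [OF y(1)])
  show "conv k f y = vzero (E y)"
  proof (rule conv_unique [OF k f y(1)])
    fix a assume a: "a \<in> pts (E y)"
    have "weak_conv k f y a = (LINT z|lam (r y). 0)"
      unfolding weak_conv_def
    proof (rule Bochner_Integration.integral_cong [OF refl])
      fix z
      show "(if z \<in> rfibre G (r y) then complex_of_real (k z) * vinner (E y) a (f (iv z \<cdot> y)) else 0) = 0"
        using L [of z y] Z [of z] y a by (cases "k z = 0") (auto simp: rfibre_def)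
    qed
    then show "vinner (E y) a (vzero (E y)) = weak_conv k f y a" using a by simp
  qed auto
qed

text \<open>Convolution with a kernel of mass one concentrated near \<open>x\<close>. The bound \<open>L\<close> on the supports is the
  same for all \<open>e\<close>, as the kernels are taken inside one compact neighbourhood of \<open>x\<close>.\<close>

lemma translate_approx:
  assumes f: "f \<in> pts V" and x: "x \<in> arr"
  obtains L where "compactin CT L"
    "\<And>e. 0 < e \<Longrightarrow> \<exists>g\<in>pts V. supported L g \<and> (\<forall>y\<in>rfibre G (r x). dst (d y) (g y) (f (iv x \<cdot> y)) \<le> e)"
proof -
  obtain Z Zc where Z: "openin (gtop G) Z" "compactin (gtop G) Zc" "x \<in> Z" "Z \<subseteq> Zc"
    using locally_compact x unfolding locally_compact_space_def arrows_def by blast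
  obtain L where L: "compactin CT L"
    "\<And>z y. z \<in> Zc \<Longrightarrow> y \<in> arr \<Longrightarrow> r z = r y \<Longrightarrow> q y \<notin> L \<Longrightarrow> f (iv z \<cdot> y) = vzero (E y)"
    using translate_support [OF f Z(2)] by metis
  have "\<exists>g\<in>pts V. supported L g \<and> (\<forall>y\<in>rfibre G (r x). dst (d y) (g y) (f (iv x \<cdot> y)) \<le> e)" if e: "0 < e" for e
  proof -
    let ?D = "rfibre G (r x) \<times> rfibre G (r x)"
    have D: "closedin PG ?D" using closedin_rfibre [of "r x"] x by (simp add: closedin_prod_Times_iff)
    have DRD: "?D \<subseteq> same_range" by (auto simp: rfibre_def arrows_def)
    define N where "N p = dst (d (snd p)) (f (iv (fst p) \<cdot> snd p)) (f (iv x \<cdot> snd p))" for p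
    have N: "continuous_map (subtopology PG ?D) euclideanreal N"
      unfolding N_def
    proof (intro cts_norm cts_diff)
      have "subtopology PG ?D = subtopology (subtopology PG same_range) ?D"
        using DRD by (simp add: subtopology_subtopology Int_absorb1)
      then show "cts (subtopology PG ?D) (\<lambda>p. d (snd p)) (\<lambda>p. f (iv (fst p) \<cdot> snd p))"
        using cts_subtopology [OF cts_translate [OF f]] by simp
      have "continuous_map (subtopology PG ?D) (subtopology PG same_range) (\<lambda>p. (x, snd p))"
        unfolding continuous_map_in_subtopology
      proof
        show "continuous_map (subtopology PG ?D) PG (\<lambda>p. (x, snd p))"
          using x by (intro continuous_map_pairedI continuous_map_from_subtopology continuous_map_snd) (auto simp: arrows_def)
        show "(\<lambda>p. (x, snd p)) \<in> topspace (subtopology PG ?D) \<rightarrow> same_range"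
          using x by (auto simp: rfibre_def arrows_def)
      qed
      from cts_compose [OF cts_translate [OF f] this]
      show "cts (subtopology PG ?D) (\<lambda>p. d (snd p)) (\<lambda>p. f (iv x \<cdot> snd p))" by simp
    qed
    have zero: "N (z, y) = 0" if "z \<in> Zc" "(z, y) \<in> ?D" "q y \<notin> L" for z y
    proof -
      have y: "y \<in> arr" "r y = r x" "r z = r x" using that by (auto simp: rfibre_def)
      interpret hilbert "E y" by (rule hilbert_E [OF y(1)])
      show ?thesis using L(2) [of z y] L(2) [of x y] that y Z by (auto simp: N_def)
    qed
    have inv: "(z, c) \<in> ?D \<and> N (z, c) = N (z, y)" if zy: "(z, y) \<in> ?D" and c: "c \<in> arr" "q y = q c" for z y c
    proof -
      have y: "y \<in> arr" "r y = r x" "z \<in> arr" "r z = r x" using zy by (auto simp: rfibre_def)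
      obtain h where h: "h \<in> H" "d y = r h" "c = y \<cdot> h" by (rule coset_eqE [OF y(1) c])
      note ha = H_arr [OF h(1)]
      have "N (z, c) = N (z, y)"
        using unitary_map_norm_diff [OF unitary_sigma_inv [OF h(1)] fib_hilbert, of "f (iv z \<cdot> y)" "f (iv x \<cdot> y)"]
          translate_closed [OF f, of z y] translate_closed [OF f, of x y] y h ha x
        by (simp add: N_def translate_equivariant [OF f])
      then show ?thesis using zy c y h ha by (auto simp: rfibre_def)
    qed
    have small: "N (x, y) < e" if "(x, y) \<in> ?D" for y
    proof -
      have y: "y \<in> arr" "r y = r x" using that by (auto simp: rfibre_def)
      interpret hilbert "E y" by (rule hilbert_E [OF y(1)])
      show ?thesis using translate_closed [OF f x, of y] y e by (simp add: N_def)
    qed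
    have "N (z, y) < e" if "z \<in> Z" "(z, y) \<in> ?D" "q y \<notin> L" for z y
      using zero [of z y] that Z(4) e by auto
    from tube [OF D N Z(3) Z(1) small L(1) this inv]
    obtain W where W: "openin (gtop G) W" "x \<in> W" "W \<subseteq> Z" "\<forall>z\<in>W. \<forall>y. (z, y) \<in> ?D \<longrightarrow> N (z, y) < e"
      by blast
    obtain b :: "'g \<Rightarrow> real" where b: "\<And>y. y \<in> topspace (gtop G) \<Longrightarrow> 0 \<le> b y" "b x = 1"
      "\<And>y. y \<in> topspace (gtop G) \<Longrightarrow> y \<notin> W \<Longrightarrow> b y = 0" "(\<lambda>y. complex_of_real (b y)) \<in> Cc (gtop G)"
      using bump_function [OF locally_compact Hausdorff W(1,2)] by metis
    define m where "m = (LINT y|lam (r x). b y)"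
    have m: "0 < m" unfolding m_def using b x by (intro haar_bump_pos) (auto simp: arrows_def)
    define k where "k z = b z / m" for z
    have kC: "(\<lambda>z. complex_of_real (k z)) \<in> Cc (gtop G)"
    proof -
      have "continuous_map (gtop G) euclidean (\<lambda>z. complex_of_real (1 / m) * complex_of_real (b z))"
        by (intro continuous_map_complex_mult CcD(1) [OF b(4)]) simp
      moreover have "{y \<in> topspace (gtop G). complex_of_real (k y) \<noteq> 0} = {y \<in> topspace (gtop G). complex_of_real (b y) \<noteq> 0}"
        using m by (auto simp: k_def)
      ultimately show ?thesis using CcD(2) [OF b(4)] by (simp add: Cc_def k_def)
    qed
    then have k: "conv_kernel k" using b m by (auto simp: conv_kernel_def k_def arrows_def)
    have k1: "(LINT z|lam (r x). k z) = 1" using m by (simp add: k_def m_def)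
    have kW: "z \<in> W" if "z \<in> arr" "k z \<noteq> 0" for z using b(3) [of z] that by (auto simp: k_def arrows_def)
    have g: "restrict (conv k f) arr \<in> pts V" and gL: "supported L (conv k f)"
    proof -
      show gL: "supported L (conv k f)"
        by (rule conv_supported [OF k f, of Zc]) (use kW W(3) Z(4) L(2) in auto)
      show "restrict (conv k f) arr \<in> pts V"
        by (intro F0I [OF cts_conv [OF k f] conv_equivariant [OF k f] L(1) gL])
    qed
    have "dst (d y) (conv k f y) (f (iv x \<cdot> y)) \<le> e" if y: "y \<in> rfibre G (r x)" for y
    proof (rule conv_le [OF k f])
      show ya: "y \<in> arr" using y by (simp add: rfibre_def)
      have ry: "r y = r x" using y by (simp add: rfibre_def)
      show fx: "f (iv x \<cdot> y) \<in> pts (E y)" using translate_closed [OF f x ya] ry by simp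
      show "0 \<le> e" using e by simp
      fix a assume a: "a \<in> pts (E y)"
      interpret hilbert "E y" by (rule hilbert_E [OF ya])
      let ?F = "\<lambda>z. complex_of_real (k z) * vinner (E y) a (f (iv x \<cdot> y))"
      have ki: "integrable (lam (r y)) (\<lambda>z. complex_of_real (k z))"
        using Cc_integrable [OF haar_radon kC] ya by simp
      have F: "integrable (lam (r y)) ?F" using ki by simp
      have "cmod (weak_conv k f y a - (LINT z|lam (r y). ?F z)) \<le> (vnorm (E y) a * e) * (LINT z|lam (r y). k z)"
      proof (rule weak_conv_estimate [OF k f ya a F])
        fix z assume z: "z \<in> arr" "r z = r y"
        show "cmod (complex_of_real (k z) * vinner (E y) a (f (iv z \<cdot> y)) - ?F z) \<le> vnorm (E y) a * e * k z"
        proof (cases "k z = 0")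
          case False
          have fz: "f (iv z \<cdot> y) \<in> pts (E y)" using translate_closed [OF f z(1) ya z(2)] .
          have "N (z, y) < e" using bspec [OF W(4) kW [OF z(1) False]] z ya ry by (simp add: rfibre_def)
          then have "cmod (vinner (E y) a (vdiff (E y) (f (iv z \<cdot> y)) (f (iv x \<cdot> y)))) \<le> vnorm (E y) a * e"
            using Cauchy_Schwarz [OF a diff_closed [OF fz fx]] vnorm_nonneg [OF a]
            by (auto simp: N_def intro!: order_trans [OF Cauchy_Schwarz [OF a diff_closed [OF fz fx]]] mult_left_mono)
          then have "k z * cmod (vinner (E y) a (vdiff (E y) (f (iv z \<cdot> y)) (f (iv x \<cdot> y)))) \<le> k z * (vnorm (E y) a * e)"
            using conv_kernelD(2) [OF k z(1)] by (rule mult_left_mono)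
          moreover have "complex_of_real (k z) * vinner (E y) a (f (iv z \<cdot> y)) - ?F z =
              complex_of_real (k z) * vinner (E y) a (vdiff (E y) (f (iv z \<cdot> y)) (f (iv x \<cdot> y)))"
            using a fz fx by (simp add: inner_diff_right right_diff_distrib)
          ultimately show ?thesis using conv_kernelD(2) [OF k z(1)] by (simp add: norm_mult mult_ac)
        qed simp
      qed
      moreover have "(LINT z|lam (r y). ?F z) = vinner (E y) a (f (iv x \<cdot> y))"
        using k1 ry by simp
      ultimately show "cmod (weak_conv k f y a - vinner (E y) a (f (iv x \<cdot> y))) \<le> e * vnorm (E y) a"
        using k1 ry by (simp add: mult.commute)
    qed
    then show ?thesis
      using g gL by (intro bexI [OF _ g]) (auto simp: supported_def rfibre_def)
  qed
  with L(1) show ?thesis by (rule that)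
qed

end

section \<open>Exact extension of translates\<close>

lemma (in seminormed) geometric_diff:
  assumes s: "\<And>n. s n \<in> pts V" and le: "\<And>n. \<nu> (vdiff V (s (Suc n)) (s n)) \<le> (1/2) ^ n" and "n \<le> m"
  shows "\<nu> (vdiff V (s m) (s n)) \<le> 2 * (1/2) ^ n"
proof -
  have "\<nu> (vdiff V (s m) (s n)) \<le> 2 * (1/2) ^ n - 2 * (1/2) ^ m"
    using \<open>n \<le> m\<close>
  proof (induction m rule: dec_induct)
    case base
    then show ?case using s by simp
  next
    case (step m)
    have "\<nu> (vdiff V (s (Suc m)) (s n)) \<le> \<nu> (vdiff V (s (Suc m)) (s m)) + \<nu> (vdiff V (s m) (s n))"
      by (intro norm_diff_triangle s)
    then show ?case using step.IH le [of m] by simp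
  qed
  then show ?thesis by (smt (verit) zero_le_power divide_nonneg_nonneg)
qed

lemma half_power_small:
  assumes "0 < (e::real)" obtains N where "\<And>n. N \<le> n \<Longrightarrow> c * (1/2) ^ n < e"
proof -
  have "(\<lambda>n. c * (1/2::real) ^ n) \<longlonglongrightarrow> c * 0"
    by (intro tendsto_mult_left LIMSEQ_power_zero) simp
  then have "\<forall>\<^sub>F n in sequentially. c * (1/2) ^ n < e"
    using assms by (intro order_tendstoD) auto
  then show ?thesis using that unfolding eventually_sequentially by blast
qed

lemma (in seminormed) geometric_cauchy:
  assumes s: "\<And>n. s n \<in> pts V" and le: "\<And>n. \<nu> (vdiff V (s (Suc n)) (s n)) \<le> (1/2) ^ n"
  shows "cauchy_seq V \<nu> s"
  unfolding cauchy_seq_def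
proof (intro conjI allI impI s)
  fix e :: real assume e: "0 < e"
  obtain N where N: "4 * (1/2) ^ N < e" using half_power_small [OF e, of 4] by blast
  show "\<exists>N. \<forall>m\<ge>N. \<forall>n\<ge>N. \<nu> (vdiff V (s m) (s n)) < e"
  proof (intro exI allI impI)
    fix m n assume mn: "N \<le> m" "N \<le> n"
    have "\<nu> (vdiff V (s m) (s n)) \<le> \<nu> (vdiff V (s m) (s N)) + \<nu> (vdiff V (s N) (s n))"
      by (intro norm_diff_triangle s)
    also have "\<dots> \<le> 2 * (1/2) ^ N + 2 * (1/2) ^ N"
      using geometric_diff [OF s le mn(1)] geometric_diff [OF s le mn(2)] norm_diff_commute [OF s s, of N n] by simp
    finally show "\<nu> (vdiff V (s m) (s n)) < e" using N by simp
  qed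
qed

lemma (in hilbert) limit_bound:
  assumes s: "\<And>n. s n \<in> pts V" and a: "a \<in> pts V" "(\<lambda>n. vnorm V (vdiff V (s n) a)) \<longlonglongrightarrow> 0"
    and b: "b \<in> pts V" "\<And>n. N \<le> n \<Longrightarrow> vnorm V (vdiff V (s n) b) \<le> c"
  shows "vnorm V (vdiff V a b) \<le> c"
proof -
  have "(\<lambda>n. vnorm V (vdiff V (s n) a) + c) \<longlonglongrightarrow> 0 + c" by (intro tendsto_intros a)
  moreover have "vnorm V (vdiff V a b) \<le> vnorm V (vdiff V (s n) a) + c" if "N \<le> n" for n
    using norm_diff_triangle [OF a(1) s b(1), of n] norm_diff_commute [OF a(1) s, of n] b(2) [OF that] by simp
  ultimately show ?thesis by (intro LIMSEQ_le_const [of _ "0 + c", simplified]) auto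
qed

context induced_setting
begin

text \<open>Truncation at height \<open>e\<close> keeps a function inside \<open>F0\<close>, because its norm is invariant.\<close>

lemma F0_truncate:
  assumes f: "f \<in> pts V" and e: "0 < e"
  obtains t where "t \<in> pts V" "\<forall>x\<in>arr. vnorm (E x) (t x) \<le> e \<and> (vnorm (E x) (f x) \<le> e \<longrightarrow> t x = f x)"
    "\<forall>K. supported K f \<longrightarrow> supported K t"
proof -
  define \<theta> where "\<theta> x = e / max e (vnorm (E x) (f x))" for x
  have pos: "0 < max e (vnorm (E x) (f x))" for x using e by auto
  have "continuous_map (gtop G) euclideanreal \<theta>"
    unfolding \<theta>_def
    by (intro continuous_map_real_divide continuous_map_real_max cts_norm F0D f)
      (use pos in \<open>auto simp: less_imp_neq [symmetric]\<close>)
  then have c: "continuous_map (gtop G) euclidean (\<lambda>x. complex_of_real (\<theta> x))" by (rule continuous_map_of_real)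
  have "complex_of_real (\<theta> (x \<cdot> h)) = complex_of_real (\<theta> x)" if "x \<in> arr" "h \<in> H" "d x = r h" for x h
    using norm_invariant [OF f that] by (simp add: \<theta>_def)
  from F0_multiply [OF f c this]
  have t: "(\<lambda>x\<in>arr. vscale (E x) (complex_of_real (\<theta> x)) (f x)) \<in> pts V" .
  show ?thesis
  proof (rule that [OF t], intro ballI)
    fix x assume x: "x \<in> arr"
    interpret hilbert "E x" by (rule hilbert_E [OF x])
    have fx: "f x \<in> pts (E x)" by (rule F0D(4) [OF f x])
    have n: "0 \<le> vnorm (E x) (f x)" by (rule vnorm_nonneg [OF fx])
    have "\<theta> x * vnorm (E x) (f x) \<le> e"
    proof (cases "vnorm (E x) (f x) \<le> e")
      case True
      then show ?thesis using e by (simp add: \<theta>_def max_def)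
    next
      case False
      then show ?thesis using e by (simp add: \<theta>_def max_def)
    qed
    moreover have "0 \<le> \<theta> x" using e pos [of x] by (simp add: \<theta>_def)
    moreover have "\<theta> x = 1" if "vnorm (E x) (f x) \<le> e" using that e by (simp add: \<theta>_def max_def)
    ultimately show "vnorm (E x) ((\<lambda>x\<in>arr. vscale (E x) (complex_of_real (\<theta> x)) (f x)) x) \<le> e \<and>
      (vnorm (E x) (f x) \<le> e \<longrightarrow> (\<lambda>x\<in>arr. vscale (E x) (complex_of_real (\<theta> x)) (f x)) x = f x)"
      using x fx by (simp add: norm_scale)
  next
    show "\<forall>K. supported K f \<longrightarrow> supported K (\<lambda>x\<in>arr. vscale (E x) (complex_of_real (\<theta> x)) (f x))"
      unfolding supported_def
    proof (intro allI impI ballI)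
      fix K x assume K: "\<forall>x\<in>arr. q x \<notin> K \<longrightarrow> f x = vzero (E x)" and x: "x \<in> arr" "q x \<notin> K"
      interpret hilbert "E x" by (rule hilbert_E [OF x(1)])
      show "(\<lambda>x\<in>arr. vscale (E x) (complex_of_real (\<theta> x)) (f x)) x = vzero (E x)" using K x by simp
    qed
  qed
qed

text \<open>The increments are summable uniformly on \<open>G\<close> and all members are supported in one compact set of cosets, so
  continuity, equivariance and support pass to the pointwise limit.\<close>

lemma F0_uniform_limit:
  assumes s: "\<And>n. s n \<in> pts V" and L: "compactin CT L" "\<And>n. supported L (s n)"
    and le: "\<And>n x. x \<in> arr \<Longrightarrow> dst (d x) (s (Suc n) x) (s n x) \<le> (1/2) ^ n"
  obtains g where "g \<in> pts V" "\<forall>x\<in>arr. \<forall>n. dst (d x) (g x) (s n x) \<le> 2 * (1/2) ^ n"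
proof -
  have "\<exists>a\<in>pts (E x). (\<lambda>n. dst (d x) (s n x) a) \<longlonglongrightarrow> 0" if x: "x \<in> arr" for x
  proof -
    interpret hilbert "E x" by (rule hilbert_E [OF x])
    show ?thesis by (intro complete geometric_cauchy F0D(4) [OF s x] le x)
  qed
  then have "\<forall>x\<in>arr. \<exists>a. a \<in> pts (E x) \<and> (\<lambda>n. dst (d x) (s n x) a) \<longlonglongrightarrow> 0" by blast
  from bchoice [OF this] obtain g where g: "\<forall>x\<in>arr. g x \<in> pts (E x) \<and> (\<lambda>n. dst (d x) (s n x) (g x)) \<longlonglongrightarrow> 0" ..
  then have gE: "g x \<in> pts (E x)" and glim: "(\<lambda>n. dst (d x) (s n x) (g x)) \<longlonglongrightarrow> 0" if "x \<in> arr" for x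
    using that by auto
  have bound: "dst (d x) (g x) (s n x) \<le> 2 * (1/2) ^ n" if x: "x \<in> arr" for x n
  proof -
    interpret hilbert "E x" by (rule hilbert_E [OF x])
    show ?thesis
      by (rule limit_bound [OF F0D(4) [OF s x] gE [OF x] glim [OF x] F0D(4) [OF s x]])
        (rule geometric_diff [OF F0D(4) [OF s x] le [OF x]])
  qed
  have "cts (gtop G) d g"
  proof (rule cts_limit [OF continuous_d])
    show "g y \<in> pts (E y)" if "y \<in> topspace (gtop G)" for y using gE that by (simp add: arrows_def)
    fix y and e :: real assume y: "y \<in> topspace (gtop G)" and e: "0 < e"
    obtain N where N: "\<And>n. N \<le> n \<Longrightarrow> 2 * (1/2::real) ^ n < e" using half_power_small [OF e, of 2] by blast
    have "dst (d z) (g z) (s N z) < e" if "z \<in> topspace (gtop G)" for z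
      using bound [of z N] N [of N] that by (simp add: arrows_def)
    then show "\<exists>f W. cts (gtop G) d f \<and> openin (gtop G) W \<and> y \<in> W \<and> (\<forall>z\<in>W. dst (d z) (g z) (f z) < e)"
      using F0D(2) [OF s] y by (intro exI [of _ "s N"] exI [of _ "topspace (gtop G)"]) auto
  qed
  moreover have "equivariant_fun g"
    unfolding equivariant_fun_def
  proof (intro ballI impI)
    fix x h assume x: "x \<in> arr" and h: "h \<in> H" "d x = r h"
    note ha = H_arr [OF h(1)] and U = unitary_sigma_inv [OF h(1)]
    have xh: "x \<cdot> h \<in> arr" using x h ha by simp
    interpret W: hilbert "E (x \<cdot> h)" by (rule hilbert_E [OF xh])
    have hr: "hilbert (fib \<H> (r h))" using ha by (intro fib_hilbert) simp
    have gx: "g x \<in> pts (fib \<H> (r h))" using gE [OF x] h by simp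
    have sx: "s n x \<in> pts (fib \<H> (r h))" for n using F0D(4) [OF s x] h by simp
    have Ug: "\<sigma> (iv h) (g x) \<in> pts (E (x \<cdot> h))" using unitary_map_closed [OF U gx] x h ha by simp
    have eq: "dst (d (x \<cdot> h)) (\<sigma> (iv h) (g x)) (s n (x \<cdot> h)) = dst (d x) (g x) (s n x)" for n
      using unitary_map_norm_diff [OF U hr gx sx] x h ha by (simp add: equivariant_apply s)
    have "dst (d (x \<cdot> h)) (g (x \<cdot> h)) (\<sigma> (iv h) (g x)) \<le> 0 + e" if e: "0 < e" for e
    proof -
      obtain N where N: "\<And>n. N \<le> n \<Longrightarrow> 4 * (1/2::real) ^ n < e" using half_power_small [OF e, of 4] by blast
      have "dst (d (x \<cdot> h)) (g (x \<cdot> h)) (\<sigma> (iv h) (g x)) \<le>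
          dst (d (x \<cdot> h)) (g (x \<cdot> h)) (s N (x \<cdot> h)) + dst (d (x \<cdot> h)) (s N (x \<cdot> h)) (\<sigma> (iv h) (g x))"
        by (intro W.norm_diff_triangle gE xh F0D(4) s Ug)
      also have "\<dots> \<le> 2 * (1/2) ^ N + 2 * (1/2) ^ N"
        using bound [OF xh, of N] bound [OF x, of N] eq [of N] W.norm_diff_commute [OF Ug F0D(4) [OF s xh], of N] by simp
      finally show ?thesis using N [of N] by simp
    qed
    then have "dst (d (x \<cdot> h)) (g (x \<cdot> h)) (\<sigma> (iv h) (g x)) \<le> 0" by (rule field_le_epsilon)
    then show "g (x \<cdot> h) = \<sigma> (iv h) (g x)"
      using W.vnorm_nonneg [OF W.diff_closed [OF gE [OF xh] Ug]] gE [OF xh] Ug by (intro W.eq_if_norm_diff_zero) auto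
  qed
  moreover have "supported L g"
    unfolding supported_def
  proof (intro ballI impI)
    fix x assume x: "x \<in> arr" "q x \<notin> L"
    interpret hilbert "E x" by (rule hilbert_E [OF x(1)])
    have "s n x = vzero (E x)" for n using L(2) x by (simp add: supported_def)
    then have "(\<lambda>n. vnorm (E x) (vdiff (E x) (vzero (E x)) (g x))) \<longlonglongrightarrow> 0" using glim [OF x(1)] by simp
    then have "vnorm (E x) (vdiff (E x) (vzero (E x)) (g x)) = 0" by (simp add: LIMSEQ_const_iff)
    then have "vzero (E x) = g x" using gE [OF x(1)] by (intro eq_if_norm_diff_zero) auto
    then show "g x = vzero (E x)" by simp
  qed
  ultimately have "restrict g arr \<in> pts V" using L(1) by (intro F0I)
  then show ?thesis using bound by (intro that [of "restrict g arr"]) auto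
qed

text \<open>Approximations of the translate are corrected by truncated differences. Their series is dominated by a
  geometric series on \<open>G\<close> and telescopes on the fibre, where truncation has no effect.\<close>

lemma F0_extend_translate:
  assumes f: "f \<in> pts V" and x: "x \<in> arr"
  obtains g where "g \<in> pts V" "\<forall>y\<in>rfibre G (r x). g y = f (iv x \<cdot> y)"
proof -
  let ?R = "rfibre G (r x)" and ?\<psi> = "\<lambda>y. f (iv x \<cdot> y)"
  have R: "y \<in> arr" "r y = r x" "?\<psi> y \<in> pts (E y)" if "y \<in> ?R" for y
    using that translate_closed [OF f x, of y] by (auto simp: rfibre_def)
  obtain L where L: "compactin CT L"
    and ap: "\<And>e. 0 < e \<Longrightarrow> \<exists>g\<in>pts V. supported L g \<and> (\<forall>y\<in>?R. dst (d y) (g y) (?\<psi> y) \<le> e)"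
    using translate_approx [OF f x] by blast
  have "\<forall>n. \<exists>g. g \<in> pts V \<and> supported L g \<and> (\<forall>y\<in>?R. dst (d y) (g y) (?\<psi> y) \<le> (1/2) ^ n / 2)"
  proof
    fix n :: nat
    show "\<exists>g. g \<in> pts V \<and> supported L g \<and> (\<forall>y\<in>?R. dst (d y) (g y) (?\<psi> y) \<le> (1/2) ^ n / 2)"
      using ap [of "(1/2) ^ n / 2"] by auto
  qed
  from choice [OF this] obtain g where
    "\<forall>n. g n \<in> pts V \<and> supported L (g n) \<and> (\<forall>y\<in>?R. dst (d y) (g n y) (?\<psi> y) \<le> (1/2) ^ n / 2)" ..
  then have g: "g n \<in> pts V" "supported L (g n)" "y \<in> ?R \<Longrightarrow> dst (d y) (g n y) (?\<psi> y) \<le> (1/2) ^ n / 2" for n y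
    by auto
  \<comment> \<open>on the fibre \<open>w n\<close> has norm at most \<open>(1/2)\<^sup>n\<close>, so the truncation \<open>t n\<close> below does not change it there\<close>
  define w where "w n = vdiff V (g (Suc n)) (g n)" for n
  have w: "w n \<in> pts V" for n unfolding w_def by (intro F0.diff_closed g)
  have "\<forall>n. \<exists>t. t \<in> pts V \<and> (\<forall>x\<in>arr. vnorm (E x) (t x) \<le> (1/2) ^ n \<and> (vnorm (E x) (w n x) \<le> (1/2) ^ n \<longrightarrow> t x = w n x)) \<and>
      supported L t"
  proof
    fix n
    have "supported L (w n)"
      unfolding supported_def
    proof (intro ballI impI)
      fix y assume y: "y \<in> arr" "q y \<notin> L"
      interpret hilbert "E y" by (rule hilbert_E [OF y(1)])
      show "w n y = vzero (E y)" using y g(2) by (simp add: w_def F0_diff supported_def)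
    qed
    then show "\<exists>t. t \<in> pts V \<and> (\<forall>x\<in>arr. vnorm (E x) (t x) \<le> (1/2) ^ n \<and> (vnorm (E x) (w n x) \<le> (1/2) ^ n \<longrightarrow> t x = w n x)) \<and>
        supported L t"
      using F0_truncate [OF w, of "(1/2) ^ n" n] by (metis zero_less_divide_1_iff zero_less_numeral zero_less_power)
  qed
  from choice [OF this] obtain t where
    "\<forall>n. t n \<in> pts V \<and> (\<forall>x\<in>arr. vnorm (E x) (t n x) \<le> (1/2) ^ n \<and> (vnorm (E x) (w n x) \<le> (1/2) ^ n \<longrightarrow> t n x = w n x)) \<and>
      supported L (t n)" ..
  then have t: "t n \<in> pts V" "y \<in> arr \<Longrightarrow> vnorm (E y) (t n y) \<le> (1/2) ^ n"
    "y \<in> arr \<Longrightarrow> vnorm (E y) (w n y) \<le> (1/2) ^ n \<Longrightarrow> t n y = w n y" "supported L (t n)" for n y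
    by auto
  define s where "s = rec_nat (g 0) (\<lambda>n a. vadd V a (t n))"
  have s0: "s 0 = g 0" and sS: "s (Suc n) = vadd V (s n) (t n)" for n by (simp_all add: s_def del: F0_ops)
  have s: "s n \<in> pts V" for n by (induction n) (auto simp: s0 sS g t simp del: F0_ops)
  have sL: "supported L (s n)" for n
  proof (induction n)
    case (Suc n)
    show ?case
      unfolding supported_def
    proof (intro ballI impI)
      fix y assume y: "y \<in> arr" "q y \<notin> L"
      interpret hilbert "E y" by (rule hilbert_E [OF y(1)])
      show "s (Suc n) y = vzero (E y)" using y Suc t(4) [of n] by (simp add: sS supported_def)
    qed
  qed (simp add: s0 g)
  have sR: "s n y = g n y" if y: "y \<in> ?R" for n y
  proof (induction n)
    case (Suc n)
    have ya: "y \<in> arr" using R y by simp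
    interpret hilbert "E y" by (rule hilbert_E [OF ya])
    note gy = F0D(4) [OF g(1) ya]
    have "vnorm (E y) (w n y) \<le> dst (d y) (g (Suc n) y) (?\<psi> y) + dst (d y) (?\<psi> y) (g n y)"
      using norm_diff_triangle [OF gy R(3) [OF y] gy, of "Suc n" n] ya by (simp add: w_def F0_diff)
    also have "\<dots> \<le> (1/2) ^ Suc n / 2 + (1/2) ^ n / 2"
      using g(3) [OF y, of "Suc n"] g(3) [OF y, of n] norm_diff_commute [OF R(3) [OF y] gy, of n] by simp
    also have "\<dots> \<le> (1/2) ^ n" by simp
    finally have "t n y = w n y" by (rule t(3) [OF ya])
    then show ?case using Suc ya gy by (simp add: sS w_def F0_diff)
  qed (simp add: s0)
  have le: "dst (d y) (s (Suc n) y) (s n y) \<le> (1/2) ^ n" if y: "y \<in> arr" for n y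
  proof -
    interpret hilbert "E y" by (rule hilbert_E [OF y])
    show ?thesis using F0D(4) [OF s y] F0D(4) [OF t(1) y] t(2) [OF y, of n] y
      by (simp add: sS add_left_diff_cancel)
  qed
  obtain k where k: "k \<in> pts V" "\<forall>x\<in>arr. \<forall>n. dst (d x) (k x) (s n x) \<le> 2 * (1/2) ^ n"
    by (rule F0_uniform_limit [OF s L sL le])
  have "k y = ?\<psi> y" if y: "y \<in> ?R" for y
  proof -
    have ya: "y \<in> arr" using R y by simp
    interpret hilbert "E y" by (rule hilbert_E [OF ya])
    note gy = F0D(4) [OF g(1) ya] and ky = F0D(4) [OF k(1) ya]
    have "dst (d y) (k y) (?\<psi> y) \<le> 0 + e" if e: "0 < e" for e
    proof -
      obtain N where N: "\<And>n. N \<le> n \<Longrightarrow> 3 * (1/2::real) ^ n < e" using half_power_small [OF e, of 3] by blast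
      have "dst (d y) (k y) (?\<psi> y) \<le> dst (d y) (k y) (g N y) + dst (d y) (g N y) (?\<psi> y)"
        by (rule norm_diff_triangle [OF ky gy R(3) [OF y]])
      also have "\<dots> \<le> 2 * (1/2) ^ N + (1/2) ^ N / 2"
      proof (rule add_mono)
        show "dst (d y) (k y) (g N y) \<le> 2 * (1/2) ^ N"
          using bspec [OF k(2) ya, THEN spec, of N] by (simp only: sR [OF y])
      qed (rule g(3) [OF y])
      also have "\<dots> \<le> 3 * (1/2) ^ N" by simp
      finally show ?thesis using N [of N] by simp
    qed
    then have "dst (d y) (k y) (?\<psi> y) \<le> 0" by (rule field_le_epsilon)
    then show ?thesis using vnorm_nonneg [OF diff_closed [OF ky R(3) [OF y]]] ky R(3) [OF y]
      by (intro eq_if_norm_diff_zero) auto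
  qed
  then show ?thesis using k(1) by (intro that) auto
qed

text \<open>For \<open>z\<close> near \<open>x\<close> both functions are supported in one compact set of cosets and their distance is
  constant on cosets, so the tube lemma applies to it. At \<open>z = x\<close> the distance is zero.\<close>

lemma translate_near_extension:
  assumes f: "f \<in> pts V" and g: "g \<in> pts V" and x: "x \<in> arr"
    and ext: "\<forall>y\<in>rfibre G (r x). g y = f (iv x \<cdot> y)" and e: "0 < e"
  obtains W where "openin (gtop G) W" "x \<in> W"
    "\<forall>z\<in>W. \<forall>y\<in>rfibre G (r z). dst (d y) (f (iv z \<cdot> y)) (g y) < e"
proof -
  obtain Z Zc where Z: "openin (gtop G) Z" "compactin (gtop G) Zc" "x \<in> Z" "Z \<subseteq> Zc"
    using locally_compact x unfolding locally_compact_space_def arrows_def by blast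
  obtain L where L: "compactin CT L"
    "\<And>z y. z \<in> Zc \<Longrightarrow> y \<in> arr \<Longrightarrow> r z = r y \<Longrightarrow> q y \<notin> L \<Longrightarrow> f (iv z \<cdot> y) = vzero (E y)"
    using translate_support [OF f Z(2)] by metis
  obtain K where K: "compactin CT K" "supported K g" using g by (rule F0E)
  define N where "N p = dst (d (snd p)) (f (iv (fst p) \<cdot> snd p)) (g (snd p))" for p
  have N: "continuous_map (subtopology PG same_range) euclideanreal N"
    unfolding N_def
  proof (intro cts_norm cts_diff cts_translate f)
    have "continuous_map (subtopology PG same_range) (gtop G) snd"
      by (intro continuous_map_from_subtopology continuous_map_snd)
    from cts_compose [OF F0D(2) [OF g] this]
    show "cts (subtopology PG same_range) (\<lambda>p. d (snd p)) (\<lambda>p. g (snd p))" .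
  qed
  have small: "N (x, y) < e" if "(x, y) \<in> same_range" for y
  proof -
    have y: "y \<in> arr" "r y = r x" using that by (auto simp: arrows_def)
    interpret hilbert "E y" by (rule hilbert_E [OF y(1)])
    show ?thesis using ext y F0D(4) [OF g y(1)] e by (simp add: N_def rfibre_def)
  qed
  have out: "N (z, y) < e" if "z \<in> Z" "(z, y) \<in> same_range" "q y \<notin> L \<union> K" for z y
  proof -
    have y: "y \<in> arr" "r z = r y" using that by (auto simp: arrows_def)
    interpret hilbert "E y" by (rule hilbert_E [OF y(1)])
    show ?thesis using L(2) [of z y] K(2) that y Z(4) e by (auto simp: N_def supported_def)
  qed
  have inv: "(z, c) \<in> same_range \<and> N (z, c) = N (z, y)" if zy: "(z, y) \<in> same_range" and c: "c \<in> arr" "q y = q c" for z y c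
  proof -
    have y: "y \<in> arr" "z \<in> arr" "r z = r y" using zy by (auto simp: arrows_def)
    obtain h where h: "h \<in> H" "d y = r h" "c = y \<cdot> h" by (rule coset_eqE [OF y(1) c])
    note ha = H_arr [OF h(1)]
    have "N (z, c) = N (z, y)"
      using unitary_map_norm_diff [OF unitary_sigma_inv [OF h(1)] fib_hilbert, of "f (iv z \<cdot> y)" "g y"]
        translate_closed [OF f, of z y] F0D(4) [OF g y(1)] y h ha
      by (simp add: N_def translate_equivariant [OF f] equivariant_apply g)
    then show ?thesis using c y h ha by (auto simp: arrows_def [symmetric])
  qed
  obtain W where W: "openin (gtop G) W" "x \<in> W" "\<forall>z\<in>W. \<forall>y. (z, y) \<in> same_range \<longrightarrow> N (z, y) < e"
    using tube [OF closedin_same_range N Z(3) Z(1) small compactin_Un [OF L(1) K(1)] out inv] by blast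
  have "\<forall>z\<in>W. \<forall>y\<in>rfibre G (r z). dst (d y) (f (iv z \<cdot> y)) (g y) < e"
  proof (intro ballI)
    fix z y assume "z \<in> W" "y \<in> rfibre G (r z)"
    then have "(z, y) \<in> same_range" using openin_subset [OF W(1)] by (auto simp: rfibre_def arrows_def)
    then have "N (z, y) < e" using W(3) \<open>z \<in> W\<close> by blast
    then show "dst (d y) (f (iv z \<cdot> y)) (g y) < e" by (simp add: N_def)
  qed
  with W(1,2) show ?thesis by (rule that)
qed

end

section \<open>The bundle of fibres\<close>

context induced_setting
begin

abbreviation "mod_at u \<equiv> F_at G H \<H> \<sigma> mu u"
abbreviation "fibre u \<equiv> F_fibre G H \<H> \<sigma> mu u"
abbreviation "emb f \<equiv> F_embed G H \<H> \<sigma> mu f"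
text \<open>The vector at the unit \<open>u\<close> determined by the restriction of \<open>f\<close> to the range fibre of \<open>u\<close>.\<close>

abbreviation "ev u f \<equiv> null_coset (mod_at u) (emb f)"
abbreviation "Fmodule \<equiv> F_module G H \<H> \<sigma> mu"

lemma F_at_eq: "mod_at u = with_inner (completion V nu) (completion_inner (inn u))"
proof -
  have "F_inner G H \<H> mu u = completion_inner (inn u)"
    by (intro ext) (simp add: F_inner_def completion_inner_def)
  then show ?thesis by (simp add: F_at_def F_module_def with_inner_def Let_def)
qed

lemma emb_eq: "emb f = cauchy_class V nu (\<lambda>n. f)"
  by (simp add: F_embed_def)

lemma semi_inner_at: "u \<in> units G \<Longrightarrow> semi_inner (mod_at u)"
  unfolding F_at_eq by (rule seminormed_inner.semi_inner_completion [OF seminormed_inner_F0])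

lemma unorm_diff_agree:
  assumes u: "u \<in> units G" and f: "f \<in> pts V" and g: "g \<in> pts V" and eq: "\<forall>y\<in>rfibre G u. f y = g y"
  shows "unorm u (vdiff V f g) = 0"
proof -
  have fg: "vdiff V f g \<in> pts V" using f g by (rule F0.diff_closed)
  have "inn u (vdiff V f g) (vdiff V f g) = inn u (vzero V) (vzero V)"
  proof (rule inner_cong [OF u fg fg F0.zero_closed F0.zero_closed])
    fix x assume x: "x \<in> arr" "r x = u"
    interpret hilbert "E x" by (rule hilbert_E [OF x(1)])
    show "vinner (E x) (vdiff V f g x) (vdiff V f g x) = vinner (E x) (vzero V x) (vzero V x)"
      using eq x F0D(4) [OF g x(1)] by (simp add: F0_diff rfibre_def)
  qed
  moreover interpret W: semi_inner "space_at u" by (rule semi_inner_F0 [OF u])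
  have "inn u (vzero V) (vzero V) = 0" using W.inner_zero [of "vzero V"] F0.zero_closed by simp
  ultimately show ?thesis by (simp add: vnorm_def)
qed

text \<open>Localisation at \<open>u\<close>: multiplying by a function of the range that is \<open>1\<close> at \<open>u\<close> and truncates
  the continuous function \<open>v \<mapsto> \<parallel>f\<parallel>\<^sub>v\<close> makes the sup norm as small as the norm at \<open>u\<close>.\<close>

lemma F0_localise:
  assumes f: "f \<in> pts V" and u: "u \<in> units G" and e: "0 < e" and le: "unorm u f \<le> e"
  obtains t where "t \<in> pts V" "nu t \<le> e" "\<forall>y\<in>rfibre G u. t y = f y"
proof -
  define b where "b v = e / max e (unorm v f)" for v
  have pos: "0 < max e (unorm v f)" for v using e by auto
  have bc: "continuous_map (unit_top G) euclideanreal b"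
    unfolding b_def
    by (intro continuous_map_real_divide continuous_map_real_max unorm_continuous f)
      (use pos in \<open>auto simp: less_imp_neq [symmetric]\<close>)
  have "continuous_map (gtop G) euclidean (\<lambda>x. complex_of_real (b (r x)))"
    using continuous_map_compose [OF continuous_r bc] by (intro continuous_map_of_real) (simp add: o_def)
  moreover have "complex_of_real (b (r (x \<cdot> h))) = complex_of_real (b (r x))" if "x \<in> arr" "h \<in> H" "d x = r h" for x h
    using that H_arr by simp
  ultimately have t: "(\<lambda>x\<in>arr. vscale (E x) (complex_of_real (b (r x))) (f x)) \<in> pts V" (is "?t \<in> _")
    by (rule F0_multiply [OF f])
  have "unorm v ?t \<le> e" if v: "v \<in> units G" for v
  proof -
    interpret W: semi_inner "space_at v" by (rule semi_inner_F0 [OF v])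
    have bf: "vscale V (complex_of_real (b v)) f \<in> pts V" using f by (rule F0.scale_closed)
    have "inn v ?t ?t = inn v (vscale V (complex_of_real (b v)) f) (vscale V (complex_of_real (b v)) f)"
      by (rule inner_cong [OF v t t bf bf]) simp
    then have "unorm v ?t = unorm v (vscale V (complex_of_real (b v)) f)" by (simp add: vnorm_def)
    also have "\<dots> = cmod (complex_of_real (b v)) * unorm v f" using W.norm_scale [of f "complex_of_real (b v)"] f by (simp del: F0_ops)
    also have "\<dots> \<le> e"
    proof -
      have "0 \<le> b v" using e pos [of v] by (simp add: b_def)
      moreover have "b v * unorm v f \<le> e"
        using e by (cases "unorm v f \<le> e") (auto simp: b_def max_def)
      ultimately show ?thesis by simp
    qed
    finally show ?thesis .
  qed
  then have "nu ?t \<le> e" using u by (intro nu_le) auto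
  moreover have "?t y = f y" if y: "y \<in> rfibre G u" for y
  proof -
    have ya: "y \<in> arr" "r y = u" using y by (auto simp: rfibre_def)
    interpret hilbert "E y" by (rule hilbert_E [OF ya(1)])
    have "b u = 1" using le e by (simp add: b_def max_def)
    then show ?thesis using ya F0D(4) [OF f ya(1)] by simp
  qed
  ultimately show ?thesis using t by (intro that) auto
qed

text \<open>A Cauchy sequence at \<open>u\<close> is replaced by a sequence in \<open>F0\<close> with increments at most \<open>2\<^sup>-\<^sup>n\<close> at \<open>u\<close>.
  Localising the increments changes nothing at \<open>u\<close> and makes the sequence Cauchy in the sup norm, so it
  defines an element of the completion.\<close>

lemma at_complete:
  assumes u: "u \<in> units G" and S: "cauchy_seq (mod_at u) (vnorm (mod_at u)) S"
  shows "\<exists>a\<in>pts (mod_at u). (\<lambda>n. vnorm (mod_at u) (vdiff (mod_at u) (S n) a)) \<longlonglongrightarrow> 0"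
proof -
  interpret S: seminormed_inner V nu "inn u" by (rule seminormed_inner_F0 [OF u])
  interpret A: semi_inner "mod_at u" by (rule semi_inner_at [OF u])
  note At = F_at_eq [of u, symmetric]
  have AD: "vdiff (mod_at u) = vdiff (completion V nu)" by (simp add: F_at_eq)
  have AP: "pts (mod_at u) = pts (completion V nu)" by (simp add: F_at_eq)
  have Sp: "S n \<in> pts (mod_at u)" for n using S by (simp add: cauchy_seq_def)
  have embp: "emb f \<in> pts (mod_at u)" if "f \<in> pts V" for f
    using that by (simp add: AP emb_eq)
  have dd: "vnorm (mod_at u) (vdiff (mod_at u) (emb f) (emb g)) = unorm u (vdiff V f g)" if "f \<in> pts V" "g \<in> pts V" for f g
    using that S.completion_diff [of "\<lambda>n. f" "\<lambda>n. g"] S.completion_norm_const [of "vdiff V f g"]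
    by (simp add: emb_eq AD At)
  have "\<forall>n::nat. \<exists>N. \<forall>m\<ge>N. \<forall>k\<ge>N. vnorm (mod_at u) (vdiff (mod_at u) (S m) (S k)) < (1/2) ^ n / 4"
  proof
    fix n :: nat
    have "0 < (1/2) ^ n / (4::real)" by simp
    then show "\<exists>N. \<forall>m\<ge>N. \<forall>k\<ge>N. vnorm (mod_at u) (vdiff (mod_at u) (S m) (S k)) < (1/2) ^ n / 4"
      using S unfolding cauchy_seq_def by blast
  qed
  from choice [OF this] obtain N where
    N: "\<forall>n. \<forall>m\<ge>N n. \<forall>k\<ge>N n. vnorm (mod_at u) (vdiff (mod_at u) (S m) (S k)) < (1/2) ^ n / 4" ..
  \<comment> \<open>partial sums give an increasing sequence of indices above \<open>N\<close>\<close>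
  define \<phi> where "\<phi> n = (\<Sum>i\<le>n. N i)" for n
  have \<phi>N: "N n \<le> \<phi> n" for n unfolding \<phi>_def by (rule member_le_sum) auto
  have \<phi>S: "\<phi> n \<le> \<phi> (Suc n)" for n by (simp add: \<phi>_def)
  have "\<forall>n::nat. \<exists>f. f \<in> pts V \<and> vnorm (mod_at u) (vdiff (mod_at u) (emb f) (S (\<phi> n))) < (1/2) ^ n / 4"
  proof
    fix n :: nat
    obtain s where s: "cauchy_seq V nu s" "S (\<phi> n) = cauchy_class V nu s"
      using Sp [of "\<phi> n"] unfolding AP by (rule S.completion_cases)
    obtain a where "a \<in> pts V" "vnorm S.CI (vdiff S.cpl (S.cls (\<lambda>n. a)) (S.cls s)) < (1/2) ^ n / 4"
      by (rule S.completion_approx [OF s(1), of "(1/2) ^ n / 4"]) auto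
    then show "\<exists>f. f \<in> pts V \<and> vnorm (mod_at u) (vdiff (mod_at u) (emb f) (S (\<phi> n))) < (1/2) ^ n / 4"
      using s by (intro exI [of _ a]) (simp add: emb_eq At AD)
  qed
  from choice [OF this] obtain f where
    "\<forall>n. f n \<in> pts V \<and> vnorm (mod_at u) (vdiff (mod_at u) (emb (f n)) (S (\<phi> n))) < (1/2) ^ n / 4" ..
  then have f: "f n \<in> pts V" "vnorm (mod_at u) (vdiff (mod_at u) (emb (f n)) (S (\<phi> n))) < (1/2) ^ n / 4" for n by auto
  have fd: "unorm u (vdiff V (f (Suc n)) (f n)) \<le> (1/2) ^ n" for n
  proof -
    let ?d = "\<lambda>a b. vnorm (mod_at u) (vdiff (mod_at u) a b)"
    have "unorm u (vdiff V (f (Suc n)) (f n)) = ?d (emb (f (Suc n))) (emb (f n))" using dd f by simp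
    also have "\<dots> \<le> ?d (emb (f (Suc n))) (S (\<phi> (Suc n))) + ?d (S (\<phi> (Suc n))) (emb (f n))"
      by (intro A.norm_diff_triangle embp f Sp)
    also have "?d (S (\<phi> (Suc n))) (emb (f n)) \<le> ?d (S (\<phi> (Suc n))) (S (\<phi> n)) + ?d (S (\<phi> n)) (emb (f n))"
      by (intro A.norm_diff_triangle embp f Sp)
    also have "?d (S (\<phi> n)) (emb (f n)) = ?d (emb (f n)) (S (\<phi> n))" by (intro A.norm_diff_commute embp f Sp)
    also have "?d (emb (f (Suc n))) (S (\<phi> (Suc n))) + (?d (S (\<phi> (Suc n))) (S (\<phi> n)) + ?d (emb (f n)) (S (\<phi> n))) \<le>
        (1/2) ^ Suc n / 4 + ((1/2) ^ n / 4 + (1/2) ^ n / 4)"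
      using f(2) [of "Suc n"] f(2) [of n] N \<phi>N [of n] order_trans [OF \<phi>N \<phi>S, of n] by (intro add_mono less_imp_le) auto
    also have "\<dots> \<le> (1/2) ^ n" by simp
    finally show ?thesis by simp
  qed
  have "\<forall>n. \<exists>t. t \<in> pts V \<and> nu t \<le> (1/2) ^ n \<and> (\<forall>y\<in>rfibre G u. t y = vdiff V (f (Suc n)) (f n) y)"
  proof
    fix n
    have "vdiff V (f (Suc n)) (f n) \<in> pts V" by (intro F0.diff_closed f)
    from F0_localise [OF this u _ fd]
    obtain t where "t \<in> pts V" "nu t \<le> (1/2) ^ n" "\<forall>y\<in>rfibre G u. t y = vdiff V (f (Suc n)) (f n) y" by auto
    then show "\<exists>t. t \<in> pts V \<and> nu t \<le> (1/2) ^ n \<and> (\<forall>y\<in>rfibre G u. t y = vdiff V (f (Suc n)) (f n) y)" by blast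
  qed
  from choice [OF this] obtain t where
    "\<forall>n. t n \<in> pts V \<and> nu (t n) \<le> (1/2) ^ n \<and> (\<forall>y\<in>rfibre G u. t n y = vdiff V (f (Suc n)) (f n) y)" ..
  then have t: "t n \<in> pts V" "nu (t n) \<le> (1/2) ^ n" "y \<in> rfibre G u \<Longrightarrow> t n y = vdiff V (f (Suc n)) (f n) y" for n y
    by auto
  define s where "s = rec_nat (f 0) (\<lambda>n a. vadd V a (t n))"
  have s0: "s 0 = f 0" and sS: "s (Suc n) = vadd V (s n) (t n)" for n by (simp_all add: s_def del: F0_ops)
  have s: "s n \<in> pts V" for n by (induction n) (auto simp: s0 sS f t simp del: F0_ops)
  have sf: "s n y = f n y" if y: "y \<in> rfibre G u" for n y
  proof (induction n)
    case (Suc n)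
    have ya: "y \<in> arr" using y by (simp add: rfibre_def)
    interpret hilbert "E y" by (rule hilbert_E [OF ya])
    show ?case using Suc ya F0D(4) [OF f(1) ya] t(3) [OF y, of n] by (simp add: sS F0_diff)
  qed (simp add: s0)
  have le: "nu (vdiff V (s (Suc n)) (s n)) \<le> (1/2) ^ n" for n
    using F0.add_left_diff_cancel [OF s t(1), of n n] t(2) [of n] by (simp add: sS del: F0_ops)
  have sc: "cauchy_seq V nu s" by (rule S.geometric_cauchy [OF s le])
  define a where "a = cauchy_class V nu s"
  have a: "a \<in> pts (mod_at u)" using sc by (simp add: a_def AP)
  have as: "vnorm (mod_at u) (vdiff (mod_at u) (emb (s n)) a) \<le> 2 * (1/2) ^ n" for n
  proof -
    have "vnorm S.CI (S.cls (\<lambda>m. vdiff V (s n) (s m))) \<le> 2 * (1/2) ^ n"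
    proof (rule S.completion_norm_le [where N = n])
      show "cauchy_seq V nu (\<lambda>m. vdiff V (s n) (s m))" by (intro S.cauchy_seq_diff S.cauchy_seq_const s sc)
      show "nu (vdiff V (s n) (s m)) \<le> 2 * (1/2) ^ n" if "n \<le> m" for m
        using S.geometric_diff [OF s le that] S.norm_diff_commute [OF s s, of n m] by simp
    qed
    then show ?thesis
      using S.completion_diff [OF S.cauchy_seq_const [OF s] sc, of n] by (simp add: a_def emb_eq At AD)
  qed
  have main: "vnorm (mod_at u) (vdiff (mod_at u) (S m) a) \<le> 3 * (1/2) ^ n" if m: "\<phi> n \<le> m" for m n
  proof -
    let ?d = "\<lambda>a b. vnorm (mod_at u) (vdiff (mod_at u) a b)"
    have "?d (S m) a \<le> ?d (S m) (S (\<phi> n)) + ?d (S (\<phi> n)) a"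
      by (intro A.norm_diff_triangle a Sp)
    also have "?d (S (\<phi> n)) a \<le> ?d (S (\<phi> n)) (emb (f n)) + ?d (emb (f n)) a"
      by (intro A.norm_diff_triangle a Sp embp f)
    also have "?d (emb (f n)) a \<le> ?d (emb (f n)) (emb (s n)) + ?d (emb (s n)) a"
      by (intro A.norm_diff_triangle a embp f s)
    also have "?d (emb (f n)) (emb (s n)) = 0"
      using dd [OF f(1) s] unorm_diff_agree [OF u f(1) s] sf by simp
    also have "?d (S (\<phi> n)) (emb (f n)) = ?d (emb (f n)) (S (\<phi> n))" by (intro A.norm_diff_commute embp f Sp)
    also have "?d (S m) (S (\<phi> n)) + (?d (emb (f n)) (S (\<phi> n)) + (0 + ?d (emb (s n)) a)) \<le>
       (1/2) ^ n / 4 + ((1/2) ^ n / 4 + (0 + 2 * (1/2) ^ n))"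
      using f(2) [of n] as [of n] N \<phi>N [of n] order_trans [OF \<phi>N m] by (intro add_mono) (auto intro: less_imp_le)
    also have "\<dots> \<le> 3 * (1/2) ^ n" by simp
    finally show ?thesis by simp
  qed
  have "(\<lambda>n. vnorm (mod_at u) (vdiff (mod_at u) (S n) a)) \<longlonglongrightarrow> 0"
  proof (rule LIMSEQ_I)
    fix e :: real assume "0 < e"
    then obtain n where n: "3 * (1/2) ^ n < e" using half_power_small [of e 3] by blast
    have "norm (vnorm (mod_at u) (vdiff (mod_at u) (S m) a) - 0) < e" if "\<phi> n \<le> m" for m
      using main [OF that] n A.vnorm_nonneg [OF A.diff_closed [OF Sp a], of m] by simp
    then show "\<exists>no. \<forall>n\<ge>no. norm (vnorm (mod_at u) (vdiff (mod_at u) (S n) a) - 0) < e" by blast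
  qed
  then show ?thesis using a by blast
qed

lemma hilbert_fibre: "u \<in> units G \<Longrightarrow> hilbert (fibre u)"
  unfolding F_fibre_def using semi_inner.hilbert_null_quotient [OF semi_inner_at] at_complete by blast

lemma emb_module: "u \<in> units G \<Longrightarrow> f \<in> pts V \<Longrightarrow> emb f \<in> pts Fmodule"
  unfolding emb_eq F_module_def
  by (intro seminormed.completion_closed [OF seminormed_F0] seminormed.cauchy_seq_const [OF seminormed_F0]) auto

lemma at_simps [simp]: "pts (mod_at u) = pts Fmodule" "vadd (mod_at u) = vadd Fmodule" "vzero (mod_at u) = vzero Fmodule"
  "vscale (mod_at u) = vscale Fmodule" "vdiff (mod_at u) = vdiff Fmodule"
  by (simp_all add: F_at_eq F_module_def)

lemma ev_simps:
  assumes u: "u \<in> units G" and f: "f \<in> pts V" and g: "g \<in> pts V"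
  shows "ev u f \<in> pts (fibre u)" "vinner (fibre u) (ev u f) (ev u g) = inn u f g"
    "vdiff (fibre u) (ev u f) (ev u g) = ev u (vdiff V f g)" "vnorm (fibre u) (ev u f) = unorm u f"
proof -
  interpret S: seminormed_inner V nu "inn u" by (rule seminormed_inner_F0 [OF u])
  interpret A: semi_inner "mod_at u" by (rule semi_inner_at [OF u])
  note e = emb_module [OF u]
  show "ev u f \<in> pts (fibre u)" using e [OF f] by (simp add: F_fibre_def)
  have inner: "vinner (fibre u) (ev u f) (ev u g) = inn u f g" if "f \<in> pts V" "g \<in> pts V" for f g
    using e that A.null_quotient_inner [of "emb f" "emb g"] S.completion_inner_const [of f g]
    by (simp add: F_fibre_def) (simp add: F_at_eq emb_eq)
  show "vinner (fibre u) (ev u f) (ev u g) = inn u f g" using inner f g by blast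
  show "vnorm (fibre u) (ev u f) = unorm u f" using inner [OF f f] by (simp add: vnorm_def)
  have "vdiff Fmodule (emb f) (emb g) = emb (vdiff V f g)"
    using f g S.completion_diff [of "\<lambda>n. f" "\<lambda>n. g"] by (simp add: emb_eq F_module_def)
  then show "vdiff (fibre u) (ev u f) (ev u g) = ev u (vdiff V f g)"
    using e f g A.null_quotient_diff [of "emb f" "emb g"] by (simp add: F_fibre_def)
qed

lemma ev_dense:
  assumes u: "u \<in> units G" and a: "a \<in> pts (fibre u)" and e: "0 < e"
  obtains f where "f \<in> pts V" "vnorm (fibre u) (vdiff (fibre u) (ev u f) a) < e"
proof -
  interpret S: seminormed_inner V nu "inn u" by (rule seminormed_inner_F0 [OF u])
  interpret A: semi_inner "mod_at u" by (rule semi_inner_at [OF u])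
  obtain S where S: "S \<in> pts Fmodule" "a = null_coset (mod_at u) S"
    using a unfolding F_fibre_def by (metis A.null_quotient_cases at_simps(1))
  obtain s where s: "cauchy_seq V nu s" "S = cauchy_class V nu s"
    using S(1) unfolding F_module_def by (rule S.completion_cases)
  obtain f where f: "f \<in> pts V" "vnorm S.CI (vdiff S.cpl (S.cls (\<lambda>n. f)) (S.cls s)) < e"
    by (rule S.completion_approx [OF s(1) e])
  have "vnorm (fibre u) (vdiff (fibre u) (ev u f) a) = vnorm (mod_at u) (vdiff Fmodule (emb f) S)"
    using S emb_module [OF u f(1)] A.diff_closed [of "emb f" S]
    by (simp add: F_fibre_def A.null_quotient_simps)
  also have "\<dots> < e" using f s by (simp add: emb_eq F_at_eq F_module_def)
  finally show ?thesis using f(1) by (intro that)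
qed

lemma ev_agree:
  assumes u: "u \<in> units G" and f: "f \<in> pts V" and g: "g \<in> pts V" and eq: "\<forall>y\<in>rfibre G u. f y = g y"
  shows "ev u f = ev u g"
proof -
  interpret hilbert "fibre u" by (rule hilbert_fibre [OF u])
  have "vnorm (fibre u) (vdiff (fibre u) (ev u f) (ev u g)) = 0"
    using unorm_diff_agree [OF assms] ev_simps(4) [OF u F0.diff_closed [OF f g] F0.diff_closed [OF f g]]
    by (simp add: ev_simps u f g)
  then show ?thesis by (intro eq_if_norm_diff_zero) (use ev_simps(1) [OF u f f] ev_simps(1) [OF u g g] in auto)
qed

abbreviation "sec \<equiv> F_section G H \<H> \<sigma> mu"
abbreviation "FB \<equiv> F_bundle G H \<H> \<sigma> mu"

lemma sec_apply: "u \<in> units G \<Longrightarrow> sec S u = null_coset (mod_at u) S"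
  by (simp add: F_section_def)

text \<open>A uniform limit of the continuous functions \<open>u \<mapsto> \<parallel>f\<parallel>\<^sub>u\<close> with \<open>f \<in> F0\<close>.\<close>

lemma sec_norm_continuous:
  assumes ne: "units G \<noteq> {}" and S: "S \<in> pts Fmodule"
  shows "continuous_map (unit_top G) euclideanreal (\<lambda>u. vnorm (fibre u) (sec S u))"
proof -
  note sn = seminormed_F0 [OF ne]
  obtain s where s: "cauchy_seq V nu s" "S = cauchy_class V nu s"
    using S unfolding F_module_def by (rule seminormed.completion_cases [OF sn])
  have close: "\<bar>vnorm (fibre u) (sec S u) - unorm u f\<bar> \<le> e"
    if u: "u \<in> units G" and f: "f \<in> pts V" and le: "\<And>n. N \<le> n \<Longrightarrow> nu (vdiff V (s n) f) \<le> e" for u f e N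
  proof -
    interpret S: seminormed_inner V nu "inn u" by (rule seminormed_inner_F0 [OF u])
    interpret A: semi_inner "mod_at u" by (rule semi_inner_at [OF u])
    have "vnorm S.CI (S.cls (\<lambda>n. vdiff V (s n) f)) \<le> e"
      using f le by (intro S.completion_norm_le [where N = N] S.cauchy_seq_diff s S.cauchy_seq_const) auto
    then have "vnorm (mod_at u) (vdiff Fmodule S (emb f)) \<le> e"
      using S.completion_diff [OF s(1) S.cauchy_seq_const [OF f]] s by (simp add: emb_eq F_at_eq F_module_def)
    moreover have "vnorm (fibre u) (sec S u) = vnorm (mod_at u) S" "vnorm (mod_at u) (emb f) = unorm u f"
      using S f s S.completion_norm_const [of f]
      by (simp_all add: F_fibre_def sec_apply u A.null_quotient_norm) (simp add: emb_eq F_at_eq)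
    ultimately show ?thesis
      using A.norm_diff_abs [of S "emb f"] S emb_module [OF u f] by simp
  qed
  show ?thesis
    unfolding continuous_map_euclidean_iff
  proof (intro ballI allI impI)
    fix u and e :: real assume "u \<in> topspace (unit_top G)" and e: "0 < e"
    then have u: "u \<in> units G" by simp
    have "0 < e / 4" using e by simp
    then obtain N where N: "\<forall>m\<ge>N. \<forall>n\<ge>N. nu (vdiff V (s m) (s n)) < e / 4"
      using s(1) unfolding cauchy_seq_def by blast
    have leN: "nu (vdiff V (s n) (s N)) \<le> e / 4" if "N \<le> n" for n using N that by (simp add: less_imp_le)
    have sN: "s N \<in> pts V" by (rule seminormed.cauchy_seqD [OF sn s(1)])
    obtain W where W: "openin (unit_top G) W" "u \<in> W" "\<forall>v\<in>W. dist (unorm v (s N)) (unorm u (s N)) < e/4"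
      using continuous_map_euclideanD [OF unorm_continuous [OF sN], of u "e/4"] u e by auto
    have "dist (vnorm (fibre v) (sec S v)) (vnorm (fibre u) (sec S u)) < e" if v: "v \<in> W" for v
    proof -
      have vu: "v \<in> units G" using openin_subset [OF W(1)] v by auto
      have "\<bar>vnorm (fibre v) (sec S v) - unorm v (s N)\<bar> \<le> e / 4" by (rule close [OF vu sN leN])
      moreover have "\<bar>vnorm (fibre u) (sec S u) - unorm u (s N)\<bar> \<le> e / 4" by (rule close [OF u sN leN])
      ultimately show ?thesis using bspec [OF W(3) v] e unfolding dist_real_def by linarith
    qed
    then show "\<exists>W. openin (unit_top G) W \<and> u \<in> W \<and> (\<forall>v\<in>W. dist (vnorm (fibre v) (sec S v)) (vnorm (fibre u) (sec S u)) < e)"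
      using W by blast
  qed
qed

lemma hilbert_bundle_F:
  assumes ne: "units G \<noteq> {}"
  shows "hilbert_bundle (unit_top G) FB"
    and "Delta G H \<H> \<sigma> mu \<subseteq> sects FB"
proof -
  let ?D = "Delta G H \<H> \<sigma> mu"
  interpret M: cvs Fmodule unfolding F_module_def by (rule seminormed.cvs_completion [OF seminormed_F0 [OF ne]])
  have D: "\<exists>S\<in>pts Fmodule. f = sec S" if "f \<in> ?D" for f using that by (auto simp: Delta_def)
  have secD: "sec S \<in> ?D" if "S \<in> pts Fmodule" for S using that by (auto simp: Delta_def)
  note facts = hilbert_bundle_closure [of "unit_top G" fibre ?D]
  have 1: "hilbert (fibre u)" if "u \<in> topspace (unit_top G)" for u using hilbert_fibre that by simp
  have nq: "null_coset (mod_at u) S \<in> pts (fibre u)" "vzero (fibre u) = null_coset (mod_at u) (vzero Fmodule)"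
    "vadd (fibre u) (null_coset (mod_at u) S) (null_coset (mod_at u) T) = null_coset (mod_at u) (vadd Fmodule S T)"
    "vscale (fibre u) c (null_coset (mod_at u) S) = null_coset (mod_at u) (vscale Fmodule c S)"
    if "u \<in> units G" "S \<in> pts Fmodule" "T \<in> pts Fmodule" for u S T c
  proof -
    interpret A: semi_inner "mod_at u" by (rule semi_inner_at [OF that(1)])
    show "null_coset (mod_at u) S \<in> pts (fibre u)" "vzero (fibre u) = null_coset (mod_at u) (vzero Fmodule)"
    "vadd (fibre u) (null_coset (mod_at u) S) (null_coset (mod_at u) T) = null_coset (mod_at u) (vadd Fmodule S T)"
    "vscale (fibre u) c (null_coset (mod_at u) S) = null_coset (mod_at u) (vscale Fmodule c S)"
      using that A.null_quotient_closed [of S] A.null_quotient_zero A.null_quotient_add [of S T] A.null_quotient_scale [of S c]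
      by (simp_all add: F_fibre_def)
  qed
  have 2: "?D \<subseteq> all_sections (unit_top G) fibre"
    using nq by (auto simp: Delta_def all_sections_def F_section_def)
  have 3: "(\<lambda>u\<in>topspace (unit_top G). vzero (fibre u)) \<in> ?D"
  proof -
    have "(\<lambda>u\<in>topspace (unit_top G). vzero (fibre u)) = sec (vzero Fmodule)"
      using nq(2) [OF _ M.zero_closed M.zero_closed] by (auto simp: F_section_def intro!: restrict_ext)
    then show ?thesis using secD by simp
  qed
  have 4: "(\<lambda>u\<in>topspace (unit_top G). vadd (fibre u) (f u) (g u)) \<in> ?D" if f: "f \<in> ?D" and g: "g \<in> ?D" for f g
  proof -
    obtain S T where ST: "S \<in> pts Fmodule" "f = sec S" "T \<in> pts Fmodule" "g = sec T" using D [OF f] D [OF g] by blast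
    then have "(\<lambda>u\<in>topspace (unit_top G). vadd (fibre u) (f u) (g u)) = sec (vadd Fmodule S T)"
      using nq(3) [of _ S T] by (auto simp: F_section_def intro!: restrict_ext)
    then show ?thesis using secD ST by simp
  qed
  have 5: "(\<lambda>u\<in>topspace (unit_top G). vscale (fibre u) c (f u)) \<in> ?D" if f: "f \<in> ?D" for c f
  proof -
    obtain S where S: "S \<in> pts Fmodule" "f = sec S" using D [OF f] by blast
    then have "(\<lambda>u\<in>topspace (unit_top G). vscale (fibre u) c (f u)) = sec (vscale Fmodule c S)"
      using nq(4) [of _ S S c] by (auto simp: F_section_def intro!: restrict_ext)
    then show ?thesis using secD S by simp
  qed
  have 6: "\<exists>f\<in>?D. vnorm (fibre u) (vdiff (fibre u) (f u) h) < e"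
    if "u \<in> topspace (unit_top G)" and h: "h \<in> pts (fibre u)" and e: "0 < e" for u h and e :: real
  proof -
    have u: "u \<in> units G" using that by simp
    obtain f where f: "f \<in> pts V" "vnorm (fibre u) (vdiff (fibre u) (ev u f) h) < e" by (rule ev_dense [OF u h e])
    then show ?thesis using secD [OF emb_module [OF u f(1)]] u by (intro bexI [of _ "sec (emb f)"]) (simp_all add: sec_apply)
  qed
  have 7: "continuous_map (unit_top G) euclideanreal (\<lambda>u. vnorm (fibre u) (f u))" if f: "f \<in> ?D" for f
  proof -
    obtain S where "S \<in> pts Fmodule" "f = sec S" using D [OF f] by blast
    then show ?thesis using sec_norm_continuous [OF ne] by simp
  qed
  show "hilbert_bundle (unit_top G) FB"
    unfolding F_bundle_def by (rule facts(1) [OF 1 2 3 4 5 6 7])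
  show "?D \<subseteq> sects FB"
  proof -
    have "?D \<subseteq> local_uniform_closure (unit_top G) fibre ?D" by (rule facts(2) [OF 1 2 3 4 5 6 7])
    then show ?thesis by (simp add: F_bundle_def)
  qed
qed

lemma fib_FB [simp]: "fib FB = fibre"
  by (simp add: F_bundle_def)

end

section \<open>The representation by left translation\<close>

lemma unitary_map_compose:
  assumes S: "unitary_map U V S" and T: "unitary_map V W T"
  shows "unitary_map U W (\<lambda>a. T (S a))"
  using assms unitary_map_closed [OF S] bij_betw_trans [of S "pts U" "pts V" T "pts W"]
  by (simp add: unitary_map_def o_def)

lemma unitary_map_id: "unitary_map V V (\<lambda>a. a)"
  by (simp add: unitary_map_def bij_betw_def)

text \<open>Over an empty unit space the only section is the empty function. This case is separate because
  \<open>Delta\<close> may then be empty.\<close>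

lemma hilbert_bundle_empty:
  assumes "topspace X = {}"
  shows "hilbert_bundle X \<lparr>fib = E, sects = local_uniform_closure X E D\<rparr>"
  using assms
  by (auto simp: hilbert_bundle_def local_uniform_closure_def all_sections_def continuous_map_def)

context induced_setting
begin

lemma ev_closed: "u \<in> units G \<Longrightarrow> f \<in> pts V \<Longrightarrow> ev u f \<in> pts (fibre u)"
  using ev_simps(1) [of u f f] by simp

definition translates :: "'g \<Rightarrow> ('g \<Rightarrow> 'h) \<Rightarrow> ('g \<Rightarrow> 'h) \<Rightarrow> bool" where
  "translates x f g \<longleftrightarrow> f \<in> pts V \<and> g \<in> pts V \<and> (\<forall>y\<in>rfibre G (r x). g y = f (iv x \<cdot> y))"

lemma translates_exists: "x \<in> arr \<Longrightarrow> f \<in> pts V \<Longrightarrow> \<exists>g. translates x f g"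
  using F0_extend_translate [of f x] by (auto simp: translates_def)

text \<open>Extend the translate of \<open>g\<close> by the inverse arrow.\<close>

lemma translates_exists_source:
  assumes x: "x \<in> arr" and g: "g \<in> pts V" shows "\<exists>f. translates x f g"
proof -
  obtain f where f: "f \<in> pts V" "\<forall>y\<in>rfibre G (r (iv x)). f y = g (iv (iv x) \<cdot> y)"
    by (rule F0_extend_translate [OF g inv_arr [OF x]])
  have "g y = f (iv x \<cdot> y)" if "y \<in> rfibre G (r x)" for y
  proof -
    have y: "y \<in> arr" "r y = r x" using that by (auto simp: rfibre_def)
    then have "iv x \<cdot> y \<in> rfibre G (r (iv x))" using x by (simp add: rfibre_def)
    then show ?thesis using f(2) x y by simp
  qed
  then show ?thesis using f g by (auto simp: translates_def)
qed

lemma translates_apply: "translates x f g \<Longrightarrow> x \<in> arr \<Longrightarrow> y \<in> arr \<Longrightarrow> r y = d x \<Longrightarrow> g (x \<cdot> y) = f y"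
  by (auto simp: translates_def rfibre_def)

lemma translates_inner:
  assumes x: "x \<in> arr" and t: "translates x f g" "translates x f' g'"
  shows "inn (r x) g g' = inn (d x) f f'"
  unfolding inner_eq
proof (rule mu_translate [OF x])
  have p: "f \<in> pts V" "g \<in> pts V" "f' \<in> pts V" "g' \<in> pts V" using t by (auto simp: translates_def)
  show "integrand g g' \<in> Cc CT" "integrand f f' \<in> Cc CT" using p integrand_Cc by auto
  show "integrand g g' (q (x \<cdot> y)) = integrand f f' (q y)" if "y \<in> arr" "r y = d x" for y
    using that x p translates_apply [OF t(1) x that] translates_apply [OF t(2) x that]
    by (simp add: integrand_Cc)
qed

definition l1norm :: "'g \<Rightarrow> ('g \<Rightarrow> 'h) \<Rightarrow> real" where
  "l1norm u f = Re (LINT c|mu u. pnorm f c)"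

lemma l1norm_continuous: "f \<in> pts V \<Longrightarrow> continuous_map (unit_top G) euclideanreal (\<lambda>u. l1norm u f)"
  unfolding l1norm_def by (intro continuous_map_Re mu_continuous pnorm_Cc)

lemma l1norm_translate:
  assumes x: "x \<in> arr" and t: "translates x f g"
  shows "l1norm (r x) g = l1norm (d x) f"
proof -
  have p: "f \<in> pts V" "g \<in> pts V" using t by (auto simp: translates_def)
  have "(LINT c|mu (r x). pnorm g c) = (LINT c|mu (d x). pnorm f c)"
  proof (rule mu_translate [OF x])
    show "pnorm g \<in> Cc CT" "pnorm f \<in> Cc CT" using p pnorm_Cc by auto
    show "pnorm g (q (x \<cdot> y)) = pnorm f (q y)" if "y \<in> arr" "r y = d x" for y
      using that x p translates_apply [OF t x that] by (simp add: pnorm_Cc)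
  qed
  then show ?thesis by (simp add: l1norm_def)
qed

text \<open>Pointwise \<open>|w|\<^sup>2 \<le> \<delta> (|g| + |g'|)\<close>. Using \<open>L\<^sup>1\<close> norms of \<open>g\<close> and \<open>g'\<close> on the right avoids bounding the
  measure of a support: these norms are invariant under translation and continuous in the unit.\<close>

lemma unorm_sq_le:
  assumes u: "u \<in> units G" and w: "w \<in> pts V" and g: "g \<in> pts V" "g' \<in> pts V" and \<delta>: "0 \<le> \<delta>"
    and le: "\<And>y. y \<in> arr \<Longrightarrow> r y = u \<Longrightarrow> vnorm (E y) (w y) \<le> \<delta>"
      "\<And>y. y \<in> arr \<Longrightarrow> r y = u \<Longrightarrow> vnorm (E y) (w y) \<le> vnorm (E y) (g y) + vnorm (E y) (g' y)"
  shows "(unorm u w)\<^sup>2 \<le> \<delta> * (l1norm u g + l1norm u g')"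
proof -
  interpret W: semi_inner "space_at u" by (rule semi_inner_F0 [OF u])
  note iw = mu_integrable [OF u integrand_Cc(1) [OF w w]]
    and ig = mu_integrable [OF u pnorm_Cc(1) [OF g(1)]] and ig' = mu_integrable [OF u pnorm_Cc(1) [OF g(2)]]
  have "(unorm u w)\<^sup>2 = (LINT c|mu u. Re (integrand w w c))"
    using W.norm_sq [of w] w iw by (simp add: inner_eq)
  also have "\<dots> \<le> (LINT c|mu u. \<delta> * (Re (pnorm g c) + Re (pnorm g' c)))"
  proof (rule integral_mono_AE)
    show "integrable (mu u) (\<lambda>c. Re (integrand w w c))" using iw by simp
    show "integrable (mu u) (\<lambda>c. \<delta> * (Re (pnorm g c) + Re (pnorm g' c)))" using ig ig' by simp
    show "AE c in mu u. Re (integrand w w c) \<le> \<delta> * (Re (pnorm g c) + Re (pnorm g' c))"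
    proof (rule eventually_mono [OF mu_AE [OF u]])
      fix c assume "c \<in> moment_fibre G H u"
      then obtain y where y: "y \<in> arr" "c = q y" "r y = u" by (auto simp: mem_moment_fibre)
      interpret hilbert "E y" by (rule hilbert_E [OF y(1)])
      have wy: "w y \<in> pts (E y)" by (rule F0D(4) [OF w y(1)])
      have "Re (integrand w w c) = vnorm (E y) (w y) * vnorm (E y) (w y)"
        using y norm_sq [OF wy] by (simp add: integrand_Cc w power2_eq_square)
      also have "\<dots> \<le> \<delta> * (vnorm (E y) (g y) + vnorm (E y) (g' y))"
        using le y vnorm_nonneg [OF wy] \<delta> by (intro mult_mono) auto
      finally show "Re (integrand w w c) \<le> \<delta> * (Re (pnorm g c) + Re (pnorm g' c))"
        using y g by (simp add: pnorm_Cc)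
    qed
  qed
  also have "\<dots> = \<delta> * (l1norm u g + l1norm u g')" using ig ig' by (simp add: l1norm_def)
  finally show ?thesis .
qed

text \<open>Every \<open>f\<close> has a translate and every \<open>g\<close> is one, so the relation has dense domain and dense range.\<close>

lemma translation_operator:
  assumes x: "x \<in> arr"
  obtains T where "T \<in> pts (fibre (d x)) \<rightarrow>\<^sub>E pts (fibre (r x))" "unitary_map (fibre (d x)) (fibre (r x)) T"
    "\<forall>f g. translates x f g \<longrightarrow> T (ev (d x) f) = ev (r x) g"
proof -
  have u: "d x \<in> units G" "r x \<in> units G" using x by auto
  define D where "D = {(ev (d x) f, ev (r x) g) | f g. translates x f g}"
  have tV: "f \<in> pts V" "g \<in> pts V" if "translates x f g" for f g using that by (auto simp: translates_def)
  obtain T where T: "T \<in> pts (fibre (d x)) \<rightarrow>\<^sub>E pts (fibre (r x))" "unitary_map (fibre (d x)) (fibre (r x)) T"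
    "\<And>a b. (a, b) \<in> D \<Longrightarrow> T a = b"
  proof (rule unitary_extension [OF hilbert_fibre [OF u(1)] hilbert_fibre [OF u(2)], of D])
    show "D \<subseteq> pts (fibre (d x)) \<times> pts (fibre (r x))"
      using ev_closed tV u by (auto simp: D_def)
    show "\<exists>(c, e')\<in>D. vnorm (fibre (d x)) (vdiff (fibre (d x)) c a) < e" if a: "a \<in> pts (fibre (d x))" and e: "0 < e" for a e
    proof -
      obtain f where f: "f \<in> pts V" "vnorm (fibre (d x)) (vdiff (fibre (d x)) (ev (d x) f) a) < e" by (rule ev_dense [OF u(1) a e])
      obtain g where "translates x f g" using translates_exists [OF x f(1)] ..
      then have "(ev (d x) f, ev (r x) g) \<in> D" by (auto simp: D_def)
      then show ?thesis using f(2) by blast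
    qed
    show "\<exists>(c, e')\<in>D. vnorm (fibre (r x)) (vdiff (fibre (r x)) e' b) < e" if b: "b \<in> pts (fibre (r x))" and e: "0 < e" for b e
    proof -
      obtain g where g: "g \<in> pts V" "vnorm (fibre (r x)) (vdiff (fibre (r x)) (ev (r x) g) b) < e" by (rule ev_dense [OF u(2) b e])
      obtain f where "translates x f g" using translates_exists_source [OF x g(1)] ..
      then have "(ev (d x) f, ev (r x) g) \<in> D" by (auto simp: D_def)
      then show ?thesis using g(2) by blast
    qed
    show "vinner (fibre (r x)) b b' = vinner (fibre (d x)) a a'" if "(a, b) \<in> D" "(a', b') \<in> D" for a b a' b'
    proof -
      obtain f g f' g' where fg: "translates x f g" "a = ev (d x) f" "b = ev (r x) g"
        "translates x f' g'" "a' = ev (d x) f'" "b' = ev (r x) g'" using \<open>(a, b) \<in> D\<close> \<open>(a', b') \<in> D\<close> by (auto simp: D_def)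
      then show ?thesis using translates_inner [OF x fg(1,4)] tV u by (simp add: ev_simps(2))
    qed
  qed blast
  have "\<forall>f g. translates x f g \<longrightarrow> T (ev (d x) f) = ev (r x) g"
  proof (intro allI impI)
    fix f g assume "translates x f g"
    then have "(ev (d x) f, ev (r x) g) \<in> D" unfolding D_def by blast
    then show "T (ev (d x) f) = ev (r x) g" by (rule T(3))
  qed
  with T(1,2) show ?thesis by (rule that)
qed

text \<open>An extension of the translate is not unique, but its value at \<open>r x\<close> is: hence the existential quantifier over
  extensions may be replaced by a universal one.\<close>

lemma left_translation_iff:
  "left_translation G H \<H> \<sigma> mu L \<longleftrightarrow> L \<in> extensional arr \<and>
     (\<forall>x\<in>arr. L x \<in> pts (fibre (d x)) \<rightarrow>\<^sub>E pts (fibre (r x)) \<and> norm_continuous (fibre (d x)) (fibre (r x)) (L x) \<and>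
        (\<forall>f g. translates x f g \<longrightarrow> L x (ev (d x) f) = ev (r x) g))"
proof -
  have eq: "(\<forall>f\<in>pts V. \<exists>g\<in>pts V. (\<forall>y\<in>rfibre G (r x). g y = f (iv x \<cdot> y)) \<and> L x (sec (emb f) (d x)) = sec (emb g) (r x)) \<longleftrightarrow>
      (\<forall>f g. translates x f g \<longrightarrow> L x (ev (d x) f) = ev (r x) g)" if x: "x \<in> arr" for x
  proof -
    have se: "sec (emb f) (d x) = ev (d x) f" "sec (emb f) (r x) = ev (r x) f" for f
      using x by (simp_all add: sec_apply)
    show ?thesis
      unfolding se
    proof (intro iffI allI impI ballI)
      fix f g assume *: "\<forall>f\<in>pts V. \<exists>g\<in>pts V. (\<forall>y\<in>rfibre G (r x). g y = f (iv x \<cdot> y)) \<and> L x (ev (d x) f) = ev (r x) g"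
        and t: "translates x f g"
      then have fg: "f \<in> pts V" "g \<in> pts V" "\<forall>y\<in>rfibre G (r x). g y = f (iv x \<cdot> y)" by (auto simp: translates_def)
      obtain g' where g': "g' \<in> pts V" "\<forall>y\<in>rfibre G (r x). g' y = f (iv x \<cdot> y)" "L x (ev (d x) f) = ev (r x) g'"
        using * fg(1) by blast
      have "ev (r x) g' = ev (r x) g" using x g' fg by (intro ev_agree) auto
      then show "L x (ev (d x) f) = ev (r x) g" using g' by simp
    next
      fix f assume *: "\<forall>f g. translates x f g \<longrightarrow> L x (ev (d x) f) = ev (r x) g" and f: "f \<in> pts V"
      obtain g where g: "translates x f g" using translates_exists [OF x f] ..
      then have "L x (ev (d x) f) = ev (r x) g" using * by blast
      then show "\<exists>g\<in>pts V. (\<forall>y\<in>rfibre G (r x). g y = f (iv x \<cdot> y)) \<and> L x (ev (d x) f) = ev (r x) g"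
        using g by (auto simp: translates_def)
    qed
  qed
  show ?thesis
    unfolding left_translation_def by (intro conj_cong ball_cong refl eq)
qed

lemma operator_unique:
  assumes x: "x \<in> arr"
    and S: "norm_continuous (fibre (d x)) (fibre v) S" "\<And>a. a \<in> pts (fibre (d x)) \<Longrightarrow> S a \<in> pts (fibre v)"
    and T: "norm_continuous (fibre (d x)) (fibre v) T" "\<And>a. a \<in> pts (fibre (d x)) \<Longrightarrow> T a \<in> pts (fibre v)" and v: "v \<in> units G"
    and eq: "\<And>f. f \<in> pts V \<Longrightarrow> S (ev (d x) f) = T (ev (d x) f)" and a: "a \<in> pts (fibre (d x))"
  shows "S a = T a"
proof (rule norm_continuous_unique [OF hilbert_fibre hilbert_fibre S T])
  show u: "d x \<in> units G" "v \<in> units G" using x v by auto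
  show "\<exists>c\<in>ev (d x) ` pts V. c \<in> pts (fibre (d x)) \<and> vnorm (fibre (d x)) (vdiff (fibre (d x)) c a) < e"
    if a: "a \<in> pts (fibre (d x))" and e: "0 < e" for a e
  proof -
    obtain f where "f \<in> pts V" "vnorm (fibre (d x)) (vdiff (fibre (d x)) (ev (d x) f) a) < e" by (rule ev_dense [OF u(1) a e])
    then show ?thesis using ev_closed [OF u(1)] by blast
  qed
  show "S c = T c" if "c \<in> ev (d x) ` pts V" for c using eq that by blast
qed (simp_all add: a)

lemma left_translation_unitary:
  assumes L: "left_translation G H \<H> \<sigma> mu L" and x: "x \<in> arr"
  shows "unitary_map (fibre (d x)) (fibre (r x)) (L x)"
proof -
  obtain T where T: "T \<in> pts (fibre (d x)) \<rightarrow>\<^sub>E pts (fibre (r x))" "unitary_map (fibre (d x)) (fibre (r x)) T"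
    "\<forall>f g. translates x f g \<longrightarrow> T (ev (d x) f) = ev (r x) g" by (rule translation_operator [OF x])
  have Lx: "L x \<in> pts (fibre (d x)) \<rightarrow>\<^sub>E pts (fibre (r x))" "norm_continuous (fibre (d x)) (fibre (r x)) (L x)"
    "\<forall>f g. translates x f g \<longrightarrow> L x (ev (d x) f) = ev (r x) g"
    using L x by (auto simp: left_translation_iff)
  have "L x a = T a" if "a \<in> pts (fibre (d x))" for a
  proof (rule operator_unique [OF x Lx(2) _ norm_continuous_unitary [OF T(2)] _ _ _ that])
    show "L x (ev (d x) f) = T (ev (d x) f)" if f: "f \<in> pts V" for f
      using translates_exists [OF x f] Lx(3) T(3) by metis
  qed (use Lx(1) T(1) x hilbert_fibre in auto)
  then have "L x = T" using Lx(1) T(1) by (intro extensionalityI [of _ "pts (fibre (d x))"]) (auto simp: PiE_def)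
  then show ?thesis using T(2) by simp
qed

lemma left_translation_exists_unique: "\<exists>!L. left_translation G H \<H> \<sigma> mu L"
proof -
  have "\<forall>x\<in>arr. \<exists>T. T \<in> pts (fibre (d x)) \<rightarrow>\<^sub>E pts (fibre (r x)) \<and> unitary_map (fibre (d x)) (fibre (r x)) T \<and>
    (\<forall>f g. translates x f g \<longrightarrow> T (ev (d x) f) = ev (r x) g)"
  proof
    fix x assume x: "x \<in> arr"
    obtain T where "T \<in> pts (fibre (d x)) \<rightarrow>\<^sub>E pts (fibre (r x))" "unitary_map (fibre (d x)) (fibre (r x)) T"
      "\<forall>f g. translates x f g \<longrightarrow> T (ev (d x) f) = ev (r x) g" by (rule translation_operator [OF x])
    then show "\<exists>T. T \<in> pts (fibre (d x)) \<rightarrow>\<^sub>E pts (fibre (r x)) \<and> unitary_map (fibre (d x)) (fibre (r x)) T \<and>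
      (\<forall>f g. translates x f g \<longrightarrow> T (ev (d x) f) = ev (r x) g)" by blast
  qed
  from bchoice [OF this] obtain T where T: "\<forall>x\<in>arr. T x \<in> pts (fibre (d x)) \<rightarrow>\<^sub>E pts (fibre (r x)) \<and>
    unitary_map (fibre (d x)) (fibre (r x)) (T x) \<and> (\<forall>f g. translates x f g \<longrightarrow> T x (ev (d x) f) = ev (r x) g)" ..
  have "left_translation G H \<H> \<sigma> mu (restrict T arr)"
    unfolding left_translation_iff
  proof (intro conjI ballI)
    fix x assume x: "x \<in> arr"
    have "norm_continuous (fibre (d x)) (fibre (r x)) (T x)"
      using T x hilbert_fibre by (intro norm_continuous_unitary) auto
    then show "norm_continuous (fibre (d x)) (fibre (r x)) (restrict T arr x)" using x by simp
    show "restrict T arr x \<in> pts (fibre (d x)) \<rightarrow>\<^sub>E pts (fibre (r x))"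
      "\<forall>f g. translates x f g \<longrightarrow> restrict T arr x (ev (d x) f) = ev (r x) g" using T x by auto
  qed simp
  moreover have "L = L'" if L: "left_translation G H \<H> \<sigma> mu L" and L': "left_translation G H \<H> \<sigma> mu L'" for L L'
  proof (rule extensionalityI [of _ arr])
    show "L \<in> extensional arr" "L' \<in> extensional arr" using L L' by (auto simp: left_translation_iff)
    fix x assume x: "x \<in> arr"
    have Lx: "L x \<in> pts (fibre (d x)) \<rightarrow>\<^sub>E pts (fibre (r x))" "norm_continuous (fibre (d x)) (fibre (r x)) (L x)"
      "\<forall>f g. translates x f g \<longrightarrow> L x (ev (d x) f) = ev (r x) g"
      using L x by (auto simp: left_translation_iff)
    have Lx': "L' x \<in> pts (fibre (d x)) \<rightarrow>\<^sub>E pts (fibre (r x))" "norm_continuous (fibre (d x)) (fibre (r x)) (L' x)"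
      "\<forall>f g. translates x f g \<longrightarrow> L' x (ev (d x) f) = ev (r x) g"
      using L' x by (auto simp: left_translation_iff)
    have "L x a = L' x a" if "a \<in> pts (fibre (d x))" for a
    proof (rule operator_unique [OF x Lx(2) _ Lx'(2) _ _ _ that])
      show "L x (ev (d x) f) = L' x (ev (d x) f)" if f: "f \<in> pts V" for f
        using translates_exists [OF x f] Lx(3) Lx'(3) by metis
    qed (use Lx(1) Lx'(1) x in auto)
    then show "L x = L' x" using Lx(1) Lx'(1) by (intro extensionalityI [of _ "pts (fibre (d x))"]) (auto simp: PiE_def)
  qed
  ultimately show ?thesis by blast
qed

text \<open>Strong continuity. Near \<open>x\<^sub>0\<close> the section is compared with the distinguished section of an extension
  \<open>g\<close> of the translate by \<open>x\<^sub>0\<close> of some \<open>f\<close> that is close to \<open>\<xi>(d x\<^sub>0)\<close>. The unitary operators preserve the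
  distance of \<open>f\<close> from \<open>\<xi>\<close>, and \<open>L\<^sup>1\<close> norms are invariant under translation.\<close>

lemma translation_continuous:
  assumes ne: "units G \<noteq> {}" and L: "left_translation G H \<H> \<sigma> mu L"
    and xi: "cts_section (unit_top G) (unit_top G) FB (\<lambda>u. u) xi"
  shows "cts_section (gtop G) (unit_top G) FB r (\<lambda>x. L x (xi (d x)))"
proof -
  interpret B: hilb_bundle "unit_top G" FB
    by unfold_locales (rule hilbert_bundle_F [OF ne])
  have unit: "unitary_map (fibre (d x)) (fibre (r x)) (L x)" if "x \<in> arr" for x
    by (rule left_translation_unitary [OF L that])
  have Lt: "L x (ev (d x) f) = ev (r x) g" if "x \<in> arr" "translates x f g" for x f g
    using L that by (auto simp: left_translation_iff)
  have xiF: "xi u \<in> pts (fibre u)" if "u \<in> units G" for u using B.ctsD(2) [OF xi, of u] that by simp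
  have secB: "sec (emb f) \<in> sects FB" if "f \<in> pts V" for f
  proof -
    obtain u where "u \<in> units G" using ne by blast
    then have "sec (emb f) \<in> Delta G H \<H> \<sigma> mu" using emb_module that by (auto simp: Delta_def)
    then show ?thesis using hilbert_bundle_F(2) [OF ne] by blast
  qed
  show ?thesis
  proof (rule B.cts_limit [OF continuous_r])
    show "L x (xi (d x)) \<in> pts (fib FB (r x))" if "x \<in> topspace (gtop G)" for x
      using unitary_map_closed [OF unit xiF] that by (simp add: arrows_def)
    fix x0 and e :: real assume "x0 \<in> topspace (gtop G)" and e: "0 < e"
    then have x0: "x0 \<in> arr" by (simp add: arrows_def)
    have u0: "d x0 \<in> units G" "r x0 \<in> units G" using x0 by auto
    interpret F0': hilbert "fibre (d x0)" by (rule hilbert_fibre [OF u0(1)])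
    have e2: "0 < e / 2" using e by simp
    obtain f where f: "f \<in> pts V" "vnorm (fibre (d x0)) (vdiff (fibre (d x0)) (ev (d x0) f) (xi (d x0))) < e / 2"
      by (rule ev_dense [OF u0(1) xiF [OF u0(1)] e2])
    obtain g where g: "translates x0 f g" using translates_exists [OF x0 f(1)] ..
    then have gV: "g \<in> pts V" "\<forall>y\<in>rfibre G (r x0). g y = f (iv x0 \<cdot> y)" by (auto simp: translates_def)
    have xd: "cts_section (gtop G) (unit_top G) FB d (\<lambda>x. xi (d x))" by (rule B.cts_compose [OF xi continuous_d])
    have N1: "continuous_map (gtop G) euclideanreal (\<lambda>x. B.dst (d x) (xi (d x)) (sec (emb f) (d x)))"
      by (intro B.cts_norm B.cts_diff xd B.cts_sect secB f continuous_d)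
    have "B.dst (d x0) (xi (d x0)) (sec (emb f) (d x0)) < e / 2"
      using f(2) F0'.norm_diff_commute [OF xiF [OF u0(1)] ev_closed [OF u0(1) f(1)]] u0 by (simp add: sec_apply)
    then obtain W1 where W1: "openin (gtop G) W1" "x0 \<in> W1"
      "\<And>x. x \<in> W1 \<Longrightarrow> B.dst (d x) (xi (d x)) (sec (emb f) (d x)) < e / 2"
      using continuous_map_realD [OF N1, of x0 "e/2"] x0 by (auto simp: arrows_def)
    define Q where "Q x = l1norm (d x) f + l1norm (r x) g" for x
    have Qc: "continuous_map (gtop G) euclideanreal Q"
      unfolding Q_def
      using continuous_map_compose [OF continuous_d l1norm_continuous [OF f(1)]]
        continuous_map_compose [OF continuous_r l1norm_continuous [OF gV(1)]]
      by (intro continuous_map_add) (simp_all add: o_def)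
    \<comment> \<open>\<open>\<delta>\<close> is chosen so that \<open>unorm_sq_le\<close> gives a distance of at most \<open>e / 2\<close> where \<open>Q < M\<close>\<close>
    define M where "M = \<bar>Q x0\<bar> + 1"
    have M: "0 < M" "Q x0 < M" by (auto simp: M_def)
    obtain W2 where W2: "openin (gtop G) W2" "x0 \<in> W2" "\<And>x. x \<in> W2 \<Longrightarrow> Q x < M"
      using continuous_map_realD [OF Qc, of x0 M] x0 M by (auto simp: arrows_def)
    define \<delta> where "\<delta> = (e / 2)\<^sup>2 / M"
    have \<delta>: "0 < \<delta>" using e M by (simp add: \<delta>_def)
    obtain W3 where W3: "openin (gtop G) W3" "x0 \<in> W3"
      "\<forall>x\<in>W3. \<forall>y\<in>rfibre G (r x). dst (d y) (f (iv x \<cdot> y)) (g y) < \<delta>"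
      by (rule translate_near_extension [OF f(1) gV(1) x0 gV(2) \<delta>])
    let ?W = "W1 \<inter> (W2 \<inter> W3)"
    have main: "B.dst (r x) (L x (xi (d x))) (sec (emb g) (r x)) < e" if xW: "x \<in> ?W" for x
    proof -
      have x: "x \<in> arr" using xW openin_subset [OF W1(1)] by (auto simp: arrows_def)
      have u: "d x \<in> units G" "r x \<in> units G" using x by auto
      obtain gx where gx: "translates x f gx" using translates_exists [OF x f(1)] ..
      then have gxV: "gx \<in> pts V" "\<forall>y\<in>rfibre G (r x). gx y = f (iv x \<cdot> y)" by (auto simp: translates_def)
      interpret R: hilbert "fibre (r x)" by (rule hilbert_fibre [OF u(2)])
      let ?w = "vdiff V gx g"
      have w: "?w \<in> pts V" by (rule F0.diff_closed [OF gxV(1) gV(1)])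
      have "(unorm (r x) ?w)\<^sup>2 \<le> \<delta> * (l1norm (r x) gx + l1norm (r x) g)"
      proof (rule unorm_sq_le [OF u(2) w gxV(1) gV(1)])
        fix y assume y: "y \<in> arr" "r y = r x"
        interpret Y: hilbert "E y" by (rule hilbert_E [OF y(1)])
        have yR: "y \<in> rfibre G (r x)" using y by (simp add: rfibre_def)
        have "dst (d y) (f (iv x \<cdot> y)) (g y) < \<delta>" using W3(3) xW yR by blast
        then show "vnorm (E y) (?w y) \<le> \<delta>" using gxV(2) yR y by (simp add: F0_diff less_imp_le)
        show "vnorm (E y) (?w y) \<le> vnorm (E y) (gx y) + vnorm (E y) (g y)"
          using Y.norm_diff_le [OF F0D(4) [OF gxV(1) y(1)] F0D(4) [OF gV(1) y(1)]] y by (simp add: F0_diff)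
      qed (use \<delta> in simp)
      also have "\<dots> = \<delta> * Q x" by (simp add: Q_def l1norm_translate [OF x gx])
      also have "\<dots> \<le> \<delta> * M" using W2(3) [of x] xW \<delta> by (intro mult_left_mono) auto
      also have "\<dots> = (e / 2)\<^sup>2" using M by (simp add: \<delta>_def)
      finally have uw: "unorm (r x) ?w \<le> e / 2" by (rule power2_le_imp_le) (use e in simp)
      have jf: "ev (d x) f \<in> pts (fibre (d x))" by (rule ev_closed [OF u(1) f(1)])
      have jg: "ev (r x) g \<in> pts (fibre (r x))" "ev (r x) gx \<in> pts (fibre (r x))"
        using ev_closed [OF u(2)] gV(1) gxV(1) by auto
      have Lx: "L x (xi (d x)) \<in> pts (fibre (r x))" by (rule unitary_map_closed [OF unit [OF x] xiF [OF u(1)]])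
      have "B.dst (r x) (L x (xi (d x))) (sec (emb g) (r x)) \<le>
          B.dst (r x) (L x (xi (d x))) (ev (r x) gx) + B.dst (r x) (ev (r x) gx) (ev (r x) g)"
        using R.norm_diff_triangle [OF Lx jg(2) jg(1)] u by (simp add: sec_apply)
      also have "B.dst (r x) (L x (xi (d x))) (ev (r x) gx) = B.dst (d x) (xi (d x)) (ev (d x) f)"
        using unitary_map_norm_diff [OF unit [OF x] hilbert_fibre [OF u(1)] xiF [OF u(1)] jf] Lt [OF x gx] by simp
      also have "B.dst (r x) (ev (r x) gx) (ev (r x) g) = unorm (r x) ?w"
        using ev_simps(3) [OF u(2) gxV(1) gV(1)] ev_simps(4) [OF u(2) w w] by simp
      finally show ?thesis using W1(3) [of x] xW u uw by (simp add: sec_apply)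
    qed
    show "\<exists>k W. cts_section (gtop G) (unit_top G) FB r k \<and> openin (gtop G) W \<and> x0 \<in> W \<and>
        (\<forall>x\<in>W. B.dst (r x) (L x (xi (d x))) (k x) < e)"
    proof (intro exI conjI ballI)
      show "cts_section (gtop G) (unit_top G) FB r (\<lambda>x. sec (emb g) (r x))"
        by (intro B.cts_sect secB gV continuous_r)
      show "openin (gtop G) ?W" "x0 \<in> ?W" using W1 W2 W3 by auto
    qed (rule main)
  qed
qed

lemma left_translation_representation:
  assumes L: "left_translation G H \<H> \<sigma> mu L"
  shows "unitary_representation G FB L"
proof (cases "units G = {}")
  case True
  then have "topspace (unit_top G) = {}" by simp
  moreover have a: "arr = {}" using True r_units by blast
  moreover have "topspace (gtop G) = {}" using a by (simp add: arrows_def)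
  ultimately show ?thesis
    unfolding unitary_representation_def using True
    by (auto simp: F_bundle_def composable_def hilbert_bundle_empty continuous_map_def)
next
  case ne: False
  interpret B: hilb_bundle "unit_top G" FB
    by unfold_locales (rule hilbert_bundle_F [OF ne])
  have unit: "unitary_map (fibre (d x)) (fibre (r x)) (L x)" if "x \<in> arr" for x
    by (rule left_translation_unitary [OF L that])
  have Lt: "L x (ev (d x) f) = ev (r x) g" if "x \<in> arr" "translates x f g" for x f g
    using L that by (auto simp: left_translation_iff)
  have id: "L u h = h" if u: "u \<in> units G" and h: "h \<in> pts (fibre u)" for u h
  proof -
    have ua: "u \<in> arr" by (rule units_arr [OF u])
    have "L u h = (\<lambda>a. a) h"
    proof (rule operator_unique [OF ua, where v = u and S = "L u" and T = "\<lambda>a. a"])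
      show "norm_continuous (fibre (d u)) (fibre u) (L u)"
        using norm_continuous_unitary [OF unit [OF ua] hilbert_fibre] u by simp
      show "norm_continuous (fibre (d u)) (fibre u) (\<lambda>a. a)"
        using norm_continuous_unitary [OF unitary_map_id hilbert_fibre] u by simp
      show "L u (ev (d u) f) = ev (d u) f" if f: "f \<in> pts V" for f
      proof -
        have "f y = f (iv u \<cdot> y)" if "y \<in> rfibre G (r u)" for y
        proof -
          have "y \<in> arr" "r y = u" using that u by (auto simp: rfibre_def)
          then have "iv u \<cdot> y = y" using r_mul_self [of y] u by simp
          then show ?thesis by simp
        qed
        then have "translates u f f" using f by (simp add: translates_def)
        from Lt [OF ua this] show ?thesis using u by simp
      qed
      show "L u a \<in> pts (fibre u)" if "a \<in> pts (fibre (d u))" for a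
        using unitary_map_closed [OF unit [OF ua] that] u by simp
    qed (use u h in auto)
    then show ?thesis by simp
  qed
  have mult: "L x (L y h) = L (x \<cdot> y) h" if x: "x \<in> arr" and y: "y \<in> arr" and xy: "d x = r y" and h: "h \<in> pts (fibre (d y))" for x y h
  proof (rule operator_unique [OF y, where v = "r x" and S = "\<lambda>a. L x (L y a)" and T = "L (x \<cdot> y)"])
    have xya: "x \<cdot> y \<in> arr" using x y xy by simp
    have U: "unitary_map (fibre (d y)) (fibre (r x)) (\<lambda>a. L x (L y a))"
      using unitary_map_compose [OF unit [OF y]] unit [OF x] xy by simp
    have U': "unitary_map (fibre (d y)) (fibre (r x)) (L (x \<cdot> y))" using unit [OF xya] x y xy by simp
    have hd: "hilbert (fibre (d y))" using hilbert_fibre y by simp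
    show "norm_continuous (fibre (d y)) (fibre (r x)) (\<lambda>a. L x (L y a))" "norm_continuous (fibre (d y)) (fibre (r x)) (L (x \<cdot> y))"
      using norm_continuous_unitary U U' hd by auto
    show "L x (L y a) \<in> pts (fibre (r x))" "L (x \<cdot> y) a \<in> pts (fibre (r x))" if "a \<in> pts (fibre (d y))" for a
      using unitary_map_closed [OF U that] unitary_map_closed [OF U' that] by auto
    show "L x (L y (ev (d y) f)) = L (x \<cdot> y) (ev (d y) f)" if f: "f \<in> pts V" for f
    proof -
      obtain g where g: "translates y f g" using translates_exists [OF y f] ..
      then have gV: "g \<in> pts V" by (simp add: translates_def)
      obtain k where k: "translates x g k" using translates_exists [OF x gV] ..
      have "k z = f (iv (x \<cdot> y) \<cdot> z)" if "z \<in> rfibre G (r (x \<cdot> y))" for z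
      proof -
        have z: "z \<in> arr" "r z = r x" using that x y xy by (auto simp: rfibre_def)
        then have "k z = g (iv x \<cdot> z)" using k by (simp add: translates_def rfibre_def)
        also have "\<dots> = f (iv y \<cdot> (iv x \<cdot> z))"
          using g z x y xy by (simp add: translates_def rfibre_def)
        also have "iv y \<cdot> (iv x \<cdot> z) = iv (x \<cdot> y) \<cdot> z" using x y xy z by (simp add: inv_mul assoc)
        finally show ?thesis .
      qed
      then have t: "translates (x \<cdot> y) f k" using f k by (simp add: translates_def)
      show ?thesis using Lt [OF y g] Lt [OF x k] Lt [OF xya t] x y xy by simp
    qed
  qed (use x h in auto)
  have inv: "L (iv x) h = inv_into (pts (fibre (d x))) (L x) h" if x: "x \<in> arr" and h: "h \<in> pts (fibre (r x))" for x h
  proof (rule inv_into_f_eq [symmetric])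
    show "inj_on (L x) (pts (fibre (d x)))" using unit [OF x] by (simp add: unitary_map_def bij_betw_def)
    show "L (iv x) h \<in> pts (fibre (d x))" using unitary_map_closed [OF unit [of "iv x"], of h] x h by simp
    have "L x (L (iv x) h) = L (x \<cdot> iv x) h" using mult [of x "iv x" h] x h by simp
    also have "\<dots> = h" using id [OF r_units [OF x] h] unfolding rng_def [of G x] .
    finally show "L x (L (iv x) h) = h" .
  qed
  have cont: "continuous_map (gtop G) euclidean (\<lambda>x. vinner (fibre (r x)) (L x (xi (d x))) (eta (r x)))"
    if xi: "xi \<in> C0_sections (unit_top G) FB" and eta: "eta \<in> C0_sections (unit_top G) FB" for xi eta
  proof -
    have c: "cts_section (unit_top G) (unit_top G) FB (\<lambda>u. u) z" if "z \<in> C0_sections (unit_top G) FB" for z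
      using that B.cts_iff_total_top [of "unit_top G" "\<lambda>u. u" z] by (auto simp: C0_sections_def all_sections_def)
    from B.cts_inner [OF translation_continuous [OF ne L c [OF xi]] B.cts_compose [OF c [OF eta] continuous_r]]
    show ?thesis by simp
  qed
  show ?thesis
    unfolding unitary_representation_def fib_FB
    using hilbert_bundle_F(1) [OF ne] unit id mult inv cont by (auto simp: composable_iff)
qed

end

theorem proposition3p5:
  fixes G :: "'g groupoid"
    and H :: "'g set"
    and lam lamH :: "'g \<Rightarrow> 'g measure"
    and mu :: "'g \<Rightarrow> 'g set measure"
    and \<H> :: "('g, 'h) hbundle"
    and \<sigma> :: "'g \<Rightarrow> 'h \<Rightarrow> 'h"
  assumes "topological_groupoid G"
    and "second_countable (gtop G)"
    and "locally_compact_space (gtop G)"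
    and "Hausdorff_space (gtop G)"
    and "haar_system G lam"
    and "wide_subgroupoid G H"
    and "closedin (gtop G) H"
    and "haar_system (restrict_groupoid G H) lamH"
    and "equivariant_system G H mu"
    and "unitary_representation (restrict_groupoid G H) \<H> \<sigma>"
  shows "(\<exists>!L. left_translation G H \<H> \<sigma> mu L) \<and>
         (\<forall>L. left_translation G H \<H> \<sigma> mu L \<longrightarrow>
              unitary_representation G (F_bundle G H \<H> \<sigma> mu) L)"
proof -
  interpret induced_setting G lam H lamH mu \<H> \<sigma>
    using assms by unfold_locales
  show ?thesis using left_translation_exists_unique left_translation_representation by blast
qed

end
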